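(* Let $F$ be a number field with ring of integers $\mathcal{O}_F$, let $p$ be a prime number, and let $f\in\mathcal{O}_F[T]$ be monic of degree $d=p^e$ for some $e\in\mathbb{N}$. Suppose that $f$ is postcritically finite, that $f$ is not $\overline F$-linearly conjugate to a Chebyshev polynomial or a negative Chebyshev polynomial, and that the barycenter of $f$ is an algebraic integer. Let $(k,l)\in\mathbb{N}^2$ be an $(F,f)$-admissible pair with $k<l$. Let $\alpha\in\overline F$ be $f$-preperiodic. Then $$d^{\frac{\mathrm{preper}(\alpha)}{k}-1}\le[F(\alpha):F]\quad\text{and}\quad\mathrm{per}(\alpha)\le(l-k)[F(\alpha):F].$$
   Context: $\mathbb{N}=\{1,2,\ldots\}$; $\overline F$ is an algebraic closure of $F$. $f^{(n)}$ is the $n$-th iterate of $f$, $f^{(0)}=T$. A point is $f$-preperiodic if its forward orbit $\{f^{(n)}(\alpha):n\ge0\}$ is finite, and $f$-periodic if $f^{(n)}(\alpha)=\alpha$ for some $n\ge1$. For preperiodic $\alpha$, $\mathrm{preper}(\alpha)$ is the least $m\ge0$ such that $f^{(m)}(\alpha)$ is periodic, and $\mathrm{per}(\alpha)$ is the least $n\ge1$ with $f^{(n)}(f^{(m)}(\alpha))=f^{(m)}(\alpha)$ for that $m$. $f$ is postcritically finite if all roots of $f'$ in $\overline F$ are $f$-preperiodic. The barycenter of a monic polynomial $T^d+f_1T^{d-1}+\cdots$ is $-f_1/d$. Two polynomials $f,g$ are $\overline F$-linearly conjugate if $f=(g(aT+b)-b)/a$ for some $a\in\overline F^\times$, $b\in\overline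 F$. The degree $d$ Chebyshev polynomial $\Psi_d$ is the monic polynomial with $\Psi_d(2\cos\theta)=2\cos(d\theta)$ for all $\theta\in\mathbb{C}$; a negative Chebyshev polynomial is $-\Psi_d$. Admissible pairs. Let $\mathcal{O}_{F,p}=\{x\in F: |x|_v\le1\text{ for all places } v\mid p\text{ of }F\}$. For $f\in F[T]$ of degree $d\ge2$, a power of $p$, a pair $(k,l)\in\mathbb{N}^2$ is $(F,f)$-admissible if (a) $a^{d^{k-1}}-a^{d^{l-1}}\in p\mathcal{O}_{F,p}$ for all $a\in\mathcal{O}_{F,p}$, and (b) $f^{(k-1)}(0)-f^{(l-1)}(0)\in p\mathcal{O}_{F,p}$. *)

theory Defs
  imports
    "HOL-Analysis.Analysis"
    "HOL-Algebra.Generated_Fields"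
    "HOL-Algebra.Algebraic_Closure_Type"
begin

section \<open>Number fields and their algebraic closures\<close>

text \<open>
  A number field is a type \<open>'f\<close>; its algebraic closure is the type \<open>'f alg_closure\<close> with the
  embedding \<^const>\<open>to_ac\<close>.
\<close>

definition number_field :: "'f::field_char_0 itself \<Rightarrow> bool" where
  "number_field _ \<longleftrightarrow>
     (\<exists>B. finite_dimensional_vector_space (\<lambda>(q::rat) (x::'f). of_rat q * x) B)"

definition adjoin :: "'f::field alg_closure \<Rightarrow> 'f alg_closure set" where
  "adjoin \<alpha> = generate_field ring_of_type_algebra (insert \<alpha> (range to_ac))"

definition adjoin_degree :: "'f::field alg_closure \<Rightarrow> nat" where
  "adjoin_degree \<alpha> = vector_space.dim (\<lambda>(c::'f) x. to_ac c * x) (adjoin \<alpha>)"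

text \<open>The constant \<^const>\<open>vector_space.dim\<close> is meaningful here:\<close>

lemma vector_space_alg_closure:
  "vector_space (\<lambda>(c::'f::field) (x::'f alg_closure). to_ac c * x)"
  by unfold_locales (auto simp: algebra_simps)


section \<open>Places above a prime\<close>

definition absolute_value :: "('a::field \<Rightarrow> real) \<Rightarrow> bool" where
  "absolute_value v \<longleftrightarrow>
     (\<forall>x. 0 \<le> v x) \<and> (\<forall>x. v x = 0 \<longleftrightarrow> x = 0) \<and>
     (\<forall>x y. v (x * y) = v x * v y) \<and> (\<forall>x y. v (x + y) \<le> v x + v y)"

text \<open>
  A place of \<open>F\<close> above \<open>p\<close> is represented by the absolute value in its class that restricts to the
  normalised \<open>p\<close>-adic absolute value on \<open>\<rat>\<close>. By multiplicativity it suffices to state this on the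
  integers. The condition \<open>v x \<le> 1\<close> does not depend on the chosen representative.
\<close>

definition place_above :: "nat \<Rightarrow> ('f::field_char_0 \<Rightarrow> real) \<Rightarrow> bool" where
  "place_above p v \<longleftrightarrow> absolute_value v \<and>
     (\<forall>n::int. n \<noteq> 0 \<longrightarrow> v (of_int n) = (1 / real p) ^ multiplicity (int p) n)"

definition p_integers :: "nat \<Rightarrow> 'f::field_char_0 set" where
  "p_integers p = {x. \<forall>v. place_above p v \<longrightarrow> v x \<le> 1}"

definition admissible :: "nat \<Rightarrow> 'f::field_char_0 poly \<Rightarrow> nat \<Rightarrow> nat \<Rightarrow> bool" where
  "admissible p f k l \<longleftrightarrow> 1 \<le> k \<and> 1 \<le> l \<and>
     (\<forall>a\<in>p_integers p :: 'f set.
        a ^ (Polynomial.degree f ^ (k - 1)) - a ^ (Polynomial.degree f ^ (l - 1))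
          \<in> (*) (of_nat p) ` p_integers p) \<and>
     (poly f ^^ (k - 1)) 0 - (poly f ^^ (l - 1)) 0 \<in> (*) (of_nat p) ` p_integers p"


section \<open>Preperiodic points\<close>

definition preperiodic :: "('a \<Rightarrow> 'a) \<Rightarrow> 'a \<Rightarrow> bool" where
  "preperiodic g x \<longleftrightarrow> finite (range (\<lambda>n. (g ^^ n) x))"

definition periodic :: "('a \<Rightarrow> 'a) \<Rightarrow> 'a \<Rightarrow> bool" where
  "periodic g x \<longleftrightarrow> (\<exists>n\<ge>1. (g ^^ n) x = x)"

definition preper :: "('a \<Rightarrow> 'a) \<Rightarrow> 'a \<Rightarrow> nat" where
  "preper g x = (LEAST m. periodic g ((g ^^ m) x))"

definition per :: "('a \<Rightarrow> 'a) \<Rightarrow> 'a \<Rightarrow> nat" where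
  "per g x = (LEAST n. 1 \<le> n \<and> (g ^^ n) ((g ^^ preper g x) x) = (g ^^ preper g x) x)"

abbreviation over_closure :: "'f::field poly \<Rightarrow> 'f alg_closure poly" where
  "over_closure f \<equiv> map_poly to_ac f"

definition postcritically_finite :: "'f::field poly \<Rightarrow> bool" where
  "postcritically_finite f \<longleftrightarrow>
     (\<forall>c. poly (over_closure (pderiv f)) c = 0 \<longrightarrow> preperiodic (poly (over_closure f)) c)"


section \<open>Polynomials\<close>

definition barycenter :: "'f::field poly \<Rightarrow> 'f" where
  "barycenter f = - Polynomial.coeff f (Polynomial.degree f - 1) / of_nat (Polynomial.degree f)"

definition linearly_conjugate :: "'a::field poly \<Rightarrow> 'a poly \<Rightarrow> bool" where
  "linearly_conjugate f g \<longleftrightarrow>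
     (\<exists>a b. a \<noteq> 0 \<and> f = Polynomial.smult (1 / a) (pcompose g [:b, a:] - [:b:]))"

text \<open>
  The defining property determines a monic complex polynomial, whose coefficients turn out to be
  integers (see \<open>chebyshev_ex1\<close> below); we take it in \<open>\<int>[T]\<close> so that it can be mapped to any ring.
  In degree \<open>0\<close> there is no such polynomial.
\<close>

definition is_chebyshev :: "nat \<Rightarrow> int poly \<Rightarrow> bool" where
  "is_chebyshev d P \<longleftrightarrow> Polynomial.lead_coeff P = 1 \<and>
     (\<forall>\<theta>::complex. poly (map_poly of_int P) (2 * cos \<theta>) = 2 * cos (of_nat d * \<theta>))"

definition chebyshev :: "nat \<Rightarrow> int poly" where
  "chebyshev d = (THE P. is_chebyshev d P)"

fun cheb_rec :: "nat \<Rightarrow> int poly" where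
  "cheb_rec 0 = [:2:]"
| "cheb_rec (Suc 0) = [:0, 1:]"
| "cheb_rec (Suc (Suc n)) = [:0, 1:] * cheb_rec (Suc n) - cheb_rec n"

lemma cheb_rec_cos:
  "poly (map_poly of_int (cheb_rec n)) (2 * cos (\<theta>::complex)) = 2 * cos (of_nat n * \<theta>)"
proof (induction n rule: cheb_rec.induct)
  case (3 n)
  have 1: "map_poly of_int (pCons 0 P - Q) = pCons 0 (map_poly of_int P) - (map_poly of_int Q :: complex poly)"
    for P Q :: "int poly"
    by (rule poly_eqI) (auto simp: coeff_map_poly coeff_pCons split: nat.splits)
  have 2: "2 * cos (of_nat (Suc (Suc n)) * \<theta>) = 2 * cos \<theta> * (2 * cos (of_nat (Suc n) * \<theta>)) - 2 * cos (of_nat n * \<theta>)"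
  proof -
    have "of_nat (Suc (Suc n)) * \<theta> = of_nat (Suc n) * \<theta> + \<theta>" "of_nat n * \<theta> = of_nat (Suc n) * \<theta> - \<theta>"
      by (auto simp: algebra_simps)
    thus ?thesis by (simp only: cos_add cos_diff) (simp add: algebra_simps)
  qed
  show ?case unfolding 2 3 [symmetric] by (simp add: 1)
qed (auto simp: map_poly_pCons)

lemma cheb_rec_monic:
  "Polynomial.degree (cheb_rec (Suc n)) = Suc n \<and> Polynomial.lead_coeff (cheb_rec (Suc n)) = 1 \<and>
   Polynomial.degree (cheb_rec n) \<le> n"
proof (induction n)
  case (Suc n)
  let ?A = "[:0, 1:] * cheb_rec (Suc n)"
  have A: "Polynomial.degree ?A = Suc (Suc n)" "Polynomial.lead_coeff ?A = 1"
    using Suc by (auto simp: degree_mult_eq)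
  have "Polynomial.degree (cheb_rec n) < Polynomial.degree ?A" using Suc A by simp
  hence "Polynomial.degree (?A - cheb_rec n) = Suc (Suc n)"
    using A(1) degree_add_eq_left[of "- cheb_rec n" ?A] by simp
  moreover have "Polynomial.coeff (?A - cheb_rec n) (Suc (Suc n)) = 1"
    using A Suc coeff_eq_0[of "cheb_rec n" "Suc (Suc n)"] by (simp del: mult_pCons_left)
  ultimately show ?case using Suc by simp
qed auto

lemma chebyshev_ex1:
  assumes "1 \<le> d"
  shows "\<exists>!P. is_chebyshev d P"
proof (rule ex_ex1I)
  show "\<exists>P. is_chebyshev d P"
    using cheb_rec_cos[of d] cheb_rec_monic[of "d - 1"] assms
    by (auto simp: is_chebyshev_def intro!: exI[of _ "cheb_rec d"])
next
  fix P Q assume PQ: "is_chebyshev d P" "is_chebyshev d Q"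
  have "poly (map_poly of_int P) z = poly (map_poly of_int Q) (z::complex)" for z
    using PQ[unfolded is_chebyshev_def] cos_Arccos[of "z / 2"]
    by (metis nonzero_mult_div_cancel_left times_divide_eq_right zero_neq_numeral)
  hence "map_poly of_int P = (map_poly of_int Q :: complex poly)"
    using poly_eq_poly_eq_iff by blast
  thus "P = Q"
    by (metis (no_types, lifting) coeff_map_poly of_int_0 of_int_eq_iff poly_eqI)
qed

lemma is_chebyshev_chebyshev: "1 \<le> d \<Longrightarrow> is_chebyshev d (chebyshev d)"
  unfolding chebyshev_def using chebyshev_ex1 by (rule theI')

end

(*
  Translating by the barycenter, let f be centred of degree d = p^e. Since the roots of f' are
  preperiodic, f'/d has algebraic integer coefficients. At every complex embedding the critical orbits
  are bounded, so the area theorem applies to the exterior (Boettcher) coordinates of the iterates of f;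
  it makes the highest coefficient a_m with m prime to p satisfy |a_m/d| < 1, unless f is a Joukowski
  (Chebyshev) map. An algebraic integer all of whose conjugates are < 1 vanishes, so f is a polynomial
  in T^p, and induction writes f as a composition of maps q_i = T^p - c_i with algebraic integers c_i in F.

  Comparing absolute values along orbits of the q_i gives |z|^(p-1) <= 2 for every point z on the
  orbit of a preperiodic point, and |z| < p as f is not Chebyshev. Let alpha have preperiod m > k, let
  beta be the point f^N(alpha) with the same image under f^m, and let z, y be the last distinct points of
  their orbits under the q_i, so that z = omega y with omega^p = 1. If at all places over p the points
  preceding z and y had a difference t with v(t)^(p-1) <= v(p), then y/p would be an algebraic integer,
  against |y| < p. At a place where this fails, v(alpha - beta)^(p^J (p-1)) = v(p) v(y)^(p-1) lies in the
  value group of F, where J >= e(m-1). Admissibility bounds the ramification of F, and v(alpha - beta) has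
  order at most [F(alpha):F] modulo the value group of F; this gives d^(m-k) <= [F(alpha):F].

  For the period take any place over p. There f^n(x) = x^(d^n) + f^n(0) modulo the maximal ideal, so
  admissibility makes f^(l-k) reduce to a power of Frobenius that fixes the residue field of F. Two of
  the first [F(alpha):F] + 1 points of the orbit of alpha under f^(l-k) are then congruent, and f
  contracts residue discs, so they have the same image under a high iterate of f.
*)
theory Submission
  imports Defs "HOL-Complex_Analysis.Complex_Analysis"
begin

text \<open>All arguments run inside one algebraically closed field whose elements are algebraic
  over the rationals. Its places and complex embeddings come from Zorn's lemma; F enters as a
  subfield \<open>S\<close>, and [F(\<alpha>):F] as the length of linear relations over
  \<open>S\<close>, so neither residue fields nor extensions of valuations are constructed. The area
  theorem is used at finite level: the critical orbits lie in one disc of radius \<rho>, so the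
  coordinate of the N-th iterate lives outside radius \<rho>^(1/d^N), which tends to 1, while the
  coefficients in question do not change with N. The inequality bounds the sum of k |c_(k+1)|^2 and
  is silent about c_1; therefore f must be centred, by a translation that keeps the coefficients
  integral. After f = g o s has been found, g need not be postcritically finite; the induction
  continues with s o g. The condition v(t)^(p-1) > v(p) separates differences t whose value is
  raised to its exact p-th power from those that shrink by v(p). Once lost along an orbit it stays
  lost, so its validity at one late time determines the value of the initial difference.\<close>

hide_const (open) up_ring.coeff up_ring.monom Divisibility.prime Polynomials.degree
  Coset.order Divisibility.irreducible module.smult Polynomials.lead_coeff

subsection \<open>Valuation rings and places\<close>

text \<open>The same notion covers the integers, algebraic integers, valuation rings, unit balls of
  places, the copy of F in its closure and F(\<alpha>), so the closure rules are proved once for all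
  of them.\<close>

definition unital_subring :: "'a::field set \<Rightarrow> bool" where
  "unital_subring R \<longleftrightarrow> 1 \<in> R \<and> (\<forall>x\<in>R. \<forall>y\<in>R. x - y \<in> R \<and> x * y \<in> R)"

definition valuation_ring :: "'a::field set \<Rightarrow> bool" where
  "valuation_ring V \<longleftrightarrow> unital_subring V \<and> (\<forall>x. x \<in> V \<or> inverse x \<in> V)"

definition adjoin_to :: "'a::field set \<Rightarrow> 'a \<Rightarrow> 'a set" where
  "adjoin_to R x = {poly P x | P. \<forall>i. coeff P i \<in> R}"

context
  fixes R :: "'a::field set"
  assumes R: "unital_subring R"
begin

lemma sr_1: "1 \<in> R" and sr_diff: "x \<in> R \<Longrightarrow> y \<in> R \<Longrightarrow> x - y \<in> R"
  and sr_mult: "x \<in> R \<Longrightarrow> y \<in> R \<Longrightarrow> x * y \<in> R"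
  using R by (auto simp: unital_subring_def)

lemma sr_0: "0 \<in> R" using sr_diff[OF sr_1 sr_1] by simp
lemma sr_minus: "x \<in> R \<Longrightarrow> - x \<in> R" using sr_diff[OF sr_0, of x] by simp
lemma sr_add: "x \<in> R \<Longrightarrow> y \<in> R \<Longrightarrow> x + y \<in> R" using sr_diff[of x "- y"] sr_minus by simp
lemma sr_power: "x \<in> R \<Longrightarrow> x ^ n \<in> R" by (induction n) (auto simp: sr_1 sr_mult)
lemma sr_sum: "(\<And>i. i \<in> A \<Longrightarrow> f i \<in> R) \<Longrightarrow> sum f A \<in> R"
  by (induction A rule: infinite_finite_induct) (auto simp: sr_0 sr_add)
lemma sr_nat: "of_nat n \<in> R" by (induction n) (auto simp: sr_0 sr_1 sr_add)
lemma sr_int: "of_int n \<in> R" by (cases n) (auto simp: sr_nat sr_minus sr_diff simp del: of_nat_Suc)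

lemma sr_poly: "(\<And>i. coeff P i \<in> R) \<Longrightarrow> x \<in> R \<Longrightarrow> poly P x \<in> R"
  unfolding poly_altdef by (intro sr_sum sr_mult sr_power)

lemma sr_coeff_mult: "(\<And>i. coeff P i \<in> R) \<Longrightarrow> (\<And>i. coeff Q i \<in> R) \<Longrightarrow> coeff (P * Q) i \<in> R"
  unfolding coeff_mult by (intro sr_sum sr_mult)

lemma adjoin_to_subring: "unital_subring (adjoin_to R x)"
  unfolding unital_subring_def
proof (intro conjI ballI)
  show "1 \<in> adjoin_to R x" unfolding adjoin_to_def
    by (rule CollectI, rule exI[of _ 1]) (auto simp: coeff_1 sr_0 sr_1)
  fix a b assume "a \<in> adjoin_to R x" "b \<in> adjoin_to R x"
  then obtain P Q where PQ: "a = poly P x" "b = poly Q x" "\<And>i. coeff P i \<in> R" "\<And>i. coeff Q i \<in> R"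
    by (auto simp: adjoin_to_def)
  show "a - b \<in> adjoin_to R x" unfolding adjoin_to_def
    by (rule CollectI, rule exI[of _ "P - Q"]) (use PQ in \<open>auto intro: sr_diff\<close>)
  show "a * b \<in> adjoin_to R x" unfolding adjoin_to_def
    by (rule CollectI, rule exI[of _ "P * Q"]) (use PQ in \<open>auto intro: sr_coeff_mult\<close>)
qed

lemma adjoin_to_base: "R \<subseteq> adjoin_to R x"
proof
  fix a assume "a \<in> R"
  then show "a \<in> adjoin_to R x" unfolding adjoin_to_def
    by (intro CollectI exI[of _ "[:a:]"]) (auto simp: coeff_pCons sr_0 split: nat.splits)
qed

lemma adjoin_to_self: "x \<in> adjoin_to R x"
  unfolding adjoin_to_def
  by (intro CollectI exI[of _ "[:0, 1:]"]) (auto simp: coeff_pCons sr_0 sr_1 split: nat.splits)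

end

lemma unital_subring_Ints: "unital_subring (\<int> :: 'a::field set)"
  by (auto simp: unital_subring_def)

text \<open>The powers run downwards because the relation arises from multiplying
  \<open>b = poly P (inverse b)\<close> by \<open>b ^ n\<close>.\<close>

lemma algebraic_int_relation:
  fixes b :: "'a::field_char_0"
  assumes "b ^ Suc n = (\<Sum>i\<le>n. a i * b ^ (n - i))" "\<And>i. a i \<in> \<int>"
  shows "algebraic_int b"
proof -
  define S where "S = (\<Sum>i\<le>n. monom (a i) (n - i))"
  have dS: "degree S \<le> n" unfolding S_def
    by (intro degree_sum_le) (auto intro: order_trans[OF degree_monom_le])
  have S0: "coeff S (Suc n) = 0" using dS by (intro coeff_eq_0) auto
  have d: "degree (monom 1 (Suc n) - S) = Suc n"
    using degree_add_eq_left[of "- S" "monom 1 (Suc n)"] dS by (simp add: degree_monom_eq)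
  have c: "coeff S i \<in> \<int>" for i unfolding S_def coeff_sum by (auto intro!: Ints_sum assms(2))
  show ?thesis unfolding algebraic_int.simps
  proof (intro exI conjI)
    show "b = b" ..
    show "lead_coeff (monom 1 (Suc n) - S) = 1" using d S0 by simp
    show "\<forall>i. coeff (monom 1 (Suc n) - S) i \<in> \<int>" using c by auto
    show "poly (monom 1 (Suc n) - S) b = 0"
      using assms(1) by (simp add: S_def poly_sum poly_monom)
  qed
qed

text \<open>Chevalley's extension theorem: a subring that is maximal among those containing \<open>1/b\<close> but
  not \<open>b\<close> is a valuation ring.\<close>

lemma exists_valuation_ring:
  fixes b :: "'a::field_char_0"
  assumes b: "\<not> algebraic_int b"
  obtains V where "valuation_ring V" "b \<notin> V"
proof -
  define A where "A = {R :: 'a set. unital_subring R \<and> inverse b \<in> R \<and> b \<notin> R}"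
  have b0: "b \<noteq> 0" using b by auto
  have "adjoin_to \<int> (inverse b) \<in> A"
  proof -
    have "b \<notin> adjoin_to \<int> (inverse b)"
    proof
      assume "b \<in> adjoin_to \<int> (inverse b)"
      then obtain P where P: "b = poly P (inverse b)" "\<And>i. coeff P i \<in> \<int>" by (auto simp: adjoin_to_def)
      have "b ^ Suc (degree P) = b ^ degree P * poly P (inverse b)" using P(1) by simp
      also have "\<dots> = (\<Sum>i\<le>degree P. coeff P i * b ^ (degree P - i))"
        unfolding poly_altdef sum_distrib_left
        by (intro sum.cong refl) (auto simp: b0 power_diff power_inverse field_simps)
      finally show False using algebraic_int_relation P(2) b by blast
    qed
    then show ?thesis unfolding A_def
      using adjoin_to_subring[OF unital_subring_Ints] adjoin_to_self[OF unital_subring_Ints] by blast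
  qed
  then have "A \<noteq> {}" by auto
  moreover have "\<Union>C \<in> A" if C: "C \<noteq> {}" "subset.chain A C" for C
  proof -
    have CA: "\<And>R. R \<in> C \<Longrightarrow> R \<in> A" and tot: "\<And>R S. R \<in> C \<Longrightarrow> S \<in> C \<Longrightarrow> R \<subseteq> S \<or> S \<subseteq> R"
      using C(2) by (auto simp: subset.chain_def)
    obtain R0 where R0: "R0 \<in> C" using C by auto
    have "unital_subring (\<Union>C)" unfolding unital_subring_def
    proof (intro conjI ballI)
      show "1 \<in> \<Union>C" using CA[OF R0] R0 by (auto simp: A_def unital_subring_def)
      fix x y assume "x \<in> \<Union>C" "y \<in> \<Union>C"
      then obtain R S where RS: "x \<in> R" "R \<in> C" "y \<in> S" "S \<in> C" by auto
      then obtain T where T: "T \<in> C" "x \<in> T" "y \<in> T" using tot[of R S] by blast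
      then have "x - y \<in> T" "x * y \<in> T" using CA[OF T(1)] by (auto simp: A_def unital_subring_def)
      then show "x - y \<in> \<Union>C" "x * y \<in> \<Union>C" using T(1) by auto
    qed
    moreover have "inverse b \<in> \<Union>C" using CA[OF R0] R0 by (auto simp: A_def)
    moreover have "b \<notin> \<Union>C" using CA by (auto simp: A_def)
    ultimately show ?thesis by (simp add: A_def)
  qed
  ultimately obtain V where V: "V \<in> A" and max: "\<And>R. R \<in> A \<Longrightarrow> V \<subseteq> R \<Longrightarrow> R = V"
    using subset_Zorn_nonempty[of A] by meson
  have sr: "unital_subring V" and ib: "inverse b \<in> V" and bV: "b \<notin> V" using V by (auto simp: A_def)
  have big: "b \<in> adjoin_to V y" if "y \<notin> V" for y
  proof (rule ccontr)
    assume "b \<notin> adjoin_to V y"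
    then have "adjoin_to V y \<in> A"
      using adjoin_to_subring[OF sr] adjoin_to_base[OF sr] ib by (auto simp: A_def)
    then have "adjoin_to V y = V" using max adjoin_to_base[OF sr] by blast
    then show False using adjoin_to_self[OF sr, of y] that by simp
  qed
  \<comment> \<open>Elements congruent to 1 modulo \<open>inverse b\<close> are units of
    \<open>V\<close>: otherwise \<open>b\<close> is a polynomial in \<open>inverse u\<close>, so
    \<open>b * u ^ n\<close> lies in \<open>V\<close> for some \<open>n\<close>; but
    \<open>b * u = b - c\<close> keeps \<open>b * u ^ n\<close> congruent to \<open>b\<close> modulo
    \<open>V\<close>.\<close>
  have unit: "inverse (1 - c * inverse b) \<in> V" if c: "c \<in> V" for c
  proof (rule ccontr)
    define u where "u = 1 - c * inverse b"
    assume "inverse (1 - c * inverse b) \<notin> V"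
    then have "b \<in> adjoin_to V (inverse u)" using big u_def by simp
    then obtain P where P: "b = poly P (inverse u)" "\<And>i. coeff P i \<in> V" by (auto simp: adjoin_to_def)
    have u0: "u \<noteq> 0"
    proof
      assume "u = 0" then have "c = b" using b0 by (simp add: u_def field_simps)
      then show False using c bV by simp
    qed
    have uV: "u \<in> V" unfolding u_def by (intro sr_diff[OF sr] sr_1[OF sr] sr_mult[OF sr] c ib)
    have "b * u ^ degree P = u ^ degree P * poly P (inverse u)" using P(1) by simp
    also have "\<dots> = (\<Sum>i\<le>degree P. coeff P i * u ^ (degree P - i))"
      unfolding poly_altdef sum_distrib_left
      by (intro sum.cong refl) (auto simp: u0 power_diff power_inverse field_simps)
    also have "\<dots> \<in> V" by (intro sr_sum[OF sr] sr_mult[OF sr] sr_power[OF sr] uV P(2))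
    finally have 1: "b * u ^ degree P \<in> V" .
    have 2: "b * u ^ n - b \<in> V" for n
    proof (induction n)
      case 0 then show ?case using sr_0[OF sr] by simp
    next
      case (Suc n)
      have "b * u ^ Suc n - b = (b * u ^ n - b) * u - c" using b0 by (simp add: u_def algebra_simps)
      then show ?case using sr_diff[OF sr sr_mult[OF sr Suc uV] c] by simp
    qed
    have "b \<in> V" using sr_diff[OF sr 1 2[of "degree P"]] by simp
    then show False using bV by simp
  qed
  \<comment> \<open>The usual argument writes 1 as a polynomial in \<open>x\<close> with
    coefficients in the maximal ideal. Here the coefficients are divisible by
    \<open>inverse b\<close>, and clearing it leaves a representation of \<open>b\<close> over
    \<open>V\<close>.\<close>
  define rep where "rep x n \<longleftrightarrow> (\<exists>a. (\<forall>i. a i \<in> V) \<and> b = (\<Sum>i\<le>n. a i * x ^ i))" for x :: 'a and n :: nat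
  have rep_ex: "\<exists>n. rep y n" if "y \<notin> V" for y
  proof -
    obtain P where "b = poly P y" "\<And>i. coeff P i \<in> V" using big \<open>y \<notin> V\<close> by (auto simp: adjoin_to_def)
    then have "rep y (degree P)" unfolding rep_def by (intro exI[of _ "coeff P"]) (auto simp: poly_altdef)
    then show ?thesis ..
  qed
  \<comment> \<open>The constant term of the relation in \<open>inverse x\<close> is absorbed by
    \<open>unit\<close>, which leaves \<open>b\<close> as a combination of negative powers of
    \<open>x\<close>. Substituted into the top term, written as
    \<open>a n * inverse b * b * x ^ n\<close>, it lowers the degree because
    \<open>m \<le> n\<close>.\<close>
  have red: "\<exists>n'<n. rep x n'" if n: "rep x n" and m: "rep (inverse x) m" and mn: "m \<le> n" and x0: "x \<noteq> 0" for x n m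
  proof -
    obtain a where a: "\<And>i. a i \<in> V" "b = (\<Sum>i\<le>n. a i * x ^ i)" using n by (auto simp: rep_def)
    obtain c where c: "\<And>i. c i \<in> V" "b = (\<Sum>i\<le>m. c i * inverse x ^ i)" using m by (auto simp: rep_def)
    have n0: "0 < n"
    proof (rule ccontr)
      assume "\<not> 0 < n" then have "b = a 0" using a(2) by simp
      then show False using a(1) bV by metis
    qed
    define y where "y = inverse (1 - c 0 * inverse b)"
    have yV: "y \<in> V" unfolding y_def by (rule unit[OF c(1)])
    have nz: "1 - c 0 * inverse b \<noteq> 0"
    proof
      assume "1 - c 0 * inverse b = 0" then have "b = c 0" using b0 by (simp add: field_simps)
      then show False using c(1) bV by metis
    qed
    have sp: "{..m} = insert 0 {1..m}" by auto
    have "b * (1 - c 0 * inverse b) = b - c 0" using b0 by (simp add: algebra_simps)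
    also have "b - c 0 = (\<Sum>j\<in>{1..m}. c j * inverse x ^ j)"
      using arg_cong[OF c(2), of "\<lambda>t. t - c 0"] unfolding sp by simp
    finally have b1: "b = y * (\<Sum>j\<in>{1..m}. c j * inverse x ^ j)"
      using nz by (simp add: y_def field_simps)
    define T where "T = {t. \<exists>a. (\<forall>i. a i \<in> V) \<and> t = (\<Sum>i<n. a i * x ^ i)}"
    have T_add: "s + t \<in> T" if st: "s \<in> T" "t \<in> T" for s t
    proof -
      obtain a a' where "\<And>i. a i \<in> V" "s = (\<Sum>i<n. a i * x ^ i)" "\<And>i. a' i \<in> V" "t = (\<Sum>i<n. a' i * x ^ i)"
        using st by (auto simp: T_def)
      then show ?thesis unfolding T_def
        by (intro CollectI exI[of _ "\<lambda>i. a i + a' i"]) (auto simp: sum.distrib algebra_simps intro: sr_add[OF sr])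
    qed
    have T_mon: "v * x ^ i \<in> T" if "v \<in> V" "i < n" for v i
      unfolding T_def
      by (rule CollectI, rule exI[of _ "\<lambda>k. if k = i then v else 0"])
        (use that sr_0[OF sr] in \<open>auto simp: if_distrib[of "\<lambda>t. t * _"] sum.delta cong: if_cong\<close>)
    have T_0: "0 \<in> T" using T_mon[OF sr_0[OF sr] n0] by simp
    have T_sum: "sum f J \<in> T" if "\<And>j. j \<in> J \<Longrightarrow> f j \<in> T" for f :: "nat \<Rightarrow> 'a" and J
      using that by (induction J rule: infinite_finite_induct) (auto simp: T_0 T_add)
    have sp2: "{..n} = insert n {..<n}" by auto
    have "a n * x ^ n = (a n * inverse b) * b * x ^ n" using b0 by simp
    also have "\<dots> = (\<Sum>j\<in>{1..m}. a n * inverse b * y * c j * x ^ (n - j))"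
      apply (subst (2) b1)
      unfolding sum_distrib_left sum_distrib_right
      by (intro sum.cong refl) (use mn x0 in \<open>auto simp: power_diff power_inverse field_simps\<close>)
    also have "\<dots> \<in> T"
      by (intro T_sum T_mon sr_mult[OF sr] a(1) c(1) ib yV) (use n0 in auto)
    finally have "a n * x ^ n \<in> T" .
    moreover have "(\<Sum>i<n. a i * x ^ i) \<in> T" by (intro T_sum T_mon a(1)) auto
    ultimately have "b \<in> T" using T_add a(2) unfolding sp2 by simp
    then obtain a' where "\<And>i. a' i \<in> V" "b = (\<Sum>i<n. a' i * x ^ i)" by (auto simp: T_def)
    moreover have "{..<n} = {..n-1}" using n0 by auto
    ultimately have "rep x (n - 1)" unfolding rep_def by auto
    then show ?thesis using n0 by (intro exI[of _ "n - 1"]) auto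
  qed
  have "x \<in> V \<or> inverse x \<in> V" for x
  proof (rule ccontr)
    assume *: "\<not> (x \<in> V \<or> inverse x \<in> V)"
    then have x0: "x \<noteq> 0" using sr_0[OF sr] by auto
    define n where "n = (LEAST n. rep x n)"
    define m where "m = (LEAST n. rep (inverse x) n)"
    have n: "rep x n" and m: "rep (inverse x) m"
      using rep_ex * by (auto simp: n_def m_def intro: LeastI_ex)
    show False
    proof (cases "m \<le> n")
      case True
      then obtain n' where "n' < n" "rep x n'" using red[OF n m _ x0] by auto
      then show False unfolding n_def using not_less_Least by blast
    next
      case False
      then obtain n' where "n' < m" "rep (inverse x) n'" using red[of "inverse x" m n] n m x0 by auto
      then show False unfolding m_def using not_less_Least by blast
    qed
  qed
  then have "valuation_ring V" using sr by (simp add: valuation_ring_def)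
  then show thesis using that bV by blast
qed

text \<open>If \<open>x\<close> lay outside \<open>V\<close>, its inverse would lie inside, and
  dividing the equation by \<open>x ^ (n - 1)\<close> would express \<open>x\<close> through
  elements of \<open>V\<close>.\<close>

lemma valuation_ring_integrally_closed:
  assumes V: "valuation_ring V"
    and P: "lead_coeff P = 1" "\<And>i. coeff P i \<in> V" "poly P x = 0"
  shows "x \<in> V"
proof (rule ccontr)
  assume xV: "x \<notin> V"
  have sr: "unital_subring V" using V by (simp add: valuation_ring_def)
  have ix: "inverse x \<in> V" using V xV by (auto simp: valuation_ring_def)
  have x0: "x \<noteq> 0" using xV sr_0[OF sr] by auto
  define n where "n = degree P"
  have n0: "0 < n"
  proof (rule ccontr)
    assume "\<not> 0 < n"
    then obtain c where "P = [:c:]" by (auto simp: n_def elim: degree_eq_zeroE)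
    then show False using P by auto
  qed
  have sp: "{..n} = insert n {..<n}" by auto
  have "0 = inverse x ^ (n - 1) * (\<Sum>i\<le>n. coeff P i * x ^ i)"
    using P(3) by (simp add: poly_altdef n_def)
  also have "\<dots> = inverse x ^ (n - 1) * x ^ n + (\<Sum>i<n. coeff P i * inverse x ^ (n - 1 - i))"
    using P(1) unfolding sp
    apply (simp add: n_def[symmetric] distrib_left sum_distrib_left)
    by (intro sum.cong refl) (use x0 in \<open>auto simp: power_diff power_inverse field_simps\<close>)
  also have "inverse x ^ (n - 1) * x ^ n = x"
    using n0 x0 by (cases n) (auto simp: power_inverse)
  finally have e: "x = - (\<Sum>i<n. coeff P i * inverse x ^ (n - 1 - i))" by (simp add: eq_neg_iff_add_eq_0)
  have "- (\<Sum>i<n. coeff P i * inverse x ^ (n - 1 - i)) \<in> V"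
    by (intro sr_minus[OF sr] sr_sum[OF sr] sr_mult[OF sr] sr_power[OF sr] ix P(2))
  then show False using e xV by metis
qed

lemma algebraic_int_in_valuation_ring:
  assumes V: "valuation_ring V" and x: "algebraic_int x"
  shows "x \<in> V"
proof -
  have sr: "unital_subring V" using V by (simp add: valuation_ring_def)
  from x obtain P where P: "lead_coeff P = 1" "\<And>i. coeff P i \<in> \<int>" "poly P x = 0"
    by (auto simp: algebraic_int.simps)
  have "coeff P i \<in> V" for i using P(2)[of i] sr_int[OF sr] by (auto elim: Ints_cases)
  then show ?thesis using valuation_ring_integrally_closed[OF V P(1) _ P(3)] by blast
qed

text \<open>In this form Chevalley's theorem reduces the ring laws for algebraic integers, and the
  integrality of roots of monic polynomials over them, to statements about a single valuation
  ring.\<close>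

lemma algebraic_int_iff:
  fixes x :: "'a::field_char_0"
  shows "algebraic_int x \<longleftrightarrow> (\<forall>V. valuation_ring V \<longrightarrow> x \<in> V)"
  using exists_valuation_ring algebraic_int_in_valuation_ring by metis

lemma algebraic_int_subring: "unital_subring {x :: 'a::field_char_0. algebraic_int x}"
  unfolding unital_subring_def algebraic_int_iff
  by (auto simp: valuation_ring_def intro: sr_1 sr_diff sr_mult)

lemma algebraic_int_add: "algebraic_int x \<Longrightarrow> algebraic_int y \<Longrightarrow> algebraic_int (x + y)"
  and algebraic_int_diff: "algebraic_int x \<Longrightarrow> algebraic_int y \<Longrightarrow> algebraic_int (x - y)"
  and algebraic_int_mult: "algebraic_int x \<Longrightarrow> algebraic_int y \<Longrightarrow> algebraic_int (x * y)"
  and algebraic_int_power: "algebraic_int x \<Longrightarrow> algebraic_int (x ^ n)"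
  and algebraic_int_of_int: "algebraic_int (of_int i)"
  and algebraic_int_of_nat: "algebraic_int (of_nat n)"
  for x y :: "'a::field_char_0"
  using sr_add[OF algebraic_int_subring] sr_diff[OF algebraic_int_subring] sr_mult[OF algebraic_int_subring]
    sr_power[OF algebraic_int_subring] sr_int[OF algebraic_int_subring] sr_nat[OF algebraic_int_subring]
  by auto

lemma algebraic_int_poly_root:
  fixes x :: "'a::field_char_0"
  assumes "lead_coeff P = 1" "\<And>i. algebraic_int (coeff P i)" "poly P x = 0"
  shows "algebraic_int x"
  unfolding algebraic_int_iff
  using valuation_ring_integrally_closed[OF _ assms(1) _ assms(3)]
    algebraic_int_in_valuation_ring[OF _ assms(2)] by blast

section \<open>The normalised p-adic absolute value of a valuation ring in which p is not
  invertible\<close>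

locale p_valuation_ring =
  fixes V :: "'a::field_char_0 set" and p :: nat
  assumes V: "valuation_ring V" and p: "prime p" and ip: "inverse (of_nat p) \<notin> V"
    and alg: "\<And>x::'a. algebraic x"
begin

lemma sr: "unital_subring V" using V by (simp add: valuation_ring_def)

lemma p0: "of_nat p \<noteq> (0::'a)" using p by (auto simp: prime_gt_0_nat)

lemma p1: "1 < real p" using prime_gt_1_nat[OF p] by simp

definition un :: "'a \<Rightarrow> bool" where "un x \<longleftrightarrow> x \<noteq> 0 \<and> x \<in> V \<and> inverse x \<in> V"

lemma un_1: "un 1" using sr_1[OF sr] by (simp add: un_def)
lemma un_mult: "un x \<Longrightarrow> un y \<Longrightarrow> un (x * y)"
  using sr_mult[OF sr] by (auto simp: un_def)
lemma un_inverse: "un x \<Longrightarrow> un (inverse x)" by (auto simp: un_def)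
lemma un_power: "un x \<Longrightarrow> un (x ^ n)" by (induction n) (auto simp: un_1 un_mult)
lemma un_divide: "un x \<Longrightarrow> un y \<Longrightarrow> un (x / y)" by (simp add: divide_inverse un_mult un_inverse)

text \<open>Bezout gives \<open>inverse n = a * (p / n) + b\<close> or
  \<open>inverse p = a + b * (n / p)\<close>, according to which of \<open>p / n\<close> and
  \<open>n / p\<close> lies in \<open>V\<close>; the second contradicts \<open>ip\<close>.\<close>

lemma un_int: assumes "\<not> int p dvd n" shows "un (of_int n)"
proof -
  have "coprime (int p) n" using assms p prime_imp_coprime[of "int p" n] by simp
  then obtain a b where ab: "a * int p + b * n = 1"
    using bezout_int[of "int p" n] by (auto simp: coprime_iff_gcd_eq_1)
  have ab': "of_int a * of_nat p + of_int b * of_int n = (1 :: 'a)"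
    using arg_cong[OF ab, of "of_int :: int \<Rightarrow> 'a"] by simp
  have n0: "of_int n \<noteq> (0::'a)" using assms by auto
  have "inverse (of_int n) \<in> V"
  proof (cases "of_nat p / of_int n \<in> V")
    case True
    have "inverse (of_int n :: 'a) = of_int a * (of_nat p / of_int n) + of_int b"
      using ab' n0 by (simp add: field_simps)
    also have "\<dots> \<in> V" using True by (intro sr_add[OF sr] sr_mult[OF sr] sr_int[OF sr])
    finally show ?thesis .
  next
    case False
    then have T: "of_int n / of_nat p \<in> V" using V unfolding valuation_ring_def by (metis inverse_divide)
    have "inverse (of_nat p :: 'a) = of_int a + of_int b * (of_int n / of_nat p)"
      using ab' p0 by (simp add: field_simps)
    also have "\<dots> \<in> V" using T by (intro sr_add[OF sr] sr_mult[OF sr] sr_int[OF sr])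
    finally show ?thesis using ip by simp
  qed
  then show ?thesis using n0 sr_int[OF sr] by (simp add: un_def)
qed

lemma int_decomp: assumes "n \<noteq> 0"
  obtains k where "un (of_int n * of_nat p powi (- int k))" "k = multiplicity (int p) n"
proof -
  define k where "k = multiplicity (int p) n"
  have "finite {i. int p ^ i dvd n}"
    using p assms by (intro finite_divisor_powers) (auto simp: prime_gt_1_nat)
  obtain m where m: "n = int p ^ k * m" "\<not> int p dvd m"
    using multiplicity_decompose'[OF assms, of "int p"] p prime_gt_1_nat[OF p] unfolding k_def by auto
  have "of_int n * of_nat p powi (- int k) = (of_int m :: 'a)"
    using p0 by (simp add: m(1) power_int_minus field_simps)
  then show thesis using that k_def un_int[OF m(2)] by simp
qed

text \<open>The value group of an algebraic extension of the rationals is torsion modulo the powers of \<open>p\<close>: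
  two terms of a vanishing sum \<open>\<Sum>a\<^sub>i x\<^sup>i\<close> have equal value.\<close>

lemma value_ex:
  assumes x: "x \<noteq> 0"
  obtains s r where "s \<ge> 1" "un (x ^ s * of_nat p powi (- r))"
proof -
  obtain P where P: "\<And>i. coeff P i \<in> \<int>" "P \<noteq> 0" "poly P x = 0"
    using alg[of x] by (auto simp: algebraic_def)
  define I where "I = {i. coeff P i \<noteq> 0}"
  have fI: "finite I" unfolding I_def by (rule finite_subset[of _ "{..degree P}"]) (auto intro: le_degree)
  have I0: "I \<noteq> {}" using P(2) by (auto simp: I_def poly_eq_iff)
  define t where "t i = coeff P i * x ^ i" for i
  have t0: "t i \<noteq> 0" if "i \<in> I" for i using that x by (auto simp: t_def I_def)
  have "(\<Sum>i\<in>I. t i) = (\<Sum>i\<le>degree P. t i)"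
    by (rule sum.mono_neutral_left) (auto simp: I_def t_def intro: le_degree)
  also have "\<dots> = 0" using P(3) by (simp add: poly_altdef t_def)
  finally have sum0: "(\<Sum>i\<in>I. t i) = 0" .
  \<comment> \<open>Divisibility in \<open>V\<close> is a total preorder on nonzero elements, so
    finitely many terms include one of largest value.\<close>
  have max_ex: "\<exists>j\<in>J. \<forall>i\<in>J. t i / t j \<in> V" if "finite J" "J \<noteq> {}" "J \<subseteq> I" for J
    using that
  proof (induction J rule: finite_ne_induct)
    case (singleton a) then show ?case using t0 sr_1[OF sr] by auto
  next
    case (insert a J)
    then obtain j where j: "j \<in> J" "\<forall>i\<in>J. t i / t j \<in> V" by auto
    show ?case
    proof (cases "t a / t j \<in> V")
      case True then show ?thesis using j by auto
    next
      case False
      then have ja: "t j / t a \<in> V" using V unfolding valuation_ring_def by (metis inverse_divide)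
      have "t i / t a \<in> V" if "i \<in> J" for i
      proof -
        have "t i / t a = (t i / t j) * (t j / t a)" using t0[of j] j insert by auto
        then show ?thesis using j(2) that ja sr_mult[OF sr] by metis
      qed
      moreover have "t a / t a \<in> V" using t0[of a] insert sr_1[OF sr] by simp
      ultimately show ?thesis by auto
    qed
  qed
  then obtain j where j: "j \<in> I" "\<And>i. i \<in> I \<Longrightarrow> t i / t j \<in> V" 
    using max_ex[OF fI I0 subset_refl] by metis
  \<comment> \<open>If \<open>t j\<close> alone had the largest value, all other quotients
    \<open>t i / t j\<close> would lie in the maximal ideal \<open>M\<close>, and so would their
    sum, which is the unit -1.\<close>
  have "\<exists>i\<in>I. i \<noteq> j \<and> t j / t i \<in> V"
  proof (rule ccontr)
    assume *: "\<not> ?thesis"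
    have ni: "inverse (t i / t j) \<notin> V" if "i \<in> I" "i \<noteq> j" for i
      using that * by auto
    define M where "M = {a \<in> V. inverse a \<notin> V \<or> a = 0}"
    have M_add: "a + b \<in> M" if "a \<in> M" "b \<in> M" for a b
    proof (rule ccontr)
      assume n: "a + b \<notin> M"
      have ab: "a \<in> V" "b \<in> V" "a + b \<in> V" using that sr_add[OF sr] by (auto simp: M_def)
      have c: "inverse (a + b) \<in> V" "a + b \<noteq> 0" using n ab by (auto simp: M_def)
      have ab0: "a \<noteq> 0" "b \<noteq> 0" using n that by auto
      show False
      proof (cases "b / a \<in> V")
        case True
        have "inverse a = (1 + b / a) * inverse (a + b)" using ab0 c by (simp add: field_simps)
        then have "inverse a \<in> V" using sr_mult[OF sr sr_add[OF sr sr_1[OF sr] True] c(1)] by metis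
        then show False using that(1) ab0 by (simp add: M_def)
      next
        case False
        then have T: "a / b \<in> V" using V unfolding valuation_ring_def by (metis inverse_divide)
        have "inverse b = (1 + a / b) * inverse (a + b)" using ab0 c by (simp add: field_simps)
        then have "inverse b \<in> V" using sr_mult[OF sr sr_add[OF sr sr_1[OF sr] T] c(1)] by metis
        then show False using that(2) ab0 by (simp add: M_def)
      qed
    qed
    have M_0: "0 \<in> M" using sr_0[OF sr] by (simp add: M_def)
    have "(\<Sum>i\<in>I - {j}. t i / t j) \<in> M"
    proof -
      have "(\<Sum>i\<in>K. t i / t j) \<in> M" if "K \<subseteq> I - {j}" for K
        using finite_subset[OF that finite_Diff[OF fI]] that
      proof (induction K rule: finite_induct)
        case (insert i K)
        have "t i / t j \<in> M" using insert j(2)[of i] ni[of i] by (auto simp: M_def)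
        then show ?case using insert M_add by simp
      qed (simp add: M_0)
      then show ?thesis by blast
    qed
    moreover have "(\<Sum>i\<in>I - {j}. t i / t j) = - 1"
    proof -
      have "(\<Sum>i\<in>I - {j}. t i) = - t j" using sum0 sum.remove[OF fI j(1), of t] by (simp add: eq_neg_iff_add_eq_0 add.commute)
      then show ?thesis using t0[OF j(1)] by (simp add: sum_divide_distrib[symmetric])
    qed
    ultimately have "- 1 \<in> M" by simp
    then show False using sr_minus[OF sr sr_1[OF sr]] by (simp add: M_def)
  qed
  then obtain i where i: "i \<in> I" "i \<noteq> j" "t j / t i \<in> V" by auto
  have un_t: "un (t j / t i)" "un (t i / t j)"
    using i j(2)[of i] t0[of i] t0[of j] j(1) by (auto simp: un_def)
  \<comment> \<open>The coefficients are integers, hence units times powers of \<open>p\<close>, so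
    equal values of two terms make \<open>x ^ (a - b)\<close> a unit times a power of
    \<open>p\<close>.\<close>
  have main: "\<exists>r. un (x ^ (a - b) * of_nat p powi (- r))"
    if ab: "a \<in> I" "b \<in> I" "b < a" "un (t a / t b)" for a b
  proof -
    obtain A B where AB: "coeff P a = of_int A" "coeff P b = of_int B"
      using P(1)[of a] P(1)[of b] by (metis Ints_cases)
    have nz: "A \<noteq> 0" "B \<noteq> 0" using ab AB by (auto simp: I_def)
    obtain k l where kl: "un (of_int A * of_nat p powi (- int k))" "un (of_int B * of_nat p powi (- int l))"
      using int_decomp[OF nz(1)] int_decomp[OF nz(2)] by metis
    have e: "t a / t b / (of_int A * of_nat p powi (- int k)) * (of_int B * of_nat p powi (- int l))
        = x ^ (a - b) * of_nat p powi (- (int l - int k))"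
      using nz x p0 ab(3) by (simp add: t_def AB power_int_minus power_int_diff power_diff field_simps)
    have "un (t a / t b / (of_int A * of_nat p powi (- int k)) * (of_int B * of_nat p powi (- int l)))"
      by (intro un_mult un_divide ab(4) kl)
    then show ?thesis unfolding e by blast
  qed
  show thesis
  proof (cases "i < j")
    case True
    then obtain r where "un (x ^ (j - i) * of_nat p powi (- r))" using main[OF j(1) i(1) _ un_t(1)] by auto
    then show ?thesis using that[of "j - i" r] True by simp
  next
    case False
    then obtain r where "un (x ^ (i - j) * of_nat p powi (- r))" using main[OF i(1) j(1) _ un_t(2)] i(2) by auto
    then show ?thesis using that[of "i - j" r] False i(2) by simp
  qed
qed

lemma power_value:
  "((x::'a) ^ s * of_nat p powi (- r)) ^ t = x ^ (s * t) * of_nat p powi (- (r * int t))"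
proof -
  have "(of_nat p powi (- r)) ^ t = (of_nat p :: 'a) powi (- (r * int t))"
    by (metis minus_mult_left power_int_mult power_int_of_nat)
  then show ?thesis by (simp add: power_mult_distrib power_mult)
qed

lemma un_p_powi: assumes "un (of_nat p powi r)" shows "r = 0"
proof (rule ccontr)
  assume "r \<noteq> 0"
  have pp: "un (of_nat p ^ Suc n) \<Longrightarrow> False" for n
  proof -
    assume u: "un (of_nat p ^ Suc n)"
    have "inverse (of_nat p :: 'a) = of_nat p ^ n * inverse (of_nat p ^ Suc n)" using p0 by (simp add: field_simps)
    moreover have "of_nat p ^ n * inverse (of_nat p ^ Suc n) \<in> V"
      using u by (intro sr_mult[OF sr] sr_power[OF sr] sr_nat[OF sr]) (simp add: un_def)
    ultimately show False using ip by metis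
  qed
  show False
  proof (cases "r > 0")
    case True
    then obtain n where "r = int (Suc n)" by (metis pos_int_cases Suc_pred)
    then show False using assms pp[of n] by (metis power_int_of_nat)
  next
    case False
    then obtain n where "r = - int (Suc n)" using \<open>r \<noteq> 0\<close> by (metis neg_int_cases not_less_iff_gr_or_eq Suc_pred)
    then have "un (inverse (of_nat p powi r))" "inverse (of_nat p powi r) = (of_nat p ^ Suc n :: 'a)"
      using un_inverse[OF assms] by (auto simp: power_int_minus simp del: of_nat_Suc power_Suc)
    then show False using pp[of n] by simp
  qed
qed

text \<open>If \<open>x ^ s\<close> is a unit times \<open>p ^ r\<close>, the value is
  \<open>p powr (- r / s)\<close>, normalised so that \<open>p\<close> has value
  \<open>1 / p\<close>. By \<open>val_eq\<close> the quotient does not depend on the choice of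
  \<open>s\<close> and \<open>r\<close>.\<close>

definition val :: "'a \<Rightarrow> real" where
  "val x = (if x = 0 then 0 else
     real p powr (- (SOME l. \<exists>s r. s \<ge> 1 \<and> l = of_int r / real s \<and> un (x ^ s * of_nat p powi (- r)))))"

lemma val_eq:
  assumes s: "s \<ge> 1" and u: "un (x ^ s * of_nat p powi (- r))"
  shows "val x = real p powr (- (of_int r / real s))"
proof -
  have x0: "x \<noteq> 0" using u s by (auto simp: un_def)
  have uniq: "of_int r' / real s' = (of_int r / real s :: real)"
    if s': "s' \<ge> 1" and u': "un (x ^ s' * of_nat p powi (- r'))" for s' r'
  proof -
    have "un ((x ^ s * of_nat p powi (- r)) ^ s' / (x ^ s' * of_nat p powi (- r')) ^ s)"
      by (intro un_divide un_power u u')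
    also have "(x ^ s * of_nat p powi (- r)) ^ s' / (x ^ s' * of_nat p powi (- r')) ^ s
       = of_nat p powi (r' * int s - r * int s')"
    proof -
      have "(of_nat p powi (- (r * int s')) :: 'a) / of_nat p powi (- (r' * int s)) = of_nat p powi (r' * int s - r * int s')"
        using p0 by (subst power_int_diff[symmetric]) (auto simp: algebra_simps)
      then show ?thesis unfolding power_value using x0 by (simp add: mult.commute[of s' s])
    qed
    finally have "r' * int s - r * int s' = 0" by (rule un_p_powi)
    then have "real_of_int r' * real s = of_int r * real s'" by (metis (mono_tags) eq_iff_diff_eq_0 of_int_mult of_int_of_nat_eq)
    then show ?thesis using s s' by (simp add: field_simps)
  qed
  have "(SOME l. \<exists>s r. s \<ge> 1 \<and> l = of_int r / real s \<and> un (x ^ s * of_nat p powi (- r))) = of_int r / real s"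
    by (rule some_equality) (use s u uniq in blast)+
  then show ?thesis using x0 by (simp add: val_def)
qed

lemma val_0 [simp]: "val 0 = 0" by (simp add: val_def)

lemma val_pos: "x \<noteq> 0 \<Longrightarrow> 0 < val x" using p1 by (auto simp: val_def)

lemma val_nonneg: "0 \<le> val x" using val_pos[of x] by (cases "x = 0") auto

lemma val_mult: "val (x * y) = val x * val y"
proof (cases "x = 0 \<or> y = 0")
  case False
  then obtain s r s' r' where sr: "s \<ge> 1" "un (x ^ s * of_nat p powi (- r))"
      "s' \<ge> 1" "un (y ^ s' * of_nat p powi (- r'))"
    using value_ex[of x] value_ex[of y] by metis
  have "un ((x ^ s * of_nat p powi (- r)) ^ s' * (y ^ s' * of_nat p powi (- r')) ^ s)"
    by (intro un_mult un_power sr)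
  also have "(x ^ s * of_nat p powi (- r)) ^ s' * (y ^ s' * of_nat p powi (- r')) ^ s
      = (x * y) ^ (s * s') * of_nat p powi (- (r * int s' + r' * int s))"
  proof -
    have P: "(of_nat p powi (- (r * int s')) :: 'a) * of_nat p powi (- (r' * int s)) = of_nat p powi (- (r * int s' + r' * int s))"
      using p0 by (subst power_int_add[symmetric]) (auto simp: algebra_simps)
    have swap: "a * b * (c * d) = a * c * (b * d)" for a b c d :: 'a by simp
    show ?thesis unfolding power_value unfolding mult.commute[of s' s] power_mult_distrib by (subst swap) (simp only: P)
  qed
  finally have "val (x * y) = real p powr (- (of_int (r * int s' + r' * int s) / real (s * s')))"
    using sr by (intro val_eq) auto
  also have "of_int (r * int s' + r' * int s) / real (s * s') = of_int r / real s + of_int r' / real s'"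
    using sr by (simp add: add_divide_distrib)
  finally show ?thesis using val_eq[OF sr(1,2)] val_eq[OF sr(3,4)] by (simp add: powr_add[symmetric])
qed auto

text \<open>With \<open>x ^ s\<close> a unit times \<open>p ^ r\<close>, the sign of
  \<open>r\<close> decides: \<open>r \<ge> 0\<close> puts \<open>x ^ s\<close>, and hence
  \<open>x\<close>, into \<open>V\<close>, whereas for \<open>r < 0\<close> an \<open>x\<close> in
  \<open>V\<close> would put \<open>inverse p\<close> there.\<close>

lemma val_le_1: "val x \<le> 1 \<longleftrightarrow> x \<in> V"
proof (cases "x = 0")
  case True then show ?thesis using sr_0[OF sr] by simp
next
  case False
  then obtain s r where sr': "s \<ge> 1" "un (x ^ s * of_nat p powi (- r))" using value_ex by metis
  define u where "u = x ^ s * of_nat p powi (- r)"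
  have u: "u \<in> V" "inverse u \<in> V" "u \<noteq> 0" using sr'(2) by (auto simp: un_def u_def)
  have "val x \<le> 1 \<longleftrightarrow> real p powr (- (of_int r / real s)) \<le> real p powr 0"
    using val_eq[OF sr'] p1 by simp
  also have "\<dots> \<longleftrightarrow> 0 \<le> r" unfolding powr_le_cancel_iff[OF p1] using sr'(1) by (simp add: zero_le_divide_iff)
  also have "\<dots> \<longleftrightarrow> x \<in> V"
  proof
    assume "0 \<le> r"
    then obtain n where n: "r = int n" by (metis nonneg_int_cases)
    have "x ^ s = u * of_nat p ^ n" using p0 by (simp add: u_def n power_int_minus)
    then have xs: "x ^ s \<in> V" using u by (auto intro!: sr_mult[OF sr] sr_power[OF sr] sr_nat[OF sr])
    show "x \<in> V"
    proof (rule ccontr)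
      assume n: "x \<notin> V"
      then have i: "inverse x \<in> V" using V by (auto simp: valuation_ring_def)
      have "x = x ^ s * inverse x ^ (s - 1)" using sr'(1) False by (cases s) (auto simp: field_simps)
      then show False using n xs sr_mult[OF sr xs sr_power[OF sr i, of "s - 1"]] by simp
    qed
  next
    assume xV: "x \<in> V"
    show "0 \<le> r"
    proof (rule ccontr)
      assume "\<not> 0 \<le> r"
      then obtain n where n: "r = - int (Suc n)" by (metis neg_int_cases not_le Suc_pred)
      have "u = x ^ s * of_nat p ^ Suc n" unfolding u_def n by (metis minus_minus power_int_of_nat)
      then have "inverse (of_nat p) = x ^ s * of_nat p ^ n * inverse u"
        using p0 False u(3) by (simp add: field_simps)
      then show False using ip u xV by (metis sr sr_mult sr_nat sr_power)
    qed
  qed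
  finally show ?thesis .
qed

lemma val_1: "val 1 = 1" using val_eq[of 1 1 0] un_1 p1 by simp

lemma val_inverse: "val (inverse x) = inverse (val x)"
proof (cases "x = 0")
  case False
  then have "val x * val (inverse x) = 1" using val_mult[of x "inverse x"] val_1 by simp
  then show ?thesis by (metis inverse_unique)
qed auto

lemma val_add_aux: assumes "val x \<le> val y" "y \<noteq> 0" shows "val (x + y) \<le> val y"
proof -
  have "val (x / y) = val x / val y" by (simp only: divide_inverse val_mult val_inverse)
  then have "val (x / y) \<le> 1" using assms val_pos[of y] by simp
  then have "1 + x / y \<in> V" using sr_add[OF sr sr_1[OF sr]] val_le_1 by simp
  then have "val (1 + x / y) * val y \<le> 1 * val y" using val_le_1 val_nonneg by (intro mult_right_mono) auto
  moreover have "(1 + x / y) * y = x + y" using assms(2) by (simp add: distrib_right)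
  ultimately show ?thesis by (simp add: val_mult[symmetric])
qed

lemma val_add: "val (x + y) \<le> max (val x) (val y)"
proof -
  consider "val x \<le> val y" "y \<noteq> 0" | "val y \<le> val x" "x \<noteq> 0" | "x = 0" "y = 0"
    by (metis le_cases val_0 val_pos not_le)
  then show ?thesis
    by cases (use val_add_aux[of x y] val_add_aux[of y x] in \<open>auto simp: add.commute\<close>)
qed

lemma val_int: assumes "n \<noteq> 0" shows "val (of_int n) = (1 / real p) ^ multiplicity (int p) n"
proof -
  obtain k where k: "un (of_int n * of_nat p powi (- int k))" "k = multiplicity (int p) n"
    using int_decomp[OF assms] by metis
  have "val (of_int n) = real p powr (- (of_int (int k) / real 1))"
    by (rule val_eq) (use k in auto)
  also have "\<dots> = (1 / real p) ^ k" using p1 by (simp add: powr_minus powr_realpow power_one_over power_inverse divide_inverse)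
  finally show ?thesis using k by simp
qed

lemma place_above_val: "place_above p val"
proof -
  have "val (x + y) \<le> val x + val y" for x y using val_add[of x y] val_nonneg[of x] val_nonneg[of y] by linarith
  moreover have "val x = 0 \<longleftrightarrow> x = 0" for x by (metis val_0 val_pos less_irrefl)
  ultimately show ?thesis unfolding place_above_def absolute_value_def using val_nonneg val_mult val_int by blast
qed

end

text \<open>Some valuation ring omits \<open>b\<close>. Since \<open>p ^ N * b\<close> is integral,
  \<open>inverse p\<close> cannot lie in this ring, so it sits over \<open>p\<close>. The
  ultrametric inequality is returned separately because \<open>place_above\<close> records the
  triangle inequality only.\<close>

lemma exists_place:
  fixes b :: "'a::field_char_0"
  assumes alg: "\<And>x::'a. algebraic x" and p: "prime p"
    and b: "\<not> algebraic_int b" and pb: "algebraic_int (of_nat p ^ N * b)"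
  obtains v :: "'a \<Rightarrow> real" where "place_above p v" "\<And>x y. v (x + y) \<le> max (v x) (v y)"
    "\<And>x. algebraic_int x \<Longrightarrow> v x \<le> 1" "1 < v b"
proof -
  obtain W where W: "valuation_ring W" "b \<notin> W" using exists_valuation_ring[OF b] .
  have srW: "unital_subring W" using W by (simp add: valuation_ring_def)
  have "inverse (of_nat p) \<notin> W"
  proof
    assume i: "inverse (of_nat p) \<in> W"
    have "b = inverse (of_nat p) ^ N * (of_nat p ^ N * b)" using p by (auto simp: field_simps prime_gt_0_nat)
    then show False using W(2) algebraic_int_in_valuation_ring[OF W(1) pb] sr_power[OF srW i, of N] sr_mult[OF srW] by metis
  qed
  then interpret p_valuation_ring W p by unfold_locales (use W p alg in auto)
  show thesis
    by (rule that[OF place_above_val val_add])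
      (use W(2) val_le_1 algebraic_int_in_valuation_ring[OF W(1)] in \<open>auto simp: not_le[symmetric]\<close>)
qed

subsection \<open>Inverse branches of a complex polynomial\<close>

lemma degree_diff_const: "degree P > 0 \<Longrightarrow> degree (P - [:w:]) = degree P" for w :: "'a::comm_ring_1"
  by (metis degree_add_eq_left degree_minus degree_pCons_0 diff_conv_add_uminus)

lemma card_fiber:
  fixes P :: "complex poly"
  assumes d: "degree P > 0" and w: "\<And>z. poly P z = w \<Longrightarrow> poly (pderiv P) z \<noteq> 0"
  shows "finite {z. poly P z = w}" "card {z. poly P z = w} = degree P"
proof -
  define Q where "Q = P - [:w:]"
  have dQ: "degree Q = degree P" using d by (simp add: Q_def degree_diff_const)
  have Q0: "Q \<noteq> 0" using dQ d by auto
  have r: "{z. poly P z = w} = {z. poly Q z = 0}" by (auto simp: Q_def)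
  then show "finite {z. poly P z = w}" using poly_roots_finite[OF Q0] by simp
  have "rsquarefree Q" unfolding rsquarefree_roots using w by (auto simp: Q_def pderiv_diff)
  then have o: "order a Q = 1" if "poly Q a = 0" for a
    using rsquarefree_root_order[OF _ that Q0] by simp
  have "degree Q = size (proots Q)" by (simp add: size_proots_complex)
  also have "\<dots> = (\<Sum>x\<in>set_mset (proots Q). count (proots Q) x)" by (rule size_multiset_overloaded_eq)
  also have "\<dots> = (\<Sum>x\<in>{z. poly Q z = 0}. 1)"
    using Q0 o by (intro sum.cong) auto
  finally show "card {z. poly P z = w} = degree P" using dQ r by simp
qed

text \<open>Local inverses at the points of the fibre take values in balls of half the separation of
  the fibre, so they are distinct; as the fibre has \<open>degree P\<close> points, they exhaust
  every nearby fibre.\<close>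

lemma local_branches:
  fixes P :: "complex poly"
  defines "Z w \<equiv> {z. poly P z = w}"
  assumes d: "degree P > 0" and cr: "\<And>z. poly P z = w0 \<Longrightarrow> poly (pderiv P) z \<noteq> 0"
  obtains \<epsilon> g where "\<epsilon> > 0"
    "\<And>z. z \<in> Z w0 \<Longrightarrow> g z holomorphic_on ball w0 \<epsilon>" "\<And>z. z \<in> Z w0 \<Longrightarrow> g z w0 = z"
    "\<And>z w. z \<in> Z w0 \<Longrightarrow> w \<in> ball w0 \<epsilon> \<Longrightarrow> poly P (g z w) = w"
    "\<And>w. w \<in> ball w0 \<epsilon> \<Longrightarrow> Z w = (\<lambda>z. g z w) ` Z w0"
    "\<And>w. w \<in> ball w0 \<epsilon> \<Longrightarrow> inj_on (\<lambda>z. g z w) (Z w0)"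
proof -
  have fin: "finite (Z w0)" and card: "card (Z w0) = degree P"
    using card_fiber[OF d cr] by (auto simp: Z_def)
  have "\<exists>\<delta>>0. \<forall>x\<in>Z w0. x \<noteq> z \<longrightarrow> \<delta> \<le> dist z x" for z
    using finite_set_avoid[OF fin] by blast
  then obtain \<delta> where \<delta>: "\<And>z. \<delta> z > 0" "\<And>z x. x \<in> Z w0 \<Longrightarrow> x \<noteq> z \<Longrightarrow> \<delta> z \<le> dist z x" by metis
  have ex: "\<exists>A h. z \<in> A \<and> A \<subseteq> ball z (\<delta> z / 2) \<and> open (poly P ` A) \<and> h holomorphic_on (poly P ` A)
      \<and> (\<forall>x\<in>A. h (poly P x) = x)" if z: "z \<in> Z w0" for z
  proof -
    have hol: "poly P holomorphic_on ball z (\<delta> z / 2)" by (intro holomorphic_intros)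
    have "deriv (poly P) z \<noteq> 0" using cr z by (simp add: Z_def DERIV_imp_deriv[OF poly_DERIV])
    then obtain r where r: "r > 0" "ball z r \<subseteq> ball z (\<delta> z / 2)" "open (poly P ` ball z r)" "inj_on (poly P) (ball z r)"
      using has_complex_derivative_locally_invertible[OF hol, of z] \<delta>(1)[of z] by auto
    obtain h where "h holomorphic_on (poly P ` ball z r)" "\<And>x. x \<in> ball z r \<Longrightarrow> h (poly P x) = x"
      using holomorphic_has_inverse[OF holomorphic_on_subset[OF hol r(2)] open_ball r(4)] by metis
    then show ?thesis using r by (intro exI[of _ "ball z r"] exI[of _ h]) auto
  qed
  obtain A h where A: "\<And>z. z \<in> Z w0 \<Longrightarrow> z \<in> A z" "\<And>z. z \<in> Z w0 \<Longrightarrow> A z \<subseteq> ball z (\<delta> z / 2)"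
      "\<And>z. z \<in> Z w0 \<Longrightarrow> open (poly P ` A z)" "\<And>z. z \<in> Z w0 \<Longrightarrow> h z holomorphic_on (poly P ` A z)"
      "\<And>z x. z \<in> Z w0 \<Longrightarrow> x \<in> A z \<Longrightarrow> h z (poly P x) = x"
    using ex by metis
  have "open (\<Inter>z\<in>Z w0. poly P ` A z)" using fin A(3) by (intro open_INT) auto
  moreover have "w0 \<in> (\<Inter>z\<in>Z w0. poly P ` A z)" using A(1) by (force simp: Z_def)
  ultimately obtain \<epsilon> where \<epsilon>: "\<epsilon> > 0" "ball w0 \<epsilon> \<subseteq> (\<Inter>z\<in>Z w0. poly P ` A z)"
    by (meson openE)
  have inA: "h z w \<in> A z \<and> poly P (h z w) = w" if zw: "z \<in> Z w0" "w \<in> ball w0 \<epsilon>" for z w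
  proof -
    have "w \<in> poly P ` A z" using \<epsilon>(2) zw by blast
    then obtain x where "x \<in> A z" "w = poly P x" by blast
    then show ?thesis using A(5)[OF zw(1)] by simp
  qed
  have inj: "inj_on (\<lambda>z. h z w) (Z w0)" if w: "w \<in> ball w0 \<epsilon>" for w
  proof (rule inj_onI, rule ccontr)
    fix x y assume *: "x \<in> Z w0" "y \<in> Z w0" "h x w = h y w" "x \<noteq> y"
    have "h x w \<in> ball x (\<delta> x / 2)" "h x w \<in> ball y (\<delta> y / 2)"
      using inA[of x w] inA[of y w] A(2)[of x] A(2)[of y] * w by auto
    then have "dist x y < \<delta> x / 2 + \<delta> y / 2"
      using dist_triangle_half_l[of x "h x w"] dist_triangle[of x y "h x w"] by (simp add: dist_commute)
    moreover have "\<delta> x \<le> dist x y" "\<delta> y \<le> dist x y"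
      using \<delta>(2)[of y x] \<delta>(2)[of x y] * by (auto simp: dist_commute)
    ultimately show False by linarith
  qed
  show thesis
  proof (rule that[OF \<epsilon>(1), of h])
    fix w assume w: "w \<in> ball w0 \<epsilon>"
    show "inj_on (\<lambda>z. h z w) (Z w0)" by (rule inj[OF w])
    have sub: "(\<lambda>z. h z w) ` Z w0 \<subseteq> Z w" using inA w by (auto simp: Z_def)
    have P0: "P - [:w:] \<noteq> 0" using d by auto
    have Zw: "Z w = {z. poly (P - [:w:]) z = 0}" by (auto simp: Z_def)
    have "finite (Z w)" unfolding Zw by (rule poly_roots_finite[OF P0])
    moreover have "card (Z w) \<le> degree P"
      using card_poly_roots_bound[OF P0] d unfolding Zw by (simp add: degree_diff_const)
    ultimately show "Z w = (\<lambda>z. h z w) ` Z w0"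
      using card_seteq[OF _ sub] card_image[OF inj[OF w]] card by simp
  next
    fix z assume z: "z \<in> Z w0"
    show "h z holomorphic_on ball w0 \<epsilon>"
      using \<epsilon>(2) z by (intro holomorphic_on_subset[OF A(4)[OF z]]) auto
    show "h z w0 = z" using A(5)[OF z A(1)[OF z]] z by (simp add: Z_def)
  next
    fix z w assume "z \<in> Z w0" "w \<in> ball w0 \<epsilon>"
    then show "poly P (h z w) = w" using inA by blast
  qed
qed

text \<open>All critical values lie in the closed disc of radius \<open>\<rho>\<close>, so each
  point outside it has a disc over which the local branches form disjoint sheets.\<close>

lemma polynomial_covering_space:
  fixes P :: "complex poly"
  assumes d: "degree P > 0" and cr: "\<forall>z. poly (pderiv P) z = 0 \<longrightarrow> cmod (poly P z) \<le> \<rho>"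
  shows "covering_space {z. \<rho> < cmod (poly P z)} (poly P) {w. \<rho> < cmod w}"
proof
  show "continuous_on {z. \<rho> < cmod (poly P z)} (poly P)" by (intro continuous_intros)
  have opC: "open {z. \<rho> < cmod (poly P z)}" by (intro open_Collect_less continuous_intros)
  have opS: "open {w::complex. \<rho> < cmod w}" by (intro open_Collect_less continuous_intros)
  show "poly P ` {z. \<rho> < cmod (poly P z)} = {w. \<rho> < cmod w}"
  proof (intro equalityI subsetI)
    fix w assume w: "w \<in> {w. \<rho> < cmod w}"
    have "\<not> constant (poly (P - [:w:]))" using d by (simp add: constant_degree degree_diff_const)
    then obtain z where "poly (P - [:w:]) z = 0" using Fundamental_Theorem_Algebra.fundamental_theorem_of_algebra by blast
    then show "w \<in> poly P ` {z. \<rho> < cmod (poly P z)}" using w by auto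
  qed auto
  fix w0 assume w0: "w0 \<in> {w. \<rho> < cmod w}"
  have cr0: "poly (pderiv P) z \<noteq> 0" if "poly P z = w0" for z using cr that w0 by auto
  obtain \<epsilon>1 g where e1: "\<epsilon>1 > 0"
    "\<And>z. z \<in> {z. poly P z = w0} \<Longrightarrow> g z holomorphic_on ball w0 \<epsilon>1"
    "\<And>z. z \<in> {z. poly P z = w0} \<Longrightarrow> g z w0 = z"
    "\<And>z w. z \<in> {z. poly P z = w0} \<Longrightarrow> w \<in> ball w0 \<epsilon>1 \<Longrightarrow> poly P (g z w) = w"
    "\<And>w. w \<in> ball w0 \<epsilon>1 \<Longrightarrow> {z. poly P z = w} = (\<lambda>z. g z w) ` {z. poly P z = w0}"
    "\<And>w. w \<in> ball w0 \<epsilon>1 \<Longrightarrow> inj_on (\<lambda>z. g z w) {z. poly P z = w0}"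
    by (rule local_branches[OF d, of w0], erule cr0, rule that)
  obtain \<epsilon>2 where e2: "\<epsilon>2 > 0" "ball w0 \<epsilon>2 \<subseteq> {w. \<rho> < cmod w}" using opS w0 by (meson openE)
  define \<epsilon> where "\<epsilon> = min \<epsilon>1 \<epsilon>2"
  define Z where "Z = {z. poly P z = w0}"
  define T where "T = ball w0 \<epsilon>"
  have T1: "T \<subseteq> ball w0 \<epsilon>1" and T2: "T \<subseteq> {w. \<rho> < cmod w}" and \<epsilon>: "\<epsilon> > 0"
    using e1(1) e2 by (auto simp: T_def \<epsilon>_def)
  have hol: "g z holomorphic_on T" if "z \<in> Z" for z
    using holomorphic_on_subset[OF e1(2) T1] that by (auto simp: Z_def)
  have Pg: "poly P (g z w) = w" if "z \<in> Z" "w \<in> T" for z w using e1(4) T1 that by (auto simp: Z_def)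
  have injg: "inj_on (g z) T" if "z \<in> Z" for z using Pg[OF that] by (metis inj_onI)
  have opT: "open T" by (simp add: T_def)
  have op: "open (g z ` T)" if "z \<in> Z" for z
    by (rule open_mapping_thm3[OF hol[OF that] opT injg[OF that]])
  have subC: "g z ` T \<subseteq> {z. \<rho> < cmod (poly P z)}" if "z \<in> Z" for z using Pg[OF that] T2 by auto
  show "\<exists>T. w0 \<in> T \<and> openin (top_of_set {w. \<rho> < cmod w}) T \<and>
      (\<exists>v. \<Union> v = {z. \<rho> < cmod (poly P z)} \<inter> poly P -` T \<and>
        (\<forall>u\<in>v. openin (top_of_set {z. \<rho> < cmod (poly P z)}) u) \<and>
        pairwise disjnt v \<and> (\<forall>u\<in>v. \<exists>q. homeomorphism u T (poly P) q))"
  proof (intro exI[of _ T] conjI exI[of _ "(\<lambda>z. g z ` T) ` Z"])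
    show "w0 \<in> T" using \<epsilon> by (simp add: T_def)
    show "openin (top_of_set {w. \<rho> < cmod w}) T" using T2 opT by (intro open_subset) auto
    show "\<Union> ((\<lambda>z. g z ` T) ` Z) = {z. \<rho> < cmod (poly P z)} \<inter> poly P -` T"
    proof (intro equalityI subsetI)
      fix x assume "x \<in> {z. \<rho> < cmod (poly P z)} \<inter> poly P -` T"
      then have x: "poly P x \<in> T" by auto
      have "x \<in> {z. poly P z = poly P x}" by simp
      also have "\<dots> = (\<lambda>z. g z (poly P x)) ` Z" using e1(5)[OF subsetD[OF T1 x]] by (simp add: Z_def)
      finally have "x \<in> (\<lambda>z. g z (poly P x)) ` Z" .
      then show "x \<in> \<Union> ((\<lambda>z. g z ` T) ` Z)" using x by auto
    qed (use subC Pg in auto)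
    show "\<forall>u\<in>(\<lambda>z. g z ` T) ` Z. openin (top_of_set {z. \<rho> < cmod (poly P z)}) u"
      using op subC opC by (auto intro!: open_subset)
    show "pairwise disjnt ((\<lambda>z. g z ` T) ` Z)"
    proof (rule pairwise_imageI)
      fix x y assume xy: "x \<in> Z" "y \<in> Z" "x \<noteq> y" "g x ` T \<noteq> g y ` T"
      have False if "a \<in> T" "b \<in> T" "g x a = g y b" for a b
      proof -
        have "a = b" using Pg[OF xy(1) that(1)] Pg[OF xy(2) that(2)] that(3) by simp
        then show False using inj_onD[OF e1(6)[of a], of x y] that T1 xy by (auto simp: Z_def)
      qed
      then show "disjnt (g x ` T) (g y ` T)" by (auto simp: disjnt_def)
    qed
    show "\<forall>u\<in>(\<lambda>z. g z ` T) ` Z. \<exists>q. homeomorphism u T (poly P) q"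
    proof safe
      fix z assume z: "z \<in> Z"
      have "homeomorphism (g z ` T) T (poly P) (g z)"
        using Pg[OF z] hol[OF z]
        by (intro homeomorphismI) (auto intro: continuous_intros holomorphic_on_imp_continuous_on)
      then show "\<exists>q. homeomorphism (g z ` T) T (poly P) q" by (intro exI[of _ "g z"])
    qed
  qed
qed

text \<open>The exterior inverse \<open>\<phi>\<close> of a monic \<open>P\<close> of degree \<open>D\<close>, normalised by \<open>P(\<phi>(1/u)) = u\<^sup>-\<^sup>D\<close>, is
  \<open>u \<mapsto> F u / u\<close>. It is first constructed on a half plane as a lift of \<open>\<sigma> \<mapsto> exp (D \<sigma>)\<close>; a deck
  transformation makes it asymptotic to \<open>exp \<sigma>\<close>, which forces period \<open>2\<pi>i\<close>.\<close>

lemma poly_asymp: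
  fixes P :: "complex poly"
  assumes "lead_coeff P = 1"
  shows "((\<lambda>z. poly P z / z ^ degree P) \<longlongrightarrow> 1) at_infinity"
proof -
  have "((\<lambda>z. \<Sum>i\<le>degree P. coeff P i * inverse z ^ (degree P - i)) \<longlongrightarrow>
      (\<Sum>i\<le>degree P. coeff P i * 0 ^ (degree P - i))) at_infinity"
    by (intro tendsto_intros tendsto_inverse_0)
  also have "(\<Sum>i\<le>degree P. coeff P i * 0 ^ (degree P - i)) = (\<Sum>i\<in>{degree P}. coeff P i * 0 ^ (degree P - i))"
    by (rule sum.mono_neutral_right) auto
  also have "\<dots> = 1" using assms by simp
  finally show ?thesis
  proof (rule Lim_transform_eventually)
    have "eventually (\<lambda>z::complex. z \<noteq> 0) at_infinity"
      unfolding eventually_at_infinity by (intro exI[of _ 1]) auto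
    then show "\<forall>\<^sub>F z in at_infinity. (\<Sum>i\<le>degree P. coeff P i * inverse z ^ (degree P - i)) = poly P z / z ^ degree P"
    proof eventually_elim
      case (elim z)
      then show ?case unfolding poly_altdef sum_divide_distrib
        by (intro sum.cong refl) (auto simp: power_diff power_inverse field_simps)
    qed
  qed
qed

text \<open>Uniqueness of lifts belongs to the conclusion because both the periods of
  \<open>g\<close> and the injectivity of the exterior inverse are derived from it.\<close>

lemma half_plane_lift:
  fixes P :: "complex poly" and s :: real
  defines "H \<equiv> {\<sigma>. ln s < Re \<sigma>}" and "D \<equiv> degree P"
  assumes m: "lead_coeff P = 1" and d: "degree P > 0" and s: "s > 0"
    and cr: "\<forall>z. poly (pderiv P) z = 0 \<longrightarrow> cmod (poly P z) \<le> s ^ degree P"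
  shows "\<exists>g. g holomorphic_on H \<and> (\<forall>\<sigma>\<in>H. poly P (g \<sigma>) = exp (of_nat D * \<sigma>)) \<and>
    (\<forall>e>0. \<exists>R. \<forall>\<sigma>. R < Re \<sigma> \<longrightarrow> cmod (g \<sigma> / exp \<sigma> - 1) < e) \<and>
    (\<forall>h h'. continuous_on H h \<longrightarrow> continuous_on H h' \<longrightarrow> (\<forall>\<sigma>\<in>H. poly P (h \<sigma>) = exp (of_nat D * \<sigma>))
      \<longrightarrow> (\<forall>\<sigma>\<in>H. poly P (h' \<sigma>) = exp (of_nat D * \<sigma>)) \<longrightarrow> (\<exists>\<sigma>\<in>H. h \<sigma> = h' \<sigma>) \<longrightarrow> (\<forall>\<sigma>\<in>H. h \<sigma> = h' \<sigma>))"
proof -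
  have D0: "D > 0" using d by (simp add: D_def)
  note cov = polynomial_covering_space[OF d cr]
  define C where "C = {z. s ^ degree P < cmod (poly P z)}"
  define S where "S = {w::complex. s ^ degree P < cmod w}"
  have convH: "convex H" unfolding H_def using convex_halfspace_Re_gt by simp
  have oH: "open H" unfolding H_def by (rule open_halfspace_Re_gt)
  have fH: "(\<lambda>\<sigma>. exp (of_nat D * \<sigma>)) \<in> H \<rightarrow> S"
  proof
    fix \<sigma> assume "\<sigma> \<in> H"
    then have "of_nat D * ln s < of_nat D * Re \<sigma>" using D0 by (simp add: H_def)
    then have "exp (of_nat D * ln s) < exp (of_nat D * Re \<sigma>)" by simp
    then show "exp (of_nat D * \<sigma>) \<in> S" using s by (simp add: S_def D_def exp_of_nat_mult norm_power)
  qed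
  have uniq: "\<forall>\<sigma>\<in>H. h \<sigma> = h' \<sigma>" if hh: "continuous_on H h" "continuous_on H h'"
      "\<And>\<sigma>. \<sigma> \<in> H \<Longrightarrow> poly P (h \<sigma>) = exp (of_nat D * \<sigma>)"
      "\<And>\<sigma>. \<sigma> \<in> H \<Longrightarrow> poly P (h' \<sigma>) = exp (of_nat D * \<sigma>)" "\<exists>\<sigma>\<in>H. h \<sigma> = h' \<sigma>" for h h'
  proof
    fix \<tau> assume \<tau>: "\<tau> \<in> H"
    obtain a where a: "a \<in> H" "h a = h' a" using hh(5) by auto
    show "h \<tau> = h' \<tau>"
    proof (rule covering_space_lift_unique[OF cov, where f = "\<lambda>\<sigma>. exp (of_nat D * \<sigma>)" and T = H and a = a and x = \<tau> and ?g1.0 = h and ?g2.0 = h'])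
      show "continuous_on H (\<lambda>\<sigma>. exp (of_nat D * \<sigma>))" by (intro continuous_intros)
      show "h \<in> H \<rightarrow> {z. s ^ degree P < cmod (poly P z)}" "h' \<in> H \<rightarrow> {z. s ^ degree P < cmod (poly P z)}"
        using fH hh(3,4) by (auto simp: S_def)
    qed (use hh a \<tau> fH convex_connected[OF convH] in \<open>auto simp: S_def\<close>)
  qed
  obtain g0 where g0: "g0 holomorphic_on H" "g0 \<in> H \<rightarrow> C" "\<And>\<sigma>. \<sigma> \<in> H \<Longrightarrow> poly P (g0 \<sigma>) = exp (of_nat D * \<sigma>)"
  proof (rule covering_space_lift_holomorphic[OF cov])
    show "open {z. s ^ degree P < cmod (poly P z)}" by (intro open_Collect_less continuous_intros)
    show "poly P holomorphic_on {z. s ^ degree P < cmod (poly P z)}" by (intro holomorphic_intros)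
    show "(\<lambda>\<sigma>. exp (of_nat D * \<sigma>)) holomorphic_on H" by (intro holomorphic_intros)
    show "simply_connected H" using convH by (rule convex_imp_simply_connected)
    show "locally path_connected H" using convH by (rule convex_imp_locally_path_connected)
  qed (use fH in \<open>auto simp: S_def C_def\<close>)
  have big: "\<exists>R. \<forall>\<sigma>. R < Re \<sigma> \<longrightarrow> M < cmod (g0 \<sigma>)" for M :: real
  proof -
    have "bounded (poly P ` cball 0 M)"
      by (intro compact_imp_bounded compact_continuous_image continuous_intros compact_cball)
    then obtain K where "\<forall>x\<in>poly P ` cball 0 M. cmod x \<le> K" and K0: "K > 0"
      unfolding bounded_pos by blast
    then have K: "\<And>z. cmod z \<le> M \<Longrightarrow> cmod (poly P z) \<le> K" "K > 0" by auto
    have "M < cmod (g0 \<sigma>)" if "max (ln s) (ln K) < Re \<sigma>" "max 0 (ln K) < Re \<sigma>" for \<sigma>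
    proof (rule ccontr)
      assume "\<not> M < cmod (g0 \<sigma>)"
      then have "cmod (poly P (g0 \<sigma>)) \<le> K" using K(1) by simp
      then have "exp (of_nat D * Re \<sigma>) \<le> K" using g0(3)[of \<sigma>] that by (simp add: H_def)
      moreover have "Re \<sigma> \<le> of_nat D * Re \<sigma>" using D0 that mult_right_mono[of 1 "real D" "Re \<sigma>"] by simp
      then have "exp (Re \<sigma>) \<le> exp (of_nat D * Re \<sigma>)" by simp
      moreover have "K < exp (Re \<sigma>)" using that K(2) by (metis exp_less_mono exp_ln max_less_iff_conj)
      ultimately show False by linarith
    qed
    then show ?thesis by (intro exI[of _ "max (max (ln s) (ln K)) (max 0 (ln K))"]) auto
  qed
  define q where "q \<sigma> = (g0 \<sigma> / exp \<sigma>) ^ D" for \<sigma>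
  have qlim: "\<exists>R. \<forall>\<sigma>. R < Re \<sigma> \<longrightarrow> cmod (q \<sigma> - 1) < e" if e: "e > 0" for e
  proof -
    have "((\<lambda>z. inverse (poly P z / z ^ D)) \<longlongrightarrow> inverse 1) at_infinity"
      unfolding D_def by (intro tendsto_inverse poly_asymp m) auto
    then have "eventually (\<lambda>z. dist (inverse (poly P z / z ^ D)) 1 < e) at_infinity"
      using e by (simp add: tendsto_iff)
    then obtain B where B: "\<And>z. B \<le> cmod z \<Longrightarrow> dist (inverse (poly P z / z ^ D)) 1 < e"
      by (auto simp: eventually_at_infinity)
    obtain R where R: "\<And>\<sigma>. R < Re \<sigma> \<Longrightarrow> B < cmod (g0 \<sigma>)" using big by blast
    have "cmod (q \<sigma> - 1) < e" if "max R (ln s) < Re \<sigma>" for \<sigma>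
    proof -
      have "inverse (poly P (g0 \<sigma>) / g0 \<sigma> ^ D) = q \<sigma>"
        using that by (simp add: q_def g0(3) H_def power_divide exp_of_nat_mult)
      then show ?thesis using B[of "g0 \<sigma>"] R[of \<sigma>] that by (simp add: dist_norm)
    qed
    then show ?thesis by blast
  qed
  obtain R1 where R1: "\<And>\<sigma>. R1 < Re \<sigma> \<Longrightarrow> cmod (q \<sigma> - 1) < 1" using qlim[of 1] by auto
  define H1 where "H1 = {\<sigma>. max R1 (ln s) < Re \<sigma>}"
  have H1: "H1 \<subseteq> H" "convex H1" unfolding H1_def H_def by (auto intro: convex_halfspace_Re_gt simp del: max_less_iff_conj)
  have qpos: "q \<sigma> \<notin> \<real>\<^sub>\<le>\<^sub>0" if "\<sigma> \<in> H1" for \<sigma>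
  proof
    assume "q \<sigma> \<in> \<real>\<^sub>\<le>\<^sub>0"
    then have "Re (q \<sigma>) \<le> 0" by (auto simp: complex_nonpos_Reals_iff)
    moreover have "\<bar>Re (q \<sigma> - 1)\<bar> < 1" using abs_Re_le_cmod[of "q \<sigma> - 1"] R1[of \<sigma>] that by (auto simp: H1_def)
    ultimately show False by simp
  qed
  \<comment> \<open>\<open>u\<close> strips the principal \<open>D\<close>-th root of
    \<open>q\<close> from \<open>g0 / exp\<close>. Being continuous with values among the
    \<open>D\<close>-th roots of unity, it is a constant \<open>\<omega>\<close>, which the
    translation by \<open>\<tau> = Ln \<omega>\<close> removes.\<close>
  define u where "u \<sigma> = g0 \<sigma> / exp \<sigma> / exp (Ln (q \<sigma>) / of_nat D)" for \<sigma>
  have cg: "continuous_on H g0" using g0(1) by (rule holomorphic_on_imp_continuous_on)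
  have "continuous_on H1 u" unfolding u_def
    by (intro continuous_intros continuous_on_Ln continuous_on_subset[OF cg H1(1)])
      (use qpos cg H1 D0 in \<open>auto simp: q_def[abs_def] intro!: continuous_intros continuous_on_subset[OF cg H1(1)]\<close>)
  moreover have uD: "u \<sigma> ^ D = 1" if "\<sigma> \<in> H1" for \<sigma>
  proof -
    have "q \<sigma> \<noteq> 0" using qpos[OF that] by auto
    then have "exp (Ln (q \<sigma>) / of_nat D) ^ D = q \<sigma>" using D0 by (simp add: exp_of_nat_mult[symmetric])
    then show ?thesis using \<open>q \<sigma> \<noteq> 0\<close> unfolding u_def power_divide[of _ "exp (Ln (q \<sigma>) / of_nat D)"] by (simp add: q_def)
  qed
  moreover have "finite {z::complex. z ^ D = 1}" using D0 by (intro finite_roots_unity) auto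
  then have "finite (u ` H1)" by (rule finite_subset[rotated]) (use uD in auto)
  ultimately have "u constant_on H1"
    using continuous_finite_range_constant convex_connected[OF H1(2)] by blast
  then obtain \<omega> where \<omega>: "\<And>\<sigma>. \<sigma> \<in> H1 \<Longrightarrow> u \<sigma> = \<omega>" by (auto simp: constant_on_def)
  have "complex_of_real (max R1 (ln s) + 1) \<in> H1" by (simp add: H1_def max_def)
  then have \<omega>D: "\<omega> ^ D = 1" using uD \<omega> by metis
  have n\<omega>: "cmod \<omega> = 1" using power_eq_1_iff[OF \<omega>D] D0 by auto
  have \<omega>0: "\<omega> \<noteq> 0" using n\<omega> by auto
  define \<tau> where "\<tau> = Ln \<omega>"
  have \<tau>: "exp \<tau> = \<omega>" "Re \<tau> = 0" using \<omega>0 n\<omega> by (auto simp: \<tau>_def)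
  define g where "g \<sigma> = g0 (\<sigma> - \<tau>)" for \<sigma>
  have inH: "\<sigma> - \<tau> \<in> H" if "\<sigma> \<in> H" for \<sigma> using that \<tau> by (simp add: H_def)
  show ?thesis
  proof (intro exI[of _ g] conjI ballI allI impI)
    show "g holomorphic_on H" unfolding g_def
      by (rule holomorphic_on_compose_gen[OF _ g0(1), unfolded o_def]) (auto intro!: holomorphic_intros inH)
    show "poly P (g \<sigma>) = exp (of_nat D * \<sigma>)" if "\<sigma> \<in> H" for \<sigma>
    proof -
      have "exp (of_nat D * \<tau>) = 1" using \<omega>D \<tau>(1) by (simp add: exp_of_nat_mult)
      then show ?thesis using g0(3)[OF inH[OF that]] by (simp add: g_def right_diff_distrib exp_diff)
    qed
    show "\<exists>R. \<forall>\<sigma>. R < Re \<sigma> \<longrightarrow> cmod (g \<sigma> / exp \<sigma> - 1) < e" if e: "e > 0" for e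
    proof -
      have "((\<lambda>x. exp (Ln x / of_nat D)) \<longlongrightarrow> exp (Ln 1 / of_nat D)) (at 1)"
        by (intro tendsto_intros tendsto_Ln) (use D0 in auto)
      then have "((\<lambda>x. exp (Ln x / of_nat D)) \<longlongrightarrow> 1) (at (1::complex))" by simp
      then obtain \<delta> where \<delta>: "\<delta> > 0" "\<And>x. x \<noteq> 1 \<Longrightarrow> dist x 1 < \<delta> \<Longrightarrow> dist (exp (Ln x / of_nat D)) (1::complex) < e"
        using e unfolding LIM_def by (metis dist_commute)
      have \<delta>': "dist (exp (Ln x / of_nat D)) (1::complex) < e" if "dist x 1 < \<delta>" for x
        using \<delta>(2)[of x] that e by (cases "x = 1") auto
      obtain R where R: "\<And>\<sigma>. R < Re \<sigma> \<Longrightarrow> cmod (q \<sigma> - 1) < \<delta>" using qlim[OF \<delta>(1)] by blast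
      have "cmod (g \<sigma> / exp \<sigma> - 1) < e" if big: "max R (max R1 (ln s)) < Re \<sigma>" for \<sigma>
      proof -
        have in1: "\<sigma> - \<tau> \<in> H1" using big \<tau> by (simp add: H1_def)
        have "\<omega> * exp (Ln (q (\<sigma> - \<tau>)) / of_nat D) = g0 (\<sigma> - \<tau>) / exp (\<sigma> - \<tau>)"
          using \<omega>[OF in1] by (simp add: u_def field_simps)
        then have "g \<sigma> / exp \<sigma> = exp (Ln (q (\<sigma> - \<tau>)) / of_nat D)"
          using \<omega>0 \<tau>(1) by (simp add: g_def exp_diff field_simps)
        moreover have "dist (exp (Ln (q (\<sigma> - \<tau>)) / of_nat D)) 1 < e"
          using \<delta>' R[of "\<sigma> - \<tau>"] big \<tau> by (simp add: dist_norm)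
        ultimately show ?thesis by (simp add: dist_norm)
      qed
      then show ?thesis by blast
    qed
    show "h \<sigma> = h' \<sigma>" if "continuous_on H h" "continuous_on H h'" "\<forall>\<sigma>\<in>H. poly P (h \<sigma>) = exp (of_nat D * \<sigma>)"
      "\<forall>\<sigma>\<in>H. poly P (h' \<sigma>) = exp (of_nat D * \<sigma>)" "\<exists>\<sigma>\<in>H. h \<sigma> = h' \<sigma>" "\<sigma> \<in> H" for h h' \<sigma>
      using uniq[of h h'] that by blast
  qed
qed

text \<open>Near \<open>U\<close> the derivative of \<open>P\<close> is close to
  \<open>D * U ^ (D - 1)\<close>, so \<open>P\<close> divided by this number differs from the
  identity by a map with Lipschitz constant 3/4.\<close>

lemma poly_inj_near_infinity:
  fixes P :: "complex poly"
  assumes m: "lead_coeff P = 1" and d: "degree P > 0"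
  obtains e R where "e > 0" "\<And>U x y. R < cmod U \<Longrightarrow> cmod (x / U - 1) < e \<Longrightarrow> cmod (y / U - 1) < e \<Longrightarrow>
    poly P x = poly P y \<Longrightarrow> x = y"
proof -
  define D where "D = degree P"
  have D0: "D > 0" using d by (simp add: D_def)
  define Q where "Q = smult (1 / of_nat D) (pderiv P)"
  have dQ: "degree Q = D - 1" using D0 by (simp add: Q_def D_def degree_pderiv)
  have mQ: "lead_coeff Q = 1" unfolding dQ using D0 m by (simp add: Q_def coeff_pderiv D_def)
  have "eventually (\<lambda>z. dist (poly Q z / z ^ degree Q) 1 < 1/4) at_infinity"
    using tendstoD[OF poly_asymp[OF mQ], of "1/4"] by simp
  then obtain B where B: "\<And>z. B \<le> cmod z \<Longrightarrow> cmod (poly Q z / z ^ (D - 1) - 1) < 1/4"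
    by (auto simp: eventually_at_infinity dist_norm dQ)
  have "isCont (\<lambda>x::complex. x ^ (D - 1)) 1" by (intro continuous_intros)
  then have "\<forall>e>0. \<exists>\<delta>>0. \<forall>x::complex. dist x 1 < \<delta> \<longrightarrow> dist (x ^ (D - 1)) (1 ^ (D - 1)) < e"
    unfolding continuous_at_eps_delta .
  from this[rule_format, of "1/4"] have "\<exists>\<delta>>0. \<forall>x::complex. dist x 1 < \<delta> \<longrightarrow> dist (x ^ (D - 1)) (1 ^ (D - 1)) < 1/4"
    by simp
  then obtain \<delta> where \<delta>: "\<delta> > 0" "\<And>x::complex. cmod (x - 1) < \<delta> \<Longrightarrow> cmod (x ^ (D - 1) - 1) < 1/4"
    by (auto simp: dist_norm)
  define e where "e = min \<delta> (1/2)"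
  show thesis
  proof (rule that[of e "2 * \<bar>B\<bar> + 1"])
    show "e > 0" using \<delta> by (simp add: e_def)
    fix U x y assume U: "2 * \<bar>B\<bar> + 1 < cmod U" and x: "cmod (x / U - 1) < e" and y: "cmod (y / U - 1) < e"
      and eq: "poly P x = poly P y"
    have U0: "U \<noteq> 0" using U by auto
    define S where "S = ball U (e * cmod U)"
    have S: "z \<in> S \<longleftrightarrow> cmod (z / U - 1) < e" for z
    proof -
      have "z / U - 1 = (z - U) / U" using U0 by (simp add: diff_divide_distrib)
      then have "cmod (z / U - 1) = cmod (z - U) / cmod U" by (simp add: norm_divide)
      then show ?thesis using U0 by (simp add: S_def dist_norm norm_minus_commute pos_divide_less_eq)
    qed
    define h where "h z = poly P z / (of_nat D * U ^ (D - 1)) - z" for z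
    have bd: "cmod (poly Q z / U ^ (D - 1) - 1) \<le> 3/4" if zS: "z \<in> S" for z
    proof -
      have zU: "cmod (z / U - 1) < e" using zS S by simp
      have "1 - cmod (z / U) \<le> cmod (z / U - 1)" by (metis norm_minus_commute norm_one norm_triangle_ineq2)
      then have "1/2 \<le> cmod (z / U)" using zU by (simp add: e_def)
      then have "cmod U / 2 \<le> cmod z" using U0 by (simp add: norm_divide field_simps)
      then have "B \<le> cmod z" "z \<noteq> 0" using U by auto
      define a where "a = poly Q z / z ^ (D - 1)"
      define b where "b = (z / U) ^ (D - 1)"
      have a: "cmod (a - 1) < 1/4" using B \<open>B \<le> cmod z\<close> by (simp add: a_def)
      have b: "cmod (b - 1) < 1/4" using \<delta>(2)[of "z / U"] zU by (simp add: b_def e_def)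
      have "a * b - 1 = (a - 1) * (b - 1) + (a - 1) + (b - 1)" by (simp add: algebra_simps)
      then have "cmod (a * b - 1) \<le> cmod (a - 1) * cmod (b - 1) + cmod (a - 1) + cmod (b - 1)"
        by (metis norm_mult norm_triangle_ineq norm_triangle_le add_right_mono)
      also have "\<dots> \<le> 1/4 * (1/4) + 1/4 + 1/4" using a b by (intro add_mono mult_mono) auto
      also have "a * b = poly Q z / U ^ (D - 1)" using \<open>z \<noteq> 0\<close> by (simp add: a_def b_def power_divide)
      finally show ?thesis by simp
    qed
    have "cmod (h x - h y) \<le> 3/4 * cmod (x - y)"
    proof (rule field_differentiable_bound[of S h "\<lambda>z. poly Q z / U ^ (D - 1) - 1"])
      show "convex S" by (simp add: S_def)
      fix z assume z: "z \<in> S"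
      have "(h has_field_derivative poly (pderiv P) z / (of_nat D * U ^ (D - 1)) - 1) (at z within S)"
        unfolding h_def by (rule DERIV_diff[OF DERIV_cdivide[OF DERIV_subset[OF poly_DERIV]] DERIV_ident]) auto
      then show "(h has_field_derivative poly Q z / U ^ (D - 1) - 1) (at z within S)"
        by (simp add: Q_def field_simps)
      show "cmod (poly Q z / U ^ (D - 1) - 1) \<le> 3/4" by (rule bd[OF z])
    qed (use x y S in auto)
    moreover have "h x - h y = y - x" using eq by (simp add: h_def)
    ultimately show "x = y" by (simp add: norm_minus_commute)
  qed
qed

lemma exterior_inverse:
  fixes P :: "complex poly" and s :: real
  assumes m: "lead_coeff P = 1" and d: "degree P > 0" and s: "s > 0"
    and cr: "\<forall>z. poly (pderiv P) z = 0 \<longrightarrow> cmod (poly P z) \<le> s ^ degree P"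
  obtains F where "F holomorphic_on ball 0 (1 / s)" "F 0 = 1"
    "\<And>u. u \<in> ball 0 (1 / s) \<Longrightarrow> u \<noteq> 0 \<Longrightarrow> poly P (F u / u) = (1 / u) ^ degree P"
    "inj_on (\<lambda>u. F u / u) (ball 0 (1 / s) - {0})"
proof -
  define D where "D = degree P"
  define H where "H = {\<sigma>. ln s < Re \<sigma>}"
  have D0: "D > 0" using d by (simp add: D_def)
  from half_plane_lift[OF m d s cr, folded H_def D_def]
  obtain g where g0: "g holomorphic_on H" "\<forall>\<sigma>\<in>H. poly P (g \<sigma>) = exp (of_nat D * \<sigma>)"
    "\<forall>e>0. \<exists>R. \<forall>\<sigma>. R < Re \<sigma> \<longrightarrow> cmod (g \<sigma> / exp \<sigma> - 1) < e"
    "\<forall>h h'. continuous_on H h \<longrightarrow> continuous_on H h' \<longrightarrow> (\<forall>\<sigma>\<in>H. poly P (h \<sigma>) = exp (of_nat D * \<sigma>))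
      \<longrightarrow> (\<forall>\<sigma>\<in>H. poly P (h' \<sigma>) = exp (of_nat D * \<sigma>)) \<longrightarrow> (\<exists>\<sigma>\<in>H. h \<sigma> = h' \<sigma>) \<longrightarrow> (\<forall>\<sigma>\<in>H. h \<sigma> = h' \<sigma>)"
    by (elim exE conjE) (rule that)
  note g = g0(1) g0(2)[rule_format] and lim = g0(3)[rule_format] and uniq = g0(4)[THEN spec, THEN spec, THEN mp, THEN mp, THEN mp, THEN mp, THEN mp]
  have cg: "continuous_on H g" using g(1) by (rule holomorphic_on_imp_continuous_on)
  have oH: "open H" unfolding H_def by (rule open_halfspace_Re_gt)
  \<comment> \<open>Both sides lift the same map, so agreement at one point is agreement
    everywhere.\<close>
  have sh: "\<forall>\<sigma>\<in>H. g (\<sigma> + c) = g \<sigma>" if c: "Re c = 0" "exp (of_nat D * c) = 1" and ex: "\<exists>\<sigma>\<in>H. g (\<sigma> + c) = g \<sigma>" for c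
  proof (rule uniq[of "\<lambda>\<sigma>. g (\<sigma> + c)" g])
    show "continuous_on H (\<lambda>\<sigma>. g (\<sigma> + c))"
      by (rule continuous_on_compose2[OF cg]) (use c in \<open>auto intro!: continuous_intros simp: H_def\<close>)
    show "\<forall>\<sigma>\<in>H. poly P (g (\<sigma> + c)) = exp (of_nat D * \<sigma>)"
      using g(2) c by (simp add: H_def distrib_left exp_add)
  qed (use cg g(2) ex in auto)
  \<comment> \<open>A period \<open>c\<close> with \<open>exp c \<noteq> 1\<close> would make
    \<open>g \<sigma> / exp \<sigma>\<close> close both to 1 and to \<open>exp c\<close>.\<close>
  have sh1: "exp c = 1" if c: "Re c = 0" and all: "\<forall>\<sigma>\<in>H. g (\<sigma> + c) = g \<sigma>" for c
  proof (rule ccontr)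
    assume "exp c \<noteq> 1"
    then obtain R where R: "\<And>\<sigma>. R < Re \<sigma> \<Longrightarrow> cmod (g \<sigma> / exp \<sigma> - 1) < cmod (exp c - 1) / 2"
      using lim[of "cmod (exp c - 1) / 2"] by auto
    define \<sigma> where "\<sigma> = complex_of_real (max R (ln s) + 1)"
    have \<sigma>: "R < Re \<sigma>" "\<sigma> \<in> H" by (auto simp: \<sigma>_def H_def max_def)
    define G where "G = g \<sigma> / exp \<sigma>"
    have "G - exp c = exp c * (g (\<sigma> + c) / exp (\<sigma> + c) - 1)"
      using all \<sigma>(2) by (simp add: G_def exp_add field_simps)
    then have "cmod (G - exp c) < cmod (exp c - 1) / 2" using R[of "\<sigma> + c"] \<sigma> c by (simp add: norm_mult)
    moreover have "cmod (G - 1) < cmod (exp c - 1) / 2" using R[of \<sigma>] \<sigma> by (simp add: G_def)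
    moreover have "cmod (exp c - 1) \<le> cmod (G - exp c) + cmod (G - 1)"
      by (metis norm_minus_commute norm_triangle_sub add.commute diff_add_cancel norm_triangle_ineq4 diff_diff_eq2)
    ultimately show False by linarith
  qed
  obtain e0 R0 where e0: "e0 > 0" and R0: "\<And>U x y. R0 < cmod U \<Longrightarrow> cmod (x / U - 1) < e0 \<Longrightarrow> cmod (y / U - 1) < e0 \<Longrightarrow>
    poly P x = poly P y \<Longrightarrow> x = y" using poly_inj_near_infinity[OF m d] by metis
  \<comment> \<open>Far out, \<open>g \<tau>\<close> and \<open>g (\<tau> + c)\<close> are both
    close to \<open>exp \<tau>\<close> and have equal images under \<open>P\<close>, so injectivity
    near infinity identifies them.\<close>
  have per: "g (\<sigma> + c) = g \<sigma>" if c: "exp c = 1" and \<sigma>: "\<sigma> \<in> H" for c \<sigma>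
  proof -
    have rc: "Re c = 0" using c by (metis exp_eq_1 Re_complex_of_real exp_eq_one_iff norm_exp_eq_Re norm_one)
    have Dc: "exp (of_nat D * c) = 1" using c by (simp add: exp_of_nat_mult)
    obtain R where R: "\<And>\<sigma>. R < Re \<sigma> \<Longrightarrow> cmod (g \<sigma> / exp \<sigma> - 1) < e0" using lim[OF e0] by blast
    define \<tau> where "\<tau> = complex_of_real (max (max R (ln s)) (\<bar>R0\<bar>) + 1)"
    have \<tau>: "R < Re \<tau>" "\<tau> \<in> H" "\<bar>R0\<bar> < Re \<tau>" by (auto simp: \<tau>_def H_def max_def)
    have "R0 < cmod (exp \<tau>)" using \<tau>(3) exp_ge_add_one_self[of "Re \<tau>"] unfolding norm_exp_eq_Re by linarith
    then have "g (\<tau> + c) = g \<tau>"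
      using R0[of "exp \<tau>" "g (\<tau> + c)" "g \<tau>"] R[of \<tau>] R[of "\<tau> + c"] \<tau> c rc g(2)[of \<tau>] g(2)[of "\<tau> + c"] Dc
      by (simp add: exp_add H_def distrib_left)
    then show ?thesis using sh[OF rc Dc] \<tau>(2) \<sigma> by blast
  qed
  define F where "F u = (if u = 0 then 1 else u * g (- Ln u))" for u
  have inH: "- Ln u \<in> H" if u: "u \<in> ball 0 (1 / s)" "u \<noteq> 0" for u
  proof -
    have "ln (cmod u) < ln (1 / s)" using u s by (intro ln_less_cancel_iff[THEN iffD2]) auto
    then show ?thesis using u s by (simp add: H_def ln_div)
  qed
  have Fu: "F u / u = g (- Ln u)" if "u \<noteq> 0" for u using that by (simp add: F_def)
  have eL: "exp (- Ln u) = 1 / u" if "u \<noteq> 0" for u using that by (simp add: exp_minus divide_inverse)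
  have eq1: "poly P (F u / u) = (1 / u) ^ D" if "u \<in> ball 0 (1 / s)" "u \<noteq> 0" for u
    using g(2)[OF inH[OF that]] Fu[OF that(2)] eL[OF that(2)] by (simp only: exp_of_nat_mult)
  \<comment> \<open>The principal logarithm jumps along the negative axis. On a half plane around
    \<open>u0\<close> it is replaced by \<open>Ln u0 + Ln (u / u0)\<close>, which differs from it by
    a period of \<open>g\<close>.\<close>
  have hol1: "F field_differentiable (at u0)" if u0: "u0 \<in> ball 0 (1 / s)" "u0 \<noteq> 0" for u0
  proof -
    define W where "W = ball 0 (1 / s) \<inter> {u. 0 < Re (u / u0)}"
    have oW: "open W" unfolding W_def by (intro open_Int open_ball open_Collect_less continuous_intros) (use u0 in auto)
    have W0: "u \<noteq> 0" if "u \<in> W" for u using that by (auto simp: W_def)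
    have LH: "- Ln u0 - Ln (u / u0) \<in> H \<and> F u = u * g (- Ln u0 - Ln (u / u0))" if u: "u \<in> W" for u
    proof -
      have un: "u \<noteq> 0" using W0[OF u] .
      define c where "c = - Ln u0 - Ln (u / u0) - (- Ln u)"
      have "exp c = exp (- Ln u0) * exp (- Ln (u / u0)) * exp (Ln u)" by (simp add: c_def exp_add[symmetric])
      also have "\<dots> = 1" using un u0 by (simp add: eL del: Ln_minus)
      finally have ec: "exp c = 1" .
      have "Re c = 0" using ec by (metis exp_eq_one_iff norm_exp_eq_Re norm_one)
      then have "- Ln u0 - Ln (u / u0) \<in> H" using inH[of u] u un by (simp add: c_def H_def W_def)
      moreover have "g (- Ln u + c) = g (- Ln u)" by (rule per[OF ec inH]) (use u un in \<open>auto simp: W_def\<close>)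
      moreover have "- Ln u + c = - Ln u0 - Ln (u / u0)" by (simp add: c_def)
      ultimately show ?thesis using un by (simp add: F_def)
    qed
    have "(\<lambda>u. u * g (- Ln u0 - Ln (u / u0))) holomorphic_on W"
      by (intro holomorphic_intros holomorphic_on_compose_gen[OF _ g(1), unfolded o_def])
        (use LH u0 in \<open>auto simp: W_def complex_nonpos_Reals_iff\<close>)
    then have "F holomorphic_on W" by (rule holomorphic_transform) (use LH in auto)
    then show ?thesis using oW u0 by (intro holomorphic_on_imp_differentiable_at) (auto simp: W_def)
  qed
  have lim0: "(F \<longlongrightarrow> 1) (at 0)"
  proof (rule LIM_I)
    fix e :: real assume "0 < e"
    then obtain R where R: "\<And>\<sigma>. R < Re \<sigma> \<Longrightarrow> cmod (g \<sigma> / exp \<sigma> - 1) < e" using lim by blast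
    show "\<exists>r>0. \<forall>x. x \<noteq> 0 \<and> norm (x - 0) < r \<longrightarrow> norm (F x - 1) < e"
    proof (intro exI[of _ "exp (- R)"] conjI allI impI)
      fix x :: complex assume x: "x \<noteq> 0 \<and> norm (x - 0) < exp (- R)"
      then have "ln (cmod x) < - R" using ln_less_cancel_iff[of "cmod x" "exp (- R)"] by simp
      then have "cmod (g (- Ln x) / exp (- Ln x) - 1) < e" using R[of "- Ln x"] x by simp
      then show "norm (F x - 1) < e" using x eL[of x] by (simp add: F_def mult.commute)
    qed auto
  qed
  show thesis
  proof (rule that[of F])
    show "F 0 = 1" by (simp add: F_def)
    show "F holomorphic_on ball 0 (1 / s)"
    proof (rule no_isolated_singularity[of _ _ "{0}"])
      show "F holomorphic_on ball 0 (1 / s) - {0}"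
        unfolding holomorphic_on_def using hol1 by (auto intro: field_differentiable_at_within)
      show "continuous_on (ball 0 (1 / s)) F"
        unfolding continuous_on_eq_continuous_at[OF open_ball]
      proof
        fix x :: complex assume "x \<in> ball 0 (1 / s)"
        then show "isCont F x" using hol1[of x] lim0
          by (cases "x = 0") (auto simp: isCont_def F_def dest!: field_differentiable_imp_continuous_at)
      qed
    qed auto
    show "poly P (F u / u) = (1 / u) ^ degree P" if "u \<in> ball 0 (1 / s)" "u \<noteq> 0" for u
      using eq1[OF that] by (simp add: D_def)
    show "inj_on (\<lambda>u. F u / u) (ball 0 (1 / s) - {0})"
    proof (rule inj_onI)
      fix u v assume uv: "u \<in> ball 0 (1 / s) - {0}" "v \<in> ball 0 (1 / s) - {0}" "F u / u = F v / v"
      \<comment> \<open>Equal values have equal images under \<open>P\<close>, so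
        \<open>exp (D * c) = 1\<close>; then \<open>c\<close> is a period of \<open>g\<close>, and
        \<open>sh1\<close> yields \<open>u = v\<close>.\<close>
      define c where "c = - Ln v - (- Ln u)"
      have "(1 / u) ^ D = (1 / v) ^ D" using eq1[of u] eq1[of v] uv by auto
      then have Dc: "exp (of_nat D * c) = 1"
        using uv by (simp add: c_def exp_of_nat_mult exp_diff field_simps)
      have "cmod (exp c) ^ D = 1" using arg_cong[OF Dc, of cmod] by (simp add: exp_of_nat_mult norm_power)
      then have "cmod (exp c) = 1" using D0 using power_eq_1_iff[of "cmod (exp c)" D] by auto
      then have rc: "Re c = 0" by simp
      have "g (- Ln u + c) = g (- Ln u)" using uv(3) Fu[of u] Fu[of v] uv by (simp add: c_def)
      then have "exp c = 1" using sh1[OF rc sh[OF rc Dc]] inH[of u] uv by blast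
      then show "u = v" using uv by (simp add: c_def exp_diff field_simps)
    qed
  qed
qed

subsection \<open>A maximum principle for fibre sums, and the area theorem\<close>

text \<open>Preimages are counted without multiplicity, so the sum may jump at critical values; the
  maximum principle below therefore bounds it at noncritical points.\<close>

definition fiber_sum :: "complex poly \<Rightarrow> complex \<Rightarrow> real" where
  "fiber_sum P w = (\<Sum>z | poly P z = w. (cmod z)\<^sup>2)"

lemma fiber_sum_nonneg: "0 \<le> fiber_sum P w"
  unfolding fiber_sum_def by (intro sum_nonneg) auto

lemma fiber_sum_bounded:
  fixes P :: "complex poly"
  assumes d: "degree P > 0" and m: "lead_coeff P = 1"
  obtains C where "C > 0" "\<And>w. cmod w \<le> R \<Longrightarrow> fiber_sum P w \<le> C"
proof -
  have "filterlim (poly P) at_infinity at_infinity"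
  proof -
    have "filterlim (\<lambda>z. poly P z / z ^ degree P * z ^ degree P) at_infinity at_infinity"
      by (rule tendsto_mult_filterlim_at_infinity[OF poly_asymp[OF m]])
        (use d in \<open>auto intro!: filterlim_power_at_infinity filterlim_ident\<close>)
    then show ?thesis
    proof (rule filterlim_mono_eventually[OF _ order_refl order_refl])
      have "eventually (\<lambda>z::complex. z \<noteq> 0) at_infinity"
        unfolding eventually_at_infinity by (intro exI[of _ 1]) auto
      then show "\<forall>\<^sub>F x in at_infinity. poly P x / x ^ degree P * x ^ degree P = poly P x"
        by eventually_elim auto
    qed
  qed
  then have "eventually (\<lambda>z. R < cmod (poly P z)) at_infinity"
    unfolding filterlim_at_infinity_conv_norm_at_top filterlim_at_top_dense by auto
  then obtain K where K: "\<And>z. K \<le> cmod z \<Longrightarrow> R < cmod (poly P z)" by (auto simp: eventually_at_infinity)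
  have "fiber_sum P w \<le> real (degree P) * (\<bar>K\<bar>)\<^sup>2 + 1" if w: "cmod w \<le> R" for w
  proof -
    have P0: "P - [:w:] \<noteq> 0" using d by auto
    have e: "{z. poly P z = w} = {z. poly (P - [:w:]) z = 0}" by auto
    have c: "card {z. poly P z = w} \<le> degree P"
      unfolding e using card_poly_roots_bound[OF P0] degree_diff_const[OF d] by simp
    have "(cmod z)\<^sup>2 \<le> \<bar>K\<bar>\<^sup>2" if "poly P z = w" for z
    proof (rule power_mono)
      show "cmod z \<le> \<bar>K\<bar>" using K[of z] that w by (smt (verit))
    qed auto
    then have "fiber_sum P w \<le> (\<Sum>z | poly P z = w. \<bar>K\<bar>\<^sup>2)" unfolding fiber_sum_def by (intro sum_mono) auto
    also have "\<dots> = real (card {z. poly P z = w}) * \<bar>K\<bar>\<^sup>2" by simp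
    also have "\<dots> \<le> real (degree P) * \<bar>K\<bar>\<^sup>2" using c by (intro mult_right_mono) auto
    finally show ?thesis by simp
  qed
  then show thesis by (intro that[of "real (degree P) * \<bar>K\<bar>\<^sup>2 + 1"]) (auto intro: add_nonneg_pos)
qed

text \<open>The terms with \<open>\<delta>\<close> extend the vectors of the fibre by (1, u) and (1,
  w). These are proportional only for \<open>u = w\<close>, which makes the inequality strict
  elsewhere.\<close>

lemma cauchy_schwarz_strict:
  fixes u w :: complex and a b :: real
  assumes A: "(cmod A)\<^sup>2 \<le> a * b" and ab: "0 \<le> a" "0 \<le> b" and d: "\<delta> > 0"
  shows "(cmod (A + of_real \<delta> * (1 + cnj u * w)))\<^sup>2 \<le> (a + \<delta> * (1 + (cmod u)\<^sup>2)) * (b + \<delta> * (1 + (cmod w)\<^sup>2))"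
    and "u \<noteq> w \<Longrightarrow> (cmod (A + of_real \<delta> * (1 + cnj u * w)))\<^sup>2 < (a + \<delta> * (1 + (cmod u)\<^sup>2)) * (b + \<delta> * (1 + (cmod w)\<^sup>2))"
proof -
  define t where "t = cmod (1 + cnj u * w)"
  define c d where "c = 1 + (cmod u)\<^sup>2" and "d = 1 + (cmod w)\<^sup>2"
  \<comment> \<open>Lagrange's identity for the vectors (1, u) and (1, w).\<close>
  have id: "c * d - t\<^sup>2 = (cmod (u - w))\<^sup>2"
    unfolding t_def c_def d_def cmod_power2 by (simp add: algebra_simps power2_eq_square)
  have cd: "0 < c" "0 < d" by (auto simp: c_def d_def add_pos_nonneg)
  have 1: "cmod A \<le> sqrt (a * b)" using A by (rule real_le_rsqrt)
  have t2: "t \<le> sqrt (c * d)" by (rule real_le_rsqrt) (use id in \<open>metis diff_ge_0_iff_ge zero_le_power2\<close>)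
  have t3: "t < sqrt (c * d)" if "u \<noteq> w"
  proof (rule real_less_rsqrt)
    have "0 < (cmod (u - w))\<^sup>2" using that by simp
    then show "t\<^sup>2 < c * d" using id by linarith
  qed
  have n: "cmod (A + of_real \<delta> * (1 + cnj u * w)) \<le> sqrt (a * b) + \<delta> * t"
    using norm_triangle_ineq[of A "of_real \<delta> * (1 + cnj u * w)"] 1 d by (simp add: norm_mult t_def)
  have am: "(sqrt (a * b) + \<delta> * sqrt (c * d))\<^sup>2 \<le> (a + \<delta> * c) * (b + \<delta> * d)"
  proof -
    have "2 * (sqrt (a * b) * sqrt (c * d)) = 2 * (sqrt (a * d) * sqrt (b * c))"
      by (simp add: real_sqrt_mult)
    also have "\<dots> \<le> a * d + b * c"
      using sum_squares_bound[of "sqrt (a * d)" "sqrt (b * c)"] ab cd by simp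
    finally have "\<delta> * (2 * (sqrt (a * b) * sqrt (c * d))) \<le> \<delta> * (a * d + b * c)" using d by simp
    moreover have "(sqrt (a * b) + \<delta> * sqrt (c * d))\<^sup>2 = a * b + \<delta> * (2 * (sqrt (a * b) * sqrt (c * d))) + \<delta>\<^sup>2 * (c * d)"
      using ab cd by (simp add: power2_sum power_mult_distrib)
    ultimately show ?thesis by (simp add: algebra_simps power2_eq_square)
  qed
  show "(cmod (A + of_real \<delta> * (1 + cnj u * w)))\<^sup>2 \<le> (a + \<delta> * (1 + (cmod u)\<^sup>2)) * (b + \<delta> * (1 + (cmod w)\<^sup>2))"
  proof -
    have "cmod (A + of_real \<delta> * (1 + cnj u * w)) \<le> sqrt (a * b) + \<delta> * sqrt (c * d)"
      using n t2 d by (smt (verit) mult_left_mono)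
    then show ?thesis using am power_mono[of _ _ 2] unfolding c_def d_def by (smt (verit) norm_ge_zero)
  qed
  show "(cmod (A + of_real \<delta> * (1 + cnj u * w)))\<^sup>2 < (a + \<delta> * (1 + (cmod u)\<^sup>2)) * (b + \<delta> * (1 + (cmod w)\<^sup>2))" if "u \<noteq> w"
  proof -
    have "cmod (A + of_real \<delta> * (1 + cnj u * w)) < sqrt (a * b) + \<delta> * sqrt (c * d)"
      using n t3[OF that] d by (smt (verit) mult_strict_left_mono)
    then show ?thesis using am power_strict_mono[of _ _ 2] unfolding c_def d_def by (smt (verit) norm_ge_zero zero_less_numeral)
  qed
qed

text \<open>Factors that do not depend on \<open>n\<close> disappear when \<open>n\<close>-th roots
  are taken.\<close>

lemma root_limit_le:
  fixes a b K M :: real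
  assumes "\<And>n. n \<ge> 1 \<Longrightarrow> a ^ n * K \<le> b ^ n * M" "K > 0" "b > 0"
  shows "a \<le> b"
proof (rule ccontr)
  assume "\<not> a \<le> b"
  then have q: "1 < a / b" using assms by simp
  obtain n where n: "\<bar>M\<bar> / K < (a / b) ^ n" using real_arch_pow[OF q] by blast
  have "(a / b) ^ n \<le> (a / b) ^ Suc n" using q by (intro power_increasing) auto
  then have 1: "(a / b) ^ n * K \<le> (a / b) ^ Suc n * K" using assms(2) by (intro mult_right_mono) auto
  have "\<bar>M\<bar> < (a / b) ^ n * K" using n assms(2) by (simp add: pos_divide_less_eq)
  then have "\<bar>M\<bar> < (a / b) ^ Suc n * K" using 1 by linarith
  moreover have "(a / b) ^ Suc n * K \<le> M"
    using assms(1)[of "Suc n"] assms(3) unfolding power_divide by (simp add: pos_divide_le_eq field_simps del: power_Suc)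
  ultimately show False by linarith
qed

text \<open>The fibre sum is subharmonic away from the critical values; powers of it times a polynomial that
  vanishes there extend continuously. At an interior maximum, linearising by Cauchy--Schwarz turns it
  into the modulus of a holomorphic function.\<close>

lemma fiber_sum_maximum:
  fixes P :: "complex poly"
  assumes d: "degree P > 0" and m: "lead_coeff P = 1"
    and R: "\<And>w. cmod w = R \<Longrightarrow> fiber_sum P w \<le> B" and w1: "cmod w1 < R"
    and ncr: "\<And>z. poly P z = w1 \<Longrightarrow> poly (pderiv P) z \<noteq> 0"
  shows "fiber_sum P w1 \<le> B"
proof -
  define Cr where "Cr = poly P ` {z. poly (pderiv P) z = 0}"
  have "pderiv P \<noteq> 0" using d by (simp add: pderiv_eq_0_iff)
  then have fCr: "finite Cr" unfolding Cr_def using poly_roots_finite by blast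
  have nCr: "poly (pderiv P) z \<noteq> 0" if "poly P z \<notin> Cr" for z using that by (auto simp: Cr_def)
  define V where "V w = (\<Prod>c\<in>Cr. w - c)" for w
  have V0: "V w = 0 \<longleftrightarrow> w \<in> Cr" for w using fCr by (auto simp: V_def)
  have cV: "continuous_on A V" for A unfolding V_def by (intro continuous_intros)
  have hV: "V holomorphic_on A" for A unfolding V_def by (intro holomorphic_intros)
  have oCr: "open (- Cr)" using fCr by (simp add: finite_imp_closed open_Compl)
  obtain C where C: "C > 0" "\<And>w. cmod w \<le> R + 1 \<Longrightarrow> fiber_sum P w \<le> C" using fiber_sum_bounded[OF d m] by metis
  have R0: "R > 0" using w1 norm_ge_zero[of w1] by linarith
  have B0: "B \<ge> 0" using R[of "of_real R"] fiber_sum_nonneg[of P "of_real R"] R0 by simp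
  have local: "\<exists>\<epsilon> g. \<epsilon> > 0 \<and> ball w0 \<epsilon> \<subseteq> - Cr \<and> (\<forall>z\<in>{z. poly P z = w0}. g z holomorphic_on ball w0 \<epsilon> \<and> g z w0 = z) \<and>
      (\<forall>w\<in>ball w0 \<epsilon>. fiber_sum P w = (\<Sum>z | poly P z = w0. (cmod (g z w))\<^sup>2))" if w0: "w0 \<notin> Cr" for w0
  proof -
    have cr0: "poly (pderiv P) z \<noteq> 0" if "poly P z = w0" for z using nCr[of z] that w0 by simp
    obtain \<epsilon>1 g where e: "\<epsilon>1 > 0"
      "\<And>z. z \<in> {z. poly P z = w0} \<Longrightarrow> g z holomorphic_on ball w0 \<epsilon>1"
      "\<And>z. z \<in> {z. poly P z = w0} \<Longrightarrow> g z w0 = z"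
      "\<And>z w. z \<in> {z. poly P z = w0} \<Longrightarrow> w \<in> ball w0 \<epsilon>1 \<Longrightarrow> poly P (g z w) = w"
      "\<And>w. w \<in> ball w0 \<epsilon>1 \<Longrightarrow> {z. poly P z = w} = (\<lambda>z. g z w) ` {z. poly P z = w0}"
      "\<And>w. w \<in> ball w0 \<epsilon>1 \<Longrightarrow> inj_on (\<lambda>z. g z w) {z. poly P z = w0}"
      by (rule local_branches[OF d, of w0], erule cr0, rule that)
    obtain \<epsilon>2 where e2: "\<epsilon>2 > 0" "ball w0 \<epsilon>2 \<subseteq> - Cr" using oCr w0 by (meson ComplI openE)
    show ?thesis
    proof (intro exI[of _ "min \<epsilon>1 \<epsilon>2"] exI[of _ g] conjI ballI)
      show "min \<epsilon>1 \<epsilon>2 > 0" using e(1) e2(1) by simp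
      show "ball w0 (min \<epsilon>1 \<epsilon>2) \<subseteq> - Cr" using e2(2) by auto
      fix z assume z: "z \<in> {z. poly P z = w0}"
      show "g z holomorphic_on ball w0 (min \<epsilon>1 \<epsilon>2)" using e(2)[OF z] by (rule holomorphic_on_subset) auto
      show "g z w0 = z" by (rule e(3)[OF z])
    next
      fix w assume "w \<in> ball w0 (min \<epsilon>1 \<epsilon>2)"
      then have w: "w \<in> ball w0 \<epsilon>1" by auto
      show "fiber_sum P w = (\<Sum>z | poly P z = w0. (cmod (g z w))\<^sup>2)"
        unfolding fiber_sum_def e(5)[OF w] sum.reindex[OF e(6)[OF w]] by simp
    qed
  qed
  \<comment> \<open>The factor with \<open>V\<close>, which restores continuity at critical values,
    does not depend on \<open>n\<close> and disappears by \<open>root_limit_le\<close>; the term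
    with \<open>\<delta>\<close>, which provides strictness, tends to 0 at the end.\<close>
  have key: "(fiber_sum P w1 + \<delta> * (1 + (cmod w1)\<^sup>2)) ^ n * (cmod (V w1))\<^sup>2 \<le> (B + \<delta> * (1 + R\<^sup>2)) ^ n * M"
    if \<delta>: "\<delta> > 0" and n: "n \<ge> 1" and M: "\<And>w. cmod w \<le> R \<Longrightarrow> (cmod (V w))\<^sup>2 \<le> M" for \<delta> M :: real and n :: nat
  proof -
    define Y where "Y w = fiber_sum P w + \<delta> * (1 + (cmod w)\<^sup>2)" for w
    define Z where "Z w = Y w ^ n * (cmod (V w))\<^sup>2" for w
    have Y0: "0 < Y w" for w using fiber_sum_nonneg[of P w] \<delta> by (simp add: Y_def add_nonneg_pos add_pos_nonneg)
    have "isCont Z w0" if w0: "cmod w0 \<le> R" for w0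
    proof (cases "w0 \<in> Cr")
      case False
      then obtain \<epsilon> g where e: "\<epsilon> > 0" "\<forall>z\<in>{z. poly P z = w0}. g z holomorphic_on ball w0 \<epsilon> \<and> g z w0 = z"
        "\<forall>w\<in>ball w0 \<epsilon>. fiber_sum P w = (\<Sum>z | poly P z = w0. (cmod (g z w))\<^sup>2)" using local by blast
      have "continuous_on (ball w0 \<epsilon>) (\<lambda>w. ((\<Sum>z | poly P z = w0. (cmod (g z w))\<^sup>2) + \<delta> * (1 + (cmod w)\<^sup>2)) ^ n * (cmod (V w))\<^sup>2)"
        using e(2) by (intro continuous_intros cV holomorphic_on_imp_continuous_on) auto
      then have "continuous_on (ball w0 \<epsilon>) Z"
        by (rule continuous_on_cong[THEN iffD1, rotated -1]) (use e(3) in \<open>auto simp: Z_def Y_def\<close>)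
      then show ?thesis using e(1) continuous_on_eq_continuous_at[OF open_ball] by (metis centre_in_ball)
    next
      case True
      then have Z0: "Z w0 = 0" using V0[of w0] n by (simp add: Z_def)
      have "(Z \<longlongrightarrow> 0) (at w0)"
      proof (rule Lim_null_comparison)
        have "((\<lambda>w. (C + \<delta> * (1 + (R + 1)\<^sup>2)) ^ n * (cmod (V w))\<^sup>2) \<longlongrightarrow> (C + \<delta> * (1 + (R + 1)\<^sup>2)) ^ n * (cmod (V w0))\<^sup>2) (at w0)"
          using cV[of UNIV] by (intro tendsto_intros) (auto simp: continuous_on_eq_continuous_at isCont_def)
        then show "((\<lambda>w. (C + \<delta> * (1 + (R + 1)\<^sup>2)) ^ n * (cmod (V w))\<^sup>2) \<longlongrightarrow> 0) (at w0)"
          using V0[of w0] True by simp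
        have "eventually (\<lambda>w. w \<in> ball w0 1) (at w0)" by (auto simp: eventually_at dist_commute intro!: exI[of _ 1])
        then show "eventually (\<lambda>w. norm (Z w) \<le> (C + \<delta> * (1 + (R + 1)\<^sup>2)) ^ n * (cmod (V w))\<^sup>2) (at w0)"
        proof eventually_elim
          case (elim w)
          have "cmod w \<le> cmod w0 + dist w0 w" using norm_triangle_sub[of w w0] by (simp add: dist_norm norm_minus_commute)
          then have cw: "cmod w \<le> R + 1" using elim w0 by (simp)
          have "(cmod w)\<^sup>2 \<le> (R + 1)\<^sup>2" using cw by (intro power_mono) auto
          then have "Y w \<le> C + \<delta> * (1 + (R + 1)\<^sup>2)" unfolding Y_def
            using C(2)[OF cw] \<delta> by (intro add_mono mult_left_mono) auto
          then have "Y w ^ n \<le> (C + \<delta> * (1 + (R + 1)\<^sup>2)) ^ n" using Y0[of w] by (intro power_mono) auto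
          then show ?case using Y0[of w] by (simp add: Z_def mult_right_mono)
        qed
      qed
      then show ?thesis by (simp add: isCont_def Z0)
    qed
    then have "continuous_on (cball 0 R) Z" by (intro continuous_at_imp_continuous_on) auto
    then obtain w0 where w0: "w0 \<in> cball 0 R" "\<And>w. w \<in> cball 0 R \<Longrightarrow> Z w \<le> Z w0"
      using continuous_attains_sup[of "cball 0 R :: complex set" Z] R0 by auto
    have "Z w0 \<le> (B + \<delta> * (1 + R\<^sup>2)) ^ n * M"
    proof (cases "w0 \<in> Cr")
      case True
      have "0 \<le> M" using M[of 0] R0 by (smt (verit) norm_zero zero_le_power2)
      then show ?thesis using V0[of w0] True B0 \<delta> by (simp add: Z_def)
    next
      case w0Cr: False
      have "cmod w0 = R"
      proof (rule ccontr)
        assume "cmod w0 \<noteq> R"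
        then have "w0 \<in> ball 0 R" using w0(1) by simp
        then obtain \<epsilon>2 where e2: "\<epsilon>2 > 0" "ball w0 \<epsilon>2 \<subseteq> ball 0 R" by (meson openE open_ball)
        obtain \<epsilon>1 g where e1: "\<epsilon>1 > 0" "ball w0 \<epsilon>1 \<subseteq> - Cr" "\<forall>z\<in>{z. poly P z = w0}. g z holomorphic_on ball w0 \<epsilon>1 \<and> g z w0 = z"
          "\<forall>w\<in>ball w0 \<epsilon>1. fiber_sum P w = (\<Sum>z | poly P z = w0. (cmod (g z w))\<^sup>2)" using local[OF w0Cr] by blast
        define U where "U = ball w0 (min \<epsilon>1 \<epsilon>2)"
        have U: "U \<subseteq> ball w0 \<epsilon>1" "U \<subseteq> ball w0 \<epsilon>2" "w0 \<in> U" "open U" "connected U" using e1(1) e2(1) by (auto simp: U_def)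
        \<comment> \<open>With the fibre over \<open>w0\<close> frozen, \<open>A\<close> is
          holomorphic, equals the fibre sum at \<open>w0\<close>, and its squared modulus is at most
          the product of the fibre sums at \<open>w0\<close> and \<open>w\<close>.\<close>
        define A where "A w = (\<Sum>z | poly P z = w0. cnj z * g z w)" for w
        define H where "H w = A w + of_real \<delta> * (1 + cnj w0 * w)" for w
        define G where "G w = H w ^ n * V w" for w
        have "H holomorphic_on U" unfolding H_def A_def
          using e1(3) U(1) by (intro holomorphic_intros) (auto intro: holomorphic_on_subset)
        then have hG: "G holomorphic_on U" unfolding G_def by (intro holomorphic_intros hV)
        have A2: "(cmod (A w))\<^sup>2 \<le> fiber_sum P w0 * fiber_sum P w" if w: "w \<in> U" for w
        proof -
          have "cmod (A w) \<le> (\<Sum>z | poly P z = w0. cmod z * cmod (g z w))"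
            unfolding A_def by (rule order_trans[OF norm_sum]) (simp add: norm_mult)
          then have "(cmod (A w))\<^sup>2 \<le> (\<Sum>z | poly P z = w0. cmod z * cmod (g z w))\<^sup>2" by (intro power_mono) auto
          also have "\<dots> \<le> (\<Sum>z | poly P z = w0. (cmod z)\<^sup>2) * (\<Sum>z | poly P z = w0. (cmod (g z w))\<^sup>2)"
            by (rule Cauchy_Schwarz_ineq_sum)
          also have "\<dots> = fiber_sum P w0 * fiber_sum P w" using e1(4) U(1) w by (auto simp: fiber_sum_def)
          finally show ?thesis .
        qed
        have H1: "(cmod (H w))\<^sup>2 \<le> Y w0 * Y w" if w: "w \<in> U" for w
          unfolding H_def Y_def by (rule cauchy_schwarz_strict(1)[OF A2[OF w] fiber_sum_nonneg fiber_sum_nonneg \<delta>])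
        have H2: "(cmod (H w))\<^sup>2 < Y w0 * Y w" if w: "w \<in> U" "w0 \<noteq> w" for w
          unfolding H_def Y_def by (rule cauchy_schwarz_strict(2)[OF A2[OF w(1)] fiber_sum_nonneg fiber_sum_nonneg \<delta> w(2)])
        have cc: "cnj z * z = (complex_of_real (cmod z))\<^sup>2" for z
          using complex_norm_square[of z] by (simp add: mult.commute)
        have Hw0: "H w0 = of_real (Y w0)"
        proof -
          have "A w0 = (\<Sum>z | poly P z = w0. of_real ((cmod z)\<^sup>2))" unfolding A_def
            by (rule sum.cong) (use e1(3) in \<open>auto simp: cc\<close>)
          then show ?thesis by (simp add: H_def Y_def fiber_sum_def cc)
        qed
        have G1: "(cmod (G w))\<^sup>2 = ((cmod (H w))\<^sup>2) ^ n * (cmod (V w))\<^sup>2" for w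
          by (simp add: G_def norm_mult norm_power power_mult_distrib power_mult[symmetric] mult.commute)
        have G0: "(cmod (G w0))\<^sup>2 = Y w0 ^ n * Z w0"
          unfolding G1 Hw0 Z_def using Y0[of w0] by (simp add: power_mult[symmetric] power_mult_distrib power2_eq_square power_add mult_ac mult_2_right)
        have ZU: "Z w \<le> Z w0" if "w \<in> U" for w using w0(2)[of w] U(2) e2(2) that by auto
        have "cmod (G w) \<le> cmod (G w0)" if w: "w \<in> U" for w
        proof -
          have "(cmod (G w))\<^sup>2 \<le> (Y w0 * Y w) ^ n * (cmod (V w))\<^sup>2"
            unfolding G1 using H1[OF w] by (intro mult_right_mono power_mono) auto
          also have "\<dots> = Y w0 ^ n * Z w" by (simp add: Z_def power_mult_distrib)
          also have "\<dots> \<le> Y w0 ^ n * Z w0" using ZU[OF w] Y0[of w0] by (intro mult_left_mono) auto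
          finally show ?thesis unfolding G0[symmetric] by (rule power2_le_imp_le) auto
        qed
        then have "G constant_on U" using maximum_modulus_principle[OF hG U(4,5,4) order_refl U(3)] by blast
        \<comment> \<open>Any second point of \<open>U\<close> serves: the strict inequality there
          contradicts the constancy of \<open>G\<close>.\<close>
        define w where "w = w0 + of_real (min \<epsilon>1 \<epsilon>2 / 2)"
        have w: "w \<in> U" "w0 \<noteq> w" using e1(1) e2(1) by (auto simp: w_def U_def dist_norm)
        have Vw: "V w \<noteq> 0" using V0[of w] w U(1) e1(2) by auto
        have "(cmod (G w))\<^sup>2 < (Y w0 * Y w) ^ n * (cmod (V w))\<^sup>2"
          unfolding G1 using H2[OF w] Vw n by (intro mult_strict_right_mono power_strict_mono) auto
        also have "\<dots> = Y w0 ^ n * Z w" by (simp add: Z_def power_mult_distrib)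
        also have "\<dots> \<le> Y w0 ^ n * Z w0" using ZU[OF w(1)] Y0[of w0] by (intro mult_left_mono) auto
        finally have "cmod (G w) \<noteq> cmod (G w0)" unfolding G0[symmetric] by auto
        then show False using \<open>G constant_on U\<close> w(1) U(3) by (metis constant_on_def)
      qed
      then show ?thesis
        unfolding Z_def Y_def using R[of w0] M[of w0] B0 \<delta> fiber_sum_nonneg[of P w0]
        by (intro mult_mono power_mono) auto
    qed
    then show ?thesis using w0(2)[of w1] w1 unfolding Z_def Y_def by auto
  qed
  have "w1 \<notin> Cr" using ncr by (auto simp: Cr_def)
  then have V1: "0 < (cmod (V w1))\<^sup>2" using V0[of w1] by simp
  have "bounded (V ` cball 0 R)" by (intro compact_imp_bounded compact_continuous_image cV compact_cball)
  then obtain M where "\<forall>x\<in>V ` cball 0 R. cmod x \<le> M" unfolding bounded_iff by blast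
  then have M: "(cmod (V w))\<^sup>2 \<le> M\<^sup>2" if "cmod w \<le> R" for w using that by (intro power_mono) auto
  have *: "fiber_sum P w1 \<le> B + \<delta> * (1 + R\<^sup>2)" if \<delta>: "\<delta> > 0" for \<delta>
  proof -
    have "0 < B + \<delta> * (1 + R\<^sup>2)" using B0 \<delta> by (intro add_nonneg_pos mult_pos_pos add_pos_nonneg) auto
    then have "fiber_sum P w1 + \<delta> * (1 + (cmod w1)\<^sup>2) \<le> B + \<delta> * (1 + R\<^sup>2)"
      using root_limit_le[of "fiber_sum P w1 + \<delta> * (1 + (cmod w1)\<^sup>2)" _ "B + \<delta> * (1 + R\<^sup>2)"] key[OF \<delta> _ M] V1 by blast
    moreover have "0 \<le> \<delta> * (1 + (cmod w1)\<^sup>2)" using \<delta> by simp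
    ultimately show ?thesis by linarith
  qed
  show ?thesis
  proof (rule field_le_epsilon)
    fix e :: real assume "0 < e"
    then have "fiber_sum P w1 \<le> B + e / (1 + R\<^sup>2) * (1 + R\<^sup>2)" by (intro *) (auto intro!: divide_pos_pos add_pos_nonneg)
    also have "e / (1 + R\<^sup>2) * (1 + R\<^sup>2) = e" using zero_le_power2[of R] by (intro nonzero_eq_divide_eq[THEN iffD1]) (auto simp: add_nonneg_eq_0_iff)
    finally show "fiber_sum P w1 \<le> B + e" .
  qed
qed

section \<open>Discrete Parseval identities and the area inequality\<close>

lemma roots_of_unity_orthogonal:
  assumes "k < L" "l < L"
  shows "(\<Sum>j<L. cis (2 * pi * real j / real L) ^ k * cnj (cis (2 * pi * real j / real L) ^ l)) = (if k = l then of_nat L else 0)"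
proof -
  define q where "q = cis (2 * pi * real k / real L) * cnj (cis (2 * pi * real l / real L))"
  have L: "L > 0" using assms by simp
  have e: "cis (2 * pi * real j / real L) ^ k * cnj (cis (2 * pi * real j / real L) ^ l) = q ^ j" for j
  proof -
    have "cis (2 * pi * real j / real L) ^ k = cis (2 * pi * real k / real L) ^ j"
      "cis (2 * pi * real j / real L) ^ l = cis (2 * pi * real l / real L) ^ j"
      by (simp_all add: Complex.DeMoivre mult_ac)
    then show ?thesis by (simp add: q_def power_mult_distrib)
  qed
  have c1: "z * cnj z = 1" if "cmod z = 1" for z using complex_norm_square[of z] that by simp
  show ?thesis
  proof (cases "k = l")
    case True
    then show ?thesis unfolding e by (simp add: q_def c1)
  next
    case False
    have "q \<noteq> 1"
    proof
      assume q: "q = 1"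
      have "cis (2 * pi * real k / real L) = cis (2 * pi * real k / real L) * (cnj (cis (2 * pi * real l / real L)) * cis (2 * pi * real l / real L))"
        using c1[of "cis (2 * pi * real l / real L)"] by (simp add: mult.commute)
      also have "\<dots> = cis (2 * pi * real l / real L)" using q by (simp add: q_def mult.assoc[symmetric])
      finally show False
        using False assms bij_betw_imp_inj_on[OF Complex.bij_betw_roots_unity[OF L]] by (auto dest!: inj_onD)
    qed
    moreover have "q ^ L = 1"
      using L by (simp add: q_def power_mult_distrib Complex.DeMoivre complex_cnj_power[symmetric] del: complex_cnj_power)
    ultimately show ?thesis unfolding e using False by (simp add: geometric_sum)
  qed
qed

text \<open>A discrete Parseval identity: exponents up to \<open>K < L\<close> stay distinct modulo
  \<open>L\<close>, so the cross terms cancel.\<close>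

lemma roots_of_unity_mean_square:
  assumes "K < L"
  shows "(\<Sum>j<L. (cmod (\<Sum>k\<le>K. c k * (cis (2 * pi * real j / real L) * u) ^ k))\<^sup>2) =
    real L * (\<Sum>k\<le>K. (cmod (c k))\<^sup>2 * cmod u ^ (2 * k))"
proof -
  define w where "w j = cis (2 * pi * real j / real L)" for j
  have "complex_of_real (\<Sum>j<L. (cmod (\<Sum>k\<le>K. c k * (w j * u) ^ k))\<^sup>2) =
      (\<Sum>j<L. (\<Sum>k\<le>K. c k * (w j * u) ^ k) * cnj (\<Sum>l\<le>K. c l * (w j * u) ^ l))"
    unfolding of_real_sum complex_norm_square ..
  also have "\<dots> = (\<Sum>j<L. \<Sum>k\<le>K. \<Sum>l\<le>K. c k * u ^ k * cnj (c l * u ^ l) * (w j ^ k * cnj (w j ^ l)))"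
    unfolding cnj_sum sum_product by (intro sum.cong refl) (simp add: power_mult_distrib mult_ac)
  also have "\<dots> = (\<Sum>k\<le>K. \<Sum>j<L. \<Sum>l\<le>K. c k * u ^ k * cnj (c l * u ^ l) * (w j ^ k * cnj (w j ^ l)))"
    by (rule sum.swap)
  also have "\<dots> = (\<Sum>k\<le>K. \<Sum>l\<le>K. \<Sum>j<L. c k * u ^ k * cnj (c l * u ^ l) * (w j ^ k * cnj (w j ^ l)))"
    by (intro sum.cong refl sum.swap)
  also have "\<dots> = (\<Sum>k\<le>K. \<Sum>l\<le>K. c k * u ^ k * cnj (c l * u ^ l) * (if k = l then of_nat L else 0))"
    unfolding sum_distrib_left[symmetric] w_def using assms
    by (intro sum.cong refl) (simp add: roots_of_unity_orthogonal[unfolded complex_cnj_power])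
  also have "\<dots> = (\<Sum>k\<le>K. c k * u ^ k * cnj (c k * u ^ k) * of_nat L)"
    by (intro sum.cong refl) (simp add: if_distrib[of "\<lambda>x. _ * x"] sum.delta' cong: if_cong)
  also have "\<dots> = (\<Sum>k\<le>K. complex_of_real (real L * ((cmod (c k))\<^sup>2 * cmod u ^ (2 * k))))"
  proof (intro sum.cong refl)
    fix k
    have "(cmod (c k * u ^ k))\<^sup>2 = (cmod (c k))\<^sup>2 * cmod u ^ (2 * k)"
      by (simp add: norm_mult norm_power power_mult_distrib power_mult[symmetric] mult.commute)
    then show "c k * u ^ k * cnj (c k * u ^ k) * of_nat L = complex_of_real (real L * ((cmod (c k))\<^sup>2 * cmod u ^ (2 * k)))"
      unfolding complex_norm_square[symmetric] by (simp add: mult.commute)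
  qed
  also have "\<dots> = complex_of_real (real L * (\<Sum>k\<le>K. (cmod (c k))\<^sup>2 * cmod u ^ (2 * k)))"
    by (simp only: of_real_sum sum_distrib_left)
  finally show ?thesis unfolding w_def of_real_eq_iff .
qed

text \<open>After truncation at \<open>K\<close> the discrete identity applies, and the error
  depends on the tail of the series alone. Hence one \<open>K0\<close> serves all \<open>L\<close>
  and all \<open>u\<close> in the disc.\<close>

lemma mean_square_approx:
  fixes c :: "nat \<Rightarrow> complex" and f :: "complex \<Rightarrow> complex" and \<rho> e :: real
  assumes sm: "summable (\<lambda>k. cmod (c k) * \<rho> ^ k)" and \<rho>: "\<rho> \<ge> 0" and e: "e > 0"
    and f: "\<And>u. cmod u \<le> \<rho> \<Longrightarrow> (\<lambda>k. c k * u ^ k) sums f u"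
  obtains K0 where "\<And>K L u. K0 \<le> K \<Longrightarrow> K < L \<Longrightarrow> cmod u \<le> \<rho> \<Longrightarrow>
    \<bar>(\<Sum>j<L. (cmod (f (cis (2 * pi * real j / real L) * u)))\<^sup>2) - real L * (\<Sum>k\<le>K. (cmod (c k))\<^sup>2 * cmod u ^ (2 * k))\<bar> \<le> real L * e"
proof -
  define C where "C = (\<Sum>k. cmod (c k) * \<rho> ^ k)"
  have C0: "C \<ge> 0" unfolding C_def using \<rho> by (intro suminf_nonneg sm) auto
  have "(\<lambda>n. \<Sum>k<n. cmod (c k) * \<rho> ^ k) \<longlonglongrightarrow> C" unfolding C_def using sm by (rule summable_LIMSEQ)
  \<comment> \<open>\<open>C\<close> bounds both \<open>f\<close> and its partial sums, so their
    squared moduli differ by at most \<open>2 * C\<close> times the tail.\<close>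
  moreover have "0 < e / (2 * C + 1)" using e C0 by simp
  ultimately obtain N where N: "\<And>n. N \<le> n \<Longrightarrow> norm ((\<Sum>k<n. cmod (c k) * \<rho> ^ k) - C) < e / (2 * C + 1)"
    by (meson LIMSEQ_D)
  have term_le: "norm (c k * u ^ k) \<le> cmod (c k) * \<rho> ^ k" if "cmod u \<le> \<rho>" for u k
    using that by (simp add: norm_mult norm_power mult_left_mono power_mono)
  have fb: "cmod (f u) \<le> C" if u: "cmod u \<le> \<rho>" for u
  proof -
    have "f u = (\<Sum>k. c k * u ^ k)" using f[OF u] by (rule sums_unique)
    then show ?thesis unfolding C_def using norm_suminf_le[OF term_le[OF u] sm] by simp
  qed
  have pb: "cmod (\<Sum>k\<le>K. c k * u ^ k) \<le> C" if u: "cmod u \<le> \<rho>" for u K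
  proof -
    have "cmod (\<Sum>k\<le>K. c k * u ^ k) \<le> (\<Sum>k\<le>K. cmod (c k) * \<rho> ^ k)" by (rule sum_norm_le) (rule term_le[OF u])
    also have "\<dots> \<le> C" unfolding C_def by (rule sum_le_suminf[OF sm]) (use \<rho> in auto)
    finally show ?thesis .
  qed
  have tail: "cmod (f u - (\<Sum>k\<le>K. c k * u ^ k)) \<le> e / (2 * C + 1)" if u: "cmod u \<le> \<rho>" and K: "N \<le> K" for u K
  proof -
    have s: "summable (\<lambda>k. c k * u ^ k)" using f[OF u] by (rule sums_summable)
    have "f u - (\<Sum>k\<le>K. c k * u ^ k) = (\<Sum>k. c (k + Suc K) * u ^ (k + Suc K))"
      unfolding suminf_minus_initial_segment[OF s] lessThan_Suc_atMost using sums_unique[OF f[OF u]] by simp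
    also have "cmod \<dots> \<le> (\<Sum>k. cmod (c (k + Suc K)) * \<rho> ^ (k + Suc K))"
      by (rule norm_suminf_le[OF term_le[OF u]]) (rule summable_ignore_initial_segment[OF sm])
    also have "\<dots> = C - (\<Sum>k<Suc K. cmod (c k) * \<rho> ^ k)"
      unfolding C_def by (rule suminf_minus_initial_segment[OF sm])
    also have "\<dots> \<le> e / (2 * C + 1)" using N[of "Suc K"] K by (simp add: abs_le_iff real_norm_def)
    finally show ?thesis .
  qed
  show thesis
  proof (rule that[of N])
    fix K L u assume K: "N \<le> K" and KL: "K < L" and u: "cmod u \<le> \<rho>"
    define w where "w j = cis (2 * pi * real j / real L) * u" for j
    have wu: "cmod (w j) \<le> \<rho>" for j using u by (simp add: w_def norm_mult)
    have "\<bar>(\<Sum>j<L. (cmod (f (w j)))\<^sup>2) - real L * (\<Sum>k\<le>K. (cmod (c k))\<^sup>2 * cmod u ^ (2 * k))\<bar>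
        = \<bar>\<Sum>j<L. (cmod (f (w j)))\<^sup>2 - (cmod (\<Sum>k\<le>K. c k * w j ^ k))\<^sup>2\<bar>"
      unfolding roots_of_unity_mean_square[OF KL, symmetric] sum_subtractf w_def ..
    also have "\<dots> \<le> (\<Sum>j<L. \<bar>(cmod (f (w j)))\<^sup>2 - (cmod (\<Sum>k\<le>K. c k * w j ^ k))\<^sup>2\<bar>)" by (rule sum_abs)
    also have "\<dots> \<le> (\<Sum>j<L. e)"
    proof (rule sum_mono)
      fix j
      define a b where "a = cmod (f (w j))" and "b = cmod (\<Sum>k\<le>K. c k * w j ^ k)"
      have ab: "0 \<le> a" "0 \<le> b" "a \<le> C" "b \<le> C" using fb[OF wu] pb[OF wu] by (auto simp: a_def b_def)
      have "\<bar>a - b\<bar> \<le> e / (2 * C + 1)" unfolding a_def b_def using norm_triangle_ineq3 tail[OF wu K] by (rule order_trans)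
      then have "\<bar>a - b\<bar> * (a + b) \<le> e / (2 * C + 1) * (2 * C + 1)" using ab C0 e by (intro mult_mono) auto
      also have "\<dots> = e" using C0 by simp
      also have "\<bar>a - b\<bar> * (a + b) = \<bar>a\<^sup>2 - b\<^sup>2\<bar>" using ab by (simp add: square_diff_square_factored power2_eq_square abs_mult mult.commute)
      finally show "\<bar>(cmod (f (w j)))\<^sup>2 - (cmod (\<Sum>k\<le>K. c k * w j ^ k))\<^sup>2\<bar> \<le> e" by (simp add: a_def b_def)
    qed
    finally show "\<bar>(\<Sum>j<L. (cmod (f (cis (2 * pi * real j / real L) * u)))\<^sup>2) - real L * (\<Sum>k\<le>K. (cmod (c k))\<^sup>2 * cmod u ^ (2 * k))\<bar> \<le> real L * e"
      by (simp add: w_def)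
  qed
qed

context
  fixes P :: "complex poly" and s :: real and F :: "complex \<Rightarrow> complex"
  assumes m: "lead_coeff P = 1" and d: "degree P > 0" and s: "s > 0"
    and cr: "\<forall>z. poly (pderiv P) z = 0 \<longrightarrow> cmod (poly P z) \<le> s ^ degree P"
    and hF: "F holomorphic_on ball 0 (1 / s)" and F0: "F 0 = 1"
    and PF: "\<And>u. u \<in> ball 0 (1 / s) \<Longrightarrow> u \<noteq> 0 \<Longrightarrow> poly P (F u / u) = (1 / u) ^ degree P"
    and injF: "inj_on (\<lambda>u. F u / u) (ball 0 (1 / s) - {0})"
begin

text \<open>As \<open>P\<close> takes the value \<open>(1 / w) ^ degree P\<close> at
  \<open>F w / w\<close>, the \<open>L\<close> rotations of \<open>u\<close> parametrise the fibre
  of \<open>P ^ M\<close> over \<open>(1 / u) ^ L\<close>. Critical points of \<open>P ^ M\<close>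
  are zeros or critical points of \<open>P\<close>, and none of them lies in this fibre.\<close>

lemma fiber_sum_power:
  fixes u :: complex and M :: nat
  defines "L \<equiv> degree P * M"
  assumes M: "M \<ge> 1" and u: "u \<noteq> 0" "cmod u < 1 / s"
  shows "fiber_sum (P ^ M) ((1 / u) ^ L) = (\<Sum>j<L. (cmod (F (cis (2 * pi * real j / real L) * u)))\<^sup>2) / (cmod u)\<^sup>2"
    and "poly (P ^ M) z = (1 / u) ^ L \<Longrightarrow> poly (pderiv (P ^ M)) z \<noteq> 0"
proof -
  have L0: "L > 0" using d M by (simp add: L_def)
  define w where "w j = cis (2 * pi * real j / real L) * u" for j
  define \<zeta> where "\<zeta> j = F (w j) / w j" for j
  have nw: "cmod (w j) = cmod u" for j by (simp add: w_def norm_mult)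
  have w0: "w j \<noteq> 0" for j using nw[of j] u by auto
  have wb: "w j \<in> ball 0 (1 / s)" for j using nw[of j] u by simp
  have wL: "w j ^ L = u ^ L" for j
    using L0 by (simp add: w_def power_mult_distrib Complex.DeMoivre)
  have injz: "inj_on \<zeta> {..<L}"
  proof (rule inj_onI)
    fix i j assume ij: "i \<in> {..<L}" "j \<in> {..<L}" "\<zeta> i = \<zeta> j"
    then have "w i = w j" using injF wb w0 unfolding \<zeta>_def by (auto dest: inj_onD)
    then have "cis (2 * pi * real i / real L) = cis (2 * pi * real j / real L)" using u by (simp add: w_def)
    then show "i = j" using ij bij_betw_imp_inj_on[OF Complex.bij_betw_roots_unity[OF L0]] by (auto dest!: inj_onD)
  qed
  have Pz: "poly (P ^ M) (\<zeta> j) = (1 / u) ^ L" for j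
    using PF[OF wb w0, of j] wL[of j] by (simp add: \<zeta>_def L_def power_mult[symmetric] power_one_over)
  have "P \<noteq> 0" using d by auto
  then have dPM: "degree (P ^ M) = L" by (simp add: degree_power_eq L_def mult.commute)
  have P0: "P ^ M - [:(1 / u) ^ L:] \<noteq> 0" using dPM L0 by (metis degree_pCons_0 eq_iff_diff_eq_0 less_irrefl)
  have e: "{z. poly (P ^ M) z = (1 / u) ^ L} = {z. poly (P ^ M - [:(1 / u) ^ L:]) z = 0}" by auto
  have c: "card {z. poly (P ^ M) z = (1 / u) ^ L} \<le> L"
    unfolding e using card_poly_roots_bound[OF P0] degree_diff_const[of "P ^ M"] L0 dPM by simp
  have fin: "finite {z. poly (P ^ M) z = (1 / u) ^ L}" unfolding e using poly_roots_finite[OF P0] .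
  have im: "\<zeta> ` {..<L} = {z. poly (P ^ M) z = (1 / u) ^ L}"
    by (rule card_seteq[OF fin]) (use Pz c card_image[OF injz] in auto)
  have "fiber_sum (P ^ M) ((1 / u) ^ L) = (\<Sum>j<L. (cmod (\<zeta> j))\<^sup>2)"
    unfolding fiber_sum_def im[symmetric] sum.reindex[OF injz] by simp
  also have "\<dots> = (\<Sum>j<L. (cmod (F (w j)))\<^sup>2) / (cmod u)\<^sup>2"
    by (simp add: \<zeta>_def norm_divide nw power_divide sum_divide_distrib)
  finally show "fiber_sum (P ^ M) ((1 / u) ^ L) = (\<Sum>j<L. (cmod (F (cis (2 * pi * real j / real L) * u)))\<^sup>2) / (cmod u)\<^sup>2"
    by (simp add: w_def)
  assume z: "poly (P ^ M) z = (1 / u) ^ L"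
  have Pz0: "poly P z \<noteq> 0" using z u M L0 by (auto simp: power_0_left split: if_splits)
  have "cmod (poly P z) ^ M = (cmod (1 / u) ^ degree P) ^ M"
    using arg_cong[OF z, of cmod] by (simp add: norm_power L_def power_mult)
  then have "cmod (poly P z) = cmod (1 / u) ^ degree P"
    by (rule power_eq_imp_eq_base) (use M in auto)
  moreover have "s < cmod (1 / u)" using u s by (simp add: norm_divide field_simps)
  then have "s ^ degree P < cmod (1 / u) ^ degree P" using s d by (intro power_strict_mono) auto
  ultimately have "poly (pderiv P) z \<noteq> 0" using cr by force
  then show "poly (pderiv (P ^ M)) z \<noteq> 0" using Pz0 M by (auto simp: pderiv_power)
qed

text \<open>By the maximum principle the mean of |F u / u|^2 over the circle |u| = r does not
  increase with r. It equals 1/r^2 plus the sum of |c_(k+1)|^2 r^(2k), and the claim says that its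
  derivative is not positive; no area is computed.\<close>

lemma area_inequality:
  fixes x :: real
  defines "c \<equiv> \<lambda>k. (deriv ^^ k) F 0 / fact k"
  assumes x: "0 < x" "x < 1 / s"
  shows "(\<Sum>k\<le>K. real k * (cmod (c (Suc k)))\<^sup>2 * x ^ (2 * k + 2)) \<le> 1"
proof -
  have sums: "(\<lambda>k. c k * u ^ k) sums F u" if "cmod u < 1 / s" for u
    using holomorphic_power_series[OF hF, of u] that by (simp add: c_def)
  have c0: "c 0 = 1" by (simp add: c_def F0)
  define T where "T K r = (\<Sum>k\<le>K. (cmod (c k))\<^sup>2 * r ^ (2 * k))" for K and r :: real
  \<comment> \<open>Since \<open>x < y\<close>, the point belonging to \<open>y\<close> lies inside
    the circle of radius \<open>(1 / x) ^ L\<close>, so the maximum principle compares the two fibre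
    sums.\<close>
  have mono: "T K y / y\<^sup>2 \<le> T K x / x\<^sup>2 + e"
    if xy: "x < y" "y < 1 / s" and e: "e > 0" and K: "K1 \<le> K" and
      K1: "\<And>K L u. K1 \<le> K \<Longrightarrow> K < L \<Longrightarrow> cmod u \<le> y \<Longrightarrow>
    \<bar>(\<Sum>j<L. (cmod (F (cis (2 * pi * real j / real L) * u)))\<^sup>2) - real L * T K (cmod u)\<bar> \<le> real L * (e * x\<^sup>2 / 2)"
    for y e K K1
  proof -
    \<comment> \<open>Passing to the power \<open>P ^ M\<close> makes the number \<open>L\<close> of
      sample points exceed the truncation order \<open>K\<close>.\<close>
    define M where "M = Suc K"
    define L where "L = degree P * M"
    have "Suc K \<le> degree P * Suc K" using d by (cases "degree P") auto
    then have KL: "K < L" by (simp add: L_def M_def)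
    have L0: "L > 0" using KL by simp
    have y0: "y > 0" using xy x by simp
    have lm: "lead_coeff (P ^ M) = 1" by (simp add: lead_coeff_power m)
    have P0: "P \<noteq> 0" using d by auto
    have dP: "degree (P ^ M) > 0" unfolding degree_power_eq[OF P0] using d by (simp add: M_def)
    define B where "B = real L * (T K x + e * x\<^sup>2 / 2) / x\<^sup>2"
    have fs: "fiber_sum (P ^ M) w \<le> B" if w: "cmod w = (1 / x) ^ L" for w
    proof -
      have w0: "w \<noteq> 0" using w x by auto
      obtain v where v: "v ^ L = w" using exists_complex_root[of L w] L0 by auto
      define u where "u = 1 / v"
      have v0: "v \<noteq> 0" using v w0 L0 by auto
      have "cmod v ^ L = (1 / x) ^ L" using v w by (metis norm_power)
      then have "cmod v = 1 / x" by (rule power_eq_imp_eq_base) (use L0 x in auto)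
      then have cu: "cmod u = x" by (simp add: u_def norm_divide)
      have "fiber_sum (P ^ M) w = (\<Sum>j<L. (cmod (F (cis (2 * pi * real j / real L) * u)))\<^sup>2) / x\<^sup>2"
        using fiber_sum_power(1)[of M u] cu x v v0 by (simp add: L_def u_def M_def)
      also have "\<dots> \<le> B" unfolding B_def
      proof (rule divide_right_mono)
        have "cmod u \<le> y" using cu xy by simp
        from abs_le_D1[OF K1[OF K KL this]]
        show "(\<Sum>j<L. (cmod (F (cis (2 * pi * real j / real L) * u)))\<^sup>2) \<le> real L * (T K x + e * x\<^sup>2 / 2)"
          unfolding cu distrib_left by linarith
      qed auto
      finally show ?thesis .
    qed
    define u where "u = complex_of_real y"
    have u: "u \<noteq> 0" "cmod u = y" using y0 by (auto simp: u_def)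
    have "fiber_sum (P ^ M) ((1 / u) ^ L) \<le> B"
    proof (rule fiber_sum_maximum[OF dP lm fs])
      have "1 / y < 1 / x" using xy x by (simp add: field_simps)
      then show "cmod ((1 / u) ^ L) < (1 / x) ^ L"
        using L0 y0 unfolding norm_power norm_divide u(2) by (intro power_strict_mono) auto
      show "poly (pderiv (P ^ M)) z \<noteq> 0" if "poly (P ^ M) z = (1 / u) ^ L" for z
        using fiber_sum_power(2)[of M u z] u xy that by (simp add: L_def M_def)
    qed
    also have "fiber_sum (P ^ M) ((1 / u) ^ L) = (\<Sum>j<L. (cmod (F (cis (2 * pi * real j / real L) * u)))\<^sup>2) / y\<^sup>2"
      using fiber_sum_power(1)[of M u] u xy by (simp add: L_def M_def)
    finally have 1: "(\<Sum>j<L. (cmod (F (cis (2 * pi * real j / real L) * u)))\<^sup>2) / y\<^sup>2 \<le> B" .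
    have "real L * (T K y - e * x\<^sup>2 / 2) / y\<^sup>2 \<le> (\<Sum>j<L. (cmod (F (cis (2 * pi * real j / real L) * u)))\<^sup>2) / y\<^sup>2"
    proof (rule divide_right_mono)
      have "cmod u \<le> y" using u by simp
      from abs_le_D2[OF K1[OF K KL this]]
      show "real L * (T K y - e * x\<^sup>2 / 2) \<le> (\<Sum>j<L. (cmod (F (cis (2 * pi * real j / real L) * u)))\<^sup>2)"
        unfolding u(2) right_diff_distrib by linarith
    qed auto
    then have "real L * ((T K y - e * x\<^sup>2 / 2) / y\<^sup>2) \<le> real L * ((T K x + e * x\<^sup>2 / 2) / x\<^sup>2)"
      using 1 unfolding B_def by simp
    then have "(T K y - e * x\<^sup>2 / 2) / y\<^sup>2 \<le> (T K x + e * x\<^sup>2 / 2) / x\<^sup>2" by (rule mult_left_le_imp_le) (use L0 in simp)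
    moreover have "(T K x + e * x\<^sup>2 / 2) / x\<^sup>2 = T K x / x\<^sup>2 + e / 2" using x by (simp add: add_divide_distrib)
    moreover have "(T K y - e * x\<^sup>2 / 2) / y\<^sup>2 \<ge> T K y / y\<^sup>2 - e / 2"
    proof -
      have "x\<^sup>2 \<le> y\<^sup>2" using xy x by (intro power_mono) auto
      then have "(e / 2) * x\<^sup>2 / y\<^sup>2 \<le> e / 2" using e y0 by (simp add: field_simps)
      then show ?thesis by (simp add: diff_divide_distrib)
    qed
    ultimately show ?thesis by linarith
  qed
  have step: "(\<Sum>k\<le>K. real k * (cmod (c (Suc k)))\<^sup>2 * (x\<^sup>2) ^ (k - 1)) \<le> 1 / (x\<^sup>2 * y\<^sup>2)" if xy: "x < y" "y < 1 / s" for y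
  proof -
    have y0: "y > 0" using xy x by simp
    obtain y' where y': "y < y'" "y' < 1 / s" using xy dense by blast
    have "summable (\<lambda>k. c k * of_real y' ^ k)" using sums[of "of_real y'"] y' y0 by (auto simp: sums_iff)
    then have "summable (\<lambda>k. norm (c k * of_real y ^ k))" using y' y0 by (intro powser_insidea) auto
    then have sm: "summable (\<lambda>k. cmod (c k) * y ^ k)" using y0 by (simp add: norm_mult norm_power)
    have X: "x\<^sup>2 < y\<^sup>2" using xy x by (intro power_strict_mono) auto
    have fin: "(\<Sum>k\<le>K. (cmod (c (Suc k)))\<^sup>2 * ((y\<^sup>2) ^ k - (x\<^sup>2) ^ k)) \<le> 1 / x\<^sup>2 - 1 / y\<^sup>2 + e" if e: "e > 0" for e
    proof -
      have pos: "0 < e * x\<^sup>2 / 2" using e x by simp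
      have sy: "(\<lambda>k. c k * u ^ k) sums F u" if "cmod u \<le> y" for u using sums[of u] that xy by simp
      obtain K1 where K1: "\<And>K L u. K1 \<le> K \<Longrightarrow> K < L \<Longrightarrow> cmod u \<le> y \<Longrightarrow>
        \<bar>(\<Sum>j<L. (cmod (F (cis (2 * pi * real j / real L) * u)))\<^sup>2) - real L * (\<Sum>k\<le>K. (cmod (c k))\<^sup>2 * cmod u ^ (2 * k))\<bar> \<le> real L * (e * x\<^sup>2 / 2)"
        by (rule mean_square_approx[OF sm less_imp_le[OF y0] pos], erule sy, rule that, blast)
      define N where "N = max K1 K"
      have A: "T (Suc N) y / y\<^sup>2 \<le> T (Suc N) x / x\<^sup>2 + e"
        by (rule mono[OF xy e, of K1]) (use K1 in \<open>auto simp: N_def T_def\<close>)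
      have B: "T (Suc N) r / r\<^sup>2 = 1 / r\<^sup>2 + (\<Sum>k\<le>N. (cmod (c (Suc k)))\<^sup>2 * (r\<^sup>2) ^ k)" if "r > 0" for r
      proof -
        have e2: "r ^ (2 * Suc k) = (r\<^sup>2) ^ k * r\<^sup>2" for k by (metis power_mult power_Suc2)
        have "T (Suc N) r = 1 + (\<Sum>k\<le>N. (cmod (c (Suc k)))\<^sup>2 * (r\<^sup>2) ^ k) * r\<^sup>2"
          unfolding T_def sum.atMost_Suc_shift sum_distrib_right e2 by (simp add: c0 mult.assoc)
        then show ?thesis using that by (simp add: add_divide_distrib)
      qed
      have "(\<Sum>k\<le>N. (cmod (c (Suc k)))\<^sup>2 * (y\<^sup>2) ^ k) - (\<Sum>k\<le>N. (cmod (c (Suc k)))\<^sup>2 * (x\<^sup>2) ^ k) \<le> 1 / x\<^sup>2 - 1 / y\<^sup>2 + e"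
        using A B[OF x(1)] B[OF y0] by linarith
      then have "(\<Sum>k\<le>N. (cmod (c (Suc k)))\<^sup>2 * ((y\<^sup>2) ^ k - (x\<^sup>2) ^ k)) \<le> 1 / x\<^sup>2 - 1 / y\<^sup>2 + e"
        by (simp add: right_diff_distrib sum_subtractf)
      moreover have "(\<Sum>k\<le>K. (cmod (c (Suc k)))\<^sup>2 * ((y\<^sup>2) ^ k - (x\<^sup>2) ^ k)) \<le> (\<Sum>k\<le>N. (cmod (c (Suc k)))\<^sup>2 * ((y\<^sup>2) ^ k - (x\<^sup>2) ^ k))"
        by (rule sum_mono2) (use X in \<open>auto simp: N_def intro!: mult_nonneg_nonneg power_mono\<close>)
      ultimately show ?thesis by linarith
    qed
    have fin': "(\<Sum>k\<le>K. (cmod (c (Suc k)))\<^sup>2 * ((y\<^sup>2) ^ k - (x\<^sup>2) ^ k)) \<le> 1 / x\<^sup>2 - 1 / y\<^sup>2"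
      by (rule field_le_epsilon) (rule fin)
    \<comment> \<open>The power function lies above its tangent at \<open>b\<close>.\<close>
    have diff: "real k * b ^ (k - 1) * (a - b) \<le> a ^ k - b ^ k" if "0 \<le> b" "b \<le> a" for a b :: real and k
    proof -
      have "(\<Sum>i<k. b ^ (k - 1)) \<le> (\<Sum>i<k. b ^ (k - Suc i) * a ^ i)"
      proof (rule sum_mono)
        fix i assume i: "i \<in> {..<k}"
        have "b ^ (k - 1) = b ^ (k - Suc i) * b ^ i" using i by (simp flip: power_add)
        also have "\<dots> \<le> b ^ (k - Suc i) * a ^ i" using that by (intro mult_left_mono power_mono) auto
        finally show "b ^ (k - 1) \<le> b ^ (k - Suc i) * a ^ i" .
      qed
      then have "(a - b) * (real k * b ^ (k - 1)) \<le> (a - b) * (\<Sum>i<k. b ^ (k - Suc i) * a ^ i)" using that by (intro mult_left_mono) auto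
      then show ?thesis unfolding power_diff_sumr2[of a k b] by (simp add: mult_ac)
    qed
    have "(\<Sum>k\<le>K. real k * (cmod (c (Suc k)))\<^sup>2 * (x\<^sup>2) ^ (k - 1)) * (y\<^sup>2 - x\<^sup>2)
        = (\<Sum>k\<le>K. (cmod (c (Suc k)))\<^sup>2 * (real k * (x\<^sup>2) ^ (k - 1) * (y\<^sup>2 - x\<^sup>2)))"
      unfolding sum_distrib_right by (intro sum.cong refl) (simp add: mult_ac)
    also have "\<dots> \<le> (\<Sum>k\<le>K. (cmod (c (Suc k)))\<^sup>2 * ((y\<^sup>2) ^ k - (x\<^sup>2) ^ k))"
      using X by (intro sum_mono mult_left_mono diff) auto
    also have "\<dots> \<le> 1 / x\<^sup>2 - 1 / y\<^sup>2" by (rule fin')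
    also have "\<dots> = 1 / (x\<^sup>2 * y\<^sup>2) * (y\<^sup>2 - x\<^sup>2)" using x y0 by (simp add: field_simps)
    finally show ?thesis by (rule mult_right_le_imp_le) (use X in simp)
  qed
  \<comment> \<open>Letting \<open>y\<close> decrease to \<open>x\<close> turns the difference
    quotient into the derivative.\<close>
  have "(\<Sum>k\<le>K. real k * (cmod (c (Suc k)))\<^sup>2 * (x\<^sup>2) ^ (k - 1)) \<le> 1 / (x\<^sup>2 * x\<^sup>2)"
  proof (rule tendsto_lowerbound)
    show "((\<lambda>y. 1 / (x\<^sup>2 * y\<^sup>2)) \<longlongrightarrow> 1 / (x\<^sup>2 * x\<^sup>2)) (at_right x)"
      using x by (intro tendsto_intros) auto
    show "eventually (\<lambda>y. (\<Sum>k\<le>K. real k * (cmod (c (Suc k)))\<^sup>2 * (x\<^sup>2) ^ (k - 1)) \<le> 1 / (x\<^sup>2 * y\<^sup>2)) (at_right x)"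
      using eventually_at_right_less[of x] eventually_at_right_field[of "\<lambda>y. y < 1 / s" x] x step
      by (auto simp: eventually_at_right_field)
  qed auto
  then have "(\<Sum>k\<le>K. real k * (cmod (c (Suc k)))\<^sup>2 * (x\<^sup>2) ^ (k - 1)) * (x\<^sup>2 * x\<^sup>2) \<le> 1"
    using x by (simp add: pos_le_divide_eq)
  moreover have "(\<Sum>k\<le>K. real k * (cmod (c (Suc k)))\<^sup>2 * (x\<^sup>2) ^ (k - 1)) * (x\<^sup>2 * x\<^sup>2) = (\<Sum>k\<le>K. real k * (cmod (c (Suc k)))\<^sup>2 * x ^ (2 * k + 2))"
    unfolding sum_distrib_right
  proof (intro sum.cong refl)
    fix k
    have "(x\<^sup>2) ^ (k - 1) * (x\<^sup>2 * x\<^sup>2) = x ^ (2 * k + 2)" if "k > 0"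
    proof -
      have "2 * (k - 1) + (2 + 2) = 2 * k + 2" using that by simp
      then show ?thesis by (metis power_add power_mult)
    qed
    then show "real k * (cmod (c (Suc k)))\<^sup>2 * (x\<^sup>2) ^ (k - 1) * (x\<^sup>2 * x\<^sup>2) = real k * (cmod (c (Suc k)))\<^sup>2 * x ^ (2 * k + 2)"
      by (cases "k = 0") (simp_all add: mult.assoc)
  qed
  ultimately show ?thesis by simp
qed

end

subsection \<open>Exterior coordinates of the iterates of a polynomial\<close>

text \<open>\<open>f\<close> is composed on the inside, so that it carries the exterior coordinate
  of level \<open>Suc N\<close> to that of level \<open>N\<close>.\<close>

definition iter_poly :: "'a::comm_ring_1 poly \<Rightarrow> nat \<Rightarrow> 'a poly" where
  "iter_poly f N = ((\<lambda>g. pcompose g f) ^^ N) [:0, 1:]"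

lemma iter_poly_0 [simp]: "iter_poly f 0 = [:0, 1:]"
  and iter_poly_Suc: "iter_poly f (Suc N) = pcompose (iter_poly f N) f"
  by (simp_all add: iter_poly_def)

lemma poly_iter_poly: "poly (iter_poly f N) x = (poly f ^^ N) x"
  by (induction N arbitrary: x) (simp_all add: iter_poly_Suc poly_pcompose funpow_swap1)

lemma degree_iter_poly: "degree (iter_poly f N) = degree f ^ N" for f :: "'a::idom poly"
  by (induction N) (simp_all add: iter_poly_Suc degree_pcompose)

lemma lead_coeff_iter_poly:
  fixes f :: "'a::idom poly"
  assumes "lead_coeff f = 1" "degree f > 0"
  shows "lead_coeff (iter_poly f N) = 1"
proof (induction N)
  case (Suc N)
  then show ?case unfolding iter_poly_Suc lead_coeff_comp[OF assms(2)] by (simp add: assms(1))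
qed simp

lemma critical_point_iter_poly:
  fixes f :: "'a::idom poly"
  shows "poly (pderiv (iter_poly f N)) z = 0 \<Longrightarrow> \<exists>j<N. poly (pderiv f) ((poly f ^^ j) z) = 0"
proof (induction N arbitrary: z)
  case (Suc N)
  then consider "poly (pderiv f) z = 0" | "poly (pderiv (iter_poly f N)) (poly f z) = 0"
    by (auto simp: iter_poly_Suc pderiv_pcompose poly_pcompose)
  then show ?case
  proof cases
    case 1 then show ?thesis by (intro exI[of _ 0]) simp
  next
    case 2
    then obtain j where "j < N" "poly (pderiv f) ((poly f ^^ j) (poly f z)) = 0" using Suc.IH by blast
    then show ?thesis by (intro exI[of _ "Suc j"]) (simp add: funpow_swap1)
  qed
qed (simp add: pderiv_pCons)

section \<open>Power series supported on multiples of p below an index\<close>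

definition fps_sparse :: "nat \<Rightarrow> nat \<Rightarrow> 'a::comm_ring_1 fps \<Rightarrow> bool" where
  "fps_sparse p K A \<longleftrightarrow> (\<forall>k<K. \<not> p dvd k \<longrightarrow> fps_nth A k = 0)"

lemma fps_sparse_mult:
  assumes "fps_sparse p K A" "fps_sparse p K B"
  shows "fps_sparse p K (A * B)"
    and "\<not> p dvd K \<Longrightarrow> fps_nth (A * B) K = fps_nth A K * fps_nth B 0 + fps_nth A 0 * fps_nth B K"
proof -
  have z: "fps_nth A j * fps_nth B (k - j) = 0" if "\<not> p dvd k" "j \<le> k" "j < K" "k - j < K" for j k
  proof -
    have "\<not> p dvd j \<or> \<not> p dvd (k - j)" using that dvd_add[of p j "k - j"] by auto
    then show ?thesis using assms that by (auto simp: fps_sparse_def)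
  qed
  show "fps_sparse p K (A * B)" unfolding fps_sparse_def fps_mult_nth
    by (intro allI impI sum.neutral ballI z) auto
  assume K: "\<not> p dvd K"
  then have K0: "K > 0" by (cases K) auto
  have "fps_nth (A * B) K = (\<Sum>j\<in>{0, K}. fps_nth A j * fps_nth B (K - j))"
    unfolding fps_mult_nth by (rule sum.mono_neutral_right) (use z[OF K] in auto)
  then show "fps_nth (A * B) K = fps_nth A K * fps_nth B 0 + fps_nth A 0 * fps_nth B K"
    using K0 by (simp add: add.commute)
qed

lemma fps_sparse_power:
  assumes A: "fps_sparse p K A" and A0: "fps_nth A 0 = 1"
  shows "fps_sparse p K (A ^ i) \<and> (\<not> p dvd K \<longrightarrow> fps_nth (A ^ i) K = of_nat i * fps_nth A K)"
proof (induction i)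
  case 0 then show ?case by (auto simp: fps_sparse_def)
next
  case (Suc i)
  have "fps_nth (A ^ i) 0 = 1" using A0 by (simp add: fps_nth_power_0)
  then show ?case
    using fps_sparse_mult[OF A, of "A ^ i"] Suc A0 by (auto simp: algebra_simps)
qed

text \<open>Compare coefficients at \<open>k\<close>. The right side is a series in
  \<open>fps_X ^ d\<close> and contributes nothing for \<open>0 < k < d\<close>. On the left
  \<open>A\<close> is sparse below \<open>k\<close> by induction, so \<open>i = d\<close>
  contributes \<open>d\<close> times the coefficient of \<open>A\<close>, and \<open>i = m\<close>
  contributes \<open>coeff f m\<close> when \<open>k = d - m\<close>; all other terms
  vanish.\<close>

lemma sparse_functional_equation:
  fixes f :: "'a::field_char_0 poly" and A B :: "'a fps"
  defines "d \<equiv> degree f"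
  assumes eq: "(\<Sum>i\<le>d. fps_const (coeff f i) * A ^ i * fps_X ^ (d - i)) = B oo fps_X ^ d"
    and m1: "lead_coeff f = 1" and A0: "fps_nth A 0 = 1" and pd: "p dvd d"
    and m: "m < d" "0 < m" and top: "\<And>i. m < i \<Longrightarrow> \<not> p dvd i \<Longrightarrow> coeff f i = 0"
    and k: "0 < k" "k \<le> d - m" "\<not> p dvd k"
  shows "of_nat d * fps_nth A k + (if k = d - m then coeff f m else 0) = 0"
  using k
proof (induction k rule: less_induct)
  case (less k)
  have sp: "fps_sparse p k A" unfolding fps_sparse_def
  proof (intro allI impI)
    fix j assume j: "j < k" "\<not> p dvd j"
    then have "j > 0" by (cases j) auto
    then have "of_nat d * fps_nth A j = 0" using less.IH[of j] less.prems j by auto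
    then show "fps_nth A j = 0" using m by simp
  qed
  have kd: "k < d" using less.prems m by simp
  have "fps_nth (B oo fps_X ^ d) k = 0"
  proof -
    have "(fps_X ^ d :: 'a fps) ^ i $ k = 0" for i
    proof -
      have "(fps_X ^ d :: 'a fps) ^ i $ k = (if k = d * i then 1 else 0)"
        by (simp only: power_mult[symmetric] fps_X_power_nth)
      moreover have "k \<noteq> d * i" using kd less.prems by (cases i) auto
      ultimately show ?thesis by simp
    qed
    then show ?thesis by (simp add: fps_compose_nth)
  qed
  then have 0: "(\<Sum>i\<le>d. coeff f i * (if k < d - i then 0 else fps_nth (A ^ i) (k - (d - i)))) = 0"
    unfolding eq[symmetric] by (simp add: fps_sum_nth mult.assoc fps_X_power_mult_right_nth)
  have t: "coeff f i * (if k < d - i then 0 else fps_nth (A ^ i) (k - (d - i))) =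
      (if i = d then of_nat d * fps_nth A k else if i = m \<and> k = d - m then coeff f m else 0)" if i: "i \<le> d" for i
  proof -
    consider "i = d" | "i < d" "p dvd i" | "i < d" "\<not> p dvd i" "m < i" | "i < m" "i < d" | "i = m" "i < d" "\<not> p dvd i"
      using i by (metis linorder_neqE_nat order_le_less)
    then show ?thesis
    proof cases
      case 1
      then show ?thesis using fps_sparse_power[OF sp A0, of d] less.prems m1 by (simp add: d_def)
    next
      case 2
      have "fps_nth (A ^ i) (k - (d - i)) = 0" if "d - i \<le> k"
      proof -
        have "\<not> p dvd k - (d - i)"
          using less.prems(3) that 2 pd by (metis dvd_diff_nat dvd_add le_add_diff_inverse2)
        then show ?thesis using fps_sparse_power[OF sp A0, of i] 2 that less.prems by (auto simp: fps_sparse_def)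
      qed
      moreover have "coeff f m = 0" if "i = m" "k = d - m"
        using that 2 less.prems(3) pd by (metis dvd_diff_nat)
      ultimately show ?thesis using 2 by auto
    next
      case 3 then show ?thesis using top[of i] by auto
    next
      case 4 then show ?thesis using less.prems m by auto
    next
      case 5
      then show ?thesis using less.prems m A0 by (auto simp: fps_nth_power_0)
    qed
  qed
  have "(\<Sum>i\<le>d. coeff f i * (if k < d - i then 0 else fps_nth (A ^ i) (k - (d - i)))) =
     (\<Sum>i\<le>d. (if i = d then of_nat d * fps_nth A k else 0) + (if i = m then (if k = d - m then coeff f m else 0) else 0))"
    using m by (intro sum.cong refl) (subst t, auto)
  also have "\<dots> = of_nat d * fps_nth A k + (if k = d - m then coeff f m else 0)"
    using m unfolding sum.distrib by (subst (1 2) sum.delta) auto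
  finally show ?case using 0 by simp
qed

locale bounded_critical_orbits =
  fixes f :: "complex poly" and \<rho> :: real
  assumes m1: "lead_coeff f = 1" and d2: "degree f \<ge> 2" and \<rho>1: "\<rho> \<ge> 1"
    and crit: "\<And>c n. poly (pderiv f) c = 0 \<Longrightarrow> cmod ((poly f ^^ n) c) \<le> \<rho>"
begin

definition d where "d = degree f"
text \<open>The critical values of the \<open>N\<close>-th iterate are bounded by
  \<open>\<rho>\<close>, the \<open>d ^ N\<close>-th power of \<open>s N\<close>. This bound does
  not grow with \<open>N\<close>, so the radius tends to 1.\<close>

definition s where "s N = root (d ^ N) \<rho>"

text \<open>\<open>F u / u\<close> is the point whose exterior coordinate for the
  \<open>N\<close>-th iterate is \<open>1 / u\<close>; these are finite-level versions of the
  inverse Boettcher map.\<close>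

definition ext :: "nat \<Rightarrow> (complex \<Rightarrow> complex) \<Rightarrow> bool" where
  "ext N F \<longleftrightarrow> F holomorphic_on ball 0 (1 / s N) \<and> F 0 = 1 \<and>
    (\<forall>u. u \<in> ball 0 (1 / s N) \<longrightarrow> u \<noteq> 0 \<longrightarrow> poly (iter_poly f N) (F u / u) = (1 / u) ^ (d ^ N)) \<and>
    inj_on (\<lambda>u. F u / u) (ball 0 (1 / s N) - {0})"

lemma d0: "d > 0" and dN: "d ^ N > 0" using d2 by (auto simp: d_def)

lemma s1: "s N \<ge> 1" and s_pow: "s N ^ (d ^ N) = \<rho>"
  using \<rho>1 dN[of N] by (auto simp: s_def real_root_ge_1_iff real_root_pow_pos2)

lemma s_lim: "s \<longlonglongrightarrow> 1"
proof -
  have "filterlim (\<lambda>N. d ^ N) at_top sequentially"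
  proof (rule filterlim_subseq[OF strict_monoI])
    show "d ^ m < d ^ n" if "m < n" for m n using d2 that by (intro power_strict_increasing) (auto simp: d_def)
  qed
  moreover have "(\<lambda>n. root n \<rho>) \<longlonglongrightarrow> 1" using \<rho>1 by (intro LIMSEQ_root_const) auto
  ultimately show ?thesis unfolding s_def by (rule filterlim_compose[rotated])
qed

lemma iter_crit: "\<forall>z. poly (pderiv (iter_poly f N)) z = 0 \<longrightarrow> cmod (poly (iter_poly f N) z) \<le> s N ^ degree (iter_poly f N)"
proof (intro allI impI)
  fix z assume "poly (pderiv (iter_poly f N)) z = 0"
  then obtain j where j: "j < N" "poly (pderiv f) ((poly f ^^ j) z) = 0" using critical_point_iter_poly by blast
  have "(poly f ^^ N) z = (poly f ^^ (N - j)) ((poly f ^^ j) z)"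
    using j(1) by (metis funpow_add o_apply le_add_diff_inverse2 less_imp_le)
  then show "cmod (poly (iter_poly f N) z) \<le> s N ^ degree (iter_poly f N)"
    using crit[OF j(2)] s_pow[of N] by (simp add: poly_iter_poly degree_iter_poly d_def[symmetric])
qed

lemma iter_monic: "lead_coeff (iter_poly f N) = 1" and iter_degree: "degree (iter_poly f N) = d ^ N"
  and iter_degree0: "degree (iter_poly f N) > 0"
  using lead_coeff_iter_poly[OF m1] d2 dN[of N] by (auto simp: degree_iter_poly d_def)

lemma ext_ex: "\<exists>F. ext N F"
proof -
  have "s N > 0" using s1[of N] by linarith
  show ?thesis
  proof (rule exterior_inverse[OF iter_monic iter_degree0 \<open>s N > 0\<close> iter_crit])
    fix F assume "F holomorphic_on ball 0 (1 / s N)" "F 0 = 1" "inj_on (\<lambda>u. F u / u) (ball 0 (1 / s N) - {0})"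
      "\<And>u. u \<in> ball 0 (1 / s N) \<Longrightarrow> u \<noteq> 0 \<Longrightarrow> poly (iter_poly f N) (F u / u) = (1 / u) ^ degree (iter_poly f N)"
    then have "ext N F" unfolding ext_def iter_degree by blast
    then show "\<exists>F. ext N F" by (intro exI[of _ F])
  qed
qed

lemma ext_area:
  assumes F: "ext N F" and x: "0 < x" "x < 1 / s N"
  shows "(\<Sum>k\<le>K. real k * (cmod (fps_nth (fps_expansion F 0) (Suc k)))\<^sup>2 * x ^ (2 * k + 2)) \<le> 1"
proof -
  have "s N > 0" using s1[of N] by linarith
  from area_inequality[OF iter_monic iter_degree0 this iter_crit, of F x K] F x
  show ?thesis unfolding ext_def iter_degree fps_expansion_def fps_nth_Abs_fps by blast
qed

lemma ext_expansion: "ext N F \<Longrightarrow> F has_fps_expansion fps_expansion F 0"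
  using s1[of N] unfolding ext_def
  by (intro has_fps_expansion_fps_expansion[of "ball 0 (1 / s N)"]) auto

lemma ext_nth_0: "ext N F \<Longrightarrow> fps_nth (fps_expansion F 0) 0 = 1"
  by (simp add: ext_def fps_expansion_def)

text \<open>For small \<open>v\<close> the points \<open>poly f (F v / v)\<close> and
  \<open>G (v ^ d) / v ^ d\<close> have the same image under the \<open>N\<close>-th iterate, and
  both are asymptotic to \<open>1 / v ^ d\<close>; injectivity near infinity identifies
  them.\<close>

lemma ext_functional_equation:
  assumes F: "ext (Suc N) F" and G: "ext N G"
  shows "(\<Sum>i\<le>d. fps_const (coeff f i) * fps_expansion F 0 ^ i * fps_X ^ (d - i)) = fps_expansion G 0 oo fps_X ^ d"
proof -
  define E where "E v = (\<Sum>i\<le>d. coeff f i * F v ^ i * v ^ (d - i))" for v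
  note eF = ext_expansion[OF F] and eG = ext_expansion[OF G]
  have E: "E has_fps_expansion (\<Sum>i\<le>d. fps_const (coeff f i) * fps_expansion F 0 ^ i * fps_X ^ (d - i))"
    unfolding E_def[abs_def] by (intro fps_expansion_intros eF has_fps_expansion_power)
  have H: "(\<lambda>v. G (v ^ d)) has_fps_expansion (fps_expansion G 0 oo fps_X ^ d)"
    using has_fps_expansion_compose[OF eG has_fps_expansion_fps_X_power[of d]] d0 by (simp add: o_def)
  have F0: "F 0 = 1" and G0: "G 0 = 1" using F G by (auto simp: ext_def)
  have E0: "E 0 = 1"
  proof -
    have "E 0 = (\<Sum>i\<in>{d}. coeff f i * F 0 ^ i * 0 ^ (d - i))" unfolding E_def
      by (rule sum.mono_neutral_right) auto
    then show ?thesis using F0 m1 by (simp add: d_def)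
  qed
  have cE: "(E \<longlongrightarrow> 1) (at 0)" and cG: "((\<lambda>v. G (v ^ d)) \<longlongrightarrow> 1) (at 0)"
    using has_fps_expansion_imp_continuous[OF E, of UNIV] has_fps_expansion_imp_continuous[OF H, of UNIV] E0 G0 d0
    by (auto simp: continuous_within power_0_left)
  obtain e R where e: "e > 0" and inj: "\<And>U x y. R < cmod U \<Longrightarrow> cmod (x / U - 1) < e \<Longrightarrow> cmod (y / U - 1) < e \<Longrightarrow>
    poly (iter_poly f N) x = poly (iter_poly f N) y \<Longrightarrow> x = y"
    using poly_inj_near_infinity[OF iter_monic iter_degree0, of N] by metis
  have "eventually (\<lambda>v. E v = G (v ^ d)) (at 0)"
  proof -
    have "eventually (\<lambda>v. dist (E v) 1 < e) (at 0)" "eventually (\<lambda>v. dist (G (v ^ d)) 1 < e) (at 0)"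
      using cE cG e by (auto simp: tendsto_iff)
    moreover have "eventually (\<lambda>v::complex. v \<noteq> 0) (at 0)" by (simp add: eventually_at_filter)
    moreover have "eventually (\<lambda>v. v \<in> ball 0 (1 / s (Suc N))) (at 0)"
      using s1[of "Suc N"] by (intro eventually_at_in_open') auto
    moreover have "eventually (\<lambda>v::complex. v ^ d \<in> ball 0 (1 / s N)) (at 0)"
    proof -
      have "((\<lambda>v::complex. v ^ d) \<longlongrightarrow> 0) (at 0)" using d0 by (auto intro!: tendsto_eq_intros simp: power_0_left)
      then show ?thesis by (rule topological_tendstoD) (use s1[of N] in auto)
    qed
    moreover have "eventually (\<lambda>v::complex. v \<in> ball 0 (1 / (\<bar>R\<bar> + 1))) (at 0)"
      by (intro eventually_at_in_open') auto
    moreover have "eventually (\<lambda>v::complex. v \<in> ball 0 1) (at 0)"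
      by (intro eventually_at_in_open') auto
    ultimately show ?thesis
    proof eventually_elim
      case (elim v)
      define U where "U = 1 / v ^ d"
      have v0: "v \<noteq> 0" "v ^ d \<noteq> 0" using elim by auto
      have "cmod v ^ d \<le> cmod v" using power_decreasing[of 1 d "cmod v"] elim d0 by simp
      also have "\<dots> < 1 / (\<bar>R\<bar> + 1)" using elim by simp
      finally have "\<bar>R\<bar> + 1 < cmod U" using v0 by (simp add: U_def norm_divide norm_power field_simps)
      then have RU: "R < cmod U" by linarith
      have x: "poly f (F v / v) / U = E v"
        unfolding E_def poly_altdef d_def[symmetric] U_def sum_divide_distrib
        using v0 by (intro sum.cong refl) (auto simp: power_divide power_diff field_simps)
      have y: "G (v ^ d) / v ^ d / U = G (v ^ d)" using v0 by (simp add: U_def)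
      have "poly (iter_poly f N) (poly f (F v / v)) = poly (iter_poly f (Suc N)) (F v / v)"
        by (simp add: iter_poly_Suc poly_pcompose)
      also have "\<dots> = (1 / v) ^ (d ^ Suc N)" using F elim by (simp add: ext_def del: power_Suc)
      also have "\<dots> = (1 / v ^ d) ^ (d ^ N)" by (simp add: power_mult power_divide)
      also have "\<dots> = poly (iter_poly f N) (G (v ^ d) / v ^ d)" using G elim v0 by (simp add: ext_def)
      finally have "poly f (F v / v) = G (v ^ d) / v ^ d"
        using inj[OF RU] elim x y by (simp add: dist_norm)
      then show ?case using x y by simp
    qed
  qed
  then have "eventually (\<lambda>v. E v = G (v ^ d)) (nhds 0)"
    using E0 G0 d0 by (simp add: eventually_nhds_conv_at power_0_left)
  then have "(\<lambda>v. G (v ^ d)) has_fps_expansion (\<Sum>i\<le>d. fps_const (coeff f i) * fps_expansion F 0 ^ i * fps_X ^ (d - i))"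
    using E by (subst (asm) has_fps_expansion_cong[OF _ refl]) auto
  then show ?thesis using H by (intro fps_ext) (simp add: fps_nth_fps_expansion)
qed

context
  fixes p m :: nat
  assumes pd: "p dvd d" and m: "m < d" "0 < m" "\<not> p dvd m" and top: "\<And>i. m < i \<Longrightarrow> \<not> p dvd i \<Longrightarrow> coeff f i = 0"
begin

lemma ext_coeff:
  assumes F: "ext (Suc N) F"
  shows "fps_nth (fps_expansion F 0) (d - m) = - coeff f m / of_nat d"
    and "0 < k \<Longrightarrow> k < d - m \<Longrightarrow> \<not> p dvd k \<Longrightarrow> fps_nth (fps_expansion F 0) k = 0"
proof -
  obtain G where G: "ext N G" using ext_ex by blast
  note eq = sparse_functional_equation[OF ext_functional_equation[OF F G, unfolded d_def] m1 ext_nth_0[OF F],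
      folded d_def, OF pd m(1,2) top]
  have "\<not> p dvd (d - m)" using m pd by (metis dvd_diffD1 less_imp_le)
  then show "fps_nth (fps_expansion F 0) (d - m) = - coeff f m / of_nat d"
    using eq[of "d - m"] m d0 by (simp add: field_simps eq_neg_iff_add_eq_0)
  show "0 < k \<Longrightarrow> k < d - m \<Longrightarrow> \<not> p dvd k \<Longrightarrow> fps_nth (fps_expansion F 0) k = 0"
    using eq[of k] d0 by simp
qed

lemma small_radius: "0 < x \<Longrightarrow> x < 1 \<Longrightarrow> eventually (\<lambda>N. x < 1 / s N) sequentially"
proof -
  assume x: "0 < x" "x < 1"
  then have "eventually (\<lambda>N. s N < 1 / x) sequentially" using s_lim by (intro order_tendstoD(2)) auto
  then show ?thesis
  proof eventually_elim
    case (elim N)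
    then show ?case using x s1[of N] by (simp add: field_simps)
  qed
qed

text \<open>One term of the area inequality is kept and the radius sent to 1. For
  \<open>m = d - 1\<close> the factor vanishes and no bound on the coefficient results.\<close>

lemma coeff_bound: "real (d - m - 1) * (cmod (coeff f m / of_nat d))\<^sup>2 \<le> 1"
proof -
  define b where "b = cmod (coeff f m / of_nat d)"
  define q where "q = d - m - 1"
  have q: "Suc q = d - m" using m by (simp add: q_def)
  have *: "real q * b\<^sup>2 * x ^ (2 * q + 2) \<le> 1" if x: "0 < x" "x < 1" for x
  proof -
    obtain N where "x < 1 / s (Suc N)"
      using small_radius[OF x] unfolding eventually_sequentially by (metis le_Suc_eq order_refl)
    moreover obtain F where F: "ext (Suc N) F" using ext_ex by blast
    ultimately have "(\<Sum>k\<le>q. real k * (cmod (fps_nth (fps_expansion F 0) (Suc k)))\<^sup>2 * x ^ (2 * k + 2)) \<le> 1"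
      using ext_area x by blast
    moreover have "real q * (cmod (fps_nth (fps_expansion F 0) (Suc q)))\<^sup>2 * x ^ (2 * q + 2)
       \<le> (\<Sum>k\<le>q. real k * (cmod (fps_nth (fps_expansion F 0) (Suc k)))\<^sup>2 * x ^ (2 * k + 2))"
      using x by (intro member_le_sum) auto
    moreover have "cmod (fps_nth (fps_expansion F 0) (Suc q)) = b"
      unfolding q ext_coeff(1)[OF F] b_def by (simp add: norm_divide)
    ultimately show ?thesis by simp
  qed
  have "real q * b\<^sup>2 * 1 ^ (2 * q + 2) \<le> 1"
  proof (rule tendsto_upperbound)
    show "((\<lambda>x. real q * b\<^sup>2 * x ^ (2 * q + 2)) \<longlongrightarrow> real q * b\<^sup>2 * 1 ^ (2 * q + 2)) (at_left 1)"
      by (intro tendsto_intros)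
    show "eventually (\<lambda>x. real q * b\<^sup>2 * x ^ (2 * q + 2) \<le> 1) (at_left 1)"
      using * by (auto simp: eventually_at_left_field intro!: exI[of _ 0])
  qed auto
  then show ?thesis by (simp add: q_def b_def)
qed

text \<open>The extremal case of the area theorem: all further coefficients of the exterior coordinates tend
  to zero along the iterates, which leaves a Joukowski map conjugating \<open>f\<close> to a power.\<close>

lemma extremal_case:
  assumes q2: "d - m = 2" and b1: "cmod (coeff f m / of_nat d) = 1" and u: "u \<noteq> 0"
  defines "b \<equiv> - coeff f m / of_nat d"
  shows "poly f (u + b / u) = u ^ d + b / u ^ d"
proof -
  have "\<exists>F. \<forall>N. ext N (F N)" using ext_ex by metis
  then obtain F where F: "\<And>N. ext N (F N)" by blast
  define A where "A N = fps_expansion (F N) 0" for N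
  \<comment> \<open>In the coordinate \<open>1 / u\<close> this is the Joukowski map
    \<open>u + b / u\<close>, divided by \<open>u\<close>.\<close>
  define L where "L = fps_of_poly [:1, 0, b:]"
  have p1: "\<not> p dvd 1" using m by auto
  have lim: "(\<lambda>N. fps_nth (A (Suc N)) k) \<longlonglongrightarrow> fps_nth L k" for k
  proof -
    consider "k = 0" | "k = 1" | "k = 2" | j where "k = Suc j" "j \<ge> 2"
      by (metis Suc_1 One_nat_def less_2_cases not_less_eq_eq not0_implies_Suc le_SucE less_Suc0 not_le)
    then show ?thesis
    proof cases
      case 1 then show ?thesis using ext_nth_0[OF F] by (simp add: A_def L_def)
    next
      case 2 then show ?thesis using ext_coeff(2)[OF F, of 1] p1 q2 by (simp add: A_def L_def)
    next
      case 3
      then show ?thesis using ext_coeff(1)[OF F] q2 by (simp add: A_def L_def b_def numeral_2_eq_2)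
    next
      case 4
      \<comment> \<open>The coefficient of index 2 has modulus 1 and uses up \<open>x ^ 4\<close> of
        the total 1. What is left for the others, \<open>1 - x ^ 4\<close>, tends to 0 as
        \<open>x\<close> approaches 1.\<close>
      have bd: "\<exists>N0. \<forall>N\<ge>N0. cmod (fps_nth (A (Suc N)) k) < e" if e: "e > 0" for e
      proof -
        have "((\<lambda>x::real. e\<^sup>2 * x ^ (2 * k) - (1 - x ^ 4)) \<longlongrightarrow> e\<^sup>2 * 1 ^ (2 * k) - (1 - 1 ^ 4)) (at_left 1)"
          by (intro tendsto_intros)
        then have "eventually (\<lambda>x::real. 0 < e\<^sup>2 * x ^ (2 * k) - (1 - x ^ 4)) (at_left 1)"
          by (rule order_tendstoD(1)) (use e in simp)
        moreover have "eventually (\<lambda>x::real. 0 < x \<and> x < 1) (at_left 1)"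
          by (auto simp: eventually_at_left_field intro!: exI[of _ 0])
        ultimately have "eventually (\<lambda>x::real. 0 < e\<^sup>2 * x ^ (2 * k) - (1 - x ^ 4) \<and> 0 < x \<and> x < 1) (at_left 1)"
          by eventually_elim auto
        then obtain x :: real where x: "1 - x ^ 4 < e\<^sup>2 * x ^ (2 * k)" "0 < x" "x < 1"
          using eventually_happens'[of "at_left (1::real)"] by force
        obtain N0 where N0: "\<And>N. N \<ge> N0 \<Longrightarrow> x < 1 / s N"
          using small_radius[OF x(2,3)] unfolding eventually_sequentially by blast
        have "cmod (fps_nth (A (Suc N)) k) < e" if N: "N \<ge> N0" for N
        proof -
          have "x < 1 / s (Suc N)" using N0[of "Suc N"] N by simp
          then have ar: "(\<Sum>i\<le>j. real i * (cmod (fps_nth (A (Suc N)) (Suc i)))\<^sup>2 * x ^ (2 * i + 2)) \<le> 1"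
            unfolding A_def by (rule ext_area[OF F x(2)])
          define t where "t i = real i * (cmod (fps_nth (A (Suc N)) (Suc i)))\<^sup>2 * x ^ (2 * i + 2)" for i
          have "(\<Sum>i\<in>{1, j}. t i) \<le> (\<Sum>i\<le>j. t i)"
            using x 4 by (intro sum_mono2) (auto simp: t_def)
          also have "\<dots> \<le> 1" using ar by (simp only: t_def)
          also have "(\<Sum>i\<in>{1, j}. t i) = t 1 + t j" using 4 by simp
          finally have t1: "t 1 + t j \<le> 1" .
          have "cmod (fps_nth (A (Suc N)) (Suc 1)) = cmod (coeff f m / of_nat d)"
            using ext_coeff(1)[OF F[of "Suc N"]] q2 by (simp add: A_def numeral_2_eq_2 norm_divide)
          then have "t 1 = x ^ 4" unfolding t_def b1 by simp
          then have "x ^ 4 + real j * (cmod (fps_nth (A (Suc N)) k))\<^sup>2 * x ^ (2 * j + 2) \<le> 1"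
            using t1 4 by (simp only: t_def)
          moreover have "1 * ((cmod (fps_nth (A (Suc N)) k))\<^sup>2 * x ^ (2 * k)) \<le> real j * ((cmod (fps_nth (A (Suc N)) k))\<^sup>2 * x ^ (2 * k))"
            using 4 x by (intro mult_right_mono) auto
          moreover have "x ^ (2 * j + 2) = x ^ (2 * k)" using 4 by simp
          ultimately have "(cmod (fps_nth (A (Suc N)) k))\<^sup>2 * x ^ (2 * k) < e\<^sup>2 * x ^ (2 * k)"
            using x(1) by (simp only: mult.assoc)
          then have "(cmod (fps_nth (A (Suc N)) k))\<^sup>2 < e\<^sup>2" using x(2) by simp
          then show ?thesis by (rule power2_less_imp_less) (use e in simp)
        qed
        then show ?thesis by blast
      qed
      have "fps_nth L k = 0" using 4 by (simp add: L_def coeff_pCons split: nat.splits)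
      then show ?thesis using bd by (intro LIMSEQ_I) auto
    qed
  qed
  have conv_mult: "\<And>k. (\<lambda>N. fps_nth (B N * C N) k) \<longlonglongrightarrow> fps_nth (B' * C') k"
    if "\<And>k. (\<lambda>N. fps_nth (B N) k) \<longlonglongrightarrow> fps_nth B' k" "\<And>k. (\<lambda>N. fps_nth (C N) k) \<longlonglongrightarrow> fps_nth C' k"
    for B C :: "nat \<Rightarrow> complex fps" and B' C'
    unfolding fps_mult_nth by (intro tendsto_intros that)
  have conv_power: "\<And>k. (\<lambda>N. fps_nth (A (Suc N) ^ i) k) \<longlonglongrightarrow> fps_nth (L ^ i) k" for i
  proof (induction i)
    case (Suc i)
    then show ?case unfolding power_Suc by (intro conv_mult lim)
  qed simp
  \<comment> \<open>The functional equations pass to the limit coefficient by coefficient. In the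
    limit both sides are polynomials, so the identity may be evaluated at
    \<open>1 / u\<close>.\<close>
  have eq: "(\<Sum>i\<le>d. fps_const (coeff f i) * L ^ i * fps_X ^ (d - i)) = L oo fps_X ^ d"
  proof (rule fps_ext)
    fix k
    have 1: "(\<lambda>N. fps_nth (\<Sum>i\<le>d. fps_const (coeff f i) * A (Suc (Suc N)) ^ i * fps_X ^ (d - i)) k)
        \<longlonglongrightarrow> fps_nth (\<Sum>i\<le>d. fps_const (coeff f i) * L ^ i * fps_X ^ (d - i)) k"
      unfolding fps_sum_nth
      by (intro tendsto_sum conv_mult tendsto_const) (rule LIMSEQ_Suc[OF conv_power])
    have "(\<lambda>N. fps_nth (A (Suc N) oo fps_X ^ d) k) \<longlonglongrightarrow> fps_nth (L oo fps_X ^ d) k"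
      unfolding fps_compose_nth by (intro tendsto_intros lim)
    moreover have "(\<Sum>i\<le>d. fps_const (coeff f i) * A (Suc (Suc N)) ^ i * fps_X ^ (d - i)) = A (Suc N) oo fps_X ^ d" for N
      unfolding A_def by (rule ext_functional_equation[OF F F])
    ultimately show "fps_nth (\<Sum>i\<le>d. fps_const (coeff f i) * L ^ i * fps_X ^ (d - i)) k = fps_nth (L oo fps_X ^ d) k"
      using 1 LIMSEQ_unique by (simp only:)
  qed
  have "fps_of_poly (\<Sum>i\<le>d. smult (coeff f i) ([:1, 0, b:] ^ i * monom 1 (d - i))) = fps_of_poly (pcompose [:1, 0, b:] (monom 1 d))"
  proof -
    have "fps_of_poly (pcompose [:1, 0, b:] (monom 1 d)) = L oo fps_X ^ d"
      unfolding L_def using d0 by (subst fps_of_poly_pcompose) (auto simp: fps_of_poly_monom')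
    moreover have "fps_of_poly (\<Sum>i\<le>d. smult (coeff f i) ([:1, 0, b:] ^ i * monom 1 (d - i))) =
        (\<Sum>i\<le>d. fps_const (coeff f i) * L ^ i * fps_X ^ (d - i))"
      unfolding L_def by (simp add: fps_of_poly_sum fps_of_poly_smult fps_of_poly_mult fps_of_poly_power fps_of_poly_monom' mult.assoc)
    ultimately show ?thesis using eq by simp
  qed
  then have P: "(\<Sum>i\<le>d. smult (coeff f i) ([:1, 0, b:] ^ i * monom 1 (d - i))) = pcompose [:1, 0, b:] (monom 1 d)"
    by (simp only: fps_of_poly_eq_iff)
  define v where "v = 1 / u"
  have "(\<Sum>i\<le>d. coeff f i * ((1 + b * v\<^sup>2) ^ i * v ^ (d - i))) = 1 + b * (v ^ d)\<^sup>2"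
    using arg_cong[OF P, of "\<lambda>Q. poly Q v"]
    by (simp add: poly_sum poly_pcompose poly_monom power2_eq_square algebra_simps)
  then have "u ^ d * (\<Sum>i\<le>d. coeff f i * ((1 + b * v\<^sup>2) ^ i * v ^ (d - i))) = u ^ d * (1 + b * (v ^ d)\<^sup>2)" by simp
  also have "u ^ d * (\<Sum>i\<le>d. coeff f i * ((1 + b * v\<^sup>2) ^ i * v ^ (d - i))) = poly f (u + b / u)"
    unfolding poly_altdef d_def[symmetric] sum_distrib_left
  proof (intro sum.cong refl)
    fix i assume i: "i \<in> {..d}"
    have "u ^ d * v ^ (d - i) = u ^ i" using i u by (simp add: v_def power_diff power_one_over)
    moreover have "u ^ i * (1 + b * v\<^sup>2) ^ i = (u + b / u) ^ i"
      using u unfolding power_mult_distrib[symmetric] by (simp add: v_def distrib_left power2_eq_square)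
    ultimately show "u ^ d * (coeff f i * ((1 + b * v\<^sup>2) ^ i * v ^ (d - i))) = coeff f i * (u + b / u) ^ i"
      by (metis mult.assoc mult.commute)
  qed
  also have "u ^ d * (1 + b * (v ^ d)\<^sup>2) = u ^ d + b / u ^ d"
  proof -
    have "u ^ d * (v ^ d)\<^sup>2 = 1 / u ^ d" using u by (simp add: v_def power_one_over power2_eq_square)
    then show ?thesis by (simp add: distrib_left mult.left_commute[of "u ^ d" b])
  qed
  finally show ?thesis .
qed

end

end

subsection \<open>Complex embeddings\<close>

lemma int_poly_ex:
  fixes P :: "'a::ring_char_0 poly"
  shows "(\<forall>i. coeff P i \<in> \<int>) \<Longrightarrow> \<exists>Z. P = map_poly of_int Z"
proof (induction P)
  case (pCons a P)
  have "coeff P i \<in> \<int>" for i using pCons.prems[rule_format, of "Suc i"] by simp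
  then obtain Z where "P = map_poly of_int Z" using pCons.IH by blast
  moreover obtain k where "a = of_int k" using pCons.prems[rule_format, of 0] by (auto elim: Ints_cases)
  ultimately show ?case by (intro exI[of _ "pCons k Z"]) (simp add: map_poly_pCons)
qed (auto intro: exI[of _ 0])

text \<open>The graph of a ring homomorphism from a subring to the complex numbers. As a relation it
  can be united along chains; the last clause, together with differences, makes it
  single-valued.\<close>

definition partial_hom :: "('a::field_char_0 \<times> complex) set \<Rightarrow> bool" where
  "partial_hom G \<longleftrightarrow> (1, 1) \<in> G \<and> (\<forall>x r y s. (x, r) \<in> G \<longrightarrow> (y, s) \<in> G \<longrightarrow> (x - y, r - s) \<in> G \<and> (x * y, r * s) \<in> G)
    \<and> (\<forall>r. (0, r) \<in> G \<longrightarrow> r = 0)"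

context
  fixes G :: "('a::field_char_0 \<times> complex) set"
  assumes G: "partial_hom G"
begin

lemma ph_1: "(1, 1) \<in> G" and ph_diff: "(x, r) \<in> G \<Longrightarrow> (y, s) \<in> G \<Longrightarrow> (x - y, r - s) \<in> G"
  and ph_mult: "(x, r) \<in> G \<Longrightarrow> (y, s) \<in> G \<Longrightarrow> (x * y, r * s) \<in> G" and ph_0': "(0, r) \<in> G \<Longrightarrow> r = 0"
  using G unfolding partial_hom_def by blast+

lemma ph_0: "(0, 0) \<in> G" using ph_diff[OF ph_1 ph_1] by simp
lemma ph_minus: "(x, r) \<in> G \<Longrightarrow> (- x, - r) \<in> G" using ph_diff[OF ph_0, of x r] by simp
lemma ph_add: "(x, r) \<in> G \<Longrightarrow> (y, s) \<in> G \<Longrightarrow> (x + y, r + s) \<in> G"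
  using ph_diff[of x r "- y" "- s"] ph_minus by simp
lemma ph_nat: "(of_nat n, of_nat n) \<in> G" by (induction n) (auto simp: ph_0 intro: ph_add ph_1)
lemma ph_int: "(of_int n, of_int n) \<in> G"
  by (cases n) (auto simp: ph_nat simp del: of_nat_Suc intro!: ph_minus intro: ph_diff)
lemma ph_power: "(x, r) \<in> G \<Longrightarrow> (x ^ n, r ^ n) \<in> G" by (induction n) (auto simp: ph_1 ph_mult)
lemma ph_sum: "(\<And>i. i \<in> A \<Longrightarrow> (f i, g i) \<in> G) \<Longrightarrow> (sum f A, sum g A) \<in> G"
  by (induction A rule: infinite_finite_induct) (auto simp: ph_0 ph_add)
lemma ph_unique: "(x, r) \<in> G \<Longrightarrow> (x, s) \<in> G \<Longrightarrow> r = s"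
  using ph_diff[of x r x s] ph_0'[of "r - s"] by simp

definition "pg P Q \<longleftrightarrow> (\<forall>i. (coeff P i, coeff Q i) \<in> G)"

lemma pg_of_int: "pg (map_poly of_int P) (map_poly of_int P)"
  by (auto simp: pg_def coeff_map_poly ph_int)

text \<open>A nonzero \<open>x\<close> sent to 0 is a root of an integer polynomial with nonzero
  constant term, and this integer would have to be sent to 0 as well.\<close>

lemma ph_injective:
  assumes alg: "algebraic x" and x: "(x, 0) \<in> G" shows "x = 0"
proof (rule ccontr)
  assume x0: "x \<noteq> 0"
  obtain P where P: "\<And>i. coeff P i \<in> \<int>" "P \<noteq> 0" "poly P x = 0" using alg by (auto simp: algebraic_def)
  obtain n Q where Q: "P = monom 1 n * Q" "coeff Q 0 \<noteq> 0"
  proof -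
    obtain Q where Q: "P = [:- 0, 1:] ^ order 0 P * Q" "\<not> [:- 0, 1:] dvd Q" using order_decomp[OF P(2), of 0] by blast
    have "P = monom 1 (order 0 P) * Q" using Q(1) by (simp add: monom_altdef)
    moreover have "coeff Q 0 \<noteq> 0" using Q(2) by (simp add: dvd_iff_poly_eq_0 poly_0_coeff_0)
    ultimately show thesis using that by blast
  qed
  have cQ: "coeff Q i = coeff P (n + i)" for i unfolding Q(1) by (simp add: coeff_monom_mult)
  obtain Z where Z: "Q = map_poly of_int Z" using int_poly_ex[of Q] P(1) cQ by auto
  define z where "z = coeff Z"
  have z: "coeff Q i = of_int (z i)" for i by (simp add: Z z_def coeff_map_poly)
  have Qx: "poly Q x = 0" using P(3) x0 unfolding Q(1) by (simp add: poly_monom)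
  have "((\<Sum>i\<le>degree Q. of_int (z i) * x ^ i), (\<Sum>i\<le>degree Q. of_int (z i) * 0 ^ i)) \<in> G"
    by (intro ph_sum ph_mult ph_power ph_int x)
  moreover have "(\<Sum>i\<le>degree Q. of_int (z i) * x ^ i) = 0" using Qx by (simp add: poly_altdef z)
  moreover have "(\<Sum>i\<le>degree Q. of_int (z i) * 0 ^ i) = (\<Sum>i\<in>{0}. of_int (z i) * 0 ^ i :: complex)"
    by (rule sum.mono_neutral_right) auto
  ultimately have "of_int (z 0) = (0 :: complex)" using ph_0'[of "of_int (z 0)"] by simp
  then show False using Q(2) z[of 0] by simp
qed

text \<open>A polynomial of least degree with root \<open>x\<close> replaces the minimal polynomial,
  the domain being only a ring. Every root of its image \<open>Q\<close> is a possible image of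
  \<open>x\<close>; \<open>Q\<close> is returned so that a particular conjugate can be
  chosen.\<close>

lemma partial_hom_extend:
  assumes alg: "\<And>y::'a. algebraic y"
  obtains P Q where "pg P Q" "degree Q > 0" "poly P x = 0"
    "\<And>r. poly Q r = 0 \<Longrightarrow> \<exists>G'. partial_hom G' \<and> G \<subseteq> G' \<and> (x, r) \<in> G'"
proof -
  define W where "W n \<longleftrightarrow> (\<exists>P Q. pg P Q \<and> P \<noteq> 0 \<and> poly P x = 0 \<and> degree P = n)" for n
  have "\<exists>n. W n"
  proof -
    obtain P where P: "\<And>i. coeff P i \<in> \<int>" "P \<noteq> 0" "poly P x = 0" using alg[of x] by (auto simp: algebraic_def)
    obtain Z where "P = map_poly of_int Z" using int_poly_ex[of P] P(1) by blast
    then show ?thesis using P pg_of_int[of Z] unfolding W_def by blast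
  qed
  define n where "n = (LEAST n. W n)"
  have "W n" unfolding n_def using \<open>\<exists>n. W n\<close> by (rule LeastI_ex)
  then obtain P Q where PQ: "pg P Q" "P \<noteq> 0" "poly P x = 0" "degree P = n" unfolding W_def by blast
  have min: "n \<le> degree S" if "pg S T" "S \<noteq> 0" "poly S x = 0" for S T
    unfolding n_def by (rule Least_le) (use that in \<open>auto simp: W_def\<close>)
  have zero: "coeff S i = 0 \<longleftrightarrow> coeff T i = 0" if "pg S T" for S T i
    using that ph_0' ph_injective[OF alg] unfolding pg_def by metis
  have deg: "degree S = degree T" if "pg S T" for S T
  proof (rule antisym)
    show "degree S \<le> degree T" by (rule degree_le) (simp add: zero[OF that] coeff_eq_0)
    show "degree T \<le> degree S" by (rule degree_le) (simp add: zero[OF that, symmetric] coeff_eq_0)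
  qed
  have n0: "n > 0"
  proof (rule ccontr)
    assume "\<not> n > 0" then obtain c where "P = [:c:]" using PQ(4) by (auto elim: degree_eq_zeroE)
    then show False using PQ(2,3) by auto
  qed
  show thesis
  proof (rule that[OF PQ(1) _ PQ(3)])
    show "degree Q > 0" using deg[OF PQ(1)] n0 PQ(4) by simp
    fix r assume r: "poly Q r = 0"
    \<comment> \<open>Pseudo-division by \<open>P\<close> takes the place of division: it multiplies
      by \<open>lead_coeff P\<close>, whose image is nonzero and is cancelled at the end.\<close>
    have root: "poly T r = 0" if "pg S T" "poly S x = 0" for S T
      using that
    proof (induction "degree S" arbitrary: S T rule: less_induct)
      case less
      show ?case
      proof (cases "S = 0")
        case True
        then have "T = 0" using zero[OF less.prems(1)] by (intro poly_eqI) (metis coeff_0)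
        then show ?thesis by simp
      next
        case False
        then have nS: "n \<le> degree S" using min less.prems by blast
        define m where "m = degree S - n"
        define S' where "S' = smult (lead_coeff P) S - smult (lead_coeff S) (monom 1 m * P)"
        define T' where "T' = smult (lead_coeff Q) T - smult (lead_coeff T) (monom 1 m * Q)"
        have lc: "(lead_coeff P, lead_coeff Q) \<in> G" "(lead_coeff S, lead_coeff T) \<in> G"
          using PQ(1) less.prems(1) deg[OF PQ(1)] deg[OF less.prems(1)] by (auto simp: pg_def)
        have c: "pg S' T'" unfolding pg_def S'_def T'_def
        proof
          fix i
          have a: "(coeff S i, coeff T i) \<in> G" "(coeff P j, coeff Q j) \<in> G" for j
            using PQ(1) less.prems(1) by (auto simp: pg_def)
          have "(coeff (monom 1 m * P) i, coeff (monom 1 m * Q) i) \<in> G"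
            using a ph_0 by (auto simp: coeff_monom_mult)
          then show "(coeff (smult (lead_coeff P) S - smult (lead_coeff S) (monom 1 m * P)) i,
             coeff (smult (lead_coeff Q) T - smult (lead_coeff T) (monom 1 m * Q)) i) \<in> G"
            using a lc by (auto intro: ph_diff ph_mult)
        qed
        have S'x: "poly S' x = 0" using less.prems(2) PQ(3) by (simp add: S'_def)
        have "poly T' r = 0"
        proof (cases "S' = 0")
          case True
          then have "T' = 0" using zero[OF c] by (intro poly_eqI) (metis coeff_0)
          then show ?thesis by simp
        next
          case F: False
          have "degree S' \<le> degree S" unfolding S'_def
            using nS PQ(2,4) by (intro degree_diff_le) (auto simp: degree_mult_eq degree_monom_eq m_def intro: order_trans[OF degree_smult_le])
          moreover have "coeff S' (degree S) = 0"
            using nS PQ(4) by (simp add: S'_def coeff_monom_mult m_def)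
          ultimately have "degree S' < degree S"
            using F by (metis leading_coeff_0_iff order_le_less)
          then show ?thesis using less.hyps c S'x by blast
        qed
        then have "lead_coeff Q * poly T r = 0" using r by (simp add: T'_def)
        moreover have "lead_coeff Q \<noteq> 0" using zero[OF PQ(1), of n] deg[OF PQ(1)] PQ(2,4) leading_coeff_0_iff[of P] by metis
        ultimately show ?thesis by simp
      qed
    qed
    define G' where "G' = {(poly S x, poly T r) | S T. pg S T}"
    have "partial_hom G'" unfolding partial_hom_def
    proof (intro conjI allI impI)
      show "(1, 1) \<in> G'" unfolding G'_def
        by (rule CollectI, intro exI[of _ 1]) (auto simp: pg_def coeff_1 ph_0 ph_1)
      fix a b c e assume "(a, b) \<in> G'" "(c, e) \<in> G'"
      then obtain S T U V where *: "a = poly S x" "b = poly T r" "c = poly U x" "e = poly V r" "pg S T" "pg U V"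
        unfolding G'_def by blast
      have "pg (S - U) (T - V)" using *(5,6) by (auto simp: pg_def intro: ph_diff)
      then show "(a - c, b - e) \<in> G'" unfolding G'_def using *(1-4) by (metis (mono_tags, lifting) CollectI poly_diff)
      have "pg (S * U) (T * V)" using *(5,6) by (auto simp: pg_def coeff_mult intro!: ph_sum ph_mult)
      then show "(a * c, b * e) \<in> G'" unfolding G'_def using *(1-4) by (metis (mono_tags, lifting) CollectI poly_mult)
    next
      fix b assume "(0, b) \<in> G'"
      then obtain S T where "0 = poly S x" "b = poly T r" "pg S T" unfolding G'_def by blast
      then show "b = 0" using root by metis
    qed
    moreover have "G \<subseteq> G'"
    proof
      fix g assume g: "g \<in> G"
      obtain a b where ab: "g = (a, b)" by (cases g)
      have "pg [:a:] [:b:]" using g ab ph_0 by (auto simp: pg_def coeff_pCons split: nat.splits)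
      then have "(poly [:a:] x, poly [:b:] r) \<in> G'" unfolding G'_def by blast
      then show "g \<in> G'" using ab by simp
    qed
    moreover have "(x, r) \<in> G'"
    proof -
      have "pg [:0, 1:] [:0, 1:]" using ph_0 ph_1 by (auto simp: pg_def coeff_pCons split: nat.splits)
      then have "(poly [:0, 1:] x, poly [:0, 1:] r) \<in> G'" unfolding G'_def by blast
      then show ?thesis by simp
    qed
    ultimately show "\<exists>G'. partial_hom G' \<and> G \<subseteq> G' \<and> (x, r) \<in> G'" by blast
  qed
qed

end

definition field_embedding :: "('a::field_char_0 \<Rightarrow> 'b::field_char_0) \<Rightarrow> bool" where
  "field_embedding \<sigma> \<longleftrightarrow> \<sigma> 1 = 1 \<and> (\<forall>x y. \<sigma> (x - y) = \<sigma> x - \<sigma> y \<and> \<sigma> (x * y) = \<sigma> x * \<sigma> y)"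

text \<open>A maximal partial homomorphism is total, since the image polynomial in
  \<open>partial_hom_extend\<close> always has a complex root.\<close>

lemma partial_hom_total:
  fixes G :: "('a::field_char_0 \<times> complex) set"
  assumes alg: "\<And>y::'a. algebraic y" and G: "partial_hom G"
  obtains \<sigma> where "field_embedding \<sigma>" "\<And>x r. (x, r) \<in> G \<Longrightarrow> \<sigma> x = r"
proof -
  define A where "A = {G'. partial_hom G' \<and> G \<subseteq> G'}"
  have "G \<in> A" using G by (simp add: A_def)
  moreover have "\<Union>C \<in> A" if C: "C \<noteq> {}" "subset.chain A C" for C
  proof -
    have CA: "\<And>R. R \<in> C \<Longrightarrow> R \<in> A" and tot: "\<And>R S. R \<in> C \<Longrightarrow> S \<in> C \<Longrightarrow> R \<subseteq> S \<or> S \<subseteq> R"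
      using C(2) by (auto simp: subset.chain_def)
    obtain R0 where R0: "R0 \<in> C" using C by auto
    have "partial_hom (\<Union>C)" unfolding partial_hom_def
    proof (intro conjI allI impI)
      show "(1, 1) \<in> \<Union>C" using CA[OF R0] R0 ph_1 by (auto simp: A_def)
      fix x r y s assume "(x, r) \<in> \<Union>C" "(y, s) \<in> \<Union>C"
      then obtain R S where RS: "(x, r) \<in> R" "R \<in> C" "(y, s) \<in> S" "S \<in> C" by auto
      then obtain T where T: "T \<in> C" "(x, r) \<in> T" "(y, s) \<in> T" using tot[of R S] by blast
      then have "partial_hom T" using CA[OF T(1)] by (simp add: A_def)
      then have "(x - y, r - s) \<in> T" "(x * y, r * s) \<in> T" using T ph_diff ph_mult by blast+
      then show "(x - y, r - s) \<in> \<Union>C" "(x * y, r * s) \<in> \<Union>C" using T(1) by auto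
    next
      fix r assume "(0, r) \<in> \<Union>C"
      then show "r = 0" using CA ph_0' unfolding A_def by blast
    qed
    moreover have "G \<subseteq> \<Union>C" using CA[OF R0] R0 by (auto simp: A_def)
    ultimately show ?thesis by (simp add: A_def)
  qed
  ultimately obtain M where M: "M \<in> A" and max: "\<And>R. R \<in> A \<Longrightarrow> M \<subseteq> R \<Longrightarrow> R = M"
    using subset_Zorn_nonempty[of A] by (metis empty_iff)
  have ph: "partial_hom M" and GM: "G \<subseteq> M" using M by (auto simp: A_def)
  have "\<exists>r. (x, r) \<in> M" for x
  proof -
    obtain P Q where PQ: "degree Q > 0" "\<And>r. poly Q r = 0 \<Longrightarrow> \<exists>G'. partial_hom G' \<and> M \<subseteq> G' \<and> (x, r) \<in> G'"
      using partial_hom_extend[OF ph alg, of x] by metis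
    obtain r where "poly Q r = 0" using alg_closed_imp_poly_has_root[OF PQ(1)] by blast
    then obtain G' where G': "partial_hom G'" "M \<subseteq> G'" "(x, r) \<in> G'" using PQ(2) by blast
    then have "G' \<in> A" using GM by (auto simp: A_def)
    then show ?thesis using max G' by blast
  qed
  then obtain \<sigma> where \<sigma>: "\<And>x. (x, \<sigma> x) \<in> M" by metis
  show thesis
  proof (rule that)
    show "field_embedding \<sigma>" unfolding field_embedding_def
      using ph_unique[OF ph \<sigma>] ph_1[OF ph] ph_diff[OF ph \<sigma> \<sigma>] ph_mult[OF ph \<sigma> \<sigma>] by blast
    show "\<sigma> x = r" if "(x, r) \<in> G" for x r using ph_unique[OF ph \<sigma>] GM that by blast
  qed
qed

context
  fixes \<sigma> :: "'a::field_char_0 \<Rightarrow> 'b::field_char_0"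
  assumes \<sigma>: "field_embedding \<sigma>"
begin

lemma emb_1: "\<sigma> 1 = 1" and emb_diff: "\<sigma> (x - y) = \<sigma> x - \<sigma> y" and emb_mult: "\<sigma> (x * y) = \<sigma> x * \<sigma> y"
  using \<sigma> by (auto simp: field_embedding_def)
lemma emb_0: "\<sigma> 0 = 0" using emb_diff[of 0 0] by simp
lemma emb_minus: "\<sigma> (- x) = - \<sigma> x" using emb_diff[of 0 x] by (simp add: emb_0)
lemma emb_add: "\<sigma> (x + y) = \<sigma> x + \<sigma> y" using emb_diff[of x "- y"] by (simp add: emb_minus)
lemma emb_power: "\<sigma> (x ^ n) = \<sigma> x ^ n" by (induction n) (auto simp: emb_1 emb_mult)
lemma emb_nat: "\<sigma> (of_nat n) = of_nat n" by (induction n) (auto simp: emb_0 emb_1 emb_add)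
lemma emb_int: "\<sigma> (of_int n) = of_int n" by (cases n) (auto simp: emb_nat emb_minus emb_diff emb_1 simp del: of_nat_Suc)
lemma emb_sum: "\<sigma> (sum f A) = (\<Sum>i\<in>A. \<sigma> (f i))"
  by (induction A rule: infinite_finite_induct) (auto simp: emb_0 emb_add)
lemma emb_inverse: "\<sigma> (inverse x) = inverse (\<sigma> x)"
proof (cases "x = 0")
  case False
  then have "\<sigma> x * \<sigma> (inverse x) = 1" using emb_mult[of x "inverse x"] by (simp add: emb_1)
  then show ?thesis by (metis inverse_unique)
qed (simp add: emb_0)
lemma emb_divide: "\<sigma> (x / y) = \<sigma> x / \<sigma> y" by (simp add: divide_inverse emb_mult emb_inverse)
lemma emb_eq_0: "\<sigma> x = 0 \<longleftrightarrow> x = 0"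
proof
  assume "\<sigma> x = 0"
  then have "\<sigma> (x * inverse x) = 0" by (simp add: emb_mult)
  then show "x = 0" using emb_1 by (cases "x = 0") auto
qed (simp add: emb_0)
lemma emb_eq: "\<sigma> x = \<sigma> y \<longleftrightarrow> x = y" using emb_eq_0[of "x - y"] by (simp add: emb_diff)
lemma emb_coeff: "coeff (map_poly \<sigma> P) i = \<sigma> (coeff P i)" by (simp add: coeff_map_poly emb_0)
lemma emb_degree: "degree (map_poly \<sigma> P) = degree P" by (rule degree_map_poly) (simp add: emb_eq_0)
lemma emb_poly: "\<sigma> (poly P x) = poly (map_poly \<sigma> P) (\<sigma> x)"
  by (simp add: poly_altdef emb_degree emb_coeff emb_sum emb_mult emb_power)
lemma emb_pderiv: "map_poly \<sigma> (pderiv P) = pderiv (map_poly \<sigma> P)"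
  by (rule poly_eqI) (simp add: emb_coeff coeff_pderiv emb_mult emb_add emb_nat emb_1)
lemma emb_add_poly: "map_poly \<sigma> (P + Q) = map_poly \<sigma> P + map_poly \<sigma> Q"
  by (rule poly_eqI) (simp add: emb_coeff emb_add)
lemma emb_mult_poly: "map_poly \<sigma> (P * Q) = map_poly \<sigma> P * map_poly \<sigma> Q"
  by (rule poly_eqI) (simp add: emb_coeff coeff_mult emb_sum emb_mult)
lemma emb_funpow: "\<sigma> ((poly f ^^ n) x) = (poly (map_poly \<sigma> f) ^^ n) (\<sigma> x)"
  by (induction n) (auto simp: emb_poly)

end

text \<open>The roots of \<open>Q\<close> are possible images of \<open>t\<close>. The product of
  their negatives is a rational algebraic integer, hence an integer, and it is nonzero; so not all
  roots have modulus below 1.\<close>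

lemma complex_embedding_ge_1:
  fixes t :: "'a::field_char_0"
  assumes alg: "\<And>y::'a. algebraic y" and t: "algebraic_int t" "t \<noteq> 0"
  obtains \<sigma> :: "'a \<Rightarrow> complex" where "field_embedding \<sigma>" "1 \<le> cmod (\<sigma> t)"
proof -
  \<comment> \<open>Starting from the integers makes the coefficients of \<open>Q\<close>
    rational.\<close>
  define Z where "Z = range (\<lambda>n. (of_int n :: 'a, of_int n :: complex))"
  have Z: "partial_hom Z" unfolding partial_hom_def
  proof (intro conjI allI impI)
    show "(1, 1) \<in> Z" unfolding Z_def by (rule range_eqI[of _ _ 1]) simp
    fix x r y s assume "(x, r) \<in> Z" "(y, s) \<in> Z"
    then obtain a b where "x = of_int a" "r = of_int a" "y = of_int b" "s = of_int b" by (auto simp: Z_def)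
    then show "(x - y, r - s) \<in> Z" "(x * y, r * s) \<in> Z" unfolding Z_def
      by (auto intro: range_eqI[of _ _ "a - b"] range_eqI[of _ _ "a * b"])
  next
    fix r assume "(0, r) \<in> Z" then show "r = 0" by (auto simp: Z_def)
  qed
  obtain P Q where PQ: "pg Z P Q" "degree Q > 0"
    "\<And>r. poly Q r = 0 \<Longrightarrow> \<exists>G'. partial_hom G' \<and> Z \<subseteq> G' \<and> (t, r) \<in> G'"
    using partial_hom_extend[OF Z alg, of t] by metis
  have Qr: "coeff Q i \<in> \<rat>" for i
  proof -
    have "(coeff P i, coeff Q i) \<in> Z" using PQ(1) pg_def[OF Z] by blast
    then show ?thesis by (auto simp: Z_def)
  qed
  obtain A where A: "size A = degree Q" "Q = smult (lead_coeff Q) (\<Prod>x\<in>#A. [:- x, 1:])"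
    using alg_closed_imp_factorization[of Q] PQ(2) by (metis degree_0 less_irrefl)
  have lc: "lead_coeff Q \<noteq> 0" using PQ(2) by auto
  have rootA: "poly Q x = 0" if "x \<in># A" for x
    by (subst A(2)) (use that in \<open>auto simp: poly_prod_mset image_iff prod_mset_zero_iff\<close>)
  have ai: "algebraic_int x" if x: "x \<in># A" for x
  proof -
    obtain G' where G': "partial_hom G'" "(t, x) \<in> G'" using PQ(3)[OF rootA[OF x]] by blast
    obtain M where M: "lead_coeff M = 1" "\<And>i. coeff M i \<in> \<int>" "poly M t = 0"
      using t by (auto simp: algebraic_int.simps)
    obtain Z where Z: "M = map_poly of_int Z" using int_poly_ex[of M] M(2) by blast
    define z where "z = coeff Z"
    have z: "coeff M i = of_int (z i)" for i by (simp add: Z z_def coeff_map_poly)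
    define M' where "M' = (\<Sum>i\<le>degree M. monom (of_int (z i) :: complex) i)"
    have z1: "of_int (z (degree M)) = (1::complex)" using M(1) z[of "degree M"] by (metis of_int_1 of_int_eq_iff)
    have cM: "coeff M' i = (if i \<le> degree M then of_int (z i) else 0)" for i
      unfolding M'_def coeff_sum coeff_monom by simp
    have dM: "degree M' = degree M"
      by (rule antisym[OF degree_le le_degree]) (use z1 in \<open>auto simp: cM\<close>)
    have "((\<Sum>i\<le>degree M. of_int (z i) * t ^ i), (\<Sum>i\<le>degree M. of_int (z i) * x ^ i)) \<in> G'"
      using G' by (intro ph_sum ph_mult ph_power ph_int) auto
    moreover have "(\<Sum>i\<le>degree M. of_int (z i) * t ^ i) = 0" using M(3) by (simp add: poly_altdef z)
    ultimately have "poly M' x = 0"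
      using ph_0'[OF G'(1)] by (simp add: M'_def poly_sum poly_monom)
    then show ?thesis unfolding algebraic_int.simps
      using dM z1 by (intro exI[of _ M']) (auto simp: cM)
  qed
  have "\<exists>x\<in>#A. 1 \<le> cmod x"
  proof (rule ccontr)
    assume "\<not> ?thesis"
    then have lt: "\<And>x. x \<in># A \<Longrightarrow> cmod x < 1" by auto
    define q where "q = (\<Prod>x\<in>#A. - x)"
    have "poly Q 0 = lead_coeff Q * q" by (subst A(2)) (simp add: poly_prod_mset q_def)
    then have "q = coeff Q 0 / lead_coeff Q" using lc by (simp add: poly_0_coeff_0)
    then have "q \<in> \<rat>" using Qr by auto
    moreover have "algebraic_int q" unfolding q_def using ai
      by (induction A) (auto intro!: algebraic_int_mult)
    ultimately have "q \<in> \<int>" by (rule rational_algebraic_int_is_int[rotated])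
    have nq: "cmod q \<le> 1 \<and> (A \<noteq> {#} \<longrightarrow> cmod q < 1)" unfolding q_def using lt
    proof (induction A)
      case (add x A)
      then have "cmod x * cmod (\<Prod>x\<in>#A. - x) \<le> cmod x * 1" by (intro mult_left_mono) auto
      moreover have "cmod x < 1" using add.prems by simp
      ultimately show ?case by (simp add: norm_mult)
    qed simp
    have "A \<noteq> {#}" using A(1) PQ(2) by auto
    then have "cmod q < 1" using nq by simp
    then have "q = 0" using \<open>q \<in> \<int>\<close> by (auto elim!: Ints_cases)
    then have "0 \<in># A" unfolding q_def by (auto simp: prod_mset_zero_iff)
    then obtain G' where G': "partial_hom G'" "(t, 0) \<in> G'" using PQ(3) rootA by blast
    then show False using ph_injective[OF G'(1) alg] t(2) by blast
  qed
  then obtain x where x: "x \<in># A" "1 \<le> cmod x" by blast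
  obtain G' where G': "partial_hom G'" "(t, x) \<in> G'" using PQ(3)[OF rootA[OF x(1)]] by blast
  obtain \<sigma> where "field_embedding \<sigma>" "\<sigma> t = x" using partial_hom_total[OF alg G'(1)] G'(2) by metis
  then show thesis using that x(2) by simp
qed

subsection \<open>Number fields and finite extensions\<close>

context vector_space
begin

text \<open>Stated for families, since the powers to which it is applied may repeat; a repetition is
  itself a dependence.\<close>

lemma family_dependent:
  fixes f :: "nat \<Rightarrow> 'b"
  assumes T: "finite T" "card T \<le> n" and f: "\<And>i. f i \<in> span T"
  obtains c where "\<exists>i\<le>n. c i \<noteq> 0" "(\<Sum>i\<le>n. scale (c i) (f i)) = 0"
proof (cases "inj_on f {..n}")
  case False
  then obtain i j where ij: "i \<le> n" "j \<le> n" "i \<noteq> j" "f i = f j" by (auto simp: inj_on_def)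
  define c where "c k = (if k = i then 1 else if k = j then - 1 else 0 :: 'a)" for k
  have "(\<Sum>k\<le>n. scale (c k) (f k)) = (\<Sum>k\<in>{i, j}. scale (c k) (f k))"
    by (rule sum.mono_neutral_right) (use ij in \<open>auto simp: c_def\<close>)
  also have "\<dots> = 0" using ij by (simp add: c_def)
  finally have "(\<Sum>k\<le>n. scale (c k) (f k)) = 0" .
  moreover have "\<exists>k\<le>n. c k \<noteq> 0" using ij(1) by (intro exI[of _ i]) (simp add: c_def)
  ultimately show thesis by (rule that[rotated])
next
  case True
  define S where "S = f ` {..n}"
  have "\<not> independent S"
  proof
    assume "independent S"
    then have "card S \<le> card T" using independent_span_bound[OF T(1)] f by (auto simp: S_def)
    then show False using T(2) card_image[OF True] by (simp add: S_def)
  qed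
  moreover have "finite S" by (simp add: S_def)
  ultimately obtain u where u: "\<exists>v\<in>S. u v \<noteq> 0" "(\<Sum>v\<in>S. scale (u v) v) = 0"
    using dependent_finite by blast
  show thesis
  proof (rule that[of "\<lambda>i. u (f i)"])
    show "\<exists>i\<le>n. u (f i) \<noteq> 0" using u(1) by (auto simp: S_def)
    show "(\<Sum>i\<le>n. scale (u (f i)) (f i)) = 0" using u(2) sum.reindex[OF True, of "\<lambda>v. scale (u v) v"] by (simp add: S_def)
  qed
qed

end

lemma poly_of_coeffs:
  fixes c :: "nat \<Rightarrow> 'a::comm_ring_1"
  shows "coeff (\<Sum>i\<le>n. monom (c i) i) j = (if j \<le> n then c j else 0)"
    and "poly (\<Sum>i\<le>n. monom (c i) i) x = (\<Sum>i\<le>n. c i * x ^ i)"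
  by (simp_all add: coeff_sum poly_sum poly_monom)

lemma number_field_algebraic:
  assumes "number_field TYPE('f::field_char_0)"
  shows "algebraic (x :: 'f)"
proof -
  obtain B where "finite_dimensional_vector_space (\<lambda>(q::rat) (x::'f). of_rat q * x) B"
    using assms by (auto simp: number_field_def)
  then interpret V: finite_dimensional_vector_space "\<lambda>(q::rat) (x::'f). of_rat q * x" B .
  have "x ^ i \<in> V.span B" for i using V.span_Basis by simp
  then obtain c :: "nat \<Rightarrow> rat" where c: "\<exists>i\<le>card B. c i \<noteq> 0" "(\<Sum>i\<le>card B. of_rat (c i) * x ^ i) = 0"
    using V.family_dependent[OF V.finite_Basis order_refl, of "\<lambda>i. x ^ i"] by blast
  define P where "P = (\<Sum>i\<le>card B. monom (of_rat (c i) :: 'f) i)"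
  obtain i where "i \<le> card B" "c i \<noteq> 0" using c(1) by blast
  then have "coeff P i \<noteq> 0" unfolding P_def poly_of_coeffs by simp
  then have "P \<noteq> 0" by auto
  moreover have "\<forall>i. coeff P i \<in> \<rat>" unfolding P_def poly_of_coeffs by auto
  moreover have "poly P x = 0" using c(2) unfolding P_def poly_of_coeffs .
  ultimately show ?thesis unfolding algebraic_altdef by blast

qed

lemma field_embedding_to_ac: "field_embedding (to_ac :: 'f::field_char_0 \<Rightarrow> 'f alg_closure)"
  by (simp add: field_embedding_def)

lemma algebraic_int_embedding:
  assumes \<sigma>: "field_embedding \<sigma>"
  shows "algebraic_int (\<sigma> x) \<longleftrightarrow> algebraic_int x"
proof -
  have m: "map_poly \<sigma> (map_poly of_int Z) = map_poly of_int Z" for Z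
    by (rule poly_eqI) (simp add: emb_coeff[OF \<sigma>] coeff_map_poly emb_int[OF \<sigma>])
  have i: "algebraic_int y \<longleftrightarrow> (\<exists>Z. lead_coeff Z = 1 \<and> poly (map_poly of_int Z) y = 0)" for y :: "'c::field_char_0"
  proof
    assume "algebraic_int y"
    then obtain P where P: "lead_coeff P = 1" "\<And>i. coeff P i \<in> \<int>" "poly P y = 0" by (auto simp: algebraic_int.simps)
    obtain Z where Z: "P = map_poly of_int Z" using int_poly_ex[of P] P(2) by blast
    have "degree P = degree Z" unfolding Z by (rule degree_map_poly) simp
    then have "lead_coeff Z = 1" using P(1) by (simp add: Z coeff_map_poly)
    then show "\<exists>Z. lead_coeff Z = 1 \<and> poly (map_poly of_int Z) y = 0" using P(3) Z by blast
  next
    assume "\<exists>Z. lead_coeff Z = 1 \<and> poly (map_poly of_int Z) y = 0"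
    then obtain Z :: "int poly" where Z: "lead_coeff Z = 1" "poly (map_poly of_int Z) y = 0" by blast
    have d: "degree (map_poly of_int Z :: 'c poly) = degree Z" by (rule degree_map_poly) simp
    show "algebraic_int y" unfolding algebraic_int.simps
      by (rule exI[of _ "map_poly of_int Z"], rule exI[of _ y]) (use Z in \<open>simp add: coeff_map_poly d\<close>)
  qed
  have "poly (map_poly of_int Z) (\<sigma> x) = 0 \<longleftrightarrow> poly (map_poly of_int Z) x = 0" for Z
    using emb_poly[OF \<sigma>, of "map_poly of_int Z" x] m[of Z] emb_eq_0[OF \<sigma>, of "poly (map_poly of_int Z) x"] by metis
  then show ?thesis unfolding i by simp
qed

text \<open>With \<open>a\<close> the leading coefficient, multiplying the equation by
  \<open>a ^ (n - 1)\<close> gives a monic equation for \<open>a * x\<close>.\<close>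

lemma algebraic_int_lead_coeff_mult:
  fixes x :: "'a::field_char_0"
  assumes P: "\<And>i. algebraic_int (coeff P i)" "poly P x = 0" "P \<noteq> 0"
  shows "algebraic_int (lead_coeff P * x)"
proof -
  define n where "n = degree P"
  define a where "a = lead_coeff P"
  have n0: "n > 0"
  proof (rule ccontr)
    assume "\<not> n > 0" then obtain c where "P = [:c:]" by (auto simp: n_def elim: degree_eq_zeroE)
    then show False using P(2,3) by auto
  qed
  define c where "c i = (if i = n then 1 else coeff P i * a ^ (n - 1 - i))" for i
  define M where "M = (\<Sum>i\<le>n. monom (c i) i)"
  have cM: "coeff M i = (if i \<le> n then c i else 0)" for i unfolding M_def by (rule poly_of_coeffs)
  have dM: "degree M = n"
    by (rule antisym[OF degree_le le_degree]) (auto simp: cM c_def)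
  have ai: "algebraic_int (coeff M i)" for i
    using P(1) by (auto simp: cM c_def a_def intro!: algebraic_int_mult algebraic_int_power)
  have "poly M (a * x) = (\<Sum>i\<le>n. a ^ (n - 1) * (coeff P i * x ^ i))"
    unfolding M_def poly_of_coeffs
  proof (rule sum.cong[OF refl])
    fix i assume i: "i \<in> {..n}"
    show "c i * (a * x) ^ i = a ^ (n - 1) * (coeff P i * x ^ i)"
    proof (cases "i = n")
      case True
      have "a ^ n = a ^ (n - 1) * a" using n0 by (simp add: power_eq_if mult.commute)
      then show ?thesis using True by (simp add: c_def power_mult_distrib a_def n_def)
    next
      case False
      then have "a ^ (n - 1) = a ^ (n - 1 - i) * a ^ i" using i by (simp flip: power_add)
      then show ?thesis using False by (simp add: c_def power_mult_distrib)
    qed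
  qed
  also have "\<dots> = 0" unfolding sum_distrib_left[symmetric] using P(2) by (simp add: poly_altdef n_def)
  finally have "poly M (a * x) = 0" .
  then show ?thesis unfolding a_def[symmetric]
    using dM by (intro algebraic_int_poly_root[OF _ ai]) (auto simp: cM c_def)
qed

lemma algebraic_imp_multiple_algebraic_int:
  fixes x :: "'a::field_char_0"
  assumes "algebraic x"
  obtains N :: int where "N \<noteq> 0" "algebraic_int (of_int N * x)"
proof -
  obtain P where P: "\<And>i. coeff P i \<in> \<int>" "P \<noteq> 0" "poly P x = 0" using assms by (auto simp: algebraic_def)
  then obtain N where N: "lead_coeff P = of_int N" by (metis Ints_cases)
  have "algebraic_int (coeff P i)" for i using P(1)[of i] algebraic_int_of_int by (auto elim: Ints_cases)
  then have "algebraic_int (of_int N * x)" using algebraic_int_lead_coeff_mult[of P x] P N by simp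
  moreover have "N \<noteq> 0" using N P(2) by auto
  ultimately show thesis using that by blast
qed

lemma algebraic_of_multiple:
  fixes x :: "'a::field_char_0"
  assumes "N \<noteq> 0" "algebraic_int (of_int N * x)"
  shows "algebraic x"
proof -
  obtain P where P: "lead_coeff P = 1" "\<And>i. coeff P i \<in> \<int>" "poly P (of_int N * x) = 0"
    using assms(2) by (auto simp: algebraic_int.simps)
  define Q where "Q = (\<Sum>i\<le>degree P. monom (coeff P i * of_int N ^ i) i)"
  have "coeff Q (degree P) \<noteq> 0" using P(1) assms(1) unfolding Q_def poly_of_coeffs by simp
  then have "Q \<noteq> 0" by auto
  moreover have "poly Q x = 0"
    using P(3) unfolding Q_def poly_of_coeffs by (simp add: poly_altdef power_mult_distrib mult.assoc)
  moreover have "coeff Q i \<in> \<int>" for i unfolding Q_def poly_of_coeffs using P(2) by auto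
  ultimately show ?thesis unfolding algebraic_def by blast
qed

text \<open>Clearing denominators over F gives an equation for \<open>x\<close> with algebraic
  integer coefficients whose leading coefficient is an ordinary integer.\<close>

lemma alg_closure_number_field_algebraic:
  assumes "number_field TYPE('f::field_char_0)"
  shows "algebraic (x :: 'f alg_closure)"
proof -
  obtain p :: "'f poly" where p: "p \<noteq> 0" "poly (map_poly to_ac p) x = 0" by (rule alg_closure_algebraic)
  define P where "P = smult (inverse (lead_coeff p)) p"
  have "\<forall>i. \<exists>N::int. N \<noteq> 0 \<and> algebraic_int (of_int N * coeff P i)"
    using algebraic_imp_multiple_algebraic_int[OF number_field_algebraic[OF assms]] by metis
  then obtain N :: "nat \<Rightarrow> int" where N: "\<And>i. N i \<noteq> 0" "\<And>i. algebraic_int (of_int (N i) * coeff P i)" by metis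
  define M where "M = (\<Prod>i\<le>degree P. N i)"
  have M0: "M \<noteq> 0" using N(1) by (simp add: M_def)
  have "algebraic_int (of_int M * coeff P i)" for i
  proof (cases "i \<le> degree P")
    case True
    then have "M = (\<Prod>i\<in>{..degree P} - {i}. N i) * N i" unfolding M_def by (simp add: prod.remove mult.commute)
    then show ?thesis using algebraic_int_mult[OF algebraic_int_of_int N(2)[of i], of "\<Prod>i\<in>{..degree P} - {i}. N i"]
      by (simp add: mult.assoc)
  next
    case False then show ?thesis by (simp add: coeff_eq_0)
  qed
  then have "algebraic_int (to_ac (of_int M * coeff P i))" for i
    by (simp only: algebraic_int_embedding[OF field_embedding_to_ac])
  then have ai: "algebraic_int (coeff (map_poly to_ac (smult (of_int M) P)) i)" for i
    by (simp add: coeff_map_poly)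
  have "poly (map_poly to_ac (smult (of_int M) P)) x = to_ac (of_int M * inverse (lead_coeff p)) * poly (map_poly to_ac p) x"
    by (simp add: P_def poly_altdef emb_degree[OF field_embedding_to_ac] emb_coeff[OF field_embedding_to_ac] p M0 sum_distrib_left mult.assoc)
  then have "poly (map_poly to_ac (smult (of_int M) P)) x = 0" using p(2) by simp
  moreover have "lead_coeff (map_poly to_ac (smult (of_int M) P)) = of_int M"
    using p(1) M0 by (simp add: emb_degree[OF field_embedding_to_ac] emb_coeff[OF field_embedding_to_ac] P_def)
  moreover have "map_poly to_ac (smult (of_int M) P) \<noteq> 0"
    using calculation(2) M0 by (metis leading_coeff_0_iff of_int_eq_0_iff)
  ultimately have "algebraic_int (of_int M * x)" using algebraic_int_lead_coeff_mult[OF ai] by metis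
  then show ?thesis using algebraic_of_multiple M0 by blast
qed

lemma range_to_ac_subring: "unital_subring (range (to_ac :: 'f::field_char_0 \<Rightarrow> 'f alg_closure))"
  unfolding unital_subring_def
proof (intro conjI ballI)
  show "1 \<in> range to_ac" by (metis rangeI to_ac_1)
  fix x y :: "'f alg_closure" assume "x \<in> range to_ac" "y \<in> range to_ac"
  then show "x - y \<in> range to_ac" "x * y \<in> range to_ac"
    by (metis (no_types, lifting) imageE rangeI to_ac_diff, metis (no_types, lifting) imageE rangeI to_ac_mult)
qed

lemma adjoin_subring: "unital_subring (adjoin \<alpha>)"
  and adjoin_base: "range to_ac \<subseteq> adjoin \<alpha>" and adjoin_self: "\<alpha> \<in> adjoin \<alpha>"
proof -
  show b: "range to_ac \<subseteq> adjoin \<alpha>" and "\<alpha> \<in> adjoin \<alpha>"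
    unfolding adjoin_def by (auto intro: generate_field.incl)
  have add: "x + y \<in> adjoin \<alpha>" and mult: "x * y \<in> adjoin \<alpha>" if "x \<in> adjoin \<alpha>" "y \<in> adjoin \<alpha>" for x y
    using generate_field.eng_add[of x ring_of_type_algebra _ y] generate_field.eng_mult[of x ring_of_type_algebra _ y] that
    by (auto simp: adjoin_def ring_of_type_algebra_def)
  have "- y \<in> adjoin \<alpha>" if "y \<in> adjoin \<alpha>" for y
  proof -
    have "to_ac (- 1) \<in> adjoin \<alpha>" using b by blast
    then have "to_ac (- 1) * y \<in> adjoin \<alpha>" using that by (rule mult)
    then show ?thesis by simp
  qed
  moreover have "1 \<in> adjoin \<alpha>" using b by (metis rangeI subsetD to_ac_1)
  ultimately show "unital_subring (adjoin \<alpha>)"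
    unfolding unital_subring_def using add mult by (metis diff_conv_add_uminus)
qed

text \<open>The polynomials in \<alpha> over F already form a field: a nonzero \<open>h\<close>
  satisfies an equation with nonzero constant term, which expresses \<open>inverse h\<close> as a
  polynomial in \<open>h\<close>.\<close>

lemma adjoin_subset_adjoin_to:
  fixes \<alpha> :: "'f::field_char_0 alg_closure"
  shows "adjoin \<alpha> \<subseteq> adjoin_to (range to_ac) \<alpha>"
proof
  define R where "R = adjoin_to (range to_ac) \<alpha>"
  have sr: "unital_subring R" unfolding R_def by (rule adjoin_to_subring[OF range_to_ac_subring])
  have base: "to_ac c \<in> R" for c unfolding R_def using adjoin_to_base[OF range_to_ac_subring] by auto
  interpret K: field "ring_of_type_algebra :: 'f alg_closure ring" by (rule field_from_type_algebra)
  have inv: "inverse h \<in> R" if h: "h \<in> R" "h \<noteq> 0" for h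
  proof -
    obtain p :: "'f poly" where p: "p \<noteq> 0" "poly (map_poly to_ac p) h = 0" by (rule alg_closure_algebraic)
    obtain Q where Q: "p = [:- 0, 1:] ^ order 0 p * Q" "\<not> [:- 0, 1:] dvd Q" using order_decomp[OF p(1), of 0] by blast
    have "map_poly to_ac p = map_poly to_ac (monom 1 (order 0 p)) * map_poly to_ac Q"
      unfolding emb_mult_poly[OF field_embedding_to_ac, symmetric] using Q(1) by (simp add: monom_altdef)
    then have Qh: "poly (map_poly to_ac Q) h = 0" using p(2) h(2) by (simp add: map_poly_monom poly_monom)
    obtain q0 Q1 where Q1: "Q = pCons q0 Q1" by (rule pCons_cases)
    have q0: "q0 \<noteq> 0" using Q(2) by (simp add: dvd_iff_poly_eq_0 Q1)
    have "to_ac q0 + h * poly (map_poly to_ac Q1) h = 0" using Qh by (simp add: Q1 map_poly_pCons)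
    then have "h * poly (map_poly to_ac Q1) h = - to_ac q0" by (simp add: eq_neg_iff_add_eq_0 add.commute)
    then have "inverse h = to_ac (- inverse q0) * poly (map_poly to_ac Q1) h"
      using h(2) q0 by (simp add: field_simps)
    also have "\<dots> \<in> R" by (intro sr_mult[OF sr] sr_poly[OF sr] base h(1)) (simp add: coeff_map_poly base)
    finally show ?thesis .
  qed
  fix x assume "x \<in> adjoin \<alpha>"
  then show "x \<in> R" unfolding adjoin_def
  proof (induction x rule: generate_field.induct)
    case one then show ?case using sr_1[OF sr] by (simp add: ring_of_type_algebra_def)
  next
    case (incl h)
    then show ?case using base adjoin_to_self[OF range_to_ac_subring] by (auto simp: R_def)
  next
    case (a_inv h)
    have "\<ominus>\<^bsub>ring_of_type_algebra\<^esub> h = - h"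
      by (rule K.minus_equality) (auto simp: ring_of_type_algebra_def)
    then show ?case using sr_minus[OF sr a_inv.IH] by simp
  next
    case (m_inv h)
    have h0: "h \<noteq> 0" using m_inv.hyps by (simp add: ring_of_type_algebra_def)
    have "inverse h = inv\<^bsub>ring_of_type_algebra\<^esub> h"
      by (rule K.inv_unique') (use h0 in \<open>auto simp: ring_of_type_algebra_def\<close>)
    then show ?case using inv[OF m_inv.IH h0] by simp
  next
    case (eng_add h1 h2)
    then show ?case using sr_add[OF sr] by (simp add: ring_of_type_algebra_def)
  next
    case (eng_mult h1 h2)
    then show ?case using sr_mult[OF sr] by (simp add: ring_of_type_algebra_def)
  qed
qed

text \<open>This linear dependence of the powers of \<open>y\<close> is the form in which the degree
  [F(\<alpha>):F] is used.\<close>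

lemma adjoin_power_relation:
  fixes \<alpha> :: "'f::field_char_0 alg_closure"
  assumes y: "y \<in> adjoin \<alpha>"
  obtains c :: "nat \<Rightarrow> 'f" where "\<exists>i\<le>adjoin_degree \<alpha>. c i \<noteq> 0"
    "(\<Sum>i\<le>adjoin_degree \<alpha>. to_ac (c i) * y ^ i) = 0"
proof -
  interpret V: vector_space "\<lambda>(c::'f) (x::'f alg_closure). to_ac c * x" by (rule vector_space_alg_closure)
  obtain p :: "'f poly" where p: "p \<noteq> 0" "poly (map_poly to_ac p) \<alpha> = 0" by (rule alg_closure_algebraic)
  define k where "k = degree p"
  define T where "T = (\<lambda>i. \<alpha> ^ i) ` {..<k}"
  have Ti: "\<alpha> ^ i \<in> V.span T" if "i < k" for i using that by (intro V.span_base) (auto simp: T_def)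
  have "poly (map_poly to_ac p) \<alpha> = (\<Sum>i\<le>k. to_ac (coeff p i) * \<alpha> ^ i)"
    by (simp add: poly_altdef k_def emb_degree[OF field_embedding_to_ac] coeff_map_poly)
  also have "{..k} = insert k {..<k}" by auto
  finally have "to_ac (coeff p k) * \<alpha> ^ k = - (\<Sum>i<k. to_ac (coeff p i) * \<alpha> ^ i)"
    using p(2) by (simp add: eq_neg_iff_add_eq_0)
  then have "\<alpha> ^ k = to_ac (inverse (coeff p k)) * - (\<Sum>i<k. to_ac (coeff p i) * \<alpha> ^ i)"
    using p(1) by (simp add: k_def field_simps)
  also have "\<dots> \<in> V.span T" by (intro V.span_scale V.span_neg V.span_sum Ti) auto
  finally have Tk: "\<alpha> ^ k \<in> V.span T" .
  have mult: "\<alpha> * v \<in> V.span T" if "v \<in> V.span T" for v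
    using that
  proof (induction rule: V.span_induct_alt)
    case base then show ?case using V.span_zero by simp
  next
    case (step c x v)
    then obtain i where i: "i < k" "x = \<alpha> ^ i" by (auto simp: T_def)
    have "\<alpha> ^ Suc i \<in> V.span T" using Ti[of "Suc i"] Tk i(1) by (cases "Suc i = k") auto
    then have "to_ac c * \<alpha> ^ Suc i + \<alpha> * v \<in> V.span T" using step by (intro V.span_add V.span_scale)
    then show ?case using i(2) by (simp add: algebra_simps)
  qed
  have pow: "\<alpha> ^ i \<in> V.span T" for i
  proof (induction i)
    case 0
    have "k > 0"
    proof (rule ccontr)
      assume "\<not> k > 0" then obtain c where "p = [:c:]" by (auto simp: k_def elim: degree_eq_zeroE)
      then show False using p by (auto simp: map_poly_pCons)
    qed
    then show ?case by (rule Ti)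
  qed (use mult in auto)
  have "adjoin \<alpha> \<subseteq> V.span T"
  proof
    fix x assume "x \<in> adjoin \<alpha>"
    then obtain P where P: "x = poly P \<alpha>" "\<And>i. coeff P i \<in> range to_ac"
      using adjoin_subset_adjoin_to by (fastforce simp: adjoin_to_def)
    have "coeff P i * \<alpha> ^ i \<in> V.span T" for i
    proof -
      obtain c where "coeff P i = to_ac c" using P(2)[of i] by auto
      then show ?thesis using V.span_scale[OF pow[of i], of c] by simp
    qed
    then show "x \<in> V.span T" unfolding P(1) poly_altdef by (intro V.span_sum)
  qed
  moreover obtain B where B: "B \<subseteq> adjoin \<alpha>" "V.independent B" "adjoin \<alpha> \<subseteq> V.span B" "card B = V.dim (adjoin \<alpha>)"
    by (rule V.basis_exists)
  moreover have "finite T" by (simp add: T_def)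
  \<comment> \<open>An infinite basis would have \<open>card\<close> equal to 0; finiteness follows
    because the powers of \<alpha> below \<open>degree p\<close> span F(\<alpha>).\<close>
  ultimately have "finite B" using V.independent_span_bound by blast
  moreover have "card B \<le> adjoin_degree \<alpha>" using B(4) by (simp add: adjoin_degree_def)
  moreover have "y ^ i \<in> V.span B" for i using B(3) sr_power[OF adjoin_subring y] by blast
  ultimately show thesis using V.family_dependent[of B "adjoin_degree \<alpha>" "\<lambda>i. y ^ i"] that by blast
qed

subsection \<open>Postcritically finite polynomials of prime power degree\<close>

lemma preperiodic_obtain:
  assumes "preperiodic g x"
  obtains i j where "i < j" "(g ^^ i) x = (g ^^ j) x"
proof -
  have "\<not> inj (\<lambda>n. (g ^^ n) x)"
    using assms finite_imageD[of "\<lambda>n. (g ^^ n) x" UNIV] by (auto simp: preperiodic_def)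
  then obtain i j where ij: "i \<noteq> j" "(g ^^ i) x = (g ^^ j) x" by (auto simp: inj_def)
  show thesis using that[of i j] that[of j i] ij by (cases "i < j") auto
qed

lemma preperiodic_semiconj:
  assumes "preperiodic f x" "\<And>x. h (f x) = g (h x)"
  shows "preperiodic g (h x)"
proof -
  have "(g ^^ n) (h x) = h ((f ^^ n) x)" for n by (induction n) (auto simp: assms(2))
  then have "range (\<lambda>n. (g ^^ n) (h x)) = h ` range (\<lambda>n. (f ^^ n) x)" by auto
  then show ?thesis using assms(1) by (simp add: preperiodic_def)
qed

lemma preperiodic_step: "preperiodic g (g x) \<longleftrightarrow> preperiodic g x"
proof
  assume p: "preperiodic g (g x)"
  have "range (\<lambda>n. (g ^^ n) x) \<subseteq> insert x (range (\<lambda>n. (g ^^ n) (g x)))"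
  proof
    fix y assume "y \<in> range (\<lambda>n. (g ^^ n) x)"
    then obtain n where "y = (g ^^ n) x" by auto
    then show "y \<in> insert x (range (\<lambda>n. (g ^^ n) (g x)))" by (cases n) (auto simp: funpow_swap1)
  qed
  then show "preperiodic g x" using p unfolding preperiodic_def by (metis finite_insert finite_subset)
next
  assume "preperiodic g x" then show "preperiodic g (g x)" by (rule preperiodic_semiconj) simp
qed

lemma sr_coeff_pcompose:
  assumes R: "unital_subring R" and P: "\<And>i. coeff P i \<in> R" and Q: "\<And>i. coeff Q i \<in> R"
  shows "coeff (pcompose P Q) i \<in> R"
  using P
proof (induction P arbitrary: i)
  case 0 then show ?case using sr_0[OF R] by simp
next
  case (pCons a P)
  have a: "a \<in> R" using pCons.prems[of 0] by simp
  have "coeff P i \<in> R" for i using pCons.prems[of "Suc i"] by simp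
  then have IH: "\<And>i. coeff (pcompose P Q) i \<in> R" using pCons.IH by blast
  show ?case unfolding pcompose_pCons
    using sr_coeff_mult[OF R Q IH, of i] a sr_0[OF R] by (auto simp: coeff_pCons intro: sr_add[OF R] split: nat.splits)
qed

text \<open>Formulated in the ambient field, where the polynomials arising in the decomposition
  live.\<close>

definition pcf :: "'a::field_char_0 poly \<Rightarrow> bool" where
  "pcf f \<longleftrightarrow> (\<forall>c. poly (pderiv f) c = 0 \<longrightarrow> preperiodic (poly f) c)"

text \<open>\<open>x\<close> is a zero of the difference of two iterates, which is monic because
  their degrees differ.\<close>

lemma preperiodic_algebraic_int:
  fixes f :: "'a::field_char_0 poly"
  assumes m: "lead_coeff f = 1" and d: "degree f \<ge> 2" and ai: "\<And>i. algebraic_int (coeff f i)"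
    and x: "preperiodic (poly f) x"
  shows "algebraic_int x"
proof -
  obtain i j where ij: "i < j" "(poly f ^^ i) x = (poly f ^^ j) x" using preperiodic_obtain[OF x] by blast
  have R: "unital_subring {x::'a. algebraic_int x}" by (rule algebraic_int_subring)
  have it: "algebraic_int (coeff (iter_poly f n) k)" for n k
  proof (induction n arbitrary: k)
    case 0 then show ?case by (simp add: coeff_pCons split: nat.splits)
  next
    case (Suc n)
    then show ?case using sr_coeff_pcompose[OF R, of "iter_poly f n" f k] ai by (simp add: iter_poly_Suc)
  qed
  have dl: "degree (iter_poly f i) < degree (iter_poly f j)"
    unfolding degree_iter_poly using d ij by (intro power_strict_increasing) auto
  define P where "P = iter_poly f j - iter_poly f i"
  have dP: "degree P = degree (iter_poly f j)" unfolding P_def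
    using degree_add_eq_left[of "- iter_poly f i" "iter_poly f j"] dl by simp
  have "lead_coeff P = 1" unfolding dP using coeff_eq_0[OF dl] lead_coeff_iter_poly[OF m] d by (simp add: P_def)
  moreover have "algebraic_int (coeff P k)" for k using it by (auto simp: P_def intro: algebraic_int_diff)
  moreover have "poly P x = 0" using ij by (simp add: P_def poly_iter_poly)
  ultimately show ?thesis by (rule algebraic_int_poly_root)
qed

lemma prod_linear_algebraic_int:
  fixes A :: "'a::field_char_0 multiset"
  assumes "\<And>x. x \<in># A \<Longrightarrow> algebraic_int x"
  shows "algebraic_int (coeff (\<Prod>x\<in>#A. [:- x, 1:]) i)"
  using assms
proof (induction A arbitrary: i)
  case empty then show ?case by (auto simp: coeff_1)
next
  case (add x A)
  have R: "unital_subring {x::'a. algebraic_int x}" by (rule algebraic_int_subring)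
  have "coeff [:- x, 1:] i \<in> {x. algebraic_int x}" for i
    using add.prems[of x] by (auto simp: coeff_pCons split: nat.splits)
  moreover have "coeff (\<Prod>x\<in>#A. [:- x, 1:]) i \<in> {x. algebraic_int x}" for i using add by auto
  ultimately have "coeff ([:- x, 1:] * (\<Prod>x\<in>#A. [:- x, 1:])) i \<in> {x. algebraic_int x}" by (rule sr_coeff_mult[OF R])
  then show ?case by simp
qed

locale pcf_prime_power =
  fixes p e :: nat and f :: "'a::{alg_closed_field, field_char_0} poly"
  assumes p: "prime p" and e: "e \<ge> 1" and m1: "lead_coeff f = 1" and deg: "degree f = p ^ e"
    and ai: "\<And>i. algebraic_int (coeff f i)" and pcf: "pcf f"
begin

lemma d2: "degree f \<ge> 2"
proof -
  have "2 \<le> p" using p by (rule prime_ge_2_nat)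
  also have "p ^ 1 \<le> p ^ e" using e prime_ge_2_nat[OF p] by (intro power_increasing) auto
  finally show ?thesis using deg by simp
qed

lemma coeff_derivative: "algebraic_int (of_nat m * coeff f m / of_nat (degree f))"
proof (cases m)
  case 0 then show ?thesis by simp
next
  case (Suc k)
  define g where "g = smult (1 / of_nat (degree f)) (pderiv f)"
  have dg: "degree g = degree f - 1" using d2 by (simp add: g_def degree_pderiv)
  have mg: "lead_coeff g = 1" unfolding dg using d2 m1 by (simp add: g_def coeff_pderiv)
  obtain A where A: "size A = degree g" "g = smult (lead_coeff g) (\<Prod>x\<in>#A. [:- x, 1:])"
    using alg_closed_imp_factorization[of g] mg by force
  have "algebraic_int x" if x: "x \<in># A" for x
  proof -
    have "poly g x = 0" by (subst A(2)) (use x in \<open>auto simp: poly_prod_mset prod_mset_zero_iff image_iff\<close>)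
    then have "poly (pderiv f) x = 0" using d2 by (auto simp: g_def)
    then show ?thesis using preperiodic_algebraic_int[OF m1 d2 ai] pcf by (auto simp: pcf_def)
  qed
  then have "algebraic_int (coeff g k)" using A(2) mg prod_linear_algebraic_int[of A k] by simp
  then show ?thesis using Suc by (simp add: g_def coeff_pderiv)
qed

text \<open>\<open>m\<close> is prime to the degree, a power of \<open>p\<close>, so Bezout removes
  the factor \<open>m\<close> from \<open>coeff_derivative\<close> at the cost of a multiple of the
  integral \<open>coeff f m\<close>.\<close>

lemma coeff_div_degree: assumes m: "\<not> p dvd m" shows "algebraic_int (coeff f m / of_nat (degree f))"
proof -
  have "coprime m (degree f)" unfolding deg using p m by (metis coprime_commute coprime_power_left_iff prime_imp_coprime)
  then have "coprime (int m) (int (degree f))" by simp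
  then obtain a b where ab: "a * int m + b * int (degree f) = 1"
    using bezout_int[of "int m" "int (degree f)"] by (auto simp: coprime_iff_gcd_eq_1)
  have "of_int a * of_nat m + of_int b * of_nat (degree f) = (1::'a)"
    using arg_cong[OF ab, of "of_int :: int \<Rightarrow> 'a"] by simp
  then have "coeff f m / of_nat (degree f) = (of_int a * of_nat m + of_int b * of_nat (degree f)) * (coeff f m / of_nat (degree f))" by simp
  also have "\<dots> = of_int a * (of_nat m * coeff f m / of_nat (degree f)) + of_int b * coeff f m"
    using d2 by (simp add: distrib_right add_divide_distrib)
  finally have "coeff f m / of_nat (degree f) = of_int a * (of_nat m * coeff f m / of_nat (degree f)) + of_int b * coeff f m" .
  then show ?thesis using coeff_derivative[of m] ai[of m] algebraic_int_of_int
    by (metis algebraic_int_add algebraic_int_mult)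
qed

end

text \<open>The derivative splits over the algebraically closed field, so every complex critical
  point is the image of one there; the critical orbits are finitely many finite sets, and
  \<open>\<rho>\<close> is a maximum over them.\<close>

lemma complex_bounded_critical_orbits:
  fixes f :: "'a::{alg_closed_field, field_char_0} poly"
  assumes m1: "lead_coeff f = 1" and d2: "degree f \<ge> 2" and pcf: "pcf f" and \<sigma>: "field_embedding \<sigma>"
  obtains \<rho> where "bounded_critical_orbits (map_poly \<sigma> f) \<rho>"
proof -
  have pd: "pderiv f \<noteq> 0" using d2 by (simp add: pderiv_eq_0_iff)
  obtain A where A: "size A = degree (pderiv f)" "pderiv f = smult (lead_coeff (pderiv f)) (\<Prod>x\<in>#A. [:- x, 1:])"
    using alg_closed_imp_factorization[OF pd] by blast
  have mp: "map_poly \<sigma> (\<Prod>x\<in>#A. [:- x, 1:]) = (\<Prod>x\<in>#A. [:- \<sigma> x, 1:])"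
    by (induction A) (auto simp: emb_mult_poly[OF \<sigma>] map_poly_pCons emb_1[OF \<sigma>] emb_0[OF \<sigma>] emb_minus[OF \<sigma>] simp del: mult_pCons_left)
  have root: "\<exists>c. z = \<sigma> c \<and> poly (pderiv f) c = 0" if z: "poly (pderiv (map_poly \<sigma> f)) z = 0" for z
  proof -
    have "pderiv (map_poly \<sigma> f) = smult (\<sigma> (lead_coeff (pderiv f))) (\<Prod>x\<in>#A. [:- \<sigma> x, 1:])"
      unfolding mp[symmetric] emb_pderiv[OF \<sigma>, symmetric]
      by (subst A(2), rule poly_eqI) (simp add: emb_coeff[OF \<sigma>] emb_mult[OF \<sigma>])
    then have "(\<Prod>x\<in>#A. z - \<sigma> x) = 0"
      using z pd by (simp add: poly_prod_mset emb_eq_0[OF \<sigma>])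
    then obtain c where "c \<in># A" "z = \<sigma> c" by (auto simp: prod_mset_zero_iff)
    moreover have "poly (pderiv f) c = 0" if "c \<in># A"
      by (subst A(2)) (use that in \<open>auto simp: poly_prod_mset prod_mset_zero_iff image_iff\<close>)
    ultimately show ?thesis by blast
  qed
  define C where "C = {c. poly (pderiv f) c = 0}"
  define S where "S = (\<Union>c\<in>C. \<sigma> ` range (\<lambda>n. (poly f ^^ n) c))"
  have "finite C" unfolding C_def using pd by (rule poly_roots_finite)
  then have fS: "finite S" unfolding S_def using pcf by (auto simp: pcf_def preperiodic_def C_def)
  define \<rho> where "\<rho> = Max (insert 1 (cmod ` S))"
  have "bounded_critical_orbits (map_poly \<sigma> f) \<rho>"
  proof
    show "lead_coeff (map_poly \<sigma> f) = 1" using m1 by (simp add: emb_degree[OF \<sigma>] emb_coeff[OF \<sigma>] emb_1[OF \<sigma>])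
    show "2 \<le> degree (map_poly \<sigma> f)" using d2 by (simp add: emb_degree[OF \<sigma>])
    show "1 \<le> \<rho>" unfolding \<rho>_def using fS by (intro Max_ge) auto
    fix z n assume "poly (pderiv (map_poly \<sigma> f)) z = 0"
    then obtain c where c: "z = \<sigma> c" "c \<in> C" using root by (auto simp: C_def)
    have "(poly (map_poly \<sigma> f) ^^ n) z \<in> S"
      unfolding c(1) emb_funpow[OF \<sigma>, symmetric] S_def using c(2) by auto
    then show "cmod ((poly (map_poly \<sigma> f) ^^ n) z) \<le> \<rho>" unfolding \<rho>_def using fS by (intro Max_ge) auto
  qed
  then show thesis by (rule that)
qed

context pcf_prime_power
begin

text \<open>\<open>m\<close> is the largest index prime to \<open>p\<close> with nonzero
  coefficient, and \<open>\<sigma>\<close> is chosen so that \<open>coeff f m / degree f\<close>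
  gets modulus at least 1. Centring excludes \<open>m = degree f - 1\<close>, so
  \<open>coeff_bound\<close> can hold only with \<open>degree f - m = 2\<close> and modulus 1. Then
  \<open>p\<close> is not 2, as it divides the degree but not \<open>m\<close>.\<close>

lemma sparse_or_joukowski:
  assumes alg: "\<And>x::'a. algebraic x" and cen: "coeff f (degree f - 1) = 0"
    and m0: "\<not> p dvd m0" "coeff f m0 \<noteq> 0"
  obtains \<sigma> :: "'a \<Rightarrow> complex" and \<beta> where "field_embedding \<sigma>" "\<beta> \<noteq> 0" "p \<noteq> 2"
    "\<And>u. u \<noteq> 0 \<Longrightarrow> poly (map_poly \<sigma> f) (u + \<sigma> \<beta> / u) = u ^ degree f + \<sigma> \<beta> / u ^ degree f"
proof -
  define M where "M = {m. \<not> p dvd m \<and> coeff f m \<noteq> 0}"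
  have fM: "finite M" by (rule finite_subset[of _ "{..degree f}"]) (auto simp: M_def intro: le_degree)
  define m where "m = Max M"
  have mM: "m \<in> M" unfolding m_def by (rule Max_in[OF fM]) (use m0 in \<open>auto simp: M_def\<close>)
  have top: "coeff f i = 0" if "m < i" "\<not> p dvd i" for i
    using Max_ge[OF fM, of i] that by (auto simp: m_def M_def not_le[symmetric])
  have pm: "\<not> p dvd m" and am: "coeff f m \<noteq> 0" using mM by (auto simp: M_def)
  have pd: "p dvd degree f" using deg e by (metis dvd_power less_le_trans zero_less_one)
  have "m \<le> degree f" using am by (rule le_degree)
  moreover have "m \<noteq> degree f" using pd pm by auto
  moreover have "m \<noteq> degree f - 1" using am cen by auto
  ultimately have md: "m + 2 \<le> degree f" by linarith
  have mpos: "0 < m" using pm by (cases m) auto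
  define x where "x = coeff f m / of_nat (degree f)"
  have x: "algebraic_int x" "x \<noteq> 0" using coeff_div_degree[OF pm] am d2 by (auto simp: x_def)
  obtain \<sigma> :: "'a \<Rightarrow> complex" where \<sigma>: "field_embedding \<sigma>" "1 \<le> cmod (\<sigma> x)" using complex_embedding_ge_1[OF alg x] .
  obtain \<rho> where "bounded_critical_orbits (map_poly \<sigma> f) \<rho>" using complex_bounded_critical_orbits[OF m1 d2 pcf \<sigma>(1)] .
  then interpret B: bounded_critical_orbits "map_poly \<sigma> f" \<rho> .
  have Bd: "B.d = degree f" by (simp add: B.d_def emb_degree[OF \<sigma>(1)])
  have cx: "coeff (map_poly \<sigma> f) m / of_nat (degree f) = \<sigma> x"
    by (simp add: x_def emb_coeff[OF \<sigma>(1)] emb_divide[OF \<sigma>(1)] emb_nat[OF \<sigma>(1)])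
  have top': "coeff (map_poly \<sigma> f) i = 0" if "m < i" "\<not> p dvd i" for i
    using top[OF that] by (simp add: emb_coeff[OF \<sigma>(1)] emb_0[OF \<sigma>(1)])
  have mB: "m < B.d" "p dvd B.d" using md pd by (auto simp: Bd)
  define r where "r = real (degree f - m - 1)"
  have r: "r * (cmod (\<sigma> x))\<^sup>2 \<le> 1"
    using B.coeff_bound[OF mB(2,1) mpos pm top'] by (simp add: Bd cx r_def)
  have A1: "1 \<le> (cmod (\<sigma> x))\<^sup>2" using \<sigma>(2) by simp
  have r1: "1 \<le> r" using md by (simp add: r_def)
  have "r * 1 \<le> r * (cmod (\<sigma> x))\<^sup>2" using A1 r1 by (intro mult_left_mono) auto
  moreover have "1 * (cmod (\<sigma> x))\<^sup>2 \<le> r * (cmod (\<sigma> x))\<^sup>2" using r1 by (intro mult_right_mono) auto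
  ultimately have 1: "real (degree f - m - 1) \<le> 1" "(cmod (\<sigma> x))\<^sup>2 \<le> 1" using r by (auto simp: r_def)
  have q2: "degree f - m = 2" using 1(1) md by linarith
  have "cmod (\<sigma> x) = 1" using 1(2) \<sigma>(2) by (smt (verit) one_less_power pos2)
  then have b1: "cmod (coeff (map_poly \<sigma> f) m / of_nat B.d) = 1" by (simp only: Bd cx)
  have sb: "- coeff (map_poly \<sigma> f) m / of_nat (degree f) = \<sigma> (- x)" using cx by (simp add: emb_minus[OF \<sigma>(1)])
  show thesis
  proof (rule that[OF \<sigma>(1), of "- x"])
    show "- x \<noteq> 0" using x by simp
    show "p \<noteq> 2"
    proof
      assume "p = 2"
      then have "p dvd (degree f - m)" using q2 by simp
      then show False using pm pd md by (metis add_leD1 dvd_diffD1)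
    qed
    fix u :: complex assume u: "u \<noteq> 0"
    show "poly (map_poly \<sigma> f) (u + \<sigma> (- x) / u) = u ^ degree f + \<sigma> (- x) / u ^ degree f"
      using B.extremal_case[OF mB(2,1) mpos pm top' _ b1 u] q2 unfolding Bd sb by simp
  qed
qed

end

text \<open>A count of zeros: if \<open>y^2 + c y + b = 0\<close>, all \<open>degree h\<close>
  solutions of \<open>u ^ degree h = y\<close> give zeros \<open>u + b / u\<close> of
  \<open>G\<close>, and at most two solutions share one zero. Thus
  \<open>p * degree G \<le> 2 * degree G\<close>.\<close>

lemma joukowski_not_power_plus_const:
  fixes h G :: "complex poly"
  assumes h: "h = G ^ p - [:c:]" and p: "p > 2" and d: "degree G > 0" and b: "b \<noteq> 0"
    and eq: "\<And>u. u \<noteq> 0 \<Longrightarrow> poly h (u + b / u) = u ^ degree h + b / u ^ degree h"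
  shows False
proof -
  have G0: "G \<noteq> 0" using d by auto
  have dh: "degree h = p * degree G"
    unfolding h using degree_diff_const[of "G ^ p" c] d p by (simp add: degree_power_eq[OF G0])
  then have dh0: "degree h > 0" using d p by simp
  obtain y where y: "poly [:b, c, 1:] y = 0" using alg_closed_imp_poly_has_root[of "[:b, c, 1:]"] by auto
  then have yeq: "y\<^sup>2 + c * y + b = 0" by (simp add: power2_eq_square algebra_simps)
  have y0: "y \<noteq> 0" using yeq b by auto
  define U where "U = {u. u ^ degree h = y}"
  define \<phi> where "\<phi> u = u + b / u" for u
  have cU: "card U = degree h" unfolding U_def by (rule card_nth_roots[OF y0 dh0])
  have fU: "finite U" using cU dh0 by (metis card.infinite less_irrefl)
  have root: "poly G (\<phi> u) = 0" if "u \<in> U" for u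
  proof -
    have u0: "u \<noteq> 0" using that y0 dh0 by (auto simp: U_def)
    have "poly G (\<phi> u) ^ p = poly h (\<phi> u) + c" by (simp add: h)
    also have "\<dots> = y + b / y + c" using eq[OF u0] that by (simp add: \<phi>_def U_def)
    also have "\<dots> = (y\<^sup>2 + c * y + b) / y" using y0 by (simp add: add_divide_distrib power2_eq_square)
    finally show ?thesis using yeq by simp
  qed
  have cG: "card (\<phi> ` U) \<le> degree G"
  proof -
    have "card (\<phi> ` U) \<le> card {x. poly G x = 0}"
      using root by (intro card_mono poly_roots_finite[OF G0]) auto
    then show ?thesis using card_poly_roots_bound[OF G0] by simp
  qed
  have "U \<subseteq> (\<Union>x\<in>\<phi> ` U. {u. poly [:b, - x, 1:] u = 0})"
  proof
    fix u assume u: "u \<in> U"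
    then have u0: "u \<noteq> 0" using y0 dh0 by (auto simp: U_def)
    have "poly [:b, - \<phi> u, 1:] u = 0" using u0 by (simp add: \<phi>_def algebra_simps)
    then show "u \<in> (\<Union>x\<in>\<phi> ` U. {u. poly [:b, - x, 1:] u = 0})" using u by blast
  qed
  then have "card U \<le> card (\<Union>x\<in>\<phi> ` U. {u. poly [:b, - x, 1:] u = 0})"
    using fU by (intro card_mono finite_UN_I finite_imageI) (auto intro!: poly_roots_finite simp del: poly_pCons)
  also have "\<dots> \<le> (\<Sum>x\<in>\<phi> ` U. card {u. poly [:b, - x, 1:] u = 0})" by (intro card_UN_le finite_imageI fU)
  also have "\<dots> \<le> (\<Sum>x\<in>\<phi> ` U. 2)"
  proof (rule sum_mono)
    fix x show "card {u. poly [:b, - x, 1:] u = 0} \<le> 2" using card_poly_roots_bound[of "[:b, - x, 1:]"] by simp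
  qed
  also have "\<dots> = card (\<phi> ` U) * 2" by simp
  also have "\<dots> \<le> degree G * 2" using cG by simp
  finally show False using cU dh d p by simp
qed

lemma chebyshev_poly_cos:
  assumes "1 \<le> d"
  shows "poly (map_poly of_int (chebyshev d)) (2 * cos (\<theta>::complex)) = 2 * cos (of_nat d * \<theta>)"
  using is_chebyshev_chebyshev[OF assms] by (simp add: is_chebyshev_def)

text \<open>Every complex number has the form \<open>\<sigma> a * (2 * cos \<theta>)\<close>, so the
  hypothesis determines \<open>map_poly \<sigma> f\<close>, and injectivity of
  \<open>\<sigma>\<close> carries the identity back. The sign \<open>\<epsilon>\<close> separates
  Chebyshev from negative Chebyshev polynomials.\<close>

lemma linearly_conjugate_chebyshevI:
  fixes f :: "'a::field_char_0 poly"
  assumes \<sigma>: "field_embedding (\<sigma> :: 'a \<Rightarrow> complex)" and d: "1 \<le> d" and a: "a \<noteq> 0"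
    and \<epsilon>: "\<epsilon> = 1 \<or> \<epsilon> = - 1"
    and eq: "\<And>\<theta>. poly (map_poly \<sigma> f) (\<sigma> a * (2 * cos \<theta>)) = \<sigma> (\<epsilon> * a) * (2 * cos (of_nat d * \<theta>))"
  shows "linearly_conjugate f (map_poly of_int (chebyshev d)) \<or> linearly_conjugate f (- map_poly of_int (chebyshev d))"
proof -
  define T where "T = (map_poly of_int (chebyshev d) :: 'a poly)"
  \<comment> \<open>The conjugating scale is \<open>1 / a\<close>; its inverse is left as
    \<open>1 / (1 / a)\<close> to match \<open>linearly_conjugate\<close>.\<close>
  define g where "g = smult (1 / (1 / a)) (pcompose (smult \<epsilon> T) [:0, 1 / a:] - [:0:])"
  have "map_poly \<sigma> T = map_poly of_int (chebyshev d)"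
    by (rule poly_eqI) (simp add: T_def emb_coeff[OF \<sigma>] coeff_map_poly emb_int[OF \<sigma>])
  then have sT: "\<sigma> (poly T x) = poly (map_poly of_int (chebyshev d)) (\<sigma> x)" for x by (simp add: emb_poly[OF \<sigma>])
  have mg: "map_poly \<sigma> g = smult (\<sigma> (\<epsilon> * a)) (pcompose (map_poly of_int (chebyshev d)) [:0, 1 / \<sigma> a:])"
    by (rule poly_eqI)
      (simp add: g_def T_def emb_coeff[OF \<sigma>] coeff_pcompose_linear coeff_map_poly emb_mult[OF \<sigma>] emb_int[OF \<sigma>] emb_divide[OF \<sigma>] emb_power[OF \<sigma>] emb_1[OF \<sigma>] pcompose_smult)
  have "poly (map_poly \<sigma> f) z = poly (map_poly \<sigma> g) z" for z
  proof -
    have sa: "\<sigma> a \<noteq> 0" using a by (simp add: emb_eq_0[OF \<sigma>])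
    obtain \<theta> where \<theta>: "z / (2 * \<sigma> a) = cos \<theta>" using cos_Arccos by metis
    have z: "z = \<sigma> a * (2 * cos \<theta>)" using \<theta> sa by (simp add: field_simps)
    show ?thesis unfolding z eq mg
      using sa chebyshev_poly_cos[OF d, of \<theta>] by (simp add: poly_pcompose)
  qed
  then have "map_poly \<sigma> f = map_poly \<sigma> g" using poly_eq_poly_eq_iff by blast
  then have "f = g" by (intro poly_eqI) (metis emb_coeff[OF \<sigma>] emb_eq[OF \<sigma>])
  moreover have "smult \<epsilon> T = T \<or> smult \<epsilon> T = - T" using \<epsilon> by auto
  ultimately show ?thesis unfolding linearly_conjugate_def g_def T_def using a
    by (metis divide_eq_0_iff one_neq_zero)
qed

text \<open>With \<open>b = \<sigma> \<beta>\<close>, the map \<open>u + b / u\<close> takes the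
  same value at \<open>u\<close> and \<open>b / u\<close>, and this symmetry forces
  \<open>b ^ d = b\<close>. For \<open>a ^ 2 = \<beta>\<close> it follows that \<open>a ^ d\<close>
  is \<open>a\<close> or \<open>- a\<close>, and
  \<open>u = \<sigma> a * exp (\<i> * \<theta>)\<close> turns the Joukowski identity into the cosine
  identity.\<close>

lemma joukowski_imp_chebyshev:
  fixes f :: "'a::{alg_closed_field, field_char_0} poly"
  assumes \<sigma>: "field_embedding (\<sigma> :: 'a \<Rightarrow> complex)" and \<beta>: "\<beta> \<noteq> 0" and d: "degree f \<ge> 2"
    and eq: "\<And>u. u \<noteq> 0 \<Longrightarrow> poly (map_poly \<sigma> f) (u + \<sigma> \<beta> / u) = u ^ degree f + \<sigma> \<beta> / u ^ degree f"
  shows "linearly_conjugate f (map_poly of_int (chebyshev (degree f))) \<or> linearly_conjugate f (- map_poly of_int (chebyshev (degree f)))"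
proof -
  define d where "d = degree f"
  define b where "b = \<sigma> \<beta>"
  have b0: "b \<noteq> 0" using \<beta> by (simp add: b_def emb_eq_0[OF \<sigma>])
  have sym: "u ^ d + b / u ^ d = b ^ d / u ^ d + b * u ^ d / b ^ d" if u: "u \<noteq> 0" for u
  proof -
    have "b / u + b / (b / u) = u + b / u" using u b0 by simp
    moreover have "b / u \<noteq> 0" using u b0 by simp
    ultimately have "u ^ d + b / u ^ d = (b / u) ^ d + b / (b / u) ^ d"
      using eq[OF u, folded b_def d_def] eq[of "b / u", folded b_def d_def] by metis
    then show ?thesis by (simp add: power_divide)
  qed
  have bd: "b ^ d = b"
  proof -
    have 1: "1 + b = b ^ d + b / b ^ d" using sym[of 1] by simp
    have "(2::complex) ^ d + b / 2 ^ d = b ^ d / 2 ^ d + b * 2 ^ d / b ^ d" using sym[of 2] by simp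
    then have 2: "4 ^ d + b = b ^ d + b * 4 ^ d / b ^ d"
      by (simp add: field_simps power_mult_distrib[symmetric])
    define t where "t = b / b ^ d"
    have "4 ^ d + b = b ^ d + t * 4 ^ d" "1 + b = b ^ d + t" using 1 2 by (simp_all add: t_def)
    moreover have "(4 ^ d - 1) * (1 - t) = (4 ^ d + b - (b ^ d + t * 4 ^ d)) - (1 + b - (b ^ d + t))" by (simp add: algebra_simps)
    ultimately have "(4 ^ d - 1) * (1 - t) = 0" by simp
    moreover have "(4::complex) ^ d - 1 \<noteq> 0"
    proof
      assume "(4::complex) ^ d - 1 = 0"
      then have "norm ((4::complex) ^ d) = 1" by simp
      then show False using one_less_power[of "4::real" d] assms(3) by (simp add: d_def norm_power)
    qed
    ultimately have "t = 1" by auto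
    then show ?thesis using b0 by (simp add: t_def nonzero_divide_eq_eq)
  qed
  have \<beta>d: "\<beta> ^ d = \<beta>" using bd unfolding b_def emb_power[OF \<sigma>, symmetric] emb_eq[OF \<sigma>] .
  obtain a where a: "a ^ 2 = \<beta>" using nth_root_exists[of 2 \<beta>] by auto
  have a0: "a \<noteq> 0" using a \<beta> by auto
  define \<epsilon> where "\<epsilon> = a ^ (d - 1)"
  have d1: "a ^ d = \<epsilon> * a" using assms(3) by (simp add: \<epsilon>_def d_def power_eq_if mult.commute)
  have "(\<epsilon> * a)\<^sup>2 = a\<^sup>2" using \<beta>d a d1 by (metis mult.commute power_mult)
  then have "\<epsilon>\<^sup>2 = 1" using a0 by (simp add: power_mult_distrib)
  then have \<epsilon>: "\<epsilon> = 1 \<or> \<epsilon> = - 1" by (simp add: power2_eq_1_iff)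
  show ?thesis unfolding d_def[symmetric]
  proof (rule linearly_conjugate_chebyshevI[OF \<sigma> _ a0 \<epsilon>])
    show "1 \<le> d" using assms(3) by (simp add: d_def)
    fix \<theta> :: complex
    define s where "s = \<sigma> a"
    have s0: "s \<noteq> 0" and s2: "s\<^sup>2 = b" and sd: "\<sigma> (\<epsilon> * a) = s ^ d"
      using a0 a by (auto simp: s_def b_def emb_eq_0[OF \<sigma>] d1[symmetric] emb_power[OF \<sigma>, symmetric])
    define u where "u = s * exp (\<i> * \<theta>)"
    have u0: "u \<noteq> 0" using s0 by (simp add: u_def)
    have cosx: "2 * cos x = exp (\<i> * x) + exp (- (\<i> * x))" for x :: complex
      by (simp add: cos_exp_eq)
    have "b / u = s * exp (- (\<i> * \<theta>))"
      using s0 by (simp add: u_def s2[symmetric] power2_eq_square exp_minus divide_inverse)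
    then have x: "u + b / u = s * (2 * cos \<theta>)" unfolding cosx by (simp add: u_def distrib_left)
    have P1: "poly (map_poly \<sigma> f) (s * (2 * cos \<theta>)) = u ^ d + b / u ^ d"
      using eq[OF u0] x by (simp add: b_def d_def)
    have bs: "b = s ^ d * s ^ d" using bd s2 by (metis power2_eq_square power_mult mult.commute)
    have ud: "u ^ d = s ^ d * exp (\<i> * (of_nat d * \<theta>))"
      by (simp add: u_def power_mult_distrib exp_of_nat_mult[symmetric] mult_ac)
    have "s ^ d * s ^ d / u ^ d = s ^ d * exp (- (\<i> * (of_nat d * \<theta>)))"
      unfolding ud using s0 by (simp add: exp_minus divide_inverse)
    then have "u ^ d + b / u ^ d = s ^ d * (2 * cos (of_nat d * \<theta>))"
      unfolding bs cosx by (simp add: ud distrib_left)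
    then show "poly (map_poly \<sigma> f) (\<sigma> a * (2 * cos \<theta>)) = \<sigma> (\<epsilon> * a) * (2 * cos (of_nat d * \<theta>))"
      using P1 by (simp only: sd s_def)
  qed
qed

subsection \<open>Decomposition into unicritical polynomials\<close>

text \<open>\<open>G\<close> followed by the maps T^p - c_0, ..., T^p - c_(j-1) in this order. The
  starting polynomial is a parameter because \<open>f\<close> and its rotated compositions both have
  this shape.\<close>

primrec stage :: "nat \<Rightarrow> (nat \<Rightarrow> 'a::comm_ring_1) \<Rightarrow> nat \<Rightarrow> 'a poly \<Rightarrow> 'a poly" where
  "stage p c 0 G = G"
| "stage p c (Suc j) G = stage p c j G ^ p - [:c j:]"

lemma pcompose_power: "pcompose (P ^ n) Q = pcompose P Q ^ n" for P Q :: "'a::comm_ring_1 poly"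
  by (induction n) (simp_all add: pcompose_1 pcompose_mult)

lemma stage_pcompose: "stage p c j (pcompose G H) = pcompose (stage p c j G) H"
  by (induction j) (simp_all add: pcompose_diff pcompose_power)

lemma stage_cong: "(\<And>i. i < j \<Longrightarrow> c i = c' i) \<Longrightarrow> stage p c j G = stage p c' j G"
  by (induction j) auto

lemma stage_coeff:
  assumes R: "unital_subring R" and c: "\<And>i. i < j \<Longrightarrow> c i \<in> R" and G: "\<And>i. coeff G i \<in> R"
  shows "coeff (stage p c j G) i \<in> R"
  using c
proof (induction j arbitrary: i)
  case (Suc j)
  have IH: "coeff (stage p c j G) i \<in> R" for i using Suc by auto
  have "coeff (stage p c j G ^ n) i \<in> R" for n i
  proof (induction n arbitrary: i)
    case 0 then show ?case by (auto simp: coeff_1 sr_0[OF R] sr_1[OF R])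
  next
    case (Suc n) then show ?case using sr_coeff_mult[OF R IH] by simp
  qed
  moreover have "coeff [:c j:] i \<in> R" using Suc.prems[of j] sr_0[OF R] by (auto simp: coeff_pCons split: nat.splits)
  ultimately show ?case using sr_diff[OF R] by simp
qed (use G in auto)

lemma subleading_power:
  fixes G :: "'a::idom poly"
  assumes m: "lead_coeff G = 1" and d: "degree G > 0"
  shows "degree (G ^ n) = n * degree G" "lead_coeff (G ^ n) = 1"
    "n > 0 \<Longrightarrow> coeff (G ^ n) (n * degree G - 1) = of_nat n * coeff G (degree G - 1)"
proof -
  have G0: "G \<noteq> 0" using d by auto
  show dn: "degree (G ^ n) = n * degree G" for n by (rule degree_power_eq[OF G0])
  show ln: "lead_coeff (G ^ n) = 1" for n using m by (simp add: lead_coeff_power)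
  have two: "coeff (A * B) (degree A + degree B - 1) = coeff A (degree A - 1) * lead_coeff B + lead_coeff A * coeff B (degree B - 1)"
    if "degree A > 0" "degree B > 0" for A B :: "'a poly"
  proof -
    define a b where "a = degree A" and "b = degree B"
    have "coeff (A * B) (a + b - 1) = (\<Sum>i\<in>{a - 1, a}. coeff A i * coeff B (a + b - 1 - i))"
      unfolding coeff_mult
    proof (rule sum.mono_neutral_right)
      show "\<forall>i\<in>{..a + b - 1} - {a - 1, a}. coeff A i * coeff B (a + b - 1 - i) = 0"
      proof
        fix i assume "i \<in> {..a + b - 1} - {a - 1, a}"
        then have "i > a \<or> a + b - 1 - i > b" using that by (auto simp: a_def b_def)
        then show "coeff A i * coeff B (a + b - 1 - i) = 0" by (auto simp: a_def b_def coeff_eq_0)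
      qed
    qed (use that in \<open>auto simp: a_def b_def\<close>)
    moreover have "a + b - 1 - (a - 1) = b" "a + b - 1 - a = b - 1" "a - 1 \<noteq> a" using that by (auto simp: a_def b_def)
    ultimately show ?thesis by (simp add: a_def b_def)
  qed
  show "n > 0 \<Longrightarrow> coeff (G ^ n) (n * degree G - 1) = of_nat n * coeff G (degree G - 1)"
  proof (induction n)
    case (Suc n)
    show ?case
    proof (cases "n = 0")
      case False
      then have "degree (G ^ n) > 0" using dn d by simp
      from two[OF d this] show ?thesis
        using Suc.IH False m ln[of n] by (simp add: dn algebra_simps)
    qed simp
  qed simp
qed

lemma subleading_shift:
  fixes P :: "'a::idom poly"
  assumes m: "lead_coeff P = 1" and d: "degree P > 0"
  shows "coeff (pcompose P [:b, 1:]) (degree P - 1) = coeff P (degree P - 1) + of_nat (degree P) * b"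
proof -
  define n where "n = degree P"
  have "pcompose P [:b, 1:] = (\<Sum>i\<le>n. smult (coeff P i) ([:b, 1:] ^ i))"
    unfolding n_def
    by (subst poly_as_sum_of_monoms[symmetric], subst pcompose_sum, intro sum.cong refl)
      (simp add: monom_altdef pcompose_smult pcompose_power pcompose_pCons)
  then have "coeff (pcompose P [:b, 1:]) (n - 1) = (\<Sum>i\<le>n. coeff P i * coeff ([:b, 1:] ^ i) (n - 1))" by (simp add: coeff_sum)
  also have "\<dots> = (\<Sum>i\<in>{n - 1, n}. coeff P i * coeff ([:b, 1:] ^ i) (n - 1))"
  proof (rule sum.mono_neutral_right)
    show "\<forall>i\<in>{..n} - {n - 1, n}. coeff P i * coeff ([:b, 1:] ^ i) (n - 1) = 0"
    proof
      fix i assume "i \<in> {..n} - {n - 1, n}"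
      then have "i < n - 1" by auto
      then have "degree ([:b, 1:] ^ i) < n - 1" by (simp add: degree_power_eq)
      then show "coeff P i * coeff ([:b, 1:] ^ i) (n - 1) = 0" by (simp add: coeff_eq_0)
    qed
  qed auto
  also have "\<dots> = coeff P (n - 1) + of_nat n * b"
  proof -
    have n0: "n > 0" using d by (simp add: n_def)
    have lb: "lead_coeff [:b, 1:] = 1" "degree [:b, 1:] = 1" "degree [:b, 1:] > 0" by auto
    have "coeff ([:b, 1:] ^ (n - 1)) (n - 1) = 1" using subleading_power(1,2)[OF lb(1,3), of "n - 1"] by simp
    moreover have "coeff ([:b, 1:] ^ n) (n - 1) = of_nat n * b" using subleading_power(3)[OF lb(1,3) n0] by simp
    moreover have "n - 1 \<noteq> n" using n0 by simp
    moreover have "coeff P n = 1" using m by (simp add: n_def)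
    ultimately show ?thesis by simp
  qed
  finally show ?thesis by (simp add: n_def)
qed

text \<open>The subleading coefficient shows that centred polynomials have centred stages.\<close>

lemma stage_subleading:
  fixes G :: "'a::idom poly"
  assumes p: "p \<ge> 2" and m: "lead_coeff G = 1" and d: "degree G > 0"
  shows "lead_coeff (stage p c j G) = 1 \<and> degree (stage p c j G) = p ^ j * degree G \<and>
    coeff (stage p c j G) (p ^ j * degree G - 1) = of_nat (p ^ j) * coeff G (degree G - 1)"
proof (induction j)
  case (Suc j)
  define S where "S = stage p c j G"
  have S: "lead_coeff S = 1" "degree S = p ^ j * degree G" and dS: "degree S > 0"
    and sub: "coeff S (degree S - 1) = of_nat (p ^ j) * coeff G (degree G - 1)"
    using Suc d p by (auto simp: S_def)
  note pw = subleading_power[OF S(1) dS, of p]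
  have dp: "degree (S ^ p) \<ge> 2" using pw(1) dS p mult_le_mono[of 2 p 1 "degree S"] by simp
  have dd: "degree (S ^ p - [:c j:]) = p * degree S" using degree_diff_const[of "S ^ p" "c j"] dp unfolding pw(1) by linarith
  have "coeff (S ^ p - [:c j:]) k = coeff (S ^ p) k" if "k > 0" for k using that by (auto simp: coeff_pCons split: nat.splits)
  moreover have "p * degree S > 0" "p * degree S - 1 > 0" using dp unfolding pw(1) by linarith+
  ultimately have "lead_coeff (S ^ p - [:c j:]) = 1" "coeff (S ^ p - [:c j:]) (p * degree S - 1) = of_nat p * coeff S (degree S - 1)"
    using pw(2,3) p unfolding dd pw(1) by auto
  then show ?case using dd sub S by (simp add: S_def mult.assoc)
qed (use m in auto)

text \<open>In the factorisation of \<open>G ^ n - H ^ n\<close> the cofactor of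
  \<open>G - H\<close> has leading coefficient \<open>n\<close>.\<close>

lemma monic_power_inject:
  fixes G H :: "'a::{idom,ring_char_0} poly"
  assumes "lead_coeff G = 1" "lead_coeff H = 1" "degree G = degree H" "G ^ n = H ^ n" "n > 0"
  shows "G = H"
proof (rule ccontr)
  assume "G \<noteq> H"
  have "(G - H) * (\<Sum>i<n. H ^ (n - Suc i) * G ^ i) = 0" using power_diff_sumr2[of G n H] assms(4) by simp
  then have z: "(\<Sum>i<n. H ^ (n - Suc i) * G ^ i) = 0" using \<open>G \<noteq> H\<close> by simp
  have G0: "G \<noteq> 0" "H \<noteq> 0" using assms by auto
  have "coeff (H ^ (n - Suc i) * G ^ i) ((n - 1) * degree G) = 1" if "i < n" for i
  proof -
    have "degree (H ^ (n - Suc i) * G ^ i) = (n - Suc i) * degree G + i * degree G"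
      using G0 assms(3) by (simp add: degree_mult_eq degree_power_eq)
    also have "\<dots> = (n - 1) * degree G" using that by (simp flip: add_mult_distrib)
    finally show ?thesis using assms(1,2) by (metis lead_coeff_mult lead_coeff_power mult_1 power_one)
  qed
  then have "coeff (\<Sum>i<n. H ^ (n - Suc i) * G ^ i) ((n - 1) * degree G) = of_nat n"
    by (simp add: coeff_sum)
  then show False using z assms(5) by simp
qed

lemma stage_inject:
  fixes G H :: "'a::{idom,ring_char_0} poly"
  assumes p: "p \<ge> 2" and "lead_coeff G = 1" "lead_coeff H = 1" "degree G = degree H" "degree G > 0"
    and "stage p c j G = stage p c j H"
  shows "G = H"
  using assms(6)
proof (induction j)
  case (Suc j)
  have pw: "stage p c j G ^ p = stage p c j H ^ p" using Suc.prems by simp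
  have mo: "lead_coeff (stage p c j G) = 1" "lead_coeff (stage p c j H) = 1" "degree (stage p c j G) = degree (stage p c j H)"
    using stage_subleading[OF p, of G c j] stage_subleading[OF p, of H c j] assms by auto
  have "stage p c j G = stage p c j H" by (rule monic_power_inject[OF mo pw]) (use p in simp)
  then show ?case by (rule Suc.IH)
qed simp

lemma primitive_root_ex:
  assumes p: "prime p"
  obtains \<omega> :: "'a::{alg_closed_field, field_char_0}" where "\<omega> ^ p = 1" "\<And>m. \<not> p dvd m \<Longrightarrow> \<omega> ^ m \<noteq> 1"
proof -
  define P where "P = (\<Sum>i\<le>p - 1. monom (1::'a) i)"
  have p2: "p \<ge> 2" using p by (rule prime_ge_2_nat)
  have "coeff P (p - 1) = 1" unfolding P_def poly_of_coeffs by simp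
  then have "degree P \<ge> p - 1" by (intro le_degree) simp
  then have "degree P > 0" using p2 by simp
  then obtain \<omega> where \<omega>: "poly P \<omega> = 0" using alg_closed_imp_poly_has_root by blast
  then have s0: "(\<Sum>i\<le>p - 1. \<omega> ^ i) = 0" unfolding P_def poly_of_coeffs by simp
  have at: "{..p - 1} = {..<p}" using p2 by auto
  have \<omega>p: "\<omega> ^ p = 1" using power_diff_1_eq[of \<omega> p] s0 p2 unfolding at by simp
  have \<omega>1: "\<omega> \<noteq> 1" using s0 p2 by auto
  have "\<omega> ^ m \<noteq> 1" if m: "\<not> p dvd m" for m
  proof
    assume m1: "\<omega> ^ m = 1"
    have "coprime m p" using p m by (metis coprime_commute prime_imp_coprime)
    moreover have "m \<noteq> 0" using m by (metis dvd_0_right)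
    ultimately obtain a b where ab: "m * a = p * b + 1" using coprime_bezout_strong[of m p] p2 by (metis One_nat_def Suc_1 Suc_n_not_le_n)
    have "\<omega> ^ (m * a) = 1" by (simp add: power_mult m1)
    moreover have "\<omega> ^ (p * b + 1) = \<omega>" by (simp add: power_add power_mult \<omega>p)
    ultimately show False using ab \<omega>1 by simp
  qed
  then show thesis using that \<omega>p by blast
qed

text \<open>Once f = g o s is known, with s the composition of the maps already split off, the
  induction examines h = s o g: it is monic and centred like \<open>g\<close>, and postcritically
  finite because each rotation is semiconjugate to its predecessor, whereas \<open>g\<close> alone
  need not be. \<open>S\<close> is a subfield that has to contain the constants.\<close>

theorem unicritical_decomposition:
  fixes f :: "'a::{alg_closed_field, field_char_0} poly" and S :: "'a set"
  assumes f: "pcf_prime_power p e f" and alg: "\<And>x::'a. algebraic x"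
    and cen: "coeff f (degree f - 1) = 0"
    and S: "unital_subring S" "\<And>x. x \<in> S \<Longrightarrow> inverse x \<in> S" "\<And>i. coeff f i \<in> S"
    and ncheb: "\<not> linearly_conjugate f (map_poly of_int (chebyshev (degree f)))"
      "\<not> linearly_conjugate f (- map_poly of_int (chebyshev (degree f)))"
  obtains c where "\<And>i. i < e \<Longrightarrow> c i \<in> S" "\<And>i. i < e \<Longrightarrow> algebraic_int (c i)" "f = stage p c e [:0, 1:]"
proof -
  interpret f: pcf_prime_power p e f by (rule f)
  have p2: "p \<ge> 2" using f.p by (rule prime_ge_2_nat)
  have AI: "unital_subring {x::'a. algebraic_int x}" by (rule algebraic_int_subring)
  have Snat: "x / of_nat n \<in> S" if "x \<in> S" for x n
    using sr_mult[OF S(1) that S(2)[OF sr_nat[OF S(1)]], of n] by (simp add: divide_inverse)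
  define decomp where "decomp j c g \<longleftrightarrow> (\<forall>i<j. c i \<in> S \<and> algebraic_int (c i)) \<and> f = pcompose g (stage p c j [:0, 1:]) \<and>
    (\<forall>i. coeff g i \<in> S \<and> algebraic_int (coeff g i)) \<and> lead_coeff g = 1 \<and> degree g = p ^ (e - j) \<and>
    pcf (stage p c j g) \<and> coeff g (degree g - 1) = 0" for j c g
  have "\<exists>c g. decomp j c g" if "j \<le> e" for j
    using that
  proof (induction j)
    case 0
    have "decomp 0 (\<lambda>_. 0) f" unfolding decomp_def using S(3) f.ai f.m1 f.deg f.pcf cen by simp
    then show ?case by blast
  next
    case (Suc j)
    then obtain c g where "decomp j c g" by auto
    then have c: "\<And>i. i < j \<Longrightarrow> c i \<in> S" "\<And>i. i < j \<Longrightarrow> algebraic_int (c i)" and fg: "f = pcompose g (stage p c j [:0, 1:])"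
      and g: "\<And>i. coeff g i \<in> S" "\<And>i. algebraic_int (coeff g i)" "lead_coeff g = 1" "degree g = p ^ (e - j)"
      and pg: "pcf (stage p c j g)" and cg: "coeff g (degree g - 1) = 0"
      unfolding decomp_def by auto
    define h where "h = stage p c j g"
    have je: "j < e" using Suc.prems by simp
    have dg: "degree g > 0" using g(4) p2 by simp
    have "p ^ j * p ^ (e - j) = p ^ e" using je by (simp flip: power_add)
    then have h: "lead_coeff h = 1" "degree h = p ^ e" "coeff h (degree h - 1) = 0"
      using stage_subleading[OF p2 g(3) dg, of c j] cg g(4) by (auto simp: h_def)
    have hai: "algebraic_int (coeff h i)" for i
      unfolding h_def using stage_coeff[OF AI, of j c g p i] c g by auto
    interpret h: pcf_prime_power p e h
      by unfold_locales (use f.p f.e h hai pg in \<open>auto simp: h_def\<close>)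
    \<comment> \<open>For \<open>j = 0\<close> a Joukowski map would make \<open>f\<close> a
      Chebyshev polynomial up to sign and conjugacy. For later \<open>j\<close>, \<open>h\<close> is
      a \<open>p\<close>-th power minus a constant, which a Joukowski map with \<open>p > 2\<close>
      never is.\<close>
    have sparse: "coeff h m = 0" if pm: "\<not> p dvd m" for m
    proof (rule ccontr)
      assume nz: "coeff h m \<noteq> 0"
      obtain \<sigma> :: "'a \<Rightarrow> complex" and \<beta> where \<sigma>: "field_embedding \<sigma>" "\<beta> \<noteq> 0" "p \<noteq> 2"
        "\<And>u. u \<noteq> 0 \<Longrightarrow> poly (map_poly \<sigma> h) (u + \<sigma> \<beta> / u) = u ^ degree h + \<sigma> \<beta> / u ^ degree h"
        using h.sparse_or_joukowski[OF alg h(3) pm nz] by metis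
      show False
      proof (cases j)
        case 0
        then have "h = f" using fg by (simp add: h_def)
        then show False using joukowski_imp_chebyshev[OF \<sigma>(1,2) h.d2 \<sigma>(4)] ncheb by simp
      next
        case (Suc i)
        define G where "G = map_poly \<sigma> (stage p c i g)"
        have pw: "map_poly \<sigma> (Q ^ n) = map_poly \<sigma> Q ^ n" for Q n
          by (induction n) (simp_all add: emb_mult_poly[OF \<sigma>(1)] emb_1[OF \<sigma>(1)])
        have mh: "map_poly \<sigma> h = G ^ p - [:\<sigma> (c i):]"
        proof (rule poly_eqI)
          fix k
          have "coeff (map_poly \<sigma> h) k = \<sigma> (coeff (stage p c i g ^ p) k) - \<sigma> (coeff [:c i:] k)"
            by (simp add: h_def Suc emb_coeff[OF \<sigma>(1)] emb_diff[OF \<sigma>(1)])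
          also have "\<dots> = coeff (G ^ p) k - coeff [:\<sigma> (c i):] k"
            unfolding G_def pw[symmetric] by (simp add: emb_coeff[OF \<sigma>(1)] coeff_pCons emb_0[OF \<sigma>(1)] split: nat.splits)
          finally show "coeff (map_poly \<sigma> h) k = coeff (G ^ p - [:\<sigma> (c i):]) k" by simp
        qed
        have dG: "degree G > 0" using stage_subleading[OF p2 g(3) dg, of c i] dg p2 by (simp add: G_def emb_degree[OF \<sigma>(1)])
        have p3: "p > 2" using p2 \<sigma>(3) by simp
        have b0: "\<sigma> \<beta> \<noteq> 0" using \<sigma>(2) by (simp add: emb_eq_0[OF \<sigma>(1)])
        show False
          by (rule joukowski_not_power_plus_const[OF mh p3 dG b0]) (use \<sigma>(4) in \<open>simp add: emb_degree[OF \<sigma>(1)]\<close>)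
      qed
    qed
    \<comment> \<open>Sparsity passes from \<open>h\<close> to \<open>g\<close>: rotating the
      variable by \<open>\<omega>\<close> leaves \<open>h = stage p c j g\<close> unchanged, and
      \<open>stage_inject\<close> cancels the outer maps.\<close>
    obtain \<omega> :: 'a where \<omega>: "\<omega> ^ p = 1" "\<And>m. \<not> p dvd m \<Longrightarrow> \<omega> ^ m \<noteq> 1" using primitive_root_ex[OF f.p] by metis
    have \<omega>0: "\<omega> \<noteq> 0" using \<omega>(1) p2 by (auto simp: power_0_left split: if_splits)
    define g' where "g' = pcompose g [:0, \<omega>:]"
    have pdg: "p dvd degree g" using g(4) je by simp
    have \<omega>d: "\<omega> ^ degree g = 1" using pdg \<omega>(1) by (metis dvdE power_mult power_one)
    have dg': "degree g' = degree g" using \<omega>0 by (simp add: g'_def degree_pcompose)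
    have "stage p c j g' = pcompose h [:0, \<omega>:]" by (simp add: g'_def h_def stage_pcompose)
    also have "\<dots> = h"
    proof (rule poly_eqI)
      fix i show "coeff (pcompose h [:0, \<omega>:]) i = coeff h i"
        unfolding coeff_pcompose_linear using sparse[of i] \<omega>(1) by (cases "p dvd i") (auto simp: power_mult)
    qed
    finally have st_eq: "stage p c j g' = stage p c j g" by (simp add: h_def)
    have "lead_coeff g' = 1" unfolding dg' unfolding g'_def coeff_pcompose_linear using \<omega>d g(3) by simp
    moreover have "degree g' > 0" using dg dg' by simp
    ultimately have "g' = g" using stage_inject[OF p2 _ g(3) dg' _ st_eq] by blast
    then have gs: "coeff g m = 0" if "\<not> p dvd m" for m
      using coeff_pcompose_linear[of g \<omega> m] \<omega>(2)[OF that] by (simp add: g'_def)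
    define \<gamma> where "\<gamma> = p ^ (e - Suc j)"
    have \<gamma>0: "\<gamma> > 0" using p2 by (simp add: \<gamma>_def)
    have dg\<gamma>: "degree g = p * \<gamma>" using g(4) je by (simp add: \<gamma>_def Suc_diff_Suc flip: power_Suc)
    define g1 where "g1 = (\<Sum>i\<le>\<gamma>. monom (coeff g (p * i)) i)"
    have cg1: "coeff g1 i = coeff g (p * i)" for i
      unfolding g1_def poly_of_coeffs using p2 dg\<gamma> by (auto simp: coeff_eq_0)
    have dg1: "degree g1 = \<gamma>"
    proof (rule antisym)
      show "degree g1 \<le> \<gamma>" by (rule degree_le) (use p2 in \<open>auto simp: cg1 coeff_eq_0 dg\<gamma>\<close>)
      show "\<gamma> \<le> degree g1" by (rule le_degree) (use g(3) in \<open>simp add: cg1 flip: dg\<gamma>\<close>)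
    qed
    have lg1: "lead_coeff g1 = 1" using g(3) by (simp add: dg1 cg1 dg\<gamma>)
    have g_g1: "g = pcompose g1 (monom 1 p)"
    proof (rule poly_eqI)
      fix i
      have "pcompose g1 (monom 1 p) = (\<Sum>k\<le>\<gamma>. smult (coeff g (p * k)) (monom 1 (p * k)))"
        unfolding g1_def pcompose_sum
        by (intro sum.cong refl) (simp add: monom_altdef pcompose_smult pcompose_power pcompose_pCons power_mult)
      then have "coeff (pcompose g1 (monom 1 p)) i = (\<Sum>k\<le>\<gamma>. if p * k = i then coeff g i else 0)"
        by (simp add: coeff_sum if_distrib cong: if_cong)
      also have "\<dots> = coeff g i"
      proof (cases "p dvd i")
        case True
        then obtain k where k: "i = p * k" by blast
        have "(\<Sum>k'\<le>\<gamma>. if p * k' = i then coeff g i else 0) = (\<Sum>k'\<le>\<gamma>. if k' = k then coeff g i else 0)"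
          using p2 by (intro sum.cong refl) (auto simp: k)
        then show ?thesis using p2 dg\<gamma> k by (auto simp: coeff_eq_0)
      next
        case False then show ?thesis using gs[OF False] by (auto intro!: sum.neutral)
      qed
      finally show "coeff g i = coeff (pcompose g1 (monom 1 p)) i" by simp
    qed
    define \<kappa> where "\<kappa> = coeff g1 (\<gamma> - 1)"
    \<comment> \<open>This constant centres \<open>g1\<close>: for
      \<open>g2 = pcompose g1 [:b, 1:]\<close> it gives
      \<open>g = pcompose g2 (monom 1 p - [:b:])\<close>.\<close>
    define b where "b = - \<kappa> / of_nat \<gamma>"
    have bS: "b \<in> S" using Snat[OF sr_minus[OF S(1) g(1)]] by (simp add: b_def \<kappa>_def cg1)
    have \<kappa>ai: "algebraic_int \<kappa>" using g(2) by (simp add: \<kappa>_def cg1)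
    \<comment> \<open>Division by \<open>\<gamma>\<close>, a power of \<open>p\<close>, endangers
      integrality. For \<open>\<gamma> > 1\<close> the derivative condition on \<open>h\<close>
      makes \<open>n * b\<close> integral with \<open>n = p ^ (e - 1) - 1\<close>;
      \<open>\<gamma> * b\<close> is integral too, and \<open>n\<close> is prime to
      \<open>\<gamma>\<close>.\<close>
    have bai: "algebraic_int b"
    proof (cases "e = Suc j")
      case True
      then have "\<gamma> = 1" by (simp add: \<gamma>_def)
      then show ?thesis using \<kappa>ai by (simp add: b_def)
    next
      case False
      then have e2: "e \<ge> 2" using je by auto
      have hH: "h = pcompose (stage p c j g1) (monom 1 p)" unfolding h_def g_g1 stage_pcompose ..
      have dp: "p ^ j * \<gamma> = p ^ (e - 1)" using je by (simp add: \<gamma>_def flip: power_add)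
      define H where "H = stage p c j g1"
      have H: "degree H = p ^ (e - 1)" "coeff H (p ^ (e - 1) - 1) = of_nat (p ^ j) * \<kappa>"
        using stage_subleading[OF p2 lg1, of c j] \<gamma>0 dg1 dp by (auto simp: H_def \<kappa>_def)
      have coeffs: "coeff (pcompose H (monom 1 p)) (p * k) = coeff H k" for k
      proof -
        have "pcompose H (monom 1 p) = (\<Sum>i\<le>degree H. smult (coeff H i) (monom 1 (p * i)))"
          by (subst poly_as_sum_of_monoms[symmetric], subst pcompose_sum, intro sum.cong refl)
            (simp add: monom_altdef pcompose_smult pcompose_power pcompose_pCons power_mult)
        then have "coeff (pcompose H (monom 1 p)) (p * k) = (\<Sum>i\<le>degree H. if i = k then coeff H k else 0)"
          using p2 by (simp add: coeff_sum if_distrib cong: if_cong)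
        then show ?thesis by (auto simp: coeff_eq_0)
      qed
      define n where "n = p ^ (e - 1) - 1"
      have ch: "coeff h (p * n) = of_nat (p ^ j) * \<kappa>" using H(2) coeffs[of n] by (simp add: hH H_def[symmetric] n_def)
      have "algebraic_int (of_nat (p * n) * coeff h (p * n) / of_nat (degree h))" by (rule h.coeff_derivative)
      also have "of_nat (p * n) * coeff h (p * n) / of_nat (degree h) = - (of_nat n * b)"
      proof -
        have "degree h = p * p ^ j * \<gamma>" unfolding h(2) using dp f.e by (metis mult.assoc power_eq_if not_one_le_zero)
        then show ?thesis using p2 \<gamma>0 by (simp add: ch b_def)
      qed
      finally have nb: "algebraic_int (of_nat n * b)" by simp
      have gb: "algebraic_int (of_nat \<gamma> * b)" using \<kappa>ai \<gamma>0 by (simp add: b_def)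
      have "coprime n \<gamma>"
      proof -
        have "p dvd p ^ (e - 1)" using e2 by (intro dvd_power) auto
        moreover have "p ^ (e - 1) - n = 1" using p2 by (simp add: n_def)
        ultimately have "p dvd n \<Longrightarrow> p dvd 1" using dvd_diff_nat[of p "p ^ (e - 1)" n] by simp
        then have "\<not> p dvd n" using p2 by auto
        then show ?thesis unfolding \<gamma>_def using f.p by (metis coprime_commute coprime_power_left_iff prime_imp_coprime)
      qed
      then have "coprime (int n) (int \<gamma>)" by simp
      then obtain u v where uv: "u * int n + v * int \<gamma> = 1"
        using bezout_int[of "int n" "int \<gamma>"] by (auto simp: coprime_iff_gcd_eq_1)
      have "of_int u * of_nat n + of_int v * of_nat \<gamma> = (1::'a)"
        using arg_cong[OF uv, of "of_int :: int \<Rightarrow> 'a"] by simp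
      then have "b = (of_int u * of_nat n + of_int v * of_nat \<gamma>) * b" by simp
      also have "\<dots> = of_int u * (of_nat n * b) + of_int v * (of_nat \<gamma> * b)" by (simp add: distrib_right mult.assoc)
      finally show ?thesis using nb gb algebraic_int_of_int by (metis algebraic_int_add algebraic_int_mult)
    qed
    define g2 where "g2 = pcompose g1 [:b, 1:]"
    define c' where "c' = c(j := b)"
    have lin: "pcompose [:b, 1:] (P - [:b:]) = P" for P :: "'a poly" by (simp add: pcompose_pCons)
    have dg2: "degree g2 = \<gamma>" by (simp add: g2_def degree_pcompose dg1)
    have lg2: "lead_coeff g2 = 1" using lead_coeff_comp[of "[:b, 1:]" g1] lg1 by (simp add: g2_def)
    have g_g2: "g = pcompose g2 (monom 1 p - [:b:])" unfolding g2_def pcompose_assoc[symmetric] lin by (rule g_g1)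
    have stc: "stage p c' j G = stage p c j G" for G by (rule stage_cong) (simp add: c'_def)
    have cg2: "coeff g2 (\<gamma> - 1) = 0"
      using subleading_shift[of g1 b] lg1 dg1 \<gamma>0 by (simp add: g2_def b_def \<kappa>_def)
    have "decomp (Suc j) c' g2" unfolding decomp_def
    proof (intro conjI allI impI)
      fix i assume "i < Suc j"
      then show "c' i \<in> S" "algebraic_int (c' i)" using c bS bai by (auto simp: c'_def less_Suc_eq)
    next
      have "f = pcompose g2 (pcompose (monom 1 p - [:b:]) (stage p c j [:0, 1:]))"
        unfolding pcompose_assoc g_g2[symmetric] by (rule fg)
      also have "pcompose (monom 1 p - [:b:]) (stage p c j [:0, 1:]) = stage p c' (Suc j) [:0, 1:]"
        by (simp add: stc) (simp add: c'_def pcompose_diff monom_altdef pcompose_smult pcompose_power pcompose_pCons)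
      finally show "f = pcompose g2 (stage p c' (Suc j) [:0, 1:])" .
    next
      fix i
      have lc: "coeff [:b, 1:] i \<in> R" if "unital_subring R" "b \<in> R" for R i
        using that sr_0 sr_1 by (auto simp: coeff_pCons split: nat.splits)
      show "coeff g2 i \<in> S" unfolding g2_def
        by (intro sr_coeff_pcompose S(1) lc bS) (simp add: cg1 g(1))
      have "coeff g2 i \<in> {x. algebraic_int x}" unfolding g2_def
        by (intro sr_coeff_pcompose AI lc) (use bai g(2) in \<open>auto simp: cg1\<close>)
      then show "algebraic_int (coeff g2 i)" by simp
    next
      show "lead_coeff g2 = 1" by (rule lg2)
      show "degree g2 = p ^ (e - Suc j)" by (simp add: dg2 \<gamma>_def)
      show "coeff g2 (degree g2 - 1) = 0" using cg2 by (simp add: dg2)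
      \<comment> \<open>Moving T^p - b from the inside of \<open>A\<close> to the outside gives a
        map to which \<open>h\<close> is semiconjugate via T^p - b. Its critical points are zeros of
        \<open>A\<close>, whose image \<open>- b\<close> comes from the critical point 0 of
        \<open>h\<close>, and zeros of \<open>pderiv A\<close>, which lift to critical points of
        \<open>h\<close>.\<close>
      show "pcf (stage p c' (Suc j) g2)"
      proof -
        define A where "A = stage p c j g2"
        have hA: "h = pcompose A (monom 1 p - [:b:])" unfolding h_def A_def g_g2 stage_pcompose ..
        have st: "stage p c' (Suc j) g2 = A ^ p - [:b:]" by (simp add: A_def stc) (simp add: c'_def)
        have hx: "poly h x = poly A (x ^ p - b)" for x by (simp add: hA poly_pcompose poly_monom)
        have push: "preperiodic (poly (A ^ p - [:b:])) (x ^ p - b)" if "preperiodic (poly h) x" for x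
          by (rule preperiodic_semiconj[OF that]) (simp add: hx)
        have dh: "pderiv h = pcompose (pderiv A) (monom 1 p - [:b:]) * monom (of_nat p) (p - 1)"
          unfolding hA pderiv_pcompose by (simp add: pderiv_diff pderiv_monom pderiv_pCons)
        show ?thesis unfolding pcf_def st
        proof (intro allI impI)
          fix z assume "poly (pderiv (A ^ p - [:b:])) z = 0"
          then have "poly A z = 0 \<or> poly (pderiv A) z = 0"
            using p2 by (auto simp: pderiv_diff pderiv_power pderiv_pCons)
          then show "preperiodic (poly (A ^ p - [:b:])) z"
          proof
            assume z: "poly A z = 0"
            have "poly (pderiv h) 0 = 0" using p2 by (simp add: dh poly_monom power_0_left)
            then have "preperiodic (poly h) 0" using h.pcf by (simp add: pcf_def)
            from push[OF this] have "preperiodic (poly (A ^ p - [:b:])) (poly (A ^ p - [:b:]) z)"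
              using z by simp
            then show ?thesis by (simp only: preperiodic_step)
          next
            assume z: "poly (pderiv A) z = 0"
            obtain x where x: "x ^ p = z + b" using nth_root_exists[of p "z + b"] p2 by auto
            have "poly (pderiv h) x = 0" using z x by (simp add: dh poly_pcompose poly_monom)
            then have "preperiodic (poly h) x" using h.pcf by (simp add: pcf_def)
            from push[OF this] show ?thesis using x by simp
          qed
        qed
      qed
    qed
    then show ?case by blast
  qed
  then obtain c g where "decomp e c g" by blast
  then have c: "\<And>i. i < e \<Longrightarrow> c i \<in> S" "\<And>i. i < e \<Longrightarrow> algebraic_int (c i)" and fg: "f = pcompose g (stage p c e [:0, 1:])"
    and g: "lead_coeff g = 1" "degree g = 1" "coeff g 0 = 0" unfolding decomp_def by auto
  have "g = [:0, 1:]"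
  proof (rule poly_eqI)
    fix i :: nat
    consider "i = 0" | "i = 1" | "i > 1" by linarith
    then show "coeff g i = coeff [:0, 1:] i"
      by cases (use g in \<open>auto simp: coeff_eq_0 coeff_pCons split: nat.splits\<close>)
  qed
  then have "f = stage p c e [:0, 1:]" using fg by (simp add: pcompose_pCons)
  then show thesis using that c by blast
qed

subsection \<open>Congruences at a place\<close>

text \<open>Only the triangle inequality is available here. All powers of \<open>x\<close> are
  integer combinations of \<open>1, ..., x ^ (n - 1)\<close>, and integers have value at most 1, so
  the powers of \<open>v x\<close> are bounded.\<close>

lemma place_above_algebraic_int_le_1:
  fixes x :: "'a::field_char_0"
  assumes v: "place_above p v" and x: "algebraic_int x"
  shows "v x \<le> 1"
proof (rule ccontr)
  assume "\<not> v x \<le> 1"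
  then have v1: "1 < v x" by simp
  have av: "\<And>x y. v (x * y) = v x * v y" "\<And>x y. v (x + y) \<le> v x + v y" "\<And>x. 0 \<le> v x" "v 0 = 0"
    using v by (auto simp: place_above_def absolute_value_def)
  have vint: "v (of_int n) \<le> 1" for n :: int
  proof (cases "n = 0")
    case False
    then have e: "v (of_int n) = (1 / real p) ^ multiplicity (int p) n" using v by (auto simp: place_above_def)
    show ?thesis unfolding e by (intro power_le_one) (auto simp: divide_le_eq)
  qed (simp add: av)
  obtain P where P: "lead_coeff P = 1" "\<And>i. coeff P i \<in> \<int>" "poly P x = 0" using x by (auto simp: algebraic_int.simps)
  define n where "n = degree P"
  have n0: "n > 0"
  proof (rule ccontr)
    assume "\<not> n > 0" then obtain c where "P = [:c:]" by (auto simp: n_def elim: degree_eq_zeroE)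
    then show False using P by auto
  qed
  have sp: "{..n} = insert n {..<n}" by auto
  have xn: "x ^ n = (\<Sum>i<n. - coeff P i * x ^ i)"
    using P(3) P(1) unfolding poly_altdef n_def[symmetric] sp by (simp add: sum_negf eq_neg_iff_add_eq_0)
  define D where "D = {y. \<exists>a. (\<forall>i. a i \<in> \<int>) \<and> y = (\<Sum>i<n. a i * x ^ i)}"
  have D_mult: "x * y \<in> D" if yD: "y \<in> D" for y
  proof -
    obtain a where a: "\<And>i. a i \<in> \<int>" "y = (\<Sum>i<n. a i * x ^ i)" using yD by (auto simp: D_def)
    obtain m where m: "n = Suc m" using n0 by (cases n) auto
    have "x * y = (\<Sum>i<n. a i * x ^ Suc i)" unfolding a(2) sum_distrib_left by (intro sum.cong refl) simp
    also have "\<dots> = (\<Sum>i<m. a i * x ^ Suc i) + a m * x ^ n" by (simp add: m)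
    also have "(\<Sum>i<m. a i * x ^ Suc i) = (\<Sum>i<n. (if i = 0 then 0 else a (i - 1)) * x ^ i)"
      unfolding m sum.lessThan_Suc_shift by simp
    also have "\<dots> + a m * x ^ n = (\<Sum>i<n. ((if i = 0 then 0 else a (i - 1)) - a m * coeff P i) * x ^ i)"
      unfolding xn sum_distrib_left by (simp add: left_diff_distrib sum_subtractf sum_negf mult.assoc)
    finally show ?thesis unfolding D_def
      using a(1) P(2) by (intro CollectI exI conjI allI) (auto intro!: Ints_diff Ints_mult)
  qed
  have "x ^ N \<in> D" for N
  proof (induction N)
    case 0
    have "x ^ 0 = (\<Sum>i<n. (if i = 0 then 1 else 0) * x ^ i)"
      using n0 by (simp add: if_distrib[of "\<lambda>t. t * _"] sum.delta cong: if_cong)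
    then show ?case unfolding D_def by (intro CollectI exI[of _ "\<lambda>i. if i = 0 then 1 else 0"]) auto
  qed (use D_mult in simp)
  moreover have "v y \<le> (\<Sum>i<n. v (x ^ i))" if yD: "y \<in> D" for y
  proof -
    obtain a where a: "\<And>i. a i \<in> \<int>" "y = (\<Sum>i<n. a i * x ^ i)" using yD by (auto simp: D_def)
    have tri: "v (sum f A) \<le> (\<Sum>i\<in>A. v (f i))" for f :: "nat \<Rightarrow> 'a" and A
      by (induction A rule: infinite_finite_induct) (auto simp: av intro: order_trans[OF av(2)])
    have "v y \<le> (\<Sum>i<n. v (a i * x ^ i))" unfolding a(2) by (rule tri)
    also have "\<dots> \<le> (\<Sum>i<n. v (x ^ i))"
    proof (rule sum_mono)
      fix i
      obtain k where "a i = of_int k" using a(1)[of i] by (auto elim: Ints_cases)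
      then show "v (a i * x ^ i) \<le> v (x ^ i)" using vint[of k] av(3) by (simp add: av(1) mult_left_le_one_le)
    qed
    finally show ?thesis .
  qed
  moreover have "v (x ^ N) = v x ^ N" for N
  proof (induction N)
    case 0
    have "v 1 = v (of_int 1)" by simp
    also have "\<dots> = 1" using v by (simp add: place_above_def del: of_int_1)
    finally show ?case by simp
  qed (simp add: av)
  ultimately have "v x ^ N \<le> (\<Sum>i<n. v (x ^ i))" for N by metis
  moreover obtain N where "(\<Sum>i<n. v (x ^ i)) < v x ^ N" using real_arch_pow[OF v1] by blast
  ultimately show False by (metis not_le)
qed

locale place =
  fixes v :: "'a::field_char_0 \<Rightarrow> real" and p :: nat
  assumes pl: "place_above p v" and um: "\<And>x y. v (x + y) \<le> max (v x) (v y)" and p: "prime p"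
begin

lemma v_0 [simp]: "v 0 = 0" and v_nonneg: "0 \<le> v x" and v_eq_0: "v x = 0 \<longleftrightarrow> x = 0" and v_mult: "v (x * y) = v x * v y"
  using pl by (auto simp: place_above_def absolute_value_def)

lemma v_ai: "algebraic_int x \<Longrightarrow> v x \<le> 1" using place_above_algebraic_int_le_1[OF pl] .

lemma v_1 [simp]: "v 1 = 1"
proof -
  have "v (1 * 1) = v 1 * v 1" by (rule v_mult)
  then show ?thesis using v_eq_0[of 1] by simp
qed

lemma v_p: "v (of_nat p) = 1 / real p"
proof -
  have "v (of_int (int p)) = (1 / real p) ^ multiplicity (int p) (int p)"
    using pl p unfolding place_above_def by (metis of_nat_0_eq_iff prime_gt_0_nat less_irrefl)
  moreover have "multiplicity (int p) (int p) = 1" using p by (intro multiplicity_self) auto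
  ultimately show ?thesis by simp
qed

lemma v_p_bounds: "0 < v (of_nat p)" "v (of_nat p) < 1"
  unfolding v_p using prime_gt_1_nat[OF p] by auto

lemma v_power: "v (x ^ n) = v x ^ n" by (induction n) (auto simp: v_mult)

lemma v_minus: "v (- x) = v x"
proof -
  have "v (- 1) * v (- 1) = 1" using v_mult[of "- 1" "- 1"] by simp
  then have "v (- 1) = 1" using v_nonneg[of "- 1"] by (metis abs_of_nonneg abs_square_eq_1 power2_eq_square)
  then show ?thesis using v_mult[of "- 1" x] by simp
qed

lemma v_inverse: "v (inverse x) = inverse (v x)"
proof (cases "x = 0")
  case False
  then have "v x * v (inverse x) = 1" using v_mult[of x "inverse x"] by simp
  then show ?thesis by (metis inverse_unique)
qed simp

lemma v_divide: "v (x / y) = v x / v y" by (simp add: divide_inverse v_mult v_inverse)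

lemma v_diff: "v (x - y) \<le> max (v x) (v y)" using um[of x "- y"] by (simp add: v_minus)
lemma v_diff_commute: "v (x - y) = v (y - x)" using v_minus[of "x - y"] by simp

lemma v_add_le: "v x \<le> r \<Longrightarrow> v y \<le> r \<Longrightarrow> v (x + y) \<le> r" using um[of x y] by simp
lemma v_diff_le: "v x \<le> r \<Longrightarrow> v y \<le> r \<Longrightarrow> v (x - y) \<le> r" using v_diff[of x y] by simp
lemma v_add_less: "v x < r \<Longrightarrow> v y < r \<Longrightarrow> v (x + y) < r" using um[of x y] by simp
lemma v_mult_le: "v x \<le> 1 \<Longrightarrow> v y \<le> 1 \<Longrightarrow> v (x * y) \<le> 1" by (simp add: v_mult mult_le_one v_nonneg)
lemma v_power_le: "v x \<le> 1 \<Longrightarrow> v (x ^ n) \<le> 1" by (simp add: v_power power_le_one v_nonneg)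

lemma v_add_eq: assumes "v x < v y" shows "v (x + y) = v y"
proof -
  have "v (x + y) \<le> v y" using um[of x y] assms by simp
  moreover have "v y \<le> max (v (x + y)) (v x)" using v_diff[of "x + y" x] by simp
  ultimately show ?thesis using assms by auto
qed

lemma v_sum_le: "(\<And>i. i \<in> A \<Longrightarrow> v (f i) \<le> r) \<Longrightarrow> 0 \<le> r \<Longrightarrow> v (sum f A) \<le> r"
  by (induction A rule: infinite_finite_induct) (auto intro: v_add_le)

text \<open>Congruence modulo the maximal ideal; it expresses equality in the residue field on
  representatives.\<close>

definition cg :: "'a \<Rightarrow> 'a \<Rightarrow> bool" where "cg x y \<longleftrightarrow> v (x - y) < 1"

lemma cg_refl: "cg x x" by (simp add: cg_def)
lemma cg_sym: "cg x y \<Longrightarrow> cg y x" by (simp add: cg_def v_diff_commute)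
lemma cg_trans: "cg x y \<Longrightarrow> cg y z \<Longrightarrow> cg x z"
  using v_add_less[of "x - y" 1 "y - z"] by (simp add: cg_def)
lemma cg_add: "cg x y \<Longrightarrow> cg z w \<Longrightarrow> cg (x + z) (y + w)"
  using v_add_less[of "x - y" 1 "z - w"] by (simp add: cg_def algebra_simps)
lemma cg_diff: "cg x y \<Longrightarrow> cg z w \<Longrightarrow> cg (x - z) (y - w)"
  using cg_add[of x y "- z" "- w"] by (simp add: cg_def v_diff_commute)
lemma cg_mult_left: assumes "cg x y" "v c \<le> 1" shows "cg (c * x) (c * y)"
proof -
  have "v (c * x - c * y) = v c * v (x - y)" by (simp add: v_mult flip: right_diff_distrib)
  also have "\<dots> \<le> v (x - y)" using assms(2) v_nonneg by (simp add: mult_left_le_one_le)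
  finally show ?thesis using assms(1) by (simp add: cg_def)
qed
lemma cg_mult: "cg x y \<Longrightarrow> cg z w \<Longrightarrow> v x \<le> 1 \<Longrightarrow> v w \<le> 1 \<Longrightarrow> cg (x * z) (y * w)"
  using cg_mult_left[of z w x] cg_mult_left[of x y w] cg_trans[of "x * z" "x * w" "y * w"] by (simp add: mult.commute)
lemma cg_power: "cg x y \<Longrightarrow> v x \<le> 1 \<Longrightarrow> v y \<le> 1 \<Longrightarrow> cg (x ^ n) (y ^ n)"
  by (induction n) (auto intro!: cg_mult v_power_le cg_refl)
lemma cg_sum: "(\<And>i. i \<in> A \<Longrightarrow> cg (f i) (g i)) \<Longrightarrow> cg (sum f A) (sum g A)"
  by (induction A rule: infinite_finite_induct) (auto intro: cg_refl cg_add)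
lemma cg_0: "cg x 0 \<longleftrightarrow> v x < 1" by (simp add: cg_def)
text \<open>That \<open>A\<close> is an integer polynomial in \<open>x\<close> and \<open>y\<close>
  is expressed by membership in every subring containing them. The form
  \<open>y ^ (p - 1) + x * B\<close> isolates the part of \<open>A\<close> free of \<open>x\<close>,
  which decides the value in \<open>equal_powers_value\<close>.\<close>

lemma binomial_prime:
  fixes x y :: 'a
  obtains A where "(x + y) ^ p = x ^ p + y ^ p + of_nat p * x * A"
    "\<And>R. unital_subring R \<Longrightarrow> x \<in> R \<Longrightarrow> y \<in> R \<Longrightarrow> A \<in> R" "\<exists>B. (\<forall>R. unital_subring R \<longrightarrow> x \<in> R \<longrightarrow> y \<in> R \<longrightarrow> B \<in> R) \<and> A = y ^ (p - 1) + x * B"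
proof -
  have p2: "p \<ge> 2" using p by (rule prime_ge_2_nat)
  obtain q where q: "p = Suc (Suc q)" using p2 by (metis Suc_le_D Suc_1 add_2_eq_Suc le_Suc_ex)
  define b where "b i = (p choose i) div p" for i
  have b: "p choose i = p * b i" if "0 < i" "i < p" for i
    using dvd_choose_prime[of i p] that p by (simp add: b_def)
  define A where "A = (\<Sum>i\<le>q. of_nat (b (Suc i)) * x ^ i * y ^ (Suc q - i))"
  have "(x + y) ^ p = (\<Sum>i\<le>p. of_nat (p choose i) * x ^ i * y ^ (p - i))" by (rule binomial_ring)
  also have "\<dots> = y ^ p + (\<Sum>i\<le>q. of_nat (p choose (Suc i)) * x ^ Suc i * y ^ (p - Suc i)) + x ^ p"
    unfolding q by (subst sum.atMost_Suc_shift, subst sum.atMost_Suc) (simp del: binomial_Suc_Suc power_Suc diff_Suc_Suc)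
  also have "(\<Sum>i\<le>q. of_nat (p choose (Suc i)) * x ^ Suc i * y ^ (p - Suc i)) = of_nat p * x * A"
    unfolding A_def sum_distrib_left
  proof (intro sum.cong refl)
    fix i assume "i \<in> {..q}"
    then have "p choose (Suc i) = p * b (Suc i)" using q by (intro b) auto
    then have 1: "of_nat (p choose (Suc i)) = (of_nat p * of_nat (b (Suc i)) :: 'a)" by (simp only: of_nat_mult)
    have 2: "p - Suc i = Suc q - i" using q by simp
    show "of_nat (p choose (Suc i)) * x ^ Suc i * y ^ (p - Suc i) = of_nat p * x * (of_nat (b (Suc i)) * x ^ i * y ^ (Suc q - i))"
      unfolding 1 2 power_Suc by (simp only: mult_ac)
  qed
  finally have 1: "(x + y) ^ p = x ^ p + y ^ p + of_nat p * x * A" by (simp add: algebra_simps)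
  define B where "B = (\<Sum>i<q. of_nat (b (Suc (Suc i))) * x ^ i * y ^ (q - i))"
  have "b 1 = 1" using p2 by (simp add: b_def)
  have "A = of_nat (b 1) * y ^ Suc q + (\<Sum>i<q. of_nat (b (Suc (Suc i))) * x ^ Suc i * y ^ (q - i))"
    unfolding A_def lessThan_Suc_atMost[symmetric] sum.lessThan_Suc_shift by simp
  also have "\<dots> = y ^ (p - 1) + x * B"
    unfolding B_def sum_distrib_left using \<open>b 1 = 1\<close> q by (simp add: mult_ac)
  finally have 2: "A = y ^ (p - 1) + x * B" .
  show thesis
  proof (rule that[OF 1])
    show "A \<in> R" if "unital_subring R" "x \<in> R" "y \<in> R" for R
      unfolding A_def using that by (intro sr_sum sr_mult sr_power sr_nat)
    show "\<exists>B. (\<forall>R. unital_subring R \<longrightarrow> x \<in> R \<longrightarrow> y \<in> R \<longrightarrow> B \<in> R) \<and> A = y ^ (p - 1) + x * B"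
      
    proof (intro exI[of _ B] conjI allI impI 2)
      fix R assume "unital_subring R" "x \<in> R" "y \<in> R"
      then show "B \<in> R" unfolding B_def by (intro sr_sum sr_mult sr_power sr_nat)
    qed
  qed
qed

lemma integers_subring: "unital_subring {x. v x \<le> 1}"
  unfolding unital_subring_def by (auto intro: v_diff_le v_mult_le)

lemma cg_frobenius1: assumes "v x \<le> 1" "v y \<le> 1" shows "cg ((x + y) ^ p) (x ^ p + y ^ p)"
proof -
  obtain A where A: "(x + y) ^ p = x ^ p + y ^ p + of_nat p * x * A"
    "\<And>R. unital_subring R \<Longrightarrow> x \<in> R \<Longrightarrow> y \<in> R \<Longrightarrow> A \<in> R" by (metis binomial_prime[of x y])
  have "v A \<le> 1" using A(2)[OF integers_subring] assms by auto
  then have "v (x * A) \<le> 1" using assms by (intro v_mult_le)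
  then have "v (of_nat p) * v (x * A) \<le> v (of_nat p) * 1" by (intro mult_left_mono v_nonneg)
  moreover have "v (of_nat p * x * A) = v (of_nat p) * v (x * A)" by (simp only: v_mult mult.assoc)
  ultimately have "v (of_nat p * x * A) < 1" using v_p_bounds(2) by linarith
  then show ?thesis unfolding cg_def A(1) by simp
qed

lemma cg_frobenius: assumes x: "v x \<le> 1" and y: "v y \<le> 1" shows "cg ((x + y) ^ (p ^ j)) (x ^ (p ^ j) + y ^ (p ^ j))"
proof (induction j)
  case 0 then show ?case by (simp add: cg_refl)
next
  case (Suc j)
  have i: "v ((x + y) ^ p ^ j) \<le> 1" "v (x ^ p ^ j) \<le> 1" "v (y ^ p ^ j) \<le> 1" "v (x ^ p ^ j + y ^ p ^ j) \<le> 1"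
    using x y by (auto intro!: v_power_le v_add_le)
  have e: "z ^ p ^ Suc j = (z ^ p ^ j) ^ p" for z :: 'a by (simp add: power_mult[symmetric] mult.commute)
  show ?case unfolding e by (rule cg_trans[OF cg_power[OF Suc.IH i(1,4)] cg_frobenius1[OF i(2,3)]])
qed

lemma cg_frobenius_sum:
  assumes "\<And>i. i \<in> A \<Longrightarrow> v (f i) \<le> 1"
  shows "cg ((sum f A) ^ (p ^ j)) (\<Sum>i\<in>A. f i ^ (p ^ j))"
  using assms
proof (induction A rule: infinite_finite_induct)
  case (insert a A)
  have "v (sum f A) \<le> 1" using insert by (intro v_sum_le) auto
  then have "cg ((f a + sum f A) ^ p ^ j) (f a ^ p ^ j + sum f A ^ p ^ j)" using insert by (intro cg_frobenius) auto
  moreover have "cg (f a ^ p ^ j + sum f A ^ p ^ j) (f a ^ p ^ j + (\<Sum>i\<in>A. f i ^ (p ^ j)))"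
    using insert by (intro cg_add cg_refl) auto
  ultimately show ?case unfolding sum.insert[OF insert.hyps] by (rule cg_trans)
qed (use prime_gt_0_nat[OF p] in \<open>auto simp: cg_refl power_0_left\<close>)

text \<open>Frobenius is injective on the residue field, since the \<open>p ^ j\<close>-th power of
  a difference is congruent to the difference of the powers.\<close>

lemma cg_root: assumes "cg (x ^ (p ^ j)) (y ^ (p ^ j))" "v x \<le> 1" "v y \<le> 1" shows "cg x y"
proof -
  have i: "v (x - y) \<le> 1" using assms by (intro v_diff_le)
  have "cg ((x - y + y) ^ p ^ j) ((x - y) ^ p ^ j + y ^ p ^ j)" by (rule cg_frobenius[OF i assms(3)])
  then have "cg (x ^ p ^ j - y ^ p ^ j) ((x - y) ^ p ^ j)"
    using cg_diff[OF _ cg_refl[of "y ^ p ^ j"], of "x ^ p ^ j"] by (metis add_diff_cancel_right' diff_add_cancel)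
  then have "cg ((x - y) ^ p ^ j) 0" using assms(1) cg_sym cg_trans unfolding cg_def by (metis diff_zero cg_def)
  then have "v (x - y) ^ p ^ j < 1" by (simp add: cg_0 v_power)
  then show ?thesis unfolding cg_def using one_le_power[of "v (x - y)" "p ^ j"] by (meson not_le)
qed

lemma pow_diff_factor:
  fixes x y :: 'a
  obtains A where "x ^ p - y ^ p = (x - y) * ((x - y) ^ (p - 1) + of_nat p * A)" "v x \<le> 1 \<Longrightarrow> v y \<le> 1 \<Longrightarrow> v A \<le> 1"
proof -
  obtain A where A: "(x - y + y) ^ p = (x - y) ^ p + y ^ p + of_nat p * (x - y) * A"
    "\<And>R. unital_subring R \<Longrightarrow> x - y \<in> R \<Longrightarrow> y \<in> R \<Longrightarrow> A \<in> R" by (metis binomial_prime[of "x - y" y])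
  show thesis
  proof (rule that)
    show "x ^ p - y ^ p = (x - y) * ((x - y) ^ (p - 1) + of_nat p * A)"
      using A(1) prime_gt_0_nat[OF p] by (simp add: algebra_simps power_eq_if)
    show "v A \<le> 1" if "v x \<le> 1" "v y \<le> 1" using A(2)[OF integers_subring] that v_diff_le by auto
  qed
qed

lemma pow_diff_contract:
  assumes x: "v x \<le> 1" and y: "v y \<le> 1" and \<kappa>: "v (x - y) \<le> \<kappa>" "v (of_nat p) \<le> \<kappa>" "\<kappa> \<le> 1"
  shows "v (x ^ p - y ^ p) \<le> \<kappa> * v (x - y)"
proof -
  obtain A where e: "x ^ p - y ^ p = (x - y) * ((x - y) ^ (p - 1) + of_nat p * A)" and vA: "v A \<le> 1"
    using pow_diff_factor[of x y] x y by metis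
  have p1: "p - 1 = Suc (p - 2)" using prime_ge_2_nat[OF p] by simp
  have "v ((x - y) ^ (p - 1)) = v (x - y) * v (x - y) ^ (p - 2)" unfolding p1 by (simp only: v_power power_Suc v_mult)
  also have "\<dots> \<le> v (x - y) * 1" using \<kappa> v_nonneg[of "x - y"] by (intro mult_left_mono power_le_one) auto
  finally have 1: "v ((x - y) ^ (p - 1)) \<le> \<kappa>" using \<kappa>(1) by simp
  have "v (of_nat p * A) \<le> v (of_nat p) * 1" using vA v_nonneg by (simp add: v_mult mult_left_le)
  then have 2: "v (of_nat p * A) \<le> \<kappa>" using \<kappa>(2) by simp
  have "v ((x - y) ^ (p - 1) + of_nat p * A) \<le> \<kappa>" using 1 2 by (rule v_add_le)
  then have "v (x - y) * v ((x - y) ^ (p - 1) + of_nat p * A) \<le> v (x - y) * \<kappa>" by (intro mult_left_mono v_nonneg)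
  then show ?thesis unfolding e v_mult by (simp only: mult.commute)
qed

text \<open>Over the residue field, a polynomial of degree at most \<open>n\<close> with
  \<open>n + 1\<close> distinct zeros vanishes. Synthetic division carries this out on
  representatives, with a remainder \<open>r\<close> that is only congruent to 0.\<close>

lemma lagrange_congruence:
  assumes "degree h \<le> n" "\<And>i. v (coeff h i) \<le> 1" "\<And>i. i \<le> n \<Longrightarrow> v (z i) \<le> 1"
    "\<And>i j. i \<le> n \<Longrightarrow> j \<le> n \<Longrightarrow> i \<noteq> j \<Longrightarrow> \<not> cg (z i) (z j)" "\<And>i. i \<le> n \<Longrightarrow> v (poly h (z i)) < 1"
  shows "v (coeff h k) < 1"
  using assms
proof (induction n arbitrary: h k)
  case 0
  then obtain c where "h = [:c:]" by (auto elim: degree_eq_zeroE)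
  then show ?case using 0(5)[of 0] by (auto simp: coeff_pCons split: nat.splits)
next
  case (Suc n)
  define g where "g = synthetic_div h (z (Suc n))"
  define r where "r = poly h (z (Suc n))"
  have hg: "h + smult (z (Suc n)) g = pCons r g" unfolding g_def r_def by (rule synthetic_div_correct)
  have zn: "v (z (Suc n)) \<le> 1" using Suc.prems(3) by simp
  have r1: "v r < 1" using Suc.prems(5) by (simp add: r_def)
  have dg: "degree g \<le> n" using Suc.prems(1) by (simp add: g_def degree_synthetic_div)
  have ceq: "coeff g i = coeff h (Suc i) + z (Suc n) * coeff g (Suc i)" for i
    using arg_cong[OF hg, of "\<lambda>q. coeff q (Suc i)"] by simp
  note hc = Suc.prems(2)
  have cg1: "v (coeff g i) \<le> 1" for i
  proof (induction "Suc n - i" arbitrary: i)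
    case 0
    then have "coeff g i = 0" using dg by (intro coeff_eq_0) auto
    then show ?case by simp
  next
    case (Suc m)
    then have "v (coeff g (Suc i)) \<le> 1" by auto
    then show ?case unfolding ceq[of i] using hc zn by (intro v_add_le v_mult_le)
  qed
  have pe: "poly h x = (x - z (Suc n)) * poly g x + r" for x
  proof -
    have "poly (h + smult (z (Suc n)) g) x = poly (pCons r g) x" by (simp only: hg)
    then show ?thesis by (simp add: algebra_simps)
  qed
  have "v (poly g (z i)) < 1" if i: "i \<le> n" for i
  proof -
    have "v ((z i - z (Suc n)) * poly g (z i)) < 1"
      using v_diff[of "poly h (z i)" r] Suc.prems(5)[of i] r1 i by (simp add: pe)
    moreover have "\<not> cg (z i) (z (Suc n))" using i by (intro Suc.prems(4)) auto
    then have "1 \<le> v (z i - z (Suc n))" by (simp add: cg_def)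
    then have "1 * v (poly g (z i)) \<le> v (z i - z (Suc n)) * v (poly g (z i))" using v_nonneg by (intro mult_right_mono)
    ultimately show ?thesis by (simp add: v_mult)
  qed
  then have IH: "v (coeff g k) < 1" for k
    using Suc.prems dg cg1 by (intro Suc.IH) auto
  have "coeff h k = coeff (pCons r g) k - z (Suc n) * coeff g k"
    using arg_cong[OF hg, of "\<lambda>q. coeff q k"] by (simp add: eq_diff_eq)
  moreover have "v (coeff (pCons r g) k) < 1" using IH r1 by (auto simp: coeff_pCons split: nat.splits)
  moreover have "v (z (Suc n) * coeff g k) < 1"
    using IH[of k] zn v_nonneg by (simp add: v_mult) (meson mult_left_le_one_le order_le_less_trans)
  ultimately show ?case using v_diff[of "coeff (pCons r g) k" "z (Suc n) * coeff g k"] by simp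
qed

text \<open>The partial sums of Horner's scheme for \<open>u\<close> are algebraic integers, and one of them is a unit
  at \<open>v\<close>.\<close>

lemma integral_fraction:
  assumes alg: "algebraic u" and u: "v u \<le> 1" and R: "unital_subring R" "u \<in> R"
  obtains x y where "algebraic_int x" "algebraic_int y" "v y = 1" "y * u = x" "x \<in> R" "y \<in> R"
proof -
  obtain P where P: "\<And>i. coeff P i \<in> \<int>" "P \<noteq> 0" "poly P u = 0" using alg by (auto simp: algebraic_def)
  obtain Z0 where Z0: "P = map_poly of_int Z0" using int_poly_ex[of P] P(1) by blast
  have Z00: "Z0 \<noteq> 0" using P(2) Z0 by auto
  \<comment> \<open>Primitivity provides a coefficient prime to \<open>p\<close>, that is, a unit at
    \<open>v\<close>.\<close>
  define Z where "Z = primitive_part Z0"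
  have Z0e: "Z0 = smult (Polynomial.content Z0) Z" by (simp add: Z_def content_times_primitive_part)
  have c0: "Polynomial.content Z0 \<noteq> 0" using Z00 by simp
  have "map_poly of_int Z0 = smult (of_int (Polynomial.content Z0)) (map_poly of_int Z :: 'a poly)"
    by (rule poly_eqI) (metis (no_types, lifting) Z0e coeff_map_poly coeff_smult of_int_0 of_int_mult)
  then have Zu: "poly (map_poly of_int Z) u = 0" using P(3) c0 by (simp add: Z0)
  have "\<exists>i. \<not> int p dvd coeff Z i"
  proof (rule ccontr)
    assume "\<not> ?thesis"
    then have "int p dvd Polynomial.content Z" by (simp add: const_poly_dvd_iff_dvd_content[symmetric] const_poly_dvd_iff)
    moreover have "Polynomial.content Z = 1" using Z00 by (simp add: Z_def)
    ultimately show False using p by auto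
  qed
  then obtain i0 where i0: "\<not> int p dvd coeff Z i0" by blast
  have unit: "v (of_int a) = 1" if a: "\<not> int p dvd a" for a :: int
  proof -
    have "a \<noteq> 0" using a by auto
    then have "v (of_int a) = (1 / real p) ^ multiplicity (int p) a" using pl by (simp add: place_above_def)
    then show ?thesis using a by (simp add: not_dvd_imp_multiplicity_0)
  qed
  define n where "n = degree Z"
  define b where "b j = (\<Sum>i\<le>j. of_int (coeff Z (n - i)) * u ^ (j - i))" for j
  have bS: "b (Suc j) = b j * u + of_int (coeff Z (n - Suc j))" for j
  proof -
    have "b (Suc j) = (\<Sum>i\<le>j. of_int (coeff Z (n - i)) * u ^ (Suc j - i)) + of_int (coeff Z (n - Suc j))" by (simp add: b_def)
    also have "(\<Sum>i\<le>j. of_int (coeff Z (n - i)) * u ^ (Suc j - i)) = b j * u"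
      unfolding b_def sum_distrib_right by (intro sum.cong refl) (simp add: Suc_diff_le)
    finally show ?thesis .
  qed
  have bR: "b j \<in> R" for j unfolding b_def using R by (intro sr_sum sr_mult sr_power sr_int)
  have dZ: "degree (map_poly of_int Z :: 'a poly) = n" unfolding n_def by (rule degree_map_poly) simp
  have bn: "b n = 0"
  proof -
    have "b n = (\<Sum>i\<le>n. of_int (coeff Z i) * u ^ i)" unfolding b_def
      by (subst sum.nat_diff_reindex[symmetric, of _ "Suc n", unfolded lessThan_Suc_atMost]) (intro sum.cong refl, auto)
    then show ?thesis using Zu by (simp add: poly_altdef dZ coeff_map_poly)
  qed
  have bw: "b j * u = b (Suc j) - of_int (coeff Z (n - Suc j))" for j using bS[of j] by simp
  have bai: "algebraic_int (b j)" if "j \<le> n" for j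
  proof -
    \<comment> \<open>If \<open>u\<close> lies in \<open>V\<close>, so does Horner's sum; otherwise
      division by \<open>u\<close> leads from \<open>b (Suc j)\<close> down to \<open>b j\<close>,
      starting from \<open>b n = 0\<close>.\<close>
    have "b j \<in> V" if V: "valuation_ring V" and j: "j \<le> n" for V j
    proof (cases "u \<in> V")
      case True
      have "unital_subring V" using V by (simp add: valuation_ring_def)
      then show ?thesis unfolding b_def using True by (intro sr_sum sr_mult sr_power sr_int)
    next
      case False
      have srV: "unital_subring V" using V by (simp add: valuation_ring_def)
      have iu: "inverse u \<in> V" using V False by (auto simp: valuation_ring_def)
      have u0: "u \<noteq> 0" using False sr_0[OF srV] by auto
      show ?thesis using j
      proof (induction "n - j" arbitrary: j)
        case 0 then show ?case using bn sr_0[OF srV] by simp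
      next
        case (Suc m)
        then have "b (Suc j) \<in> V" by auto
        then have "(b (Suc j) - of_int (coeff Z (n - Suc j))) * inverse u \<in> V"
          by (intro sr_mult[OF srV] sr_diff[OF srV] sr_int[OF srV] iu)
        then show ?case unfolding bw[symmetric] using u0 by (simp add: mult.assoc)
      qed
    qed
    then show ?thesis unfolding algebraic_int_iff using that by simp
  qed
  \<comment> \<open>If every \<open>b j\<close> had value below 1, the recursion would give every
    coefficient of \<open>Z\<close> a value below 1.\<close>
  have "\<exists>j<n. v (b j) = 1"
  proof (rule ccontr)
    assume no: "\<not> ?thesis"
    have lt: "v (b j) < 1" if "j \<le> n" for j
      using no that v_ai[OF bai[OF that]] bn by (cases "j = n") (auto simp: less_le)
    have "v (of_int (coeff Z (n - j))) < 1" if "j \<le> n" for j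
    proof (cases j)
      case 0 then show ?thesis using lt[of 0] by (simp add: b_def)
    next
      case (Suc i)
      have "of_int (coeff Z (n - j)) = b j - b i * u" using bS[of i] Suc by simp
      moreover have "v (b i * u) < 1" using lt[of i] Suc that u v_nonneg[of "b i"] by (simp add: v_mult) (meson mult_right_le_one_le order_le_less_trans v_nonneg)
      ultimately show ?thesis using v_diff[of "b j" "b i * u"] lt[OF that] by simp
    qed
    moreover have "i0 \<le> n" using i0 by (intro le_degree[of Z, folded n_def]) auto
    ultimately have "v (of_int (coeff Z (n - (n - i0)))) < 1" by (metis diff_le_self)
    then show False using unit[OF i0] \<open>i0 \<le> n\<close> by simp
  qed
  then obtain j where j: "j < n" "v (b j) = 1" by blast
  show thesis
  proof (rule that[of "b j * u" "b j"])
    show "algebraic_int (b j * u)" unfolding bw using bai[of "Suc j"] j(1) by (intro algebraic_int_diff algebraic_int_of_int) auto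
  qed (use j bai bR R in \<open>auto intro: sr_mult\<close>)
qed

end

subsection \<open>Orbits along a unicritical decomposition\<close>

lemma funpow_preperiodic: "preperiodic g ((g ^^ n) x) \<longleftrightarrow> preperiodic g x"
  by (induction n) (auto simp: preperiodic_step)

text \<open>By the parallelogram law nothing is left for \<open>x - y\<close>.\<close>

lemma complex_norm_add_eq_4:
  fixes x y :: complex
  assumes "cmod x \<le> 2" "cmod y \<le> 2" "cmod (x + y) = 4"
  shows "x = y \<and> cmod x = 2"
proof -
  have "cmod (x + y) ^ 2 + cmod (x - y) ^ 2 = 2 * cmod x ^ 2 + 2 * cmod y ^ 2"
    unfolding cmod_power2 by (simp add: power2_eq_square algebra_simps)
  moreover have "cmod x ^ 2 \<le> 2 ^ 2" "cmod y ^ 2 \<le> 2 ^ 2" using assms by (intro power_mono; simp)+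
  ultimately have "cmod (x - y) ^ 2 \<le> 0" unfolding assms(3) power2_eq_square[of "2::real"] power2_eq_square[of "4::real"] by linarith
  then have "x = y" by simp
  then have "cmod (2 * x) = 4" using assms(3) by (metis mult_2)
  then show ?thesis using \<open>x = y\<close> by (simp add: norm_mult)
qed

locale stage_dynamics =
  fixes p e :: nat and c :: "nat \<Rightarrow> 'a::{alg_closed_field, field_char_0}" and g :: "'a poly"
  assumes p: "prime p" and e: "e \<ge> 1" and alg: "\<And>x::'a. algebraic x"
    and g: "g = stage p c e [:0, 1:]" and cai: "\<And>i. i < e \<Longrightarrow> algebraic_int (c i)" and pcf: "pcf g"
    and ncheb: "\<not> linearly_conjugate g (map_poly of_int (chebyshev (p ^ e)))"
      "\<not> linearly_conjugate g (- map_poly of_int (chebyshev (p ^ e)))"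
begin

text \<open>One step is a single map T^p - c_i, so \<open>e\<close> steps make one application of
  \<open>g\<close>; the phase \<open>s\<close> records at which of the \<open>e\<close> maps the
  orbit starts.\<close>

primrec orb :: "nat \<Rightarrow> 'a \<Rightarrow> nat \<Rightarrow> 'a" where
  "orb s x 0 = x"
| "orb s x (Suc i) = orb s x i ^ p - c ((s + i) mod e)"

lemma orb_add: "orb s x (i + j) = orb (s + i) (orb s x i) j"
  by (induction j) (auto simp: add.assoc)

lemma orb_mod: "orb (s mod e) x i = orb s x i"
  by (induction i) (auto simp: mod_add_left_eq)

lemma orb_stage: "j \<le> e \<Longrightarrow> orb 0 x j = poly (stage p c j [:0, 1:]) x"
  by (induction j) auto

lemma orb_iter: "orb 0 x (e * n) = (poly g ^^ n) x"
proof (induction n)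
  case (Suc n)
  have "orb 0 x (e * Suc n) = orb 0 x (e * n + e)" by (simp add: add.commute)
  also have "\<dots> = orb (e * n) ((poly g ^^ n) x) e" unfolding orb_add Suc by simp
  also have "\<dots> = orb 0 ((poly g ^^ n) x) e" using orb_mod[of "e * n"] by simp
  also have "\<dots> = poly g ((poly g ^^ n) x)" by (simp add: orb_stage g)
  finally show ?case by simp
qed simp

lemma orb_iter_add: "orb 0 x (e * n + j) = orb 0 ((poly g ^^ n) x) j"
  unfolding orb_add orb_iter using orb_mod[of "e * n"] by simp

lemma finite_orb: assumes "preperiodic (poly g) x" shows "finite (range (orb 0 x))"
proof -
  have "range (orb 0 x) \<subseteq> (\<Union>j<e. (\<lambda>y. orb 0 y j) ` range (\<lambda>n. (poly g ^^ n) x))"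
  proof
    fix w assume "w \<in> range (orb 0 x)"
    then obtain m where m: "w = orb 0 x m" by auto
    have "w = orb 0 ((poly g ^^ (m div e)) x) (m mod e)" using orb_iter_add[of x "m div e" "m mod e"] m by simp
    moreover have "m mod e < e" using e by (intro mod_less_divisor) simp
    ultimately show "w \<in> (\<Union>j<e. (\<lambda>y. orb 0 y j) ` range (\<lambda>n. (poly g ^^ n) x))" by auto
  qed
  then show ?thesis by (rule finite_subset) (use assms in \<open>simp add: preperiodic_def\<close>)
qed

lemma critical_preperiodic:
  assumes "i < e" "orb 0 x i = 0"
  shows "preperiodic (poly g) x"
proof -
  have "poly (pderiv (stage p c j [:0, 1:])) x = 0" if "i < j" "j \<le> e" for j
    using that
  proof (induction j)
    case (Suc j)
    then show ?case
    proof (cases "i = j")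
      case True
      then have "poly (stage p c j [:0, 1:]) x = 0" using assms orb_stage[of i x] by simp
      then show ?thesis using prime_ge_2_nat[OF p] by (simp add: pderiv_diff pderiv_power pderiv_pCons)
    qed (simp add: pderiv_diff pderiv_power pderiv_pCons)
  qed simp
  then show ?thesis using assms(1) pcf by (auto simp: pcf_def g)
qed

text \<open>The orbit of a critical point that passes through 0 at time \<open>i\<close> continues
  with \<open>- c i\<close>, so bounds for critical orbits are bounds for the constants.\<close>

lemma critical_ex: assumes "i < e" obtains x where "orb 0 x i = 0" "preperiodic (poly g) x" "c i = - orb 0 x (Suc i)"
proof -
  have "degree (stage p c i [:0, 1:]) = p ^ i" using stage_subleading[of p "[:0, 1:]" c i] prime_ge_2_nat[OF p] by simp
  then have "degree (stage p c i [:0, 1:]) > 0" using prime_gt_0_nat[OF p] by simp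
  then obtain x where "poly (stage p c i [:0, 1:]) x = 0" using alg_closed_imp_poly_has_root by blast
  then have x: "orb 0 x i = 0" using orb_stage[of i x] assms by simp
  have "c i = - orb 0 x (Suc i)" using x assms prime_gt_0_nat[OF p] by (simp add: power_0_left)
  then show thesis using that x critical_preperiodic[OF assms x] by blast
qed

lemma orb_algebraic_int: assumes "algebraic_int x" shows "algebraic_int (orb s x i)"
proof (induction i)
  case (Suc i)
  have "(s + i) mod e < e" using e by (intro mod_less_divisor) simp
  then show ?case using Suc cai by (auto intro!: algebraic_int_diff algebraic_int_power)
qed (use assms in simp)

text \<open>If \<open>p = 2\<close> and an orbit attains absolute value \<open>2\<close>, then it and all \<open>c i\<close> lie on that circle and
  \<open>(c i)\<^sup>2 = 2 c (i + 1)\<close>, which makes \<open>g\<close> a Chebyshev polynomial.\<close>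

lemma extremal_orbit_chebyshev:
  assumes p2: "p = 2" and \<sigma>: "field_embedding (\<sigma> :: 'a \<Rightarrow> complex)"
    and le: "\<And>n. cmod (\<sigma> (orb 0 x n)) \<le> 2" "\<And>i. i < e \<Longrightarrow> cmod (\<sigma> (c i)) \<le> 2" and eq: "cmod (\<sigma> (orb 0 x m)) = 2"
  shows False
proof -
  have me: "n mod e < e" for n :: nat using e by (intro mod_less_divisor) simp
  have pw: "z ^ p = z ^ 2" for z :: 'a by (simp add: p2)
  have os: "orb 0 x (Suc n) = orb 0 x n ^ 2 - c (n mod e)" for n by (simp add: pw)
  have step: "cmod (\<sigma> (orb 0 x (Suc n))) = 2 \<and> orb 0 x (Suc n) = c (n mod e)" if n: "cmod (\<sigma> (orb 0 x n)) = 2" for n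
  proof -
    have "\<sigma> (orb 0 x (Suc n)) + \<sigma> (c (n mod e)) = \<sigma> (orb 0 x n) ^ 2"
      unfolding os by (simp add: emb_diff[OF \<sigma>] emb_power[OF \<sigma>])
    then have "cmod (\<sigma> (orb 0 x (Suc n)) + \<sigma> (c (n mod e))) = 4" by (simp only: norm_power n) simp
    from complex_norm_add_eq_4[OF le(1) le(2)[OF me] this] show ?thesis using emb_eq[OF \<sigma>] by blast
  qed
  have all: "cmod (\<sigma> (orb 0 x (m + n))) = 2" for n
  proof (induction n)
    case (Suc n) then show ?case using step[of "m + n"] by (metis add_Suc_right)
  qed (use eq in simp)
  have cc: "c (i mod e) ^ 2 = 2 * c (Suc i mod e) \<and> cmod (\<sigma> (c (i mod e))) = 2" for i
  proof -
    \<comment> \<open>Adding \<open>e * m\<close> moves the index past \<open>m\<close> without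
      changing its residue modulo \<open>e\<close>.\<close>
    define n where "n = i + e * m"
    have "1 * m \<le> e * m" using e by (rule mult_le_mono1)
    then have "m \<le> n" unfolding n_def by linarith
    then obtain q where q: "n = m + q" using le_Suc_ex by blast
    have n2: "cmod (\<sigma> (orb 0 x n)) = 2" using all[of q] q by simp
    have 1: "orb 0 x (Suc n) = c (n mod e)" "cmod (\<sigma> (orb 0 x (Suc n))) = 2" using step[OF n2] by auto
    have 2: "orb 0 x (Suc (Suc n)) = c (Suc n mod e)" using step[OF 1(2)] by auto
    have "c (n mod e) ^ 2 - c (Suc n mod e) = c (Suc n mod e)" using 2 os[of "Suc n"] 1(1) by metis
    then have "c (n mod e) ^ 2 = 2 * c (Suc n mod e)" unfolding diff_eq_eq mult_2 .
    moreover have "n mod e = i mod e" "Suc n mod e = Suc i mod e" using mod_mult_self2[of i e m] mod_mult_self2[of "Suc i" e m] by (auto simp: n_def)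
    ultimately show ?thesis using 1 by metis
  qed
  \<comment> \<open>\<open>l i\<close> is half of the preceding constant, the shift by
    \<open>e - 1\<close> standing for -1 modulo \<open>e\<close>. As
    \<open>c i = 2 * l (Suc i)\<close> for \<open>i < e\<close> and
    \<open>l i ^ 2 = l (Suc i)\<close>, the map T^2 - c_i sends
    \<open>l i * (2 * cos \<theta>)\<close> to
    \<open>l (Suc i) * (2 * cos (2 * \<theta>))\<close>.\<close>
  define l where "l i = c ((i + (e - 1)) mod e) / 2" for i
  have ls: "l (Suc i) = c (i mod e) / 2" for i
  proof -
    have "Suc i + (e - 1) = i + e" using e by simp
    then show ?thesis by (simp add: l_def del: add_Suc)
  qed
  have l2: "l i ^ 2 = l (Suc i)" for i
  proof -
    have "Suc (i + (e - 1)) = i + e" using e by simp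
    then have "c ((i + (e - 1)) mod e) ^ 2 = 2 * c (i mod e)" using cc[of "i + (e - 1)"] by simp
    then show ?thesis unfolding ls by (simp add: l_def power_divide)
  qed
  have le0: "l e = l 0"
  proof -
    have "l e = c ((e - 1) mod e) / 2" using ls[of "e - 1"] e by simp
    then show ?thesis by (simp add: l_def)
  qed
  have l0: "l 0 \<noteq> 0" using cc[of "e - 1"] by (auto simp: l_def emb_0[OF \<sigma>])
  have key: "poly (map_poly \<sigma> (stage 2 c j [:0, 1:])) (\<sigma> (l 0) * (2 * cos \<theta>)) = \<sigma> (l j) * (2 * cos (of_nat (2 ^ j) * \<theta>))"
    if "j \<le> e" for j \<theta>
    using that
  proof (induction j)
    case 0
    have "map_poly \<sigma> [:0, 1:] = [:0, 1:]" by (rule poly_eqI) (auto simp: emb_coeff[OF \<sigma>] coeff_pCons emb_0[OF \<sigma>] emb_1[OF \<sigma>] split: nat.splits)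
    then show ?case by simp
  next
    case (Suc j)
    define P where "P = stage 2 c j [:0, 1:]"
    have mc: "map_poly \<sigma> [:- c j:] = [:- \<sigma> (c j):]"
      by (rule poly_eqI) (auto simp: emb_coeff[OF \<sigma>] coeff_pCons emb_0[OF \<sigma>] emb_minus[OF \<sigma>] split: nat.splits)
    have "stage 2 c (Suc j) [:0, 1:] = P * P + [:- c j:]" by (simp add: P_def power2_eq_square)
    then have 1: "poly (map_poly \<sigma> (stage 2 c (Suc j) [:0, 1:])) z = poly (map_poly \<sigma> P) z ^ 2 - \<sigma> (c j)" for z
      by (simp add: emb_add_poly[OF \<sigma>] emb_mult_poly[OF \<sigma>] mc power2_eq_square)
    have "c j = 2 * l (Suc j)" using ls[of j] Suc.prems by (simp add: mult.commute)
    then have "\<sigma> (c j) = 2 * \<sigma> (l (Suc j))" using emb_mult[OF \<sigma>, of 2 "l (Suc j)"] emb_nat[OF \<sigma>, of 2] by simp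
    moreover have "\<sigma> (l j) ^ 2 = \<sigma> (l (Suc j))" by (simp add: l2 flip: emb_power[OF \<sigma>])
    moreover have "cos (of_nat (2 ^ Suc j) * \<theta>) = 2 * cos (of_nat (2 ^ j) * \<theta>) ^ 2 - 1"
      using cos_double_cos[of "of_nat (2 ^ j) * \<theta>"] by (simp add: mult.assoc)
    moreover have IH: "poly (map_poly \<sigma> P) (\<sigma> (l 0) * (2 * cos \<theta>)) = \<sigma> (l j) * (2 * cos (of_nat (2 ^ j) * \<theta>))"
      using Suc by (simp add: P_def)
    ultimately show ?case unfolding 1 IH by (simp only: power_mult_distrib) (simp add: algebra_simps)
  qed
  have "linearly_conjugate g (map_poly of_int (chebyshev (2 ^ e))) \<or> linearly_conjugate g (- map_poly of_int (chebyshev (2 ^ e)))"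
    by (rule linearly_conjugate_chebyshevI[OF \<sigma> _ l0, of _ 1]) (use key[OF order_refl] le0 g p2 in auto)
  then show False using ncheb p2 by auto
qed

text \<open>The maximum \<open>R\<close> extends over the critical orbits too, so that it bounds
  every \<open>c i\<close>; where it is attained, \<open>R ^ p \<le> 2 * R\<close>. With
  \<open>R \<ge> p\<close> this leaves only \<open>R = p = 2\<close>, which
  \<open>extremal_orbit_chebyshev\<close> excludes.\<close>

lemma orb_archimedean_bound:
  assumes a: "preperiodic (poly g) a" and \<sigma>: "field_embedding (\<sigma> :: 'a \<Rightarrow> complex)"
  shows "cmod (\<sigma> (orb 0 a n)) < real p"
proof -
  have p2: "p \<ge> 2" using p by (rule prime_ge_2_nat)
  have me: "n mod e < e" for n :: nat using e by (intro mod_less_divisor) simp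
  have "\<forall>i\<in>{..<e}. \<exists>x. preperiodic (poly g) x \<and> c i = - orb 0 x (Suc i)"
    using critical_ex by (metis lessThan_iff)
  then obtain x where x: "\<And>i. i < e \<Longrightarrow> preperiodic (poly g) (x i)" "\<And>i. i < e \<Longrightarrow> c i = - orb 0 (x i) (Suc i)" by (metis lessThan_iff)
  define A where "A = insert a (x ` {..<e})"
  define W where "W = (\<Union>y\<in>A. range (orb 0 y))"
  have fW: "finite W" unfolding W_def A_def using a x(1) finite_orb by auto
  define N where "N = (\<lambda>w. cmod (\<sigma> w)) ` W"
  have N: "finite N" "N \<noteq> {}" using fW by (auto simp: N_def W_def A_def)
  define R where "R = Max N"
  have le: "cmod (\<sigma> (orb 0 y n)) \<le> R" if "y \<in> A" for y n
    unfolding R_def using N(1) that by (intro Max_ge) (auto simp: N_def W_def)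
  have cle: "cmod (\<sigma> (c i)) \<le> R" if "i < e" for i
    using le[of "x i" "Suc i"] that x(2)[OF that] by (simp add: A_def emb_minus[OF \<sigma>] del: orb.simps)
  have "R \<in> N" unfolding R_def using N by (rule Max_in)
  then obtain y m where y: "y \<in> A" "R = cmod (\<sigma> (orb 0 y m))" by (auto simp: N_def W_def)
  have "\<sigma> (orb 0 y m) ^ p = \<sigma> (orb 0 y (Suc m)) + \<sigma> (c (m mod e))" by (simp flip: emb_add[OF \<sigma>] emb_power[OF \<sigma>])
  then have "R ^ p \<le> cmod (\<sigma> (orb 0 y (Suc m))) + cmod (\<sigma> (c (m mod e)))" unfolding y(2) by (metis norm_power norm_triangle_ineq)
  then have Rp: "R ^ p \<le> 2 * R" using le[OF y(1), of "Suc m"] cle[OF me, of m] by linarith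
  have ltR: "R < real p"
  proof (rule ccontr)
    assume "\<not> ?thesis" then have Rge: "real p \<le> R" by simp
    have R2: "2 \<le> R" using Rge p2 by linarith
    have "R ^ p = R * R ^ (p - 1)" using p2 by (simp add: power_eq_if)
    then have "R ^ (p - 1) \<le> 2" using Rp R2 by (simp add: mult.commute)
    moreover have "R \<le> R ^ (p - 1)" using R2 p2 by (intro self_le_power) auto
    ultimately have "R \<le> 2" by linarith
    then have "R = 2" "p = 2" using R2 Rge p2 by linarith+
    then show False using extremal_orbit_chebyshev[OF _ \<sigma>, of y m] le[OF y(1)] cle y(2) by simp
  qed
  have "cmod (\<sigma> (orb 0 a n)) \<le> R" by (rule le) (simp add: A_def)
  then show ?thesis using ltR by (rule le_less_trans)
qed

end

subsection \<open>The preperiod\<close>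

lemma periodic_preper:
  assumes "preperiodic g x"
  shows "periodic g ((g ^^ preper g x) x)"
proof -
  obtain i j where ij: "i < j" "(g ^^ i) x = (g ^^ j) x" using preperiodic_obtain[OF assms] .
  have "(g ^^ (j - i)) ((g ^^ i) x) = (g ^^ i) x" using ij by (metis comp_apply funpow_add le_add_diff_inverse2 less_imp_le)
  then have "periodic g ((g ^^ i) x)" using ij(1) unfolding periodic_def by (intro exI[of _ "j - i"]) auto
  then show ?thesis unfolding preper_def by (rule LeastI)
qed

context place
begin

lemma v_sum_less: "finite A \<Longrightarrow> (\<And>i. i \<in> A \<Longrightarrow> v (f i) < r) \<Longrightarrow> 0 < r \<Longrightarrow> v (sum f A) < r"
  by (induction A rule: finite_induct) (auto intro: v_add_less)

lemma zero_sum_equal_values: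
  assumes A: "finite A" and s: "sum f A = 0" and nz: "\<exists>i\<in>A. f i \<noteq> 0"
  obtains i j where "i \<in> A" "j \<in> A" "i \<noteq> j" "v (f i) = v (f j)" "f i \<noteq> 0"
proof -
  define M where "M = Max ((\<lambda>i. v (f i)) ` A)"
  have le: "v (f i) \<le> M" if "i \<in> A" for i unfolding M_def using A that by (intro Max_ge) auto
  have "M \<in> (\<lambda>i. v (f i)) ` A" unfolding M_def using A nz by (intro Max_in) auto
  then obtain i where i: "i \<in> A" "v (f i) = M" by auto
  obtain i' where i': "i' \<in> A" "f i' \<noteq> 0" using nz by blast
  have "v (f i') > 0" using i'(2) v_nonneg[of "f i'"] v_eq_0[of "f i'"] by linarith
  then have M0: "M > 0" using le[OF i'(1)] by linarith
  then have fi: "f i \<noteq> 0" using i(2) by auto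
  have "\<exists>j\<in>A. j \<noteq> i \<and> v (f j) = M"
  proof (rule ccontr)
    assume no: "\<not> ?thesis"
    have "v (sum f (A - {i})) < M"
    proof (rule v_sum_less)
      fix j assume "j \<in> A - {i}"
      then show "v (f j) < M" using le[of j] no by (auto simp: less_le)
    qed (use A M0 in auto)
    then have "v (sum f (A - {i}) + f i) = v (f i)" using i(2) by (intro v_add_eq) simp
    moreover have "sum f (A - {i}) + f i = 0" using sum.remove[OF A i(1), of f] s by (simp add: add.commute)
    ultimately show False using M0 i(2) by simp
  qed
  then show thesis using that[of i] i fi by metis
qed

text \<open>Here \<open>x / y = 1 + \<tau>\<close> is a nontrivial \<open>p\<close>-th root of
  unity, and expanding \<open>(\<tau> + 1) ^ p = 1\<close> gives
  \<open>\<tau> ^ (p - 1) = - (p * (1 + \<tau> * B))\<close>. This forces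
  \<open>v \<tau> < 1\<close>, whereupon the bracket has value 1.\<close>

lemma equal_powers_value:
  assumes xy: "x ^ p = y ^ p" "x \<noteq> y"
  shows "v (x - y) ^ (p - 1) = v (of_nat p) * v y ^ (p - 1)"
proof -
  have p0: "p > 0" using p by (rule prime_gt_0_nat)
  have y0: "y \<noteq> 0" using xy p0 by (metis power_eq_0_iff)
  have "v x ^ p = v y ^ p" using xy(1) by (metis v_power)
  then have vxy: "v x = v y" using p0 v_nonneg by (intro power_eq_imp_eq_base[of "v x" p "v y"]) auto
  define \<tau> where "\<tau> = x / y - 1"
  have \<tau>0: "\<tau> \<noteq> 0" using xy(2) y0 by (simp add: \<tau>_def)
  have "v (x / y) = 1" using vxy y0 v_eq_0[of y] by (simp add: v_divide)
  then have v\<tau>: "v \<tau> \<le> 1" unfolding \<tau>_def by (intro v_diff_le) auto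
  obtain A where A: "(\<tau> + 1) ^ p = \<tau> ^ p + 1 ^ p + of_nat p * \<tau> * A"
    "\<exists>B. (\<forall>R. unital_subring R \<longrightarrow> \<tau> \<in> R \<longrightarrow> 1 \<in> R \<longrightarrow> B \<in> R) \<and> A = 1 ^ (p - 1) + \<tau> * B"
    by (metis binomial_prime[of \<tau> 1])
  then obtain B where B: "unital_subring {x. v x \<le> 1} \<longrightarrow> \<tau> \<in> {x. v x \<le> 1} \<longrightarrow> 1 \<in> {x. v x \<le> 1} \<longrightarrow> B \<in> {x. v x \<le> 1}"
    "A = 1 ^ (p - 1) + \<tau> * B" by blast
  have vB: "v B \<le> 1" using B(1) integers_subring v\<tau> by simp
  have "(\<tau> + 1) ^ p = 1" using xy(1) y0 by (simp add: \<tau>_def power_divide)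
  then have "\<tau> ^ p + of_nat p * \<tau> * A = 0" using A(1) by simp
  moreover have "\<tau> ^ p = \<tau> * \<tau> ^ (p - 1)" using p0 by (simp add: power_eq_if)
  ultimately have "\<tau> * (\<tau> ^ (p - 1) + of_nat p * A) = 0" by (simp add: algebra_simps)
  then have t: "\<tau> ^ (p - 1) = - (of_nat p * (1 + \<tau> * B))" using \<tau>0 B(2) by (simp add: eq_neg_iff_add_eq_0)
  have vpp: "v (of_nat p) < 1" "0 < v (of_nat p)" by (rule v_p_bounds)+
  have "v (1 + \<tau> * B) \<le> 1" using v\<tau> vB by (intro v_add_le v_mult_le) auto
  then have "v (of_nat p) * v (1 + \<tau> * B) \<le> v (of_nat p) * 1" by (intro mult_left_mono v_nonneg)
  then have "v \<tau> ^ (p - 1) < 1" using vpp unfolding v_power[symmetric] t v_minus v_mult by linarith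
  then have "v \<tau> < 1" by (metis not_le one_le_power)
  moreover have "v (\<tau> * B) \<le> v \<tau>" using vB v_nonneg[of \<tau>] by (simp add: v_mult mult_left_le)
  ultimately have "v (\<tau> * B) < 1" by linarith
  then have "v (\<tau> * B + 1) = v 1" by (intro v_add_eq) simp
  then have "v \<tau> ^ (p - 1) = v (of_nat p)" unfolding v_power[symmetric] t v_minus v_mult by (simp add: add.commute)
  moreover have "x - y = \<tau> * y" using y0 by (simp add: \<tau>_def field_simps)
  ultimately show ?thesis by (simp add: v_mult power_mult_distrib)
qed

text \<open>For \<open>t = x - y\<close> the terms of \<open>t * (t ^ (p - 1) + p * A)\<close> may
  balance when \<open>v t ^ (p - 1)\<close> equals the value of \<open>p\<close>. Above this
  threshold the power dominates; \<open>pow_diff_small\<close> treats the rest.\<close>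

lemma pow_diff_value:
  assumes "v x \<le> 1" "v y \<le> 1" "v (of_nat p) < v (x - y) ^ (p - 1)"
  shows "v (x ^ p - y ^ p) = v (x - y) ^ p"
proof -
  obtain A where e: "x ^ p - y ^ p = (x - y) * ((x - y) ^ (p - 1) + of_nat p * A)" and vA: "v A \<le> 1"
    using pow_diff_factor[of x y] assms by metis
  have "v (of_nat p * A) \<le> v (of_nat p)" using vA v_nonneg[of "of_nat p"] by (simp add: v_mult mult_left_le)
  then have "v (of_nat p * A + (x - y) ^ (p - 1)) = v ((x - y) ^ (p - 1))" using assms(3) by (intro v_add_eq) (simp add: v_power)
  then have "v (x ^ p - y ^ p) = v (x - y) * v (x - y) ^ (p - 1)" unfolding e v_mult by (simp add: v_power add.commute)
  then show ?thesis using prime_gt_0_nat[OF p] by (simp add: power_eq_if)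
qed

lemma pow_diff_small:
  assumes "v x \<le> 1" "v y \<le> 1" "v (x - y) ^ (p - 1) \<le> v (of_nat p)"
  shows "v (x ^ p - y ^ p) \<le> v (of_nat p) * v (x - y)"
proof -
  obtain A where e: "x ^ p - y ^ p = (x - y) * ((x - y) ^ (p - 1) + of_nat p * A)" and vA: "v A \<le> 1"
    using pow_diff_factor[of x y] assms by metis
  have "v (of_nat p * A) \<le> v (of_nat p)" using vA v_nonneg[of "of_nat p"] by (simp add: v_mult mult_left_le)
  then have "v ((x - y) ^ (p - 1) + of_nat p * A) \<le> v (of_nat p)" using assms(3) by (intro v_add_le) (simp_all add: v_power)
  then have "v (x - y) * v ((x - y) ^ (p - 1) + of_nat p * A) \<le> v (x - y) * v (of_nat p)" by (intro mult_left_mono v_nonneg)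
  then show ?thesis unfolding e v_mult by (simp only: mult.commute)
qed

text \<open>The order of \<open>v t\<close> modulo the value group of \<open>S\<close> is at most \<open>n\<close>; on the other hand the
  assumptions bound the ramification of \<open>S\<close> and thus the part of \<open>p ^ J\<close> not dividing that order.\<close>

lemma ramification_bound:
  assumes S: "unital_subring S" "\<And>x. x \<in> S \<Longrightarrow> inverse x \<in> S"
    and ram: "\<And>u. u \<in> S \<Longrightarrow> v u < 1 \<Longrightarrow> v u ^ (p ^ b) \<le> v (of_nat p)"
    and t: "t \<noteq> 0" "v t < 1"
    and rel: "\<And>i. a i \<in> S" "\<exists>i\<le>n. a i \<noteq> 0" "(\<Sum>i\<le>n. a i * t ^ i) = 0"
    and q: "q \<in> S" "v q = v t ^ (p ^ J * (p - 1))" "v (of_nat p) ^ p < v q"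
  shows "p ^ J \<le> n * p ^ b"
proof -
  have p2: "p \<ge> 2" using p by (rule prime_ge_2_nat)
  have t0: "v t > 0" using t v_nonneg[of t] v_eq_0[of t] by linarith
  have pb: "0 < v (of_nat p)" "v (of_nat p) < 1" by (rule v_p_bounds)+
  \<comment> \<open>These are the exponents for which the power of \<open>v t\<close> lies in the
    value group of \<open>S\<close>. The relation yields one between 1 and \<open>n\<close>, and the
    least one divides \<open>M\<close>.\<close>
  define G where "G s \<longleftrightarrow> (\<exists>u\<in>S. u \<noteq> 0 \<and> v t ^ s = v u)" for s
  have Gex: "\<exists>s\<ge>1. s \<le> n \<and> G s"
  proof -
    have "\<exists>i\<in>{..n}. a i * t ^ i \<noteq> 0" using rel(2) t by auto
    then obtain i j where ij: "i \<le> n" "j \<le> n" "i \<noteq> j" "v (a i * t ^ i) = v (a j * t ^ j)" "a i * t ^ i \<noteq> 0"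
      using zero_sum_equal_values[OF finite_atMost rel(3)] by (metis atMost_iff)
    have main: "\<exists>s\<ge>1. s \<le> n \<and> G s"
      if "i < j" "j \<le> n" "v (a i * t ^ i) = v (a j * t ^ j)" "a i * t ^ i \<noteq> 0" for i j
    proof -
      have nz: "a i \<noteq> 0" "a j \<noteq> 0" using that(3,4) v_eq_0[of "a i * t ^ i"] v_eq_0[of "a j * t ^ j"] by auto
      have "v (a i) * v t ^ i = v (a j) * (v t ^ (j - i) * v t ^ i)"
        using that by (simp add: v_mult v_power power_add[symmetric])
      then have "v (a i) = v (a j) * v t ^ (j - i)" using t0 by simp
      then have "v t ^ (j - i) = v (a i * inverse (a j))" using nz v_eq_0[of "a j"] by (simp add: v_divide flip: divide_inverse)
      moreover have "a i * inverse (a j) \<in> S" using rel(1) S sr_mult by metis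
      ultimately have "G (j - i)" unfolding G_def using nz by (intro bexI[of _ "a i * inverse (a j)"]) auto
      then show ?thesis using that by (intro exI[of _ "j - i"]) auto
    qed
    show ?thesis using main[of i j] main[of j i] ij v_eq_0 by (metis nat_neq_iff)
  qed
  define s where "s = (LEAST s. 1 \<le> s \<and> G s)"
  have s: "1 \<le> s" "G s" using LeastI_ex[of "\<lambda>s. 1 \<le> s \<and> G s"] Gex by (auto simp: s_def)
  have least: "s \<le> k" if "1 \<le> k" "G k" for k unfolding s_def using that by (intro Least_le) auto
  have sn: "s \<le> n" using Gex least by (meson order_trans)
  define M where "M = p ^ J * (p - 1)"
  have GM: "G M" unfolding G_def M_def
  proof (intro bexI[of _ q] conjI)
    show "q \<noteq> 0" using q(3) pb zero_le_power[of "v (of_nat p)" p] by auto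
  qed (use q in auto)
  obtain u where u: "u \<in> S" "u \<noteq> 0" "v t ^ s = v u" using s by (auto simp: G_def)
  have dvd: "s dvd M"
  proof (rule ccontr)
    assume "\<not> s dvd M"
    then have m1: "1 \<le> M mod s" by (simp add: dvd_eq_mod_eq_0)
    obtain w where w: "w \<in> S" "w \<noteq> 0" "v t ^ M = v w" using GM by (auto simp: G_def)
    have "v t ^ M = v t ^ (M mod s) * v u ^ (M div s)"
      unfolding u(3)[symmetric] power_mult[symmetric] power_add[symmetric] by simp
    then have "v t ^ (M mod s) = v (w * inverse (u ^ (M div s)))"
      using w u v_eq_0[of u] by (simp add: v_divide v_power flip: divide_inverse)
    moreover have "w * inverse (u ^ (M div s)) \<in> S" by (intro sr_mult[OF S(1)] w S(2) sr_power[OF S(1)] u)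
    ultimately have "G (M mod s)" unfolding G_def using w u by (intro bexI[of _ "w * inverse (u ^ (M div s))"]) auto
    then show False using least[OF m1] mod_less_divisor[of s M] s(1) by linarith
  qed
  then obtain r where r: "M = s * r" by blast
  have u1: "v u < 1" unfolding u(3)[symmetric] using t(2) t0 s(1) by (intro power_less_one_iff[THEN iffD2]) auto
  have u0: "0 < v u" using u v_nonneg[of u] v_eq_0[of u] by linarith
  \<comment> \<open>Comparing \<open>v u ^ r = v q\<close> with the ramification bound for
    \<open>u\<close> gives \<open>r < p ^ Suc b\<close>. So \<open>r\<close> contains at most the
    power \<open>p ^ b\<close> of \<open>p\<close>, and the rest of \<open>p ^ J\<close> divides
    \<open>s\<close>.\<close>
  have "v u ^ (p ^ b * p) \<le> v (of_nat p) ^ p" unfolding power_mult using ram[OF u(1) u1] u0 by (intro power_mono) auto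
  also have "\<dots> < v u ^ r" using q(2,3) unfolding u(3)[symmetric] power_mult[symmetric] r[symmetric] M_def by simp
  finally have rlt: "r < p ^ Suc b" using u0 u1 power_decreasing[of "p ^ Suc b" r "v u"] by (auto simp: mult.commute not_le[symmetric])
  have r0: "r > 0" using r p2 by (cases r) (auto simp: M_def)
  obtain r' where r': "r = p ^ multiplicity p r * r'" "\<not> p dvd r'"
    using multiplicity_decompose'[of r p] r0 p2 by (metis neq0_conv not_prime_unit p)
  define k where "k = multiplicity p r"
  have "p ^ k \<le> r" using r' r0 by (metis dvd_imp_le dvd_triv_left k_def)
  then have "p ^ k < p ^ Suc b" using rlt by linarith
  then have kb: "k \<le> b" using p2 by (simp only: power_strict_increasing_iff less_Suc_eq_le)
  have "p ^ J dvd s * p ^ k * r'" using r r'(1) by (metis M_def dvd_triv_left k_def mult.assoc)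
  moreover have "coprime (p ^ J) r'" using r'(2) p by (metis coprime_power_left_iff prime_imp_coprime)
  ultimately have "p ^ J dvd s * p ^ k" by (simp add: coprime_dvd_mult_left_iff)
  then have "p ^ J \<le> s * p ^ k" using s p2 by (intro dvd_imp_le) auto
  also have "\<dots> \<le> n * p ^ b" using sn kb p2 by (intro mult_le_mono power_increasing) auto
  finally show ?thesis .
qed

end

context stage_dynamics
begin

text \<open>\<open>x\<close> and \<open>y\<close> are the points two steps before the orbits meet,
  and the place is one where \<open>\<mu> = (x - y) ^ (p - 1) / p\<close> is not integral. Were
  \<open>\<mu>\<close> integral, \<open>pow_diff_small\<close> and \<open>equal_powers_value\<close>
  would bound \<open>v y'\<close> by the value of \<open>p\<close> at every such place, so
  \<open>y' / p\<close> would be an algebraic integer.\<close>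

lemma wild_place:
  assumes b: "preperiodic (poly g) b" and ai: "algebraic_int a" "algebraic_int b"
    and J: "orb 0 a (Suc J) \<noteq> orb 0 b (Suc J)" "orb 0 a (Suc (Suc J)) = orb 0 b (Suc (Suc J))"
  obtains v where "place v p" "v (of_nat p) < v (orb 0 a J - orb 0 b J) ^ (p - 1)"
proof -
  define x y where "x = orb 0 a J" and "y = orb 0 b J"
  define x' y' where "x' = orb 0 a (Suc J)" and "y' = orb 0 b (Suc J)"
  have aixy: "algebraic_int x" "algebraic_int y" "algebraic_int x'" "algebraic_int y'"
    unfolding x_def y_def x'_def y'_def using orb_algebraic_int ai by blast+
  have x'y': "x' - y' = x ^ p - y ^ p" by (simp add: x'_def y'_def x_def y_def)
  have ne: "x' \<noteq> y'" using J(1) by (simp only: x'_def y'_def not_False_eq_True)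
  have pw: "x' ^ p = y' ^ p" using J(2) by (simp add: x'_def y'_def)
  have p0: "p > 0" "of_nat p \<noteq> (0::'a)" using p by (auto simp: prime_gt_0_nat)
  have y'0: "y' \<noteq> 0" using pw ne p0 by (metis power_eq_0_iff)
  define \<mu> where "\<mu> = (x - y) ^ (p - 1) / of_nat p"
  have "\<not> algebraic_int \<mu>"
  proof
    assume \<mu>: "algebraic_int \<mu>"
    have "algebraic_int (y' / of_nat p)"
    proof (rule ccontr)
      assume n: "\<not> ?thesis"
      have pb: "algebraic_int (of_nat p ^ 1 * (y' / of_nat p))" using aixy(4) p0 by simp
      obtain v where v: "place_above p v" "\<And>x y. v (x + y) \<le> max (v x) (v y)" "1 < v (y' / of_nat p)"
        using exists_place[OF alg p n pb] by metis
      interpret v: place v p using v(1,2) p by unfold_locales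
      have vp: "0 < v (of_nat p)" using v.v_p_bounds by simp
      have "v \<mu> \<le> 1" using \<mu> by (rule v.v_ai)
      then have small: "v (x - y) ^ (p - 1) \<le> v (of_nat p)" using vp by (simp add: \<mu>_def v.v_divide v.v_power)
      have "v (x' - y') \<le> v (of_nat p) * v (x - y)" unfolding x'y' using small v.v_ai aixy by (intro v.pow_diff_small) auto
      then have "v (x' - y') ^ (p - 1) \<le> (v (of_nat p) * v (x - y)) ^ (p - 1)" by (intro power_mono v.v_nonneg)
      also have "\<dots> \<le> v (of_nat p) ^ (p - 1) * v (of_nat p)" unfolding power_mult_distrib using small vp by (intro mult_left_mono) auto
      finally have "v (of_nat p) * v y' ^ (p - 1) \<le> v (of_nat p) * v (of_nat p) ^ (p - 1)"
        unfolding v.equal_powers_value[OF pw ne] by (simp only: mult.commute)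
      then have "v y' ^ (p - 1) \<le> v (of_nat p) ^ (p - 1)" using vp by simp
      moreover have "v (of_nat p) < v y'" using v(3) vp by (simp add: v.v_divide)
      then have "v (of_nat p) ^ (p - 1) < v y' ^ (p - 1)" using vp prime_ge_2_nat[OF p] by (intro power_strict_mono) auto
      ultimately show False by linarith
    qed
    moreover have "y' / of_nat p \<noteq> 0" using y'0 p0 by simp
    ultimately obtain \<sigma> :: "'a \<Rightarrow> complex" where \<sigma>: "field_embedding \<sigma>" "1 \<le> cmod (\<sigma> (y' / of_nat p))"
      using complex_embedding_ge_1[OF alg] by metis
    have "cmod (\<sigma> y') < real p" unfolding y'_def by (rule orb_archimedean_bound[OF b \<sigma>(1)])
    then show False using \<sigma>(2) p0 by (simp add: emb_divide[OF \<sigma>(1)] emb_nat[OF \<sigma>(1)] norm_divide)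
  qed
  moreover have "algebraic_int (of_nat p ^ 1 * \<mu>)" using aixy(1,2) p0 by (simp add: \<mu>_def algebraic_int_diff algebraic_int_power)
  ultimately obtain v where v: "place_above p v" "\<And>x y. v (x + y) \<le> max (v x) (v y)" "1 < v \<mu>"
    using exists_place[OF alg p] by metis
  interpret v: place v p using v(1,2) p by unfold_locales
  have "v (of_nat p) < v (x - y) ^ (p - 1)" using v(3) v.v_p_bounds by (simp add: \<mu>_def v.v_divide v.v_power)
  then show thesis using that[OF v.place_axioms] by (simp add: x_def y_def)
qed

text \<open>A difference below the threshold of \<open>pow_diff_small\<close> stays below it. Being
  above it at time \<open>J\<close>, the orbits were above it at all earlier times, so every step
  raised the value to the exact \<open>p\<close>-th power.\<close>

lemma wild_value:
  assumes v: "place v p" and ai: "algebraic_int a" "algebraic_int b"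
    and J: "v (of_nat p) < v (orb 0 a J - orb 0 b J) ^ (p - 1)"
  shows "v (orb 0 a (Suc J) - orb 0 b (Suc J)) = v (a - b) ^ (p ^ Suc J)"
proof -
  interpret v: place v p by (rule v)
  have i: "v (orb 0 a i) \<le> 1" "v (orb 0 b i) \<le> 1" for i using v.v_ai orb_algebraic_int ai by auto
  have d: "orb 0 a (Suc i) - orb 0 b (Suc i) = orb 0 a i ^ p - orb 0 b i ^ p" for i by simp
  have big: "v (of_nat p) < v (orb 0 a (J - k) - orb 0 b (J - k)) ^ (p - 1)" for k
  proof (induction k)
    case (Suc k)
    show ?case
    proof (cases "k < J")
      case True
      define i where "i = J - Suc k"
      have Si: "J - k = Suc i" using True by (simp add: i_def)
      show ?thesis unfolding i_def[symmetric]
      proof (rule ccontr)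
        assume "\<not> v (of_nat p) < v (orb 0 a i - orb 0 b i) ^ (p - 1)"
        then have s: "v (orb 0 a i - orb 0 b i) ^ (p - 1) \<le> v (of_nat p)" by simp
        have "v (orb 0 a (Suc i) - orb 0 b (Suc i)) \<le> v (of_nat p) * v (orb 0 a i - orb 0 b i)"
          unfolding d by (rule v.pow_diff_small[OF i s])
        also have "\<dots> \<le> 1 * v (orb 0 a i - orb 0 b i)" using v.v_p_bounds by (intro mult_right_mono v.v_nonneg) auto
        finally have "v (orb 0 a (Suc i) - orb 0 b (Suc i)) ^ (p - 1) \<le> v (orb 0 a i - orb 0 b i) ^ (p - 1)"
          using v.v_nonneg by (intro power_mono) (simp_all only: mult_1)
        then show False using Suc s unfolding Si by linarith
      qed
    qed (use Suc in simp)
  qed (use J in simp)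
  have "v (orb 0 a i - orb 0 b i) = v (a - b) ^ (p ^ i)" if "i \<le> Suc J" for i
    using that
  proof (induction i)
    case (Suc i)
    have "v (of_nat p) < v (orb 0 a i - orb 0 b i) ^ (p - 1)" using big[of "J - i"] Suc.prems by simp
    then have "v (orb 0 a (Suc i) - orb 0 b (Suc i)) = v (orb 0 a i - orb 0 b i) ^ p" unfolding d by (rule v.pow_diff_value[OF i])
    then show ?case using Suc by (simp add: power_mult[symmetric] mult.commute)
  qed simp
  then show ?thesis by blast
qed

text \<open>With \<open>\<kappa>\<close> at least both the initial distance and the value of
  \<open>p\<close>, each step contracts by \<open>\<kappa>\<close>; the initial distance accounts
  for the extra factor.\<close>

lemma orb_contract:
  assumes v: "place v p" and ai: "algebraic_int x" "algebraic_int y"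
    and \<kappa>: "v (x - y) \<le> \<kappa>" "v (of_nat p) \<le> \<kappa>" "\<kappa> \<le> 1"
  shows "v (orb s x i - orb s y i) \<le> \<kappa> ^ Suc i"
proof -
  interpret v: place v p by (rule v)
  have k0: "0 < \<kappa>" using \<kappa> v.v_p_bounds by linarith
  have int: "v (orb s x i) \<le> 1" "v (orb s y i) \<le> 1" for i using v.v_ai orb_algebraic_int ai by auto
  show ?thesis
  proof (induction i)
    case (Suc i)
    have "\<kappa> ^ Suc i \<le> \<kappa>" using \<kappa> k0 by (simp add: mult_left_le power_le_one)
    then have "v (orb s x i ^ p - orb s y i ^ p) \<le> \<kappa> * v (orb s x i - orb s y i)"
      using Suc \<kappa> int by (intro v.pow_diff_contract) auto
    also have "\<dots> \<le> \<kappa> * \<kappa> ^ Suc i" using Suc k0 by (intro mult_left_mono) auto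
    finally show ?case by simp
  qed (use \<kappa> in simp)
qed

text \<open>The witness lies on the orbit of \<open>0\<close>, whose distance to that of \<open>y\<close> contracts by the factor
  \<open>v y\<close> at each step.\<close>

lemma periodic_value_in_base:
  assumes v: "place v p" and S: "unital_subring S" "\<And>i. i < e \<Longrightarrow> c i \<in> S"
    and y: "algebraic_int y" "v (of_nat p) < v y" and r: "orb J y r = y" "r > 0"
  obtains w where "w \<in> S" "v w = v y"
proof (cases "v y = 1")
  case True
  interpret v: place v p by (rule v)
  show thesis using that[of 1] sr_1[OF S(1)] True by simp
next
  case False
  interpret v: place v p by (rule v)
  define \<kappa> where "\<kappa> = v y"
  have k: "v (of_nat p) \<le> \<kappa>" "\<kappa> < 1" using y False v.v_ai[of y] by (auto simp: \<kappa>_def)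
  have k0: "0 < \<kappa>" using k v.v_p_bounds by linarith
  have me: "n mod e < e" for n :: nat using e by (intro mod_less_divisor) simp
  have dist: "v (orb J y i - orb J 0 i) \<le> \<kappa> ^ Suc i" for i
    using orb_contract[OF v y(1), of 0 \<kappa> J i] algebraic_int_of_nat[of 0] k by (simp add: \<kappa>_def)
  define w where "w = orb J 0 r"
  have "w \<in> S" unfolding w_def
  proof (induction r)
    case (Suc r) then show ?case using S(2)[OF me] by (auto intro: sr_diff[OF S(1)] sr_power[OF S(1)])
  qed (simp add: sr_0[OF S(1)])
  moreover have "v w = v y"
  proof -
    have "v (y - w) \<le> \<kappa> ^ Suc r" using dist[of r] r(1) by (simp add: w_def)
    also have "\<dots> < \<kappa> ^ 1" using k k0 r(2) by (intro power_strict_decreasing) auto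
    finally have "v (w - y) < v y" by (simp add: v.v_diff_commute \<kappa>_def)
    then have "v (w - y + y) = v y" by (rule v.v_add_eq)
    then show ?thesis by simp
  qed
  ultimately show thesis by (rule that)
qed

text \<open>\<open>S\<close> stands for F and \<open>n\<close> for [F(\<alpha>):F], which enters
  through the relations \<open>rel\<close>. The ramification bound \<open>ram\<close> is required at
  every place, since the wild place is not known in advance.\<close>

theorem preper_bound:
  assumes S: "unital_subring S" "\<And>x. x \<in> S \<Longrightarrow> inverse x \<in> S" "\<And>i. i < e \<Longrightarrow> c i \<in> S"
    and ram: "\<And>v u. place v p \<Longrightarrow> u \<in> S \<Longrightarrow> v u < 1 \<Longrightarrow> v u ^ (p ^ b) \<le> v (of_nat p)"
    and a: "preperiodic (poly g) a" "algebraic_int a"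
    and rel: "\<And>N. \<exists>q. (\<forall>i. q i \<in> S) \<and> (\<exists>i\<le>n. q i \<noteq> 0) \<and> (\<Sum>i\<le>n. q i * (a - (poly g ^^ N) a) ^ i) = 0"
    and m: "2 \<le> preper (poly g) a"
  shows "p ^ (e * (preper (poly g) a - 1)) \<le> n * p ^ b"
proof -
  define m where "m = preper (poly g) a"
  have p0: "p > 0" using p by (rule prime_gt_0_nat)
  have "periodic (poly g) ((poly g ^^ m) a)" unfolding m_def by (rule periodic_preper[OF a(1)])
  then obtain r where r: "r \<ge> 1" "(poly g ^^ r) ((poly g ^^ m) a) = (poly g ^^ m) a" unfolding periodic_def by blast
  have stab: "(poly g ^^ (m + r * k + i)) a = (poly g ^^ (m + i)) a" for k i
  proof -
    have "(poly g ^^ (m + r * k)) a = (poly g ^^ m) a"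
    proof (induction k)
      case (Suc k)
      have "(poly g ^^ (m + r * Suc k)) a = (poly g ^^ r) ((poly g ^^ (m + r * k)) a)"
        by (simp add: add_ac flip: comp_apply[of "poly g ^^ _"] funpow_add)
      then show ?case using Suc r(2) by simp
    qed simp
    then show ?thesis by (metis add.commute comp_apply funpow_add)
  qed
  \<comment> \<open>\<open>r * m\<close> is a multiple of the period \<open>r\<close> and at least
    \<open>m\<close>, so \<open>y\<close> is periodic and has the same image as \<open>a\<close>
    under the \<open>m\<close>-th iterate.\<close>
  define y where "y = (poly g ^^ (r * m)) a"
  have gy: "(poly g ^^ k) y = (poly g ^^ (r * m + k)) a" for k unfolding y_def by (metis add.commute comp_apply funpow_add)
  have mr: "m \<le> r * m" using r by simp
  have y_per: "(poly g ^^ r) y = y"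
  proof -
    have "(poly g ^^ r) y = (poly g ^^ (m + r * 1 + (r * m - m))) a" 
    proof -
      have "r * m + r = m + r * 1 + (r * m - m)" using mr by linarith
      then show ?thesis unfolding gy by (simp only:)
    qed
    also have "\<dots> = y" unfolding stab y_def using mr by simp
    finally show ?thesis .
  qed
  have y_pre: "preperiodic (poly g) y" unfolding y_def using a(1) by (simp add: funpow_preperiodic)
  have aiorb: "algebraic_int ((poly g ^^ k) a)" for k using orb_algebraic_int[OF a(2), of 0 "e * k"] orb_iter by simp
  have y_ai: "algebraic_int y" unfolding y_def by (rule aiorb)
  have eq_m: "orb 0 a (e * m) = orb 0 y (e * m)"
    unfolding orb_iter gy using stab[of m 0] by (simp add: add.commute)
  have ne_m: "orb 0 a (e * (m - 1)) \<noteq> orb 0 y (e * (m - 1))"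
  proof
    assume "orb 0 a (e * (m - 1)) = orb 0 y (e * (m - 1))"
    then have 1: "(poly g ^^ (m - 1)) a = (poly g ^^ (m - 1)) y" by (simp only: orb_iter)
    have "(poly g ^^ r) ((poly g ^^ (m - 1)) y) = (poly g ^^ (m - 1)) y"
      using y_per by (metis add.commute comp_apply funpow_add)
    then have "periodic (poly g) ((poly g ^^ (m - 1)) a)" unfolding 1 periodic_def using r(1) by blast
    then have "m \<le> m - 1" unfolding m_def preper_def by (rule Least_le)
    then show False using m by (simp add: m_def)
  qed
  \<comment> \<open>The orbits agree at \<open>e * m\<close> but not at \<open>e * (m - 1)\<close>,
    where that of \<open>y\<close> is periodic and that of \<open>a\<close> is not yet;
    \<open>J'\<close> is the last time at which they differ.\<close>
  have "\<exists>J'. e * (m - 1) \<le> J' \<and> orb 0 a J' \<noteq> orb 0 y J' \<and> orb 0 a (Suc J') = orb 0 y (Suc J')"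
  proof (rule ccontr)
    assume no: "\<not> ?thesis"
    have "orb 0 a (e * (m - 1) + k) \<noteq> orb 0 y (e * (m - 1) + k)" for k
    proof (induction k)
      case (Suc k) then show ?case using no by (metis add_Suc_right le_add1)
    qed (use ne_m in simp)
    moreover have "e * m = e * (m - 1) + e" using m by (cases m) (auto simp: m_def)
    ultimately show False using eq_m by metis
  qed
  then obtain J' where J': "e * (m - 1) \<le> J'" "orb 0 a J' \<noteq> orb 0 y J'" "orb 0 a (Suc J') = orb 0 y (Suc J')" by blast
  \<comment> \<open>A preperiod of at least 2 guarantees a time \<open>J\<close> before
    \<open>J'\<close>, at which the wild place is chosen.\<close>
  have "1 \<le> e * (m - 1)" using e m by (simp add: m_def)
  then obtain J where J: "J' = Suc J" using J'(1) by (cases J') auto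
  obtain v where v: "place v p" "v (of_nat p) < v (orb 0 a J - orb 0 y J) ^ (p - 1)"
    using wild_place[OF y_pre a(2) y_ai] J'(2,3) unfolding J by blast
  interpret v: place v p by (rule v)
  have val: "v (orb 0 a J' - orb 0 y J') = v (a - y) ^ (p ^ J')" unfolding J by (rule wild_value[OF v(1) a(2) y_ai v(2)])
  have pw: "orb 0 a J' ^ p = orb 0 y J' ^ p" using J'(3) by simp
  have val2: "v (orb 0 a J' - orb 0 y J') ^ (p - 1) = v (of_nat p) * v (orb 0 y J') ^ (p - 1)"
    by (rule v.equal_powers_value[OF pw J'(2)])
  have vp: "0 < v (of_nat p)" "v (of_nat p) < 1" by (rule v.v_p_bounds)+
  have i: "v (orb 0 a i) \<le> 1" "v (orb 0 y i) \<le> 1" for i using v.v_ai orb_algebraic_int a(2) y_ai by auto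
  have "v (orb 0 a J' - orb 0 y J') = v (orb 0 a J - orb 0 y J) ^ p"
    using v.pow_diff_value[OF i v(2)] by (simp add: J)
  then have "v (orb 0 a J' - orb 0 y J') ^ (p - 1) = (v (orb 0 a J - orb 0 y J) ^ (p - 1)) ^ p"
    by (simp only: power_mult[symmetric] mult.commute)
  moreover have "v (of_nat p) ^ p < (v (orb 0 a J - orb 0 y J) ^ (p - 1)) ^ p" using v(2) vp p0 by (intro power_strict_mono) auto
  ultimately have big: "v (of_nat p) ^ p < v (of_nat p) * v (orb 0 y J') ^ (p - 1)" unfolding val2[symmetric] by simp
  have yJ: "v (of_nat p) < v (orb 0 y J')"
  proof (rule ccontr)
    assume "\<not> ?thesis"
    then have "v (orb 0 y J') ^ (p - 1) \<le> v (of_nat p) ^ (p - 1)" by (intro power_mono v.v_nonneg) simp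
    then have "v (of_nat p) * v (orb 0 y J') ^ (p - 1) \<le> v (of_nat p) * v (of_nat p) ^ (p - 1)" using vp by simp
    then show False using big p0 by (simp add: power_eq_if[of _ p])
  qed
  have per: "orb J' (orb 0 y J') (e * r) = orb 0 y J'"
  proof -
    have "orb J' (orb 0 y J') (e * r) = orb 0 y (J' + e * r)" by (simp add: orb_add)
    also have "\<dots> = orb 0 y (e * r + J')" by (simp add: add.commute)
    also have "\<dots> = orb 0 y J'" unfolding orb_iter_add y_per ..
    finally show ?thesis .
  qed
  obtain w where w: "w \<in> S" "v w = v (orb 0 y J')"
    using periodic_value_in_base[OF v(1) S(1,3) orb_algebraic_int[OF y_ai] yJ per] e r(1) by auto
  \<comment> \<open>An element of \<open>S\<close> with the value of
    \<open>(a - y) ^ (p ^ J' * (p - 1))\<close>; by \<open>big\<close> this value exceeds that of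
    \<open>of_nat p ^ p\<close>, as \<open>ramification_bound\<close> requires.\<close>
  define q where "q = of_nat p * w ^ (p - 1)"
  have vq: "v q = v (of_nat p) * v (orb 0 y J') ^ (p - 1)" by (simp add: q_def v.v_mult v.v_power w)
  have vq': "v q = v (a - y) ^ (p ^ J' * (p - 1))" unfolding vq val2[symmetric] val power_mult ..
  have t0: "a - y \<noteq> 0" using J'(2) by auto
  have "v q \<le> v (of_nat p) * 1" unfolding vq using vp i by (intro mult_left_mono power_le_one v.v_nonneg) auto
  then have "v (a - y) ^ (p ^ J' * (p - 1)) < 1" using vp unfolding vq' by linarith
  then have t1: "v (a - y) < 1" by (metis not_le one_le_power)
  obtain \<rho> where \<rho>: "\<And>i. \<rho> i \<in> S" "\<exists>i\<le>n. \<rho> i \<noteq> 0" "(\<Sum>i\<le>n. \<rho> i * (a - y) ^ i) = 0"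
    using rel[of "r * m"] unfolding y_def by blast
  have "p ^ J' \<le> n * p ^ b"
  proof (rule v.ramification_bound[OF S(1) S(2) ram[OF v(1)] t0 t1 \<rho> _ vq'])
    show "q \<in> S" unfolding q_def by (intro sr_mult[OF S(1)] sr_nat[OF S(1)] sr_power[OF S(1)] w)
  qed (use big vq in auto)
  moreover have "p ^ (e * (m - 1)) \<le> p ^ J'" using J'(1) p0 by (intro power_increasing) auto
  ultimately show ?thesis unfolding m_def by linarith
qed

end

subsection \<open>The period\<close>

context stage_dynamics
begin

lemma orb_cg:
  assumes v: "place v p" and ai: "algebraic_int x"
  shows "place.cg v (orb 0 x i) (x ^ (p ^ i) + orb 0 0 i)"
proof -
  interpret v: place v p by (rule v)
  have int: "v (orb 0 x i) \<le> 1" "v (orb 0 0 i) \<le> 1" "v (x ^ (p ^ i)) \<le> 1" for i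
    using v.v_ai orb_algebraic_int ai algebraic_int_of_nat[of 0] by (auto intro!: v.v_power_le)
  show ?thesis
  proof (induction i)
    case (Suc i)
    have e: "x ^ p ^ Suc i = (x ^ p ^ i) ^ p" by (simp add: power_mult[symmetric] mult.commute)
    have "v.cg (orb 0 x i ^ p) ((x ^ p ^ i + orb 0 0 i) ^ p)" using Suc int by (intro v.cg_power v.v_add_le) auto
    moreover have "v.cg ((x ^ p ^ i + orb 0 0 i) ^ p) ((x ^ p ^ i) ^ p + orb 0 0 i ^ p)" using int by (intro v.cg_frobenius1) auto
    ultimately have "v.cg (orb 0 x i ^ p) (x ^ p ^ Suc i + orb 0 0 i ^ p)" unfolding e by (rule v.cg_trans)
    then have "v.cg (orb 0 x i ^ p - c (i mod e)) (x ^ p ^ Suc i + orb 0 0 i ^ p - c (i mod e))" by (intro v.cg_diff v.cg_refl)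
    then show ?case by (simp add: add_diff_eq)
  qed (simp add: v.cg_refl)
qed

text \<open>The dynamics are stated for \<open>F\<close>, the conjugate of \<open>g\<close> by
  translation with \<open>\<beta>\<close>, because admissibility refers to the orbit of 0 under the
  original polynomial and not to that of its barycenter.\<close>

theorem per_bound:
  assumes v: "place v p" and S: "unital_subring S" "\<And>x. x \<in> S \<Longrightarrow> inverse x \<in> S"
    and \<beta>: "algebraic_int \<beta>" and F: "\<And>x. F x = g' (x - \<beta>) + \<beta>" and g': "g' = poly g"
    and kl: "1 \<le> k" "k < l"
    and adm: "\<And>x. x \<in> S \<Longrightarrow> algebraic_int x \<Longrightarrow> v (x ^ (p ^ (e * (k - 1))) - x ^ (p ^ (e * (l - 1)))) < 1"
      "v ((F ^^ (k - 1)) 0 - (F ^^ (l - 1)) 0) < 1"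
    and \<alpha>: "preperiodic F \<alpha>" "algebraic_int \<alpha>"
    and rel: "\<And>i. a i \<in> S" "\<exists>i\<le>n. a i \<noteq> 0" "(\<Sum>i\<le>n. a i * \<alpha> ^ i) = 0"
  shows "per F \<alpha> \<le> (l - k) * n"
proof -
  interpret v: place v p by (rule v)
  have p0: "p > 0" using p by (rule prime_gt_0_nat)
  define \<delta> where "\<delta> = l - k"
  have \<delta>: "\<delta> > 0" "l - 1 = (k - 1) + \<delta>" using kl by (auto simp: \<delta>_def)
  define Q where "Q = e * (k - 1)"
  define D where "D = e * \<delta>"
  have QD: "e * (l - 1) = D + Q" "e * (k - 1) = Q" unfolding D_def Q_def \<delta>(2) by (simp_all only: distrib_left add.commute)
  have pQD: "x ^ p ^ (D + Q) = (x ^ p ^ D) ^ p ^ Q" for x :: 'a by (simp add: power_add power_mult)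
  have Fn: "(F ^^ N) x = orb 0 (x - \<beta>) (e * N) + \<beta>" for N x
    unfolding orb_iter by (induction N) (simp_all add: F g')
  have Fai: "algebraic_int ((F ^^ N) x)" if "algebraic_int x" for N x
    unfolding Fn using that \<beta> by (intro algebraic_int_add orb_algebraic_int algebraic_int_diff)
  have F_cg: "v.cg ((F ^^ N) x) (x ^ (p ^ (e * N)) + (F ^^ N) 0)" if x: "algebraic_int x" for x N
  proof -
    define P where "P = p ^ (e * N)"
    have \<beta>v: "v (- \<beta>) \<le> 1" using v.v_ai[OF \<beta>] by (simp add: v.v_minus)
    have 1: "v.cg ((F ^^ N) y) (((y - \<beta>) ^ P + orb 0 0 (e * N)) + \<beta>)" if "algebraic_int y" for y
      unfolding Fn P_def using that \<beta> by (intro v.cg_add v.cg_refl orb_cg v algebraic_int_diff)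
    have 2: "v.cg ((x + (- \<beta>)) ^ P) (x ^ P + (- \<beta>) ^ P)"
      unfolding P_def by (rule v.cg_frobenius[OF v.v_ai[OF x] \<beta>v])
    have "v.cg ((F ^^ N) x) (((x ^ P + (- \<beta>) ^ P) + orb 0 0 (e * N)) + \<beta>)"
      using v.cg_trans[OF 1[OF x]] v.cg_add[OF v.cg_add[OF 2 v.cg_refl] v.cg_refl, of "orb 0 0 (e * N)" \<beta>] by simp
    moreover have "v.cg (x ^ P + (F ^^ N) 0) (x ^ P + (((0 - \<beta>) ^ P + orb 0 0 (e * N)) + \<beta>))"
      using algebraic_int_of_nat[of 0] by (intro v.cg_add v.cg_refl 1) simp
    then have "v.cg (((x ^ P + (- \<beta>) ^ P) + orb 0 0 (e * N)) + \<beta>) (x ^ P + (F ^^ N) 0)"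
      using v.cg_sym by (simp add: add.assoc)
    ultimately show ?thesis unfolding P_def[symmetric] by (rule v.cg_trans)
  qed
  \<comment> \<open>\<open>F ^^ (l - 1)\<close> is \<open>F ^^ (k - 1)\<close> after
    \<open>F ^^ \<delta>\<close>. Both reduce to a power of Frobenius plus a constant; admissibility
    identifies the constants, and \<open>cg_root\<close> removes the exponent
    \<open>p ^ Q\<close>.\<close>
  have frob: "v.cg ((F ^^ \<delta>) x) (x ^ p ^ D)" if x: "algebraic_int x" for x
  proof (rule v.cg_root)
    have x': "algebraic_int ((F ^^ \<delta>) x)" by (rule Fai[OF x])
    show "v ((F ^^ \<delta>) x) \<le> 1" "v (x ^ p ^ D) \<le> 1" using v.v_ai x' x by (auto intro: v.v_power_le)
    have "(F ^^ (l - 1)) x = (F ^^ (k - 1)) ((F ^^ \<delta>) x)" unfolding \<delta>(2) funpow_add by simp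
    then have "v.cg (((F ^^ \<delta>) x) ^ p ^ Q + (F ^^ (k - 1)) 0) ((F ^^ (l - 1)) x)"
      using F_cg[OF x', of "k - 1"] v.cg_sym by (simp add: Q_def)
    then have "v.cg (((F ^^ \<delta>) x) ^ p ^ Q + (F ^^ (k - 1)) 0) (x ^ p ^ (D + Q) + (F ^^ (l - 1)) 0)"
      using F_cg[OF x, of "l - 1"] v.cg_trans unfolding QD(1)[symmetric] by blast
    moreover have "v.cg ((F ^^ (k - 1)) 0) ((F ^^ (l - 1)) 0)" using adm(2) by (simp add: v.cg_def)
    ultimately have "v.cg (((F ^^ \<delta>) x) ^ p ^ Q + (F ^^ (k - 1)) 0 - (F ^^ (k - 1)) 0) (x ^ p ^ (D + Q) + (F ^^ (l - 1)) 0 - (F ^^ (l - 1)) 0)"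
      by (rule v.cg_diff)
    then show "v.cg (((F ^^ \<delta>) x) ^ p ^ Q) ((x ^ p ^ D) ^ p ^ Q)" by (simp add: pQD)
  qed
  have fixed_int: "v.cg (x ^ p ^ D) x" if x: "x \<in> S" "algebraic_int x" for x
  proof (rule v.cg_root)
    show "v (x ^ p ^ D) \<le> 1" "v x \<le> 1" using v.v_ai x by (auto intro: v.v_power_le)
    show "v.cg ((x ^ p ^ D) ^ p ^ Q) (x ^ p ^ Q)"
      using adm(1)[OF x] unfolding QD pQD v.cg_def v.v_diff_commute[of "x ^ p ^ Q"] .
  qed
  \<comment> \<open>The hypothesis concerns algebraic integers; \<open>integral_fraction\<close>
    writes a \<open>v\<close>-integral \<open>u\<close> as \<open>x / y\<close> with algebraic
    integers of \<open>S\<close> and \<open>v y = 1\<close>.\<close>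
  have fixed: "v.cg (u ^ p ^ D) u" if u: "u \<in> S" "v u \<le> 1" for u
  proof -
    obtain x y where xy: "algebraic_int x" "algebraic_int y" "v y = 1" "y * u = x" "x \<in> S" "y \<in> S"
      using v.integral_fraction[OF alg u(2) S(1) u(1)] .
    have uD: "v (u ^ p ^ D) \<le> 1" using u(2) by (rule v.v_power_le)
    have "v.cg (y ^ p ^ D * u ^ p ^ D) (y * u ^ p ^ D)"
      by (intro v.cg_mult[OF fixed_int[OF xy(6,2)] v.cg_refl] uD v.v_power_le) (simp add: xy(3))
    moreover have "v.cg (y ^ p ^ D * u ^ p ^ D) (y * u)"
      using fixed_int[OF xy(5,1)] unfolding xy(4)[symmetric] power_mult_distrib .
    ultimately have "v.cg (y * u ^ p ^ D) (y * u)" using v.cg_sym v.cg_trans by blast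
    then have "v (y * (u ^ p ^ D - u)) < 1" by (simp add: v.cg_def right_diff_distrib)
    then show ?thesis by (simp add: v.v_mult xy(3) v.cg_def)
  qed
  define z where "z j = (F ^^ (\<delta> * j)) \<alpha>" for j
  have zai: "algebraic_int (z j)" for j unfolding z_def by (rule Fai[OF \<alpha>(2)])
  have zint: "v (z j) \<le> 1" for j using v.v_ai zai by blast
  have zS: "v.cg (z (Suc j)) (z j ^ p ^ D)" for j
    using frob[OF zai, of j] by (simp add: z_def funpow_add)
  \<comment> \<open>Division by a coefficient of largest value makes the relation
    \<open>v\<close>-integral with one coefficient equal to 1, so its reduction is nonzero.\<close>
  obtain i0 where i0: "i0 \<le> n" "a i0 \<noteq> 0" "\<And>i. i \<le> n \<Longrightarrow> v (a i) \<le> v (a i0)"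
  proof -
    define M where "M = Max ((\<lambda>i. v (a i)) ` {..n})"
    have le: "v (a i) \<le> M" if "i \<le> n" for i unfolding M_def using that by (intro Max_ge) auto
    have "M \<in> (\<lambda>i. v (a i)) ` {..n}" unfolding M_def by (intro Max_in) auto
    then obtain i where i: "i \<le> n" "v (a i) = M" by auto
    obtain i' where i': "i' \<le> n" "a i' \<noteq> 0" using rel(2) by blast
    have "v (a i') > 0" using i'(2) v.v_nonneg[of "a i'"] v.v_eq_0[of "a i'"] by linarith
    then have "a i \<noteq> 0" using le[OF i'(1)] i(2) by (metis not_le v.v_eq_0)
    then show thesis using that[of i] i le by simp
  qed
  define b where "b i = a i * inverse (a i0)" for i
  have bS: "b i \<in> S" for i unfolding b_def by (intro sr_mult[OF S(1)] S(2) rel(1))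
  have b1: "b i0 = 1" using i0 by (simp add: b_def)
  have va0: "v (a i0) > 0" using i0(2) v.v_nonneg[of "a i0"] v.v_eq_0[of "a i0"] by linarith
  have bint: "v (b i) \<le> 1" if "i \<le> n" for i
    using i0(3)[OF that] va0 by (simp add: b_def v.v_divide flip: divide_inverse)
  have b0: "(\<Sum>i\<le>n. b i * \<alpha> ^ i) = 0"
  proof -
    have "(\<Sum>i\<le>n. b i * \<alpha> ^ i) = (\<Sum>i\<le>n. a i * \<alpha> ^ i) * inverse (a i0)"
      unfolding sum_distrib_right b_def by (intro sum.cong refl) (simp add: mult_ac)
    then show ?thesis using rel(3) by simp
  qed
  \<comment> \<open>\<open>z (Suc j)\<close> is congruent to a Frobenius power of
    \<open>z j\<close>, and this power fixes the reduced coefficients, so the reduced relation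
    persists along the sequence.\<close>
  have bz: "v.cg (\<Sum>i\<le>n. b i * z j ^ i) 0" for j
  proof (induction j)
    case 0 then show ?case using b0 by (simp add: z_def v.cg_refl)
  next
    case (Suc j)
    have t: "v (b i * z j ^ i) \<le> 1" if "i \<le> n" for i using bint[OF that] zint by (intro v.v_mult_le v.v_power_le)
    have "v.cg (b i * z (Suc j) ^ i) ((b i * z j ^ i) ^ p ^ D)" if "i \<le> n" for i
    proof -
      have "v.cg (b i * z (Suc j) ^ i) (b i ^ p ^ D * (z j ^ p ^ D) ^ i)"
        using bint[OF that] zint by (intro v.cg_mult v.cg_power zS v.cg_sym[OF fixed[OF bS]] v.v_power_le) auto
      moreover have "(z j ^ p ^ D) ^ i = (z j ^ i) ^ p ^ D" by (simp add: power_mult[symmetric] mult.commute)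
      ultimately show ?thesis by (simp add: power_mult_distrib)
    qed
    then have "v.cg (\<Sum>i\<le>n. b i * z (Suc j) ^ i) (\<Sum>i\<le>n. (b i * z j ^ i) ^ p ^ D)" by (intro v.cg_sum) auto
    moreover have "v.cg ((\<Sum>i\<le>n. b i * z j ^ i) ^ p ^ D) (\<Sum>i\<le>n. (b i * z j ^ i) ^ p ^ D)"
      using t by (intro v.cg_frobenius_sum) auto
    moreover have "v.cg ((\<Sum>i\<le>n. b i * z j ^ i) ^ p ^ D) (0 ^ p ^ D)" using Suc t by (intro v.cg_power v.v_sum_le) auto
    moreover have "(0::'a) ^ p ^ D = 0" using p0 by simp
    ultimately have 1: "v.cg (\<Sum>i\<le>n. b i * z (Suc j) ^ i) (\<Sum>i\<le>n. (b i * z j ^ i) ^ p ^ D)"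
      and 2: "v.cg ((\<Sum>i\<le>n. b i * z j ^ i) ^ p ^ D) (\<Sum>i\<le>n. (b i * z j ^ i) ^ p ^ D)"
      and 3: "v.cg ((\<Sum>i\<le>n. b i * z j ^ i) ^ p ^ D) 0" by simp_all
    show ?case by (rule v.cg_trans[OF 1 v.cg_trans[OF v.cg_sym[OF 2] 3]])
  qed
  \<comment> \<open>Otherwise the reduced relation, of degree at most \<open>n\<close>, would have
    \<open>n + 1\<close> distinct zeros.\<close>
  have "\<exists>i j. i < j \<and> j \<le> n \<and> v.cg (z i) (z j)"
  proof (rule ccontr)
    assume no: "\<not> ?thesis"
    define h where "h = (\<Sum>i\<le>n. monom (b i) i)"
    have ch: "coeff h i = (if i \<le> n then b i else 0)" for i unfolding h_def by (rule poly_of_coeffs)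
    have ph: "poly h x = (\<Sum>i\<le>n. b i * x ^ i)" for x unfolding h_def by (rule poly_of_coeffs)
    have "v (coeff h i0) < 1"
    proof (rule v.lagrange_congruence[of h n z])
      show "degree h \<le> n" by (rule degree_le) (simp add: ch)
      show "v (coeff h i) \<le> 1" for i using bint by (simp add: ch)
      show "v (z i) \<le> 1" for i by (rule zint)
      show "\<not> v.cg (z i) (z j)" if "i \<le> n" "j \<le> n" "i \<noteq> j" for i j
        using no that v.cg_sym by (metis nat_neq_iff)
      show "v (poly h (z i)) < 1" for i using bz[of i] by (simp add: ph v.cg_0)
    qed
    then show False using b1 i0(1) by (simp add: ch)
  qed
  then obtain i j where ij: "i < j" "j \<le> n" "v.cg (z i) (z j)" by blast
  define \<kappa> where "\<kappa> = max (v (z i - z j)) (v (of_nat p))"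
  have k: "v (z i - z j) \<le> \<kappa>" "v (of_nat p) \<le> \<kappa>" "\<kappa> < 1" "0 < \<kappa>"
    using ij(3) v.v_p_bounds by (auto simp: \<kappa>_def v.cg_def less_max_iff_disj)
  have close: "v ((F ^^ N) (z i) - (F ^^ N) (z j)) \<le> \<kappa> ^ Suc (e * N)" for N
    unfolding Fn using orb_contract[OF v, of "z i - \<beta>" "z j - \<beta>" \<kappa> 0 "e * N"] zai \<beta> k by (simp add: algebraic_int_diff)
  have Fz: "(F ^^ N) (z j) = (F ^^ (N + \<delta> * j)) \<alpha>" for N j by (simp add: z_def funpow_add)
  define m where "m = preper F \<alpha>"
  have "periodic F ((F ^^ m) \<alpha>)" unfolding m_def by (rule periodic_preper[OF \<alpha>(1)])
  then obtain r where r: "r \<ge> 1" "(F ^^ r) ((F ^^ m) \<alpha>) = (F ^^ m) \<alpha>" unfolding periodic_def by blast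
  have cyc: "(F ^^ (s + r * t + m)) \<alpha> = (F ^^ (s + m)) \<alpha>" for s t
  proof (induction t)
    case (Suc t)
    have "(F ^^ (s + r * Suc t + m)) \<alpha> = (F ^^ (s + r * t)) ((F ^^ r) ((F ^^ m) \<alpha>))"
      by (simp add: add_ac flip: comp_apply[of "F ^^ _"] funpow_add)
    also have "\<dots> = (F ^^ (s + r * t + m)) \<alpha>" unfolding r(2) by (simp add: funpow_add)
    finally show ?case using Suc by simp
  qed simp
  \<comment> \<open>At the times \<open>r * t + m\<close> the two orbits return to the same pair of
    periodic points for every \<open>t\<close>, while their distance is at most
    \<open>\<kappa> ^ t\<close>.\<close>
  have eq: "(F ^^ (\<delta> * i + m)) \<alpha> = (F ^^ (\<delta> * j + m)) \<alpha>"
  proof (rule ccontr)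
    assume ne: "\<not> ?thesis"
    define \<epsilon> where "\<epsilon> = v ((F ^^ (\<delta> * i + m)) \<alpha> - (F ^^ (\<delta> * j + m)) \<alpha>)"
    have "\<epsilon> > 0" using ne v.v_eq_0 v.v_nonneg by (metis \<epsilon>_def eq_iff_diff_eq_0 less_eq_real_def)
    then obtain t where t: "\<kappa> ^ t < \<epsilon>" using real_arch_pow_inv k by blast
    have "(F ^^ (r * t + m)) (z j) = (F ^^ (\<delta> * j + m)) \<alpha>" for j
      unfolding Fz using cyc[of "\<delta> * j" t] by (simp add: add_ac)
    then have "\<epsilon> \<le> \<kappa> ^ Suc (e * (r * t + m))" using close[of "r * t + m"] by (simp add: \<epsilon>_def)
    also have "\<dots> \<le> \<kappa> ^ t"
    proof (rule power_decreasing)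
      have "1 * t \<le> (e * r) * t" using e r(1) by (intro mult_le_mono1) simp
      then show "t \<le> Suc (e * (r * t + m))" unfolding distrib_left mult.assoc by linarith
    qed (use k in auto)
    finally show False using t by simp
  qed
  have "(F ^^ (\<delta> * (j - i))) ((F ^^ m) \<alpha>) = (F ^^ m) \<alpha>"
  proof -
    \<comment> \<open>Moving on by \<open>s\<close> completes \<open>\<delta> * i\<close> to a
      multiple of the period \<open>r\<close>.\<close>
    define s where "s = (r - 1) * (\<delta> * i)"
    have s: "s + \<delta> * i = r * (\<delta> * i)" using r(1) by (cases r) (auto simp: s_def)
    have sj: "s + \<delta> * j = \<delta> * (j - i) + r * (\<delta> * i)" using s ij(1) by (simp add: diff_mult_distrib2)
    have "(F ^^ s) ((F ^^ (\<delta> * i + m)) \<alpha>) = (F ^^ m) \<alpha>"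
      using cyc[of 0 "\<delta> * i"] by (simp add: s add.assoc[symmetric] flip: comp_apply[of "F ^^ _"] funpow_add)
    moreover have "(F ^^ s) ((F ^^ (\<delta> * j + m)) \<alpha>) = (F ^^ (\<delta> * (j - i) + m)) \<alpha>"
      using cyc[of "\<delta> * (j - i)" "\<delta> * i"] by (simp add: sj add.assoc[symmetric] flip: comp_apply[of "F ^^ _"] funpow_add)
    ultimately show ?thesis unfolding eq by (simp add: funpow_add)
  qed
  moreover have "1 \<le> \<delta> * (j - i)" using \<delta>(1) ij(1) by (simp add: Suc_leI)
  ultimately have "per F \<alpha> \<le> \<delta> * (j - i)" unfolding per_def m_def by (intro Least_le) auto
  also have "\<dots> \<le> \<delta> * n" using ij by (intro mult_le_mono) auto
  finally show ?thesis by (simp add: \<delta>_def)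
qed

end

subsection \<open>Admissible pairs and reduction to the centred case\<close>

lemma preper_semiconj_inj:
  assumes h: "inj h" "\<And>x. h (f x) = g (h x)"
  shows "preper g (h x) = preper f x"
proof -
  have it: "(g ^^ n) (h x) = h ((f ^^ n) x)" for n x by (induction n) (auto simp: h(2))
  have "periodic g (h y) \<longleftrightarrow> periodic f y" for y unfolding periodic_def it using h(1) by (simp add: inj_eq)
  then show ?thesis by (simp add: preper_def it)
qed

lemma linearly_conjugate_translate:
  assumes "linearly_conjugate (pcompose f [:b, 1:] - [:b:]) g"
  shows "linearly_conjugate f g"
proof -
  obtain a c where a: "a \<noteq> 0" and eq: "pcompose f [:b, 1:] - [:b:] = smult (1 / a) (pcompose g [:c, a:] - [:c:])"
    using assms by (auto simp: linearly_conjugate_def)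
  have id: "pcompose [:b, 1:] [:- b, 1:] = [:0, 1:]" by (simp add: pcompose_pCons)
  have "f = pcompose (pcompose f [:b, 1:] - [:b:]) [:- b, 1:] + [:b:]"
    by (simp add: pcompose_diff pcompose_assoc[symmetric] id)
  also have "\<dots> = smult (1 / a) (pcompose g (pcompose [:c, a:] [:- b, 1:]) - [:c:]) + [:b:]"
    unfolding eq by (simp add: pcompose_diff pcompose_smult pcompose_assoc)
  also have "pcompose [:c, a:] [:- b, 1:] = [:c - a * b, a:]" by (simp add: pcompose_pCons)
  also have "smult (1 / a) (pcompose g [:c - a * b, a:] - [:c:]) + [:b:] = smult (1 / a) (pcompose g [:c - a * b, a:] - [:c - a * b:])"
    using a by (intro poly_eqI) (auto simp: coeff_pCons field_simps split: nat.splits)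
  finally show ?thesis using a unfolding linearly_conjugate_def by blast
qed

lemma place_above_comp_embedding:
  assumes \<sigma>: "field_embedding \<sigma>" and v: "place_above p v"
  shows "place_above p (\<lambda>x. v (\<sigma> x))"
  using v unfolding place_above_def absolute_value_def
  by (simp add: emb_eq_0[OF \<sigma>] emb_mult[OF \<sigma>] emb_add[OF \<sigma>] emb_int[OF \<sigma>])

lemma adjoin_degree_pos:
  fixes \<alpha> :: "'f::field_char_0 alg_closure"
  shows "1 \<le> adjoin_degree \<alpha>"
proof (rule ccontr)
  assume "\<not> ?thesis"
  then have d: "adjoin_degree \<alpha> = 0" by simp
  obtain c :: "nat \<Rightarrow> 'f" where "\<exists>i\<le>adjoin_degree \<alpha>. c i \<noteq> 0" "(\<Sum>i\<le>adjoin_degree \<alpha>. to_ac (c i) * \<alpha> ^ i) = 0"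
    using adjoin_power_relation[OF adjoin_self[of \<alpha>]] .
  then show False by (simp add: d)
qed

section \<open>Consequences of admissibility over the number field\<close>

context
  fixes f :: "'f::field_char_0 poly" and p e k l :: nat
  assumes nf: "number_field TYPE('f)" and p: "prime p" and ai: "\<forall>i. algebraic_int (coeff f i)"
    and m1: "lead_coeff f = 1" and e: "1 \<le> e" and deg: "degree f = p ^ e" and pcf: "postcritically_finite f"
    and nc: "\<forall>n\<ge>1. \<not> linearly_conjugate (over_closure f) (map_poly of_int (chebyshev n))"
      "\<forall>n\<ge>1. \<not> linearly_conjugate (over_closure f) (- map_poly of_int (chebyshev n))"
    and bc: "algebraic_int (barycenter f)" and adm: "admissible p f k l" and kl: "k < l"
begin

text \<open>A place of the closure restricts to a place of F. The first claim is confined to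
  algebraic integers because \<open>p_integers p\<close> asks for a bound at all places over
  \<open>p\<close> at once, which integrality at \<open>v\<close> alone does not supply.\<close>

lemma admissible_place:
  assumes v: "place_above p (v :: 'f alg_closure \<Rightarrow> real)"
  shows "x \<in> range to_ac \<Longrightarrow> algebraic_int x \<Longrightarrow> v (x ^ (p ^ (e * (k - 1))) - x ^ (p ^ (e * (l - 1)))) \<le> v (of_nat p)"
    and "v ((poly (over_closure f) ^^ (k - 1)) 0 - (poly (over_closure f) ^^ (l - 1)) 0) \<le> v (of_nat p)"
proof -
  have pF: "place_above p (\<lambda>x::'f. v (to_ac x))" by (rule place_above_comp_embedding[OF field_embedding_to_ac v])
  have av: "\<And>x y. v (x * y) = v x * v y" "\<And>x. 0 \<le> v x" using v by (auto simp: place_above_def absolute_value_def)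
  have mul: "v (to_ac y) \<le> v (of_nat p)" if y: "y \<in> (*) (of_nat p) ` p_integers p" for y :: 'f
  proof -
    obtain z where z: "z \<in> p_integers p" "y = of_nat p * z" using y by auto
    have "v (to_ac z) \<le> 1" using z(1) pF by (auto simp: p_integers_def)
    then have "v (of_nat p) * v (to_ac z) \<le> v (of_nat p)" using av(2)[of "of_nat p"] by (rule mult_left_le)
    then show ?thesis by (simp add: z(2) av)
  qed
  show "v ((poly (over_closure f) ^^ (k - 1)) 0 - (poly (over_closure f) ^^ (l - 1)) 0) \<le> v (of_nat p)"
  proof -
    have "(poly (over_closure f) ^^ n) 0 = to_ac ((poly f ^^ n) 0)" for n
      using emb_funpow[OF field_embedding_to_ac, of n f 0] by simp
    then show ?thesis using mul[of "(poly f ^^ (k - 1)) 0 - (poly f ^^ (l - 1)) 0"] adm by (simp add: admissible_def)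
  qed
  assume "x \<in> range to_ac" and xi: "algebraic_int x"
  then obtain y where y: "x = to_ac y" by auto
  have "algebraic_int y" using xi unfolding y algebraic_int_embedding[OF field_embedding_to_ac] .
  then have "y \<in> p_integers p" using place_above_algebraic_int_le_1 by (auto simp: p_integers_def)
  then have "y ^ (degree f ^ (k - 1)) - y ^ (degree f ^ (l - 1)) \<in> (*) (of_nat p) ` p_integers p"
    using adm by (simp add: admissible_def)
  from mul[OF this] show "v (x ^ (p ^ (e * (k - 1))) - x ^ (p ^ (e * (l - 1)))) \<le> v (of_nat p)"
    by (simp add: y deg power_mult)
qed

text \<open>\<open>integral_fraction\<close> replaces \<open>u\<close> by an algebraic integer of
  the same value, to which admissibility applies: for \<open>A < B\<close> and
  \<open>0 < v x < 1\<close> the term \<open>x ^ A\<close> dominates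
  \<open>x ^ A - x ^ B\<close>.\<close>

lemma ramification:
  fixes v :: "'f alg_closure \<Rightarrow> real"
  assumes v: "place v p" and u: "u \<in> range to_ac" "v u < 1"
  shows "v u ^ (p ^ (e * (k - 1))) \<le> v (of_nat p)"
proof (cases "u = 0")
  case True
  interpret v: place v p by (rule v)
  show ?thesis using True v.v_p_bounds p by (simp add: power_0_left)
next
  case False
  interpret v: place v p by (rule v)
  obtain x y where xy: "algebraic_int x" "v y = 1" "y * u = x" "x \<in> range to_ac"
    using v.integral_fraction[OF alg_closure_number_field_algebraic[OF nf] less_imp_le[OF u(2)] range_to_ac_subring u(1)] by metis
  have vx: "v x = v u" using xy(2) by (simp add: xy(3)[symmetric] v.v_mult)
  have u0: "0 < v u" using False v.v_nonneg[of u] v.v_eq_0[of u] by linarith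
  define A B where "A = p ^ (e * (k - 1))" and "B = p ^ (e * (l - 1))"
  have "1 \<le> k" using adm by (simp add: admissible_def)
  then have "A < B" unfolding A_def B_def using prime_gt_1_nat[OF p] e kl by (intro power_strict_increasing) auto
  then have "v x ^ B < v x ^ A" using u0 u(2) unfolding vx by (intro power_strict_decreasing)
  then have "v (- (x ^ B) + x ^ A) = v (x ^ A)" by (intro v.v_add_eq) (simp add: v.v_minus v.v_power)
  moreover have "v (x ^ A - x ^ B) \<le> v (of_nat p)" unfolding A_def B_def by (rule admissible_place(1)[OF v.pl xy(4,1)])
  ultimately show ?thesis by (simp add: v.v_power vx A_def)
qed

lemma preper_per_bounds:
  assumes \<alpha>: "preperiodic (poly (over_closure f)) \<alpha>"
  shows "k < preper (poly (over_closure f)) \<alpha> \<Longrightarrow>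
      p ^ (e * (preper (poly (over_closure f)) \<alpha> - 1)) \<le> adjoin_degree \<alpha> * p ^ (e * (k - 1))"
    and "per (poly (over_closure f)) \<alpha> \<le> (l - k) * adjoin_degree \<alpha>"
proof -
  define L where "L = over_closure f"
  define S where "S = range (to_ac :: 'f \<Rightarrow> 'f alg_closure)"
  define \<beta> where "\<beta> = to_ac (barycenter f)"
  \<comment> \<open>Since \<open>\<beta>\<close> is an algebraic integer in the image of F, this
    translation keeps the coefficients integral and in \<open>S\<close>.\<close>
  define g where "g = pcompose L [:\<beta>, 1:] - [:\<beta>:]"
  note \<sigma> = field_embedding_to_ac[where 'f = 'f]
  have k1: "1 \<le> k" using adm by (simp add: admissible_def)
  have p2: "p \<ge> 2" using p by (rule prime_ge_2_nat)
  have d2: "degree f \<ge> 2" using e p2 self_le_power[of p e] by (simp add: deg)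
  have S: "unital_subring S" unfolding S_def by (rule range_to_ac_subring)
  have Si: "inverse x \<in> S" if xS: "x \<in> S" for x 
  proof -
    obtain y where "x = to_ac y" using xS by (auto simp: S_def)
    then have "inverse x = to_ac (inverse y)" by (simp only: emb_inverse[OF \<sigma>])
    then show ?thesis unfolding S_def by (rule range_eqI)
  qed
  have AI: "unital_subring {x::'f alg_closure. algebraic_int x}" by (rule algebraic_int_subring)
  have L: "degree L = p ^ e" "coeff L i = to_ac (coeff f i)" for i
    by (simp_all add: L_def emb_degree[OF \<sigma>] emb_coeff[OF \<sigma>] deg)
  have L1: "lead_coeff L = 1" using m1 by (simp add: L deg)
  have Lai: "algebraic_int (coeff L i)" for i using ai by (simp add: L algebraic_int_embedding[OF \<sigma>])
  have \<beta>: "algebraic_int \<beta>" "\<beta> \<in> S" using bc by (simp_all add: \<beta>_def S_def algebraic_int_embedding[OF \<sigma>])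
  have gx: "poly g (x - \<beta>) = poly L x - \<beta>" for x by (simp add: g_def poly_pcompose)
  have Lx: "poly L x = poly g (x - \<beta>) + \<beta>" for x by (simp add: gx)
  have gdeg: "degree (pcompose L [:\<beta>, 1:]) = p ^ e" by (simp add: degree_pcompose L)
  have cg: "coeff g i = coeff (pcompose L [:\<beta>, 1:]) i" if "i > 0" for i
    using that by (simp add: g_def coeff_pCons split: nat.splits)
  have dg: "degree g = p ^ e"
  proof -
    have "degree (pcompose L [:\<beta>, 1:] + - [:\<beta>:]) = degree (pcompose L [:\<beta>, 1:])"
      by (rule degree_add_eq_left) (use d2 in \<open>simp add: gdeg flip: deg\<close>)
    then show ?thesis by (simp only: g_def gdeg diff_conv_add_uminus)
  qed
  have g1: "lead_coeff g = 1"
    using cg[of "p ^ e"] p2 lead_coeff_comp[of "[:\<beta>, 1:]" L] L1 gdeg by (simp add: dg)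
  have lin: "coeff [:\<beta>, 1:] i \<in> R" "coeff [:\<beta>:] i \<in> R" if "unital_subring R" "\<beta> \<in> R" for R i
    using that sr_0 sr_1 by (auto simp: coeff_pCons split: nat.splits)
  have gR: "coeff g i \<in> R" if R: "unital_subring R" "\<beta> \<in> R" "\<And>i. coeff L i \<in> R" for R i
    unfolding g_def coeff_diff by (intro sr_diff[OF R(1)] sr_coeff_pcompose[OF R(1)] R(3) lin[OF R(1,2)])
  have "coeff L i \<in> S" for i by (simp add: L S_def)
  then have gS: "coeff g i \<in> S" for i by (rule gR[OF S \<beta>(2)])
  have gai: "algebraic_int (coeff g i)" for i using gR[OF AI, of i] \<beta> Lai by simp
  have "pcf g" unfolding pcf_def
  proof (intro allI impI)
    fix x assume "poly (pderiv g) x = 0"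
    moreover have "pderiv [:\<beta>:] = 0" "pderiv [:\<beta>, 1:] = 1" by (simp_all add: pderiv_pCons)
    ultimately have "poly (pderiv L) (x + \<beta>) = 0"
      by (simp add: g_def pderiv_diff pderiv_pcompose poly_pcompose add.commute)
    then have "preperiodic (poly L) (x + \<beta>)" using pcf unfolding postcritically_finite_def L_def emb_pderiv[OF \<sigma>] by blast
    then have "preperiodic (poly g) ((x + \<beta>) - \<beta>)" by (rule preperiodic_semiconj) (simp add: gx)
    then show "preperiodic (poly g) x" by simp
  qed
  then interpret g: pcf_prime_power p e g by unfold_locales (use p e g1 dg gai in auto)
  have gcen: "coeff g (degree g - 1) = 0"
  proof -
    have "coeff g (degree g - 1) = coeff L (degree L - 1) + of_nat (degree L) * \<beta>"
    proof -
      have "degree L > 0" using p2 by (simp add: L)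
      from subleading_shift[OF L1 this, of \<beta>] show ?thesis using cg[of "p ^ e - 1"] d2 by (simp add: dg L deg)
    qed
    also have "\<dots> = to_ac (coeff f (degree f - 1) + of_nat (degree f) * barycenter f)"
      by (simp add: L \<beta>_def deg)
    also have "coeff f (degree f - 1) + of_nat (degree f) * barycenter f = 0"
      using d2 by (simp add: barycenter_def)
    finally show ?thesis by simp
  qed
  have pe1: "1 \<le> p ^ e" using p2 by simp
  have nc': "\<not> linearly_conjugate g (map_poly of_int (chebyshev (p ^ e)))" "\<not> linearly_conjugate g (- map_poly of_int (chebyshev (p ^ e)))"
    using linearly_conjugate_translate[of L \<beta>] nc pe1 unfolding g_def L_def by blast+
  have alg: "algebraic x" for x :: "'f alg_closure" by (rule alg_closure_number_field_algebraic[OF nf])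
  obtain c where c: "\<And>i. i < e \<Longrightarrow> c i \<in> S" "\<And>i. i < e \<Longrightarrow> algebraic_int (c i)" "g = stage p c e [:0, 1:]"
    using unicritical_decomposition[OF g.pcf_prime_power_axioms alg gcen S Si gS] nc' unfolding dg by blast
  interpret stage_dynamics p e c g
    by unfold_locales (use p e alg c g.pcf nc' in auto)
  have \<alpha>L: "preperiodic (poly L) \<alpha>" using \<alpha> by (simp add: L_def)
  have \<alpha>ai: "algebraic_int \<alpha>" using d2 by (intro preperiodic_algebraic_int[OF L1 _ Lai \<alpha>L]) (simp add: L deg)
  have relS: "\<exists>q. (\<forall>i. q i \<in> S) \<and> (\<exists>i\<le>adjoin_degree \<alpha>. q i \<noteq> 0) \<and> (\<Sum>i\<le>adjoin_degree \<alpha>. q i * y ^ i) = 0"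
    if y: "y \<in> adjoin \<alpha>" for y
  proof -
    obtain q :: "nat \<Rightarrow> 'f" where q: "\<exists>i\<le>adjoin_degree \<alpha>. q i \<noteq> 0" "(\<Sum>i\<le>adjoin_degree \<alpha>. to_ac (q i) * y ^ i) = 0"
      using adjoin_power_relation[OF y] .
    then show ?thesis by (intro exI[of _ "\<lambda>i. to_ac (q i)"]) (auto simp: S_def)
  qed
  have gLn: "(poly g ^^ n) (x - \<beta>) = (poly L ^^ n) x - \<beta>" for n x by (induction n) (simp_all add: gx)
  have pre_eq: "preper (poly g) (\<alpha> - \<beta>) = preper (poly L) \<alpha>"
    by (rule preper_semiconj_inj) (auto simp: inj_def gx)
  show "p ^ (e * (preper (poly (over_closure f)) \<alpha> - 1)) \<le> adjoin_degree \<alpha> * p ^ (e * (k - 1))"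
    if km: "k < preper (poly (over_closure f)) \<alpha>"
    unfolding L_def[symmetric] pre_eq[symmetric]
  proof (rule preper_bound[OF S Si c(1)])
    show "v u ^ (p ^ (e * (k - 1))) \<le> v (of_nat p)" if "place v p" "u \<in> S" "v u < 1" for v u
      using ramification that by (simp add: S_def)
    show "preperiodic (poly g) (\<alpha> - \<beta>)" by (rule preperiodic_semiconj[OF \<alpha>L]) (simp add: gx)
    show "algebraic_int (\<alpha> - \<beta>)" using \<alpha>ai \<beta>(1) by (rule algebraic_int_diff)
    show "2 \<le> preper (poly g) (\<alpha> - \<beta>)" unfolding pre_eq using km k1 by (simp add: L_def)
    fix N
    have "poly L x \<in> adjoin \<alpha>" if "x \<in> adjoin \<alpha>" for x
      using that adjoin_base by (intro sr_poly[OF adjoin_subring]) (auto simp: L)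
    then have "(poly L ^^ N) \<alpha> \<in> adjoin \<alpha>" by (induction N) (auto simp: adjoin_self)
    then have "\<alpha> - (poly L ^^ N) \<alpha> \<in> adjoin \<alpha>" by (intro sr_diff[OF adjoin_subring] adjoin_self)
    note mem = this
    \<comment> \<open>The translation cancels in the difference, which therefore lies in
      F(\<alpha>).\<close>
    have eq: "\<alpha> - \<beta> - (poly g ^^ N) (\<alpha> - \<beta>) = \<alpha> - (poly L ^^ N) \<alpha>" by (simp add: gLn)
    show "\<exists>q. (\<forall>i. q i \<in> S) \<and> (\<exists>i\<le>adjoin_degree \<alpha>. q i \<noteq> 0) \<and>
        (\<Sum>i\<le>adjoin_degree \<alpha>. q i * (\<alpha> - \<beta> - (poly g ^^ N) (\<alpha> - \<beta>)) ^ i) = 0"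
      unfolding eq by (rule relS[OF mem])
  qed
  \<comment> \<open>Any place over \<open>p\<close> will do; one exists because \<open>1 / p\<close>
    is rational and not an integer, hence not an algebraic integer.\<close>
  obtain v :: "'f alg_closure \<Rightarrow> real" where v: "place_above p v" "\<And>x y. v (x + y) \<le> max (v x) (v y)"
  proof -
    have "algebraic_int (of_nat p ^ 1 * (1 / of_nat p :: 'f alg_closure))" using p2 by simp
    moreover have "\<not> algebraic_int (1 / of_nat p :: 'f alg_closure)"
    proof
      assume a: "algebraic_int (1 / of_nat p :: 'f alg_closure)"
      have "(1 / of_nat p :: 'f alg_closure) \<in> \<rat>" by (intro Rats_divide Rats_1 Rats_of_nat)
      then have "(1 / of_nat p :: 'f alg_closure) \<in> \<int>" using a rational_algebraic_int_is_int by blast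
      then obtain i where "(1 / of_nat p :: 'f alg_closure) = of_int i" by (auto elim: Ints_cases)
      then have "(of_int (i * int p) :: 'f alg_closure) = of_int 1" using p2 by (simp add: field_simps)
      then have "i * int p = 1" by (simp only: of_int_eq_iff)
      then show False using p2 by (simp add: zmult_eq_1_iff)
    qed
    ultimately show thesis using that exists_place[OF alg p] by metis
  qed
  interpret v: place v p using v p by unfold_locales
  obtain q where q: "\<And>i. q i \<in> S" "\<exists>i\<le>adjoin_degree \<alpha>. q i \<noteq> 0" "(\<Sum>i\<le>adjoin_degree \<alpha>. q i * \<alpha> ^ i) = 0"
    using relS[OF adjoin_self] by blast
  show "per (poly (over_closure f)) \<alpha> \<le> (l - k) * adjoin_degree \<alpha>"
    unfolding L_def[symmetric]
  proof (rule per_bound[OF v.place_axioms S Si \<beta>(1) Lx refl k1 kl _ _ \<alpha>L \<alpha>ai q])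
    show "v (x ^ (p ^ (e * (k - 1))) - x ^ (p ^ (e * (l - 1)))) < 1" if "x \<in> S" "algebraic_int x" for x
      using admissible_place(1)[OF v(1), of x] that v.v_p_bounds by (simp add: S_def)
    show "v ((poly L ^^ (k - 1)) 0 - (poly L ^^ (l - 1)) 0) < 1"
      using admissible_place(2)[OF v(1)] v.v_p_bounds by (simp add: L_def)
  qed
qed

end

theorem theorem6p3:
  fixes f :: "'f::field_char_0 poly" and p e k l :: nat and \<alpha> :: "'f alg_closure"
  assumes "number_field TYPE('f)"
    and "Factorial_Ring.prime p"
    and "\<forall>i. algebraic_int (Polynomial.coeff f i)"
    and "Polynomial.lead_coeff f = 1"
    and "1 \<le> e" and "Polynomial.degree f = p ^ e"
    and "postcritically_finite f"
    and "\<forall>n\<ge>1. \<not> linearly_conjugate (over_closure f) (map_poly of_int (chebyshev n))"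
    and "\<forall>n\<ge>1. \<not> linearly_conjugate (over_closure f) (- map_poly of_int (chebyshev n))"
    and "algebraic_int (barycenter f)"
    and "admissible p f k l" and "k < l"
    and "preperiodic (poly (over_closure f)) \<alpha>"
  shows "real (Polynomial.degree f) powr (real (preper (poly (over_closure f)) \<alpha>) / real k - 1)
           \<le> real (adjoin_degree \<alpha>)
         \<and> per (poly (over_closure f)) \<alpha> \<le> (l - k) * adjoin_degree \<alpha>"
proof -
  note bounds = preper_per_bounds[OF assms(1-12)] and \<alpha> = assms(13)
  define m where "m = preper (poly (over_closure f)) \<alpha>"
  define n where "n = adjoin_degree \<alpha>"
  have n1: "1 \<le> n" unfolding n_def by (rule adjoin_degree_pos)
  have k1: "1 \<le> k" using \<open>admissible p f k l\<close> by (simp add: admissible_def)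
  have p2: "p \<ge> 2" using \<open>Factorial_Ring.prime p\<close> by (rule prime_ge_2_nat)
  have d1: "1 \<le> real (degree f)" using p2 assms(6) by simp
  have "real (degree f) powr (real m / real k - 1) \<le> real n"
  proof (cases "k < m")
    case False
    then have "real m / real k - 1 \<le> 0" using k1 by (simp add: field_simps)
    then have "real (degree f) powr (real m / real k - 1) \<le> real (degree f) powr 0" using d1 by (rule powr_mono)
    also have "\<dots> \<le> real n" using d1 n1 by simp
    finally show ?thesis .
  next
    case True
    have "p ^ (e * (m - 1)) \<le> n * p ^ (e * (k - 1))" using bounds(1)[OF \<alpha>] True by (simp add: m_def n_def)
    moreover have "m - 1 = (m - k) + (k - 1)" using True k1 by simp
    then have "p ^ (e * (m - 1)) = p ^ (e * (m - k)) * p ^ (e * (k - 1))" by (simp only: distrib_left power_add)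
    ultimately have le: "degree f ^ (m - k) \<le> n" using p2 by (simp add: assms(6) power_mult)
    have "real m / real k - 1 = real (m - k) / real k" using True k1 by (simp add: of_nat_diff diff_divide_distrib)
    \<comment> \<open>The asserted exponent is \<open>(m - k) / k\<close>, so the bound by
      \<open>d ^ (m - k)\<close> is at least as strong, with equality for
      \<open>k = 1\<close>.\<close>
    also have "\<dots> \<le> real (m - k)" using k1 divide_left_mono[of 1 "real k" "real (m - k)"] by simp
    finally have "real (degree f) powr (real m / real k - 1) \<le> real (degree f) powr real (m - k)" using d1 by (rule powr_mono)
    also have "\<dots> = real (degree f ^ (m - k))" using d1 by (simp add: powr_realpow)
    also have "\<dots> \<le> real n" using le by (simp only: of_nat_le_iff)
    finally show ?thesis .
  qed
  then show ?thesis using bounds(2)[OF \<alpha>] by (simp add: m_def n_def)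
qed

end
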